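(* Let $R$ be a prime PI-algebra of PI-degree $n$, which is finitely generated as a $k$-algebra. Let $G$ be an algebraic group acting regularly on $R$. Then there is a finitely generated commutative $k$-algebra $C$ which is a domain, and a regular action of $G$ on $C$ such that $R$ embeds $G$-equivariantly into $M_n(k)\otimes_k C$. Here $G$ acts trivially on $M_n(k)$.
   Context: $k$ is an algebraically closed field of characteristic zero; algebraic groups are linear algebraic groups over $k$ (not necessarily connected). Groups act on algebras by $k$-algebra automorphisms. An action of an algebraic group $G$ on a (not necessarily commutative) $k$-algebra $R$ is regular if every finite-dimensional $k$-subspace of $R$ is contained in a $G$-invariant finite-dimensional $k$-subspace $V$ such that the $G$-action on $V$ is given by a homomorphism of algebraic groups $G\to \mathrm{GL}(V)$. A prime PI-algebra has PI-degree $n$ if its total ring of fractions is a central simple algebra of degree $n$. *)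

theory Defs
  imports
    "Jordan_Normal_Form.VS_Connect"
    "HOL-Algebra.Group_Action"
    "HOL-Algebra.Embedded_Algebras"
    "HOL-Algebra.QuotRing"
    "HOL-Library.Poly_Mapping"
begin

section \<open>Associative algebras over a field\<close>

text \<open>
  Algebras are unital and associative, but not necessarily commutative, so the commutative locale
  \<^locale>\<open>algebra\<close> of the library does not apply.  The base field is a type of class \<^class>\<open>field\<close>,
  which enters the module-theoretic notions through \<^term>\<open>class_ring\<close>.
\<close>

definition is_algebra :: "('k::field, 'a) module \<Rightarrow> bool" where
  "is_algebra A \<longleftrightarrow> ring A \<and> vectorspace (class_ring :: 'k ring) A \<and>
     (\<forall>c. \<forall>x\<in>carrier A. \<forall>y\<in>carrier A.
        (c \<odot>\<^bsub>A\<^esub> x) \<otimes>\<^bsub>A\<^esub> y = c \<odot>\<^bsub>A\<^esub> (x \<otimes>\<^bsub>A\<^esub> y) \<and>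
        x \<otimes>\<^bsub>A\<^esub> (c \<odot>\<^bsub>A\<^esub> y) = c \<odot>\<^bsub>A\<^esub> (x \<otimes>\<^bsub>A\<^esub> y))"

definition alg_hom :: "('k::field, 'a) module \<Rightarrow> ('k, 'b) module \<Rightarrow> ('a \<Rightarrow> 'b) set" where
  "alg_hom A B =
     {h \<in> Ring.ring_hom A B. \<forall>c. \<forall>x\<in>carrier A. h (c \<odot>\<^bsub>A\<^esub> x) = c \<odot>\<^bsub>B\<^esub> h x}"

definition finitely_generated_algebra :: "('k::field, 'a) module \<Rightarrow> bool" where
  "finitely_generated_algebra A \<longleftrightarrow>
     (\<exists>S. finite S \<and> S \<subseteq> carrier A \<and>
        (\<forall>T. subring T A \<and> submodule (class_ring :: 'k ring) T A \<and> S \<subseteq> T \<longrightarrow> T = carrier A))"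

abbreviation fin_dim_subspace :: "('k::field, 'a) module \<Rightarrow> 'a set \<Rightarrow> bool" where
  "fin_dim_subspace A V \<equiv> VectorSpace.subspace (class_ring :: 'k ring) V A \<and>
     vectorspace.fin_dim (class_ring :: 'k ring) (A\<lparr>carrier := V\<rparr>)"


section \<open>Prime PI-algebras and PI-degree\<close>

definition prime_ring :: "('a, 'm) ring_scheme \<Rightarrow> bool" where
  "prime_ring A \<longleftrightarrow> ring A \<and> carrier A \<noteq> {\<zero>\<^bsub>A\<^esub>} \<and>
     (\<forall>I J. ideal I A \<and> ideal J A \<and> (\<forall>x\<in>I. \<forall>y\<in>J. x \<otimes>\<^bsub>A\<^esub> y = \<zero>\<^bsub>A\<^esub>) \<longrightarrow>
        I = {\<zero>\<^bsub>A\<^esub>} \<or> J = {\<zero>\<^bsub>A\<^esub>})"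

text \<open>
  A noncommutative polynomial in the variables \<open>x\<^sub>0, x\<^sub>1, \<dots>\<close> is a finitely supported
  function on words, the word \<open>[i, j, \<dots>]\<close> standing for the monomial \<open>x\<^sub>i x\<^sub>j \<dots>\<close>.
\<close>

definition nc_eval :: "('k::field, 'a) module \<Rightarrow> (nat \<Rightarrow> 'a) \<Rightarrow> (nat list \<Rightarrow>\<^sub>0 'k) \<Rightarrow> 'a" where
  "nc_eval A r f =
     (\<Oplus>\<^bsub>A\<^esub>w\<in>Poly_Mapping.keys f.
        Poly_Mapping.lookup f w \<odot>\<^bsub>A\<^esub> foldr (\<lambda>i y. r i \<otimes>\<^bsub>A\<^esub> y) w \<one>\<^bsub>A\<^esub>)"

definition PI_algebra :: "('k::field, 'a) module \<Rightarrow> bool" where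
  "PI_algebra A \<longleftrightarrow> is_algebra A \<and>
     (\<exists>f :: nat list \<Rightarrow>\<^sub>0 'k. f \<noteq> 0 \<and> (\<forall>r \<in> UNIV \<rightarrow> carrier A. nc_eval A r f = \<zero>\<^bsub>A\<^esub>))"

definition regular_elements :: "('a, 'm) ring_scheme \<Rightarrow> 'a set" where
  "regular_elements A =
     {s \<in> carrier A. \<forall>x\<in>carrier A.
        (s \<otimes>\<^bsub>A\<^esub> x = \<zero>\<^bsub>A\<^esub> \<longrightarrow> x = \<zero>\<^bsub>A\<^esub>) \<and> (x \<otimes>\<^bsub>A\<^esub> s = \<zero>\<^bsub>A\<^esub> \<longrightarrow> x = \<zero>\<^bsub>A\<^esub>)}"

definition total_ring_of_fractions ::
    "('a, 'm) ring_scheme \<Rightarrow> ('q, 'l) ring_scheme \<Rightarrow> ('a \<Rightarrow> 'q) \<Rightarrow> bool" where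
  "total_ring_of_fractions A Q \<iota> \<longleftrightarrow> ring Q \<and> \<iota> \<in> Ring.ring_hom A Q \<and> inj_on \<iota> (carrier A) \<and>
     (\<forall>s\<in>regular_elements A. \<iota> s \<in> Units Q) \<and>
     (\<forall>q\<in>carrier Q.
        (\<exists>a\<in>carrier A. \<exists>s\<in>regular_elements A. q = \<iota> a \<otimes>\<^bsub>Q\<^esub> inv\<^bsub>Q\<^esub> (\<iota> s)) \<and>
        (\<exists>a\<in>carrier A. \<exists>s\<in>regular_elements A. q = inv\<^bsub>Q\<^esub> (\<iota> s) \<otimes>\<^bsub>Q\<^esub> \<iota> a))"

definition ring_center :: "('a, 'm) ring_scheme \<Rightarrow> 'a set" where
  "ring_center A = {z \<in> carrier A. \<forall>x\<in>carrier A. z \<otimes>\<^bsub>A\<^esub> x = x \<otimes>\<^bsub>A\<^esub> z}"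

definition simple_ring :: "('a, 'm) ring_scheme \<Rightarrow> bool" where
  "simple_ring A \<longleftrightarrow> ring A \<and> carrier A \<noteq> {\<zero>\<^bsub>A\<^esub>} \<and>
     (\<forall>I. ideal I A \<longrightarrow> I = {\<zero>\<^bsub>A\<^esub>} \<or> I = carrier A)"

text \<open>Central simple over its own center, the degree being the square root of the dimension.\<close>

definition central_simple_of_degree :: "('a, 'm) ring_scheme \<Rightarrow> nat \<Rightarrow> bool" where
  "central_simple_of_degree A n \<longleftrightarrow> simple_ring A \<and> subfield (ring_center A) A \<and>
     ring.dimension A (n ^ 2) (ring_center A) (carrier A)"


section \<open>Linear algebraic groups\<close>

definition GL :: "nat \<Rightarrow> 'k::field mat monoid" where
  "GL N = units_of (ring_mat TYPE('k) N ())"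

text \<open>The coordinate ring \<open>k[x\<^sub>i\<^sub>j, 1/det]\<close> of \<open>GL\<^sub>N\<close>, as functions on matrices.\<close>

inductive_set GL_functions :: "nat \<Rightarrow> ('k::field mat \<Rightarrow> 'k) set" for N :: nat where
  const: "(\<lambda>_. c) \<in> GL_functions N"
| entry: "i < N \<Longrightarrow> j < N \<Longrightarrow> (\<lambda>X. X $$ (i, j)) \<in> GL_functions N"
| inv_det: "(\<lambda>X. inverse (det X)) \<in> GL_functions N"
| add: "p \<in> GL_functions N \<Longrightarrow> q \<in> GL_functions N \<Longrightarrow> (\<lambda>X. p X + q X) \<in> GL_functions N"
| mult: "p \<in> GL_functions N \<Longrightarrow> q \<in> GL_functions N \<Longrightarrow> (\<lambda>X. p X * q X) \<in> GL_functions N"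

text \<open>Zariski closed subgroups of \<open>GL\<^sub>N\<close> (over an algebraically closed field).\<close>

definition linear_algebraic_group :: "nat \<Rightarrow> 'k::alg_closed_field mat set \<Rightarrow> bool" where
  "linear_algebraic_group N G \<longleftrightarrow> subgroup G (GL N) \<and>
     (\<exists>P \<subseteq> GL_functions N. G = {X \<in> carrier (GL N). \<forall>p\<in>P. p X = 0})"

definition regular_functions :: "nat \<Rightarrow> 'k::field mat set \<Rightarrow> ('k mat \<Rightarrow> 'k) set" where
  "regular_functions N G = {f. \<exists>p\<in>GL_functions N. \<forall>X\<in>G. f X = p X}"

definition algebraic_group_hom ::
    "nat \<Rightarrow> 'k::field mat set \<Rightarrow> nat \<Rightarrow> 'k mat set \<Rightarrow> ('k mat \<Rightarrow> 'k mat) \<Rightarrow> bool" where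
  "algebraic_group_hom N G M H \<rho> \<longleftrightarrow>
     \<rho> \<in> hom (GL N\<lparr>carrier := G\<rparr>) (GL M\<lparr>carrier := H\<rparr>) \<and>
     (\<forall>q\<in>regular_functions M H. q \<circ> \<rho> \<in> regular_functions N G)"


section \<open>Regular actions\<close>

text \<open>
  \<^locale>\<open>group_action\<close> normalises each \<open>\<phi> g\<close> to be \<^term>\<open>undefined\<close> outside the carrier.
\<close>

definition algebra_action ::
    "('g, 'm) monoid_scheme \<Rightarrow> ('k::field, 'a) module \<Rightarrow> ('g \<Rightarrow> 'a \<Rightarrow> 'a) \<Rightarrow> bool" where
  "algebra_action \<G> A \<phi> \<longleftrightarrow>
     group_action \<G> (carrier A) \<phi> \<and> (\<forall>g\<in>carrier \<G>. \<phi> g \<in> alg_hom A A)"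

text \<open>
  A basis \<open>vs\<close> of \<open>V\<close> identifies \<open>GL(V)\<close> with \<open>GL\<^sub>m\<close>, \<open>m = dim V\<close>, and \<open>\<rho> g\<close> is the matrix of
  \<open>\<phi> g\<close> on \<open>V\<close>.  The choice of basis is immaterial, conjugation being an automorphism of the
  algebraic group \<open>GL\<^sub>m\<close>.
\<close>

definition algebraic_representation_on ::
    "nat \<Rightarrow> 'k::field mat set \<Rightarrow> ('k, 'a) module \<Rightarrow> ('k mat \<Rightarrow> 'a \<Rightarrow> 'a) \<Rightarrow> 'a set \<Rightarrow> bool" where
  "algebraic_representation_on N G A \<phi> V \<longleftrightarrow>
     (\<exists>vs \<rho>. distinct vs \<and>
        vectorspace.basis (class_ring :: 'k ring) (A\<lparr>carrier := V\<rparr>) (set vs) \<and>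
        algebraic_group_hom N G (length vs) (carrier (GL (length vs))) \<rho> \<and>
        (\<forall>g\<in>G. \<forall>j<length vs.
           \<phi> g (vs ! j) = (\<Oplus>\<^bsub>A\<^esub>i\<in>{..<length vs}. \<rho> g $$ (i, j) \<odot>\<^bsub>A\<^esub> vs ! i)))"

definition regular_action ::
    "nat \<Rightarrow> 'k::field mat set \<Rightarrow> ('k, 'a) module \<Rightarrow> ('k mat \<Rightarrow> 'a \<Rightarrow> 'a) \<Rightarrow> bool" where
  "regular_action N G A \<phi> \<longleftrightarrow> algebra_action (GL N\<lparr>carrier := G\<rparr>) A \<phi> \<and>
     (\<forall>W. fin_dim_subspace A W \<longrightarrow>
        (\<exists>V. fin_dim_subspace A V \<and> W \<subseteq> V \<and> (\<forall>g\<in>G. \<phi> g ` V \<subseteq> V) \<and>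
             algebraic_representation_on N G A \<phi> V))"


section \<open>Tensor products of algebras\<close>

text \<open>
  The free vector space on the set \<open>A \<times> B\<close>, with the multiplication extending
  \<open>(a, b) (a', b') = (a a', b b')\<close> bilinearly.
\<close>

definition free_tensor ::
    "('k::field, 'a) module \<Rightarrow> ('k, 'b) module \<Rightarrow> ('k, 'a \<times> 'b \<Rightarrow>\<^sub>0 'k) module" where
  "free_tensor A B =
     \<lparr>carrier = {f. Poly_Mapping.keys f \<subseteq> carrier A \<times> carrier B},
      mult = (\<lambda>f g. \<Sum>p\<in>Poly_Mapping.keys f. \<Sum>q\<in>Poly_Mapping.keys g.
        Poly_Mapping.single (fst p \<otimes>\<^bsub>A\<^esub> fst q, snd p \<otimes>\<^bsub>B\<^esub> snd q)
          (Poly_Mapping.lookup f p * Poly_Mapping.lookup g q)),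
      one = Poly_Mapping.single (\<one>\<^bsub>A\<^esub>, \<one>\<^bsub>B\<^esub>) 1,
      zero = 0,
      add = (+),
      smult = (\<lambda>c. Poly_Mapping.map ((*) c))\<rparr>"

text \<open>
  The span of the bilinearity relations is already an ideal for this multiplication, so the ideal
  they generate yields the usual tensor product over \<open>k\<close>.
\<close>

definition tensor_ideal ::
    "('k::field, 'a) module \<Rightarrow> ('k, 'b) module \<Rightarrow> ('a \<times> 'b \<Rightarrow>\<^sub>0 'k) set" where
  "tensor_ideal A B = Idl\<^bsub>free_tensor A B\<^esub>
     ({Poly_Mapping.single (a \<oplus>\<^bsub>A\<^esub> a', b) 1 - Poly_Mapping.single (a, b) 1
         - Poly_Mapping.single (a', b) 1 | a a' b.
         a \<in> carrier A \<and> a' \<in> carrier A \<and> b \<in> carrier B} \<union>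
      {Poly_Mapping.single (a, b \<oplus>\<^bsub>B\<^esub> b') 1 - Poly_Mapping.single (a, b) 1
         - Poly_Mapping.single (a, b') 1 | a b b'.
         a \<in> carrier A \<and> b \<in> carrier B \<and> b' \<in> carrier B} \<union>
      {Poly_Mapping.single (c \<odot>\<^bsub>A\<^esub> a, b) 1 - Poly_Mapping.single (a, b) c | a b c.
         a \<in> carrier A \<and> b \<in> carrier B} \<union>
      {Poly_Mapping.single (a, c \<odot>\<^bsub>B\<^esub> b) 1 - Poly_Mapping.single (a, b) c | a b c.
         a \<in> carrier A \<and> b \<in> carrier B})"

definition tensor_algebra ::
    "('k::field, 'a) module \<Rightarrow> ('k, 'b) module \<Rightarrow> ('k, ('a \<times> 'b \<Rightarrow>\<^sub>0 'k) set) module" where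
  "tensor_algebra A B =
     ring.extend (free_tensor A B Quot tensor_ideal A B)
       (module.fields
         (\<lambda>c X. \<Union>f\<in>X. tensor_ideal A B +>\<^bsub>free_tensor A B\<^esub> (c \<odot>\<^bsub>free_tensor A B\<^esub> f)))"

definition pure_tensor ::
    "('k::field, 'a) module \<Rightarrow> ('k, 'b) module \<Rightarrow> 'a \<Rightarrow> 'b \<Rightarrow> ('a \<times> 'b \<Rightarrow>\<^sub>0 'k) set" where
  "pure_tensor A B a b = tensor_ideal A B +>\<^bsub>free_tensor A B\<^esub> Poly_Mapping.single (a, b) 1"

text \<open>
  \<open>\<tau>\<close> is the action on \<open>A \<otimes> B\<close> induced by the trivial action on \<open>A\<close> and the action \<open>\<gamma>\<close> on \<open>B\<close>.
  Pure tensors span \<open>A \<otimes> B\<close>, so this determines \<open>\<tau>\<close> on the group.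
\<close>

definition trivial_tensor_action ::
    "('g, 'm) monoid_scheme \<Rightarrow> ('k::field, 'a) module \<Rightarrow> ('k, 'b) module \<Rightarrow>
     ('g \<Rightarrow> 'b \<Rightarrow> 'b) \<Rightarrow> ('g \<Rightarrow> ('a \<times> 'b \<Rightarrow>\<^sub>0 'k) set \<Rightarrow> ('a \<times> 'b \<Rightarrow>\<^sub>0 'k) set) \<Rightarrow> bool" where
  "trivial_tensor_action \<G> A B \<gamma> \<tau> \<longleftrightarrow> algebra_action \<G> (tensor_algebra A B) \<tau> \<and>
     (\<forall>g\<in>carrier \<G>. \<forall>a\<in>carrier A. \<forall>b\<in>carrier B.
        \<tau> g (pure_tensor A B a b) = pure_tensor A B a (\<gamma> g b))"

text \<open>
  Every finitely generated commutative algebra is a quotient of the polynomial ring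
  \<open>k[x\<^sub>0, x\<^sub>1, \<dots>]\<close>, so up to isomorphism its carrier may be taken to consist of sets of polynomials.
\<close>

type_synonym 'k fg_comm_alg = "('k, ((nat \<Rightarrow>\<^sub>0 nat) \<Rightarrow>\<^sub>0 'k) set) module"

end

theory Submission
  imports Defs "HOL-Library.Function_Algebras" "HOL-Library.Nat_Bijection"
begin

text \<open>
  The algebra \<open>R\<close> lies in its ring of fractions \<open>Q\<close>, of dimension \<open>n\<^sup>2\<close> over its center \<open>F\<close>, and
  \<open>Q\<close> becomes a matrix algebra over an extension of \<open>F\<close>. So \<open>R\<close> has \<open>n\<close>-dimensional representations
  over extensions of \<open>k\<close>; the proof spreads them out to an irreducible family \<open>Theta\<close> of
  representations \<open>R \<rightarrow> M\<^sub>n(k)\<close>, and \<open>C\<close> is the algebra of functions on \<open>Theta\<close> that the matrix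
  entries generate.

  Fix a basis \<open>e\<^sub>a\<close> of \<open>Q\<close> over \<open>F\<close>. Finitely many elements of \<open>F\<close> (structure constants,
  coordinates of generators of \<open>R\<close>, and coefficients witnessing that the maps \<open>x \<mapsto> \<Sum> a x b\<close> of \<open>Q\<close>
  exhaust the \<open>F\<close>-linear ones) generate a subalgebra over which the \<open>e\<^sub>a\<close> span an order that contains
  \<open>R\<close>. At a \<open>k\<close>-point of this subalgebra the order becomes an algebra of dimension \<open>n\<^sup>2\<close> over \<open>k\<close>
  that still has all linear maps as multiplication maps. By the theorems of Wedderburn and
  Skolem-Noether it has exactly one \<open>n\<close>-dimensional representation up to conjugation
  (\<open>wedderburn\<close>, \<open>struct_rep_exists_unique\<close>). The relations that hold for these representations over
  almost all points lie in a prime ideal \<open>rep_prime\<close> that contains no nonzero function of the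
  constants, and \<open>Theta\<close> consists of the representations at its points and of their conjugates.

  The family has three properties. It separates the elements of \<open>R\<close>, by the Nullstellensatz
  (\<open>Theta_separates\<close>). It is irreducible, because \<open>rep_prime\<close> is prime and two conjugates of a
  representation are joined by a line of conjugates (\<open>Theta_irreducible\<close>). Finally a polynomial in the
  entries that vanishes on \<open>Theta\<close> vanishes at \<open>\<theta> \<circ> \<phi>\<close> for each automorphism \<open>\<phi>\<close> of \<open>R\<close>
  (\<open>Theta_stable\<close>): \<open>\<phi>\<close> extends to \<open>Q\<close> and moves the center, so that at a sufficiently general point
  \<open>\<theta> \<circ> \<phi>\<close> is a representation of the order at another point, hence conjugate to the one chosen there.

  Take for generators of \<open>R\<close> a basis of a \<open>G\<close>-stable subspace, and let \<open>C\<close> be the polynomials in the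
  entries of their images modulo those vanishing on \<open>Theta\<close>. Irreducibility makes \<open>C\<close> a domain,
  stability lets \<open>G\<close> act on it by linear substitutions, and \<open>r \<mapsto> \<Sum> E\<^sub>i\<^sub>j \<otimes> r\<^sub>i\<^sub>j\<close>, where \<open>r\<^sub>i\<^sub>j\<close> is the
  function \<open>\<theta> \<mapsto> \<theta>(r)\<^sub>i\<^sub>j\<close>, is the embedding; it is injective because \<open>Theta\<close> separates.
\<close>

section \<open>Polynomials and their evaluation\<close>

abbreviation "single \<equiv> Poly_Mapping.single"
abbreviation "keys \<equiv> Poly_Mapping.keys"
abbreviation "lookup \<equiv> Poly_Mapping.lookup"

type_synonym ('i, 'k) mpol = "('i \<Rightarrow>\<^sub>0 nat) \<Rightarrow>\<^sub>0 'k"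

definition mconst :: "'k \<Rightarrow> ('i, 'k::comm_ring_1) mpol" where
  "mconst c = single 0 c"

definition mvar :: "'i \<Rightarrow> ('i, 'k::comm_ring_1) mpol" where
  "mvar i = single (single i 1) 1"

lemma mconst_simps [simp]:
  "mconst 0 = 0" "mconst 1 = 1" "mconst (a + b) = mconst a + mconst b"
  "mconst (a * b) = mconst a * mconst b" "mconst (- a) = - mconst a"
  by (simp_all add: mconst_def single_add mult_single single_uminus)

text \<open>The subalgebras all live in one ring of polynomials, so that enlarging the set of variables needs no
  inclusion maps.\<close>

inductive_set alg_gen :: "'i set \<Rightarrow> (('i, 'k::comm_ring_1) mpol) set" for V :: "'i set" where
  const: "mconst c \<in> alg_gen V"
| var: "i \<in> V \<Longrightarrow> mvar i \<in> alg_gen V"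
| add: "f \<in> alg_gen V \<Longrightarrow> g \<in> alg_gen V \<Longrightarrow> f + g \<in> alg_gen V"
| mult: "f \<in> alg_gen V \<Longrightarrow> g \<in> alg_gen V \<Longrightarrow> f * g \<in> alg_gen V"

lemma alg_gen_mono: "f \<in> alg_gen V \<Longrightarrow> V \<subseteq> W \<Longrightarrow> f \<in> alg_gen W"
  by (induct rule: alg_gen.induct) (auto intro: alg_gen.intros)

lemma alg_gen_0: "0 \<in> alg_gen V" and alg_gen_1: "1 \<in> alg_gen V"
  using alg_gen.const[of 0 V] alg_gen.const[of 1 V] by auto

lemma alg_gen_uminus: "f \<in> alg_gen V \<Longrightarrow> - f \<in> alg_gen V"
  using alg_gen.mult[OF alg_gen.const[of "-1" V], of f] by simp

lemma alg_gen_diff: "f \<in> alg_gen V \<Longrightarrow> g \<in> alg_gen V \<Longrightarrow> f - g \<in> alg_gen V"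
  using alg_gen.add[OF _ alg_gen_uminus, of f V g] by simp

lemma alg_gen_sum: "(\<And>x. x \<in> A \<Longrightarrow> f x \<in> alg_gen V) \<Longrightarrow> sum f A \<in> alg_gen V"
  by (induct A rule: infinite_finite_induct) (auto intro: alg_gen_0 alg_gen.add)

lemma alg_gen_prod: "(\<And>x. x \<in> A \<Longrightarrow> f x \<in> alg_gen V) \<Longrightarrow> prod f A \<in> alg_gen V"
  by (induct A rule: infinite_finite_induct) (auto intro: alg_gen_1 alg_gen.mult)

lemma alg_gen_power: "f \<in> alg_gen V \<Longrightarrow> f ^ n \<in> alg_gen V"
  by (induct n) (auto intro: alg_gen_1 alg_gen.mult)

lemma poly_mapping_sum_single: "f = (\<Sum>m\<in>keys f. single m (lookup f m))"
proof (rule poly_mapping_eqI)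
  fix k
  have "lookup (\<Sum>m\<in>keys f. single m (lookup f m)) k
      = (\<Sum>m\<in>keys f. if m = k then lookup f m else 0)"
    unfolding lookup_sum by (rule sum.cong) (auto simp: lookup_single)
  also have "\<dots> = lookup f k"
    by (simp add: sum.delta' in_keys_iff)
  finally show "lookup f k = lookup (\<Sum>m\<in>keys f. single m (lookup f m)) k" ..
qed

lemma single_sum_eq_prod:
  "finite A \<Longrightarrow> single (\<Sum>x\<in>A. g x) (1::'k::comm_ring_1) = (\<Prod>x\<in>A. single (g x) 1)"
  for g :: "'x \<Rightarrow> 'i \<Rightarrow>\<^sub>0 nat"
proof (induct A rule: finite_induct)
  case (insert x F)
  then show ?case using mult_single[of "g x" "1::'k" "\<Sum>x\<in>F. g x" 1] by simp
qed simp

lemma single_var_power: "single (single i n) (1::'k::comm_ring_1) = mvar i ^ n"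
proof (induct n)
  case (Suc n)
  have "single i (Suc n) = single i 1 + single i n"
    using single_add[of i 1 n] by simp
  then have "single (single i (Suc n)) (1::'k) = mvar i * single (single i n) 1"
    by (simp only: mvar_def mult_single mult_1)
  then show ?case using Suc by simp
qed simp

lemma single_eq_mvars:
  "single m (c::'a::comm_ring_1) = mconst c * (\<Prod>i\<in>keys m. mvar i ^ lookup m i)"
proof -
  have "single m c = mconst c * single m (1::'a)"
    by (simp add: mconst_def mult_single)
  also have "single m (1::'a) = (\<Prod>i\<in>keys m. mvar i ^ lookup m i)"
    using arg_cong[OF poly_mapping_sum_single[of m], of "\<lambda>m. single m (1::'a)"]
      single_sum_eq_prod[OF finite_keys, of "\<lambda>i. single i (lookup m i)" m, where 'k = 'a]
    by (simp add: single_var_power)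
  finally show ?thesis .
qed

lemma alg_gen_finite_vars: "\<exists>V. finite V \<and> f \<in> alg_gen V"
proof -
  let ?V = "\<Union>m\<in>keys f. keys m"
  have "f = (\<Sum>m\<in>keys f. single m (lookup f m))"
    by (rule poly_mapping_sum_single)
  also have "\<dots> \<in> alg_gen ?V"
    unfolding single_eq_mvars
    by (intro alg_gen_sum alg_gen.mult alg_gen.const alg_gen_prod alg_gen_power alg_gen.var) auto
  finally show ?thesis by (intro exI[of _ ?V]) auto
qed

lemma alg_gen_UNIV: "f \<in> alg_gen UNIV"
  using alg_gen_finite_vars[of f] alg_gen_mono[of f _ UNIV] by auto

lemma mp_induct [case_names const var add mult]:
  assumes "\<And>c. Q (mconst c)" "\<And>i. Q (mvar i)" "\<And>f g. Q f \<Longrightarrow> Q g \<Longrightarrow> Q (f + g)" "\<And>f g. Q f \<Longrightarrow> Q g \<Longrightarrow> Q (f * g)"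
  shows "Q f"
  using alg_gen_UNIV[of f]
proof (induct rule: alg_gen.induct)
  case (const c) show ?case by (rule assms(1))
next
  case (var i) show ?case by (rule assms(2))
next
  case (add f g) show ?case by (rule assms(3)[OF add.hyps(2,4)])
next
  case (mult f g) show ?case by (rule assms(4)[OF mult.hyps(2,4)])
qed

text \<open>Polynomials are evaluated in the center of \<open>Q\<close>, a ring with a carrier, and in type classes; the
  second case is the first one in \<open>class_ring\<close>.\<close>

definition coeff_hom :: "('k::comm_ring_1 \<Rightarrow> 'b) \<Rightarrow> ('b, 'm) ring_scheme \<Rightarrow> bool" where
  "coeff_hom \<kappa> S \<longleftrightarrow> (\<forall>c. \<kappa> c \<in> carrier S) \<and> \<kappa> 1 = \<one>\<^bsub>S\<^esub> \<and>
     (\<forall>a b. \<kappa> (a + b) = \<kappa> a \<oplus>\<^bsub>S\<^esub> \<kappa> b) \<and> (\<forall>a b. \<kappa> (a * b) = \<kappa> a \<otimes>\<^bsub>S\<^esub> \<kappa> b)"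

definition peval :: "('b, 'm) ring_scheme \<Rightarrow> ('k::comm_ring_1 \<Rightarrow> 'b) \<Rightarrow> ('i \<Rightarrow> 'b) \<Rightarrow> (('i, 'k) mpol) \<Rightarrow> 'b" where
  "peval S \<kappa> p f = (\<Oplus>\<^bsub>S\<^esub>m\<in>keys f. \<kappa> (lookup f m) \<otimes>\<^bsub>S\<^esub>
     (\<Otimes>\<^bsub>S\<^esub>i\<in>keys m. p i [^]\<^bsub>S\<^esub> lookup m i))"

context
  fixes S :: "('b, 'm) ring_scheme" (structure) and \<kappa> :: "'k::comm_ring_1 \<Rightarrow> 'b" and p :: "'i \<Rightarrow> 'b"
  assumes S: "cring S" and \<kappa>: "coeff_hom \<kappa> S" and p: "\<And>i. p i \<in> carrier S"
begin

interpretation cring S by (rule S)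

private abbreviation "M m \<equiv> (\<Otimes>i\<in>keys m. p i [^] (lookup m i :: nat))"

private lemma \<kappa>': "\<kappa> c \<in> carrier S" "\<kappa> 1 = \<one>" "\<kappa> (a + b) = \<kappa> a \<oplus> \<kappa> b" "\<kappa> (a * b) = \<kappa> a \<otimes> \<kappa> b"
  using \<kappa> by (auto simp: coeff_hom_def)

private lemma \<kappa>0: "\<kappa> 0 = \<zero>"
proof -
  have "\<kappa> 0 \<oplus> \<kappa> 0 = \<kappa> 0" by (metis \<kappa>'(3) add.right_neutral)
  then show ?thesis using \<kappa>'(1)[of 0] by (metis add.l_cancel_one)
qed

private lemma M_closed: "M m \<in> carrier S"
  by (rule finprod_closed) (use p in auto)

private lemma M_super: "finite A \<Longrightarrow> keys m \<subseteq> A \<Longrightarrow> M m = (\<Otimes>i\<in>A. p i [^] (lookup m i :: nat))"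
  by (rule finprod_mono_neutral_cong_left) (use p in \<open>auto simp: in_keys_iff\<close>)

private lemma M_add: "M (m + m') = M m \<otimes> M m'"
proof -
  let ?A = "keys m \<union> keys m'"
  have "M (m + m') = (\<Otimes>i\<in>?A. p i [^] (lookup (m + m') i))"
    by (rule M_super) (use Poly_Mapping.keys_add[of m m'] in auto)
  also have "\<dots> = (\<Otimes>i\<in>?A. p i [^] (lookup m i) \<otimes> p i [^] (lookup m' i))"
    by (rule finprod_cong') (use p in \<open>auto simp: lookup_add nat_pow_mult\<close>)
  also have "\<dots> = M m \<otimes> M m'"
    by (subst finprod_multf) (use p in \<open>auto simp: M_super[of ?A]\<close>)
  finally show ?thesis .
qed

lemma peval_closed: "peval S \<kappa> p f \<in> carrier S"
  unfolding peval_def by (rule finsum_closed) (use M_closed \<kappa>' in auto)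

private lemma peval_super: "finite A \<Longrightarrow> keys f \<subseteq> A \<Longrightarrow>
   peval S \<kappa> p f = (\<Oplus>m\<in>A. \<kappa> (lookup f m) \<otimes> M m)"
  unfolding peval_def
  by (rule add.finprod_mono_neutral_cong_left) (use M_closed \<kappa>' in \<open>auto simp: in_keys_iff \<kappa>0\<close>)

lemma peval_add: "peval S \<kappa> p (f + g) = peval S \<kappa> p f \<oplus> peval S \<kappa> p g"
proof -
  let ?A = "keys f \<union> keys g"
  have "peval S \<kappa> p (f + g) = (\<Oplus>m\<in>?A. \<kappa> (lookup (f + g) m) \<otimes> M m)"
    by (rule peval_super) (use Poly_Mapping.keys_add[of f g] in auto)
  also have "\<dots> = (\<Oplus>m\<in>?A. \<kappa> (lookup f m) \<otimes> M m \<oplus> \<kappa> (lookup g m) \<otimes> M m)"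
    by (rule finsum_cong') (use M_closed \<kappa>' in \<open>auto simp: lookup_add l_distr\<close>)
  also have "\<dots> = peval S \<kappa> p f \<oplus> peval S \<kappa> p g"
    by (subst finsum_addf) (use M_closed \<kappa>' in \<open>auto simp: peval_super[of ?A]\<close>)
  finally show ?thesis .
qed

private lemma peval_single: "peval S \<kappa> p (single m c) = \<kappa> c \<otimes> M m"
  by (subst peval_super[of "{m}"]) (use M_closed \<kappa>' in auto)

lemma peval_0: "peval S \<kappa> p 0 = \<zero>" by (simp add: peval_def)

private lemma peval_sum: "finite A \<Longrightarrow> peval S \<kappa> p (sum f A) = (\<Oplus>x\<in>A. peval S \<kappa> p (f x))"
proof (induct A rule: finite_induct)
  case (insert x F)
  then show ?case by (simp add: peval_add peval_closed)
qed (simp add: peval_0)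

lemma peval_mult: "peval S \<kappa> p (f * g) = peval S \<kappa> p f \<otimes> peval S \<kappa> p g"
proof -
  have 1: "peval S \<kappa> p (single m c * single m' c')
     = peval S \<kappa> p (single m c) \<otimes> peval S \<kappa> p (single m' c')" for m c m' c'
    using M_closed \<kappa>' by (simp add: mult_single peval_single M_add m_ac)
  have 2: "peval S \<kappa> p (single m c * g) = peval S \<kappa> p (single m c) \<otimes> peval S \<kappa> p g" for m c
  proof -
    let ?s = "\<lambda>x. single x (lookup g x)"
    have g: "g = (\<Sum>x\<in>keys g. ?s x)" by (rule poly_mapping_sum_single)
    have "peval S \<kappa> p (single m c * g) = peval S \<kappa> p (\<Sum>x\<in>keys g. single m c * ?s x)"
      by (subst g) (simp add: sum_distrib_left)
    also have "\<dots> = (\<Oplus>x\<in>keys g. peval S \<kappa> p (single m c) \<otimes> peval S \<kappa> p (?s x))"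
      by (simp only: peval_sum finite_keys 1)
    also have "\<dots> = peval S \<kappa> p (single m c) \<otimes> (\<Oplus>x\<in>keys g. peval S \<kappa> p (?s x))"
      by (subst finsum_rdistr) (auto simp: peval_closed)
    also have "(\<Oplus>x\<in>keys g. peval S \<kappa> p (?s x)) = peval S \<kappa> p g"
      by (subst peval_sum[symmetric]) (simp_all flip: g)
    finally show ?thesis .
  qed
  show ?thesis
  proof -
    let ?s = "\<lambda>x. single x (lookup f x)"
    have f: "f = (\<Sum>x\<in>keys f. ?s x)" by (rule poly_mapping_sum_single)
    have "peval S \<kappa> p (f * g) = peval S \<kappa> p (\<Sum>x\<in>keys f. ?s x * g)"
      by (subst f) (simp add: sum_distrib_right)
    also have "\<dots> = (\<Oplus>x\<in>keys f. peval S \<kappa> p (?s x) \<otimes> peval S \<kappa> p g)"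
      by (simp only: peval_sum finite_keys 2)
    also have "\<dots> = (\<Oplus>x\<in>keys f. peval S \<kappa> p (?s x)) \<otimes> peval S \<kappa> p g"
      by (subst finsum_ldistr) (auto simp: peval_closed)
    also have "(\<Oplus>x\<in>keys f. peval S \<kappa> p (?s x)) = peval S \<kappa> p f"
      by (subst peval_sum[symmetric]) (simp_all flip: f)
    finally show ?thesis .
  qed
qed

lemma peval_const: "peval S \<kappa> p (mconst c) = \<kappa> c"
  using \<kappa>' by (simp add: mconst_def peval_single)

lemma peval_var: "peval S \<kappa> p (mvar i) = p i"
  using \<kappa>' p by (simp add: mvar_def peval_single)

end

definition ev :: "('k::comm_ring_1 \<Rightarrow> 'b::comm_ring_1) \<Rightarrow> ('i \<Rightarrow> 'b) \<Rightarrow> (('i, 'k) mpol) \<Rightarrow> 'b" where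
  "ev \<kappa> p f = peval (class_ring :: 'b ring) \<kappa> p f"

lemma cring_class_ring: "cring (class_ring :: 'b::comm_ring_1 ring)"
  by (rule class_cring.cring_axioms)

lemma coeff_hom_id: "coeff_hom (\<lambda>c. c) (class_ring :: 'b::comm_ring_1 ring)"
  by (auto simp: coeff_hom_def)

lemma coeff_hom_mconst: "coeff_hom mconst class_ring"
  by (auto simp: coeff_hom_def)

lemma ev_simps:
  assumes "coeff_hom \<kappa> class_ring"
  shows "ev \<kappa> p (f + g) = ev \<kappa> p f + ev \<kappa> p g" "ev \<kappa> p (f * g) = ev \<kappa> p f * ev \<kappa> p g"
    "ev \<kappa> p (mconst c) = \<kappa> c" "ev \<kappa> p (mvar i) = p i"
  using peval_add[OF cring_class_ring assms, of p] peval_mult[OF cring_class_ring assms, of p]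
    peval_const[OF cring_class_ring assms, of p] peval_var[OF cring_class_ring assms, of p]
  by (simp_all add: ev_def)

abbreviation "evk \<equiv> ev (\<lambda>c. c)"
abbreviation "subst \<equiv> ev mconst"

lemmas evk [simp] = ev_simps[OF coeff_hom_id]
lemmas subst_simps [simp] = ev_simps[OF coeff_hom_mconst]

lemma evk_0 [simp]: "evk p 0 = 0" and evk_1 [simp]: "evk p 1 = 1"
  using evk(3)[of p 0] evk(3)[of p 1] by auto
lemma evk_uminus [simp]: "evk p (- f) = - evk p f"
  using evk(1)[of p "- f" f] by (simp add: eq_neg_iff_add_eq_0)
lemma evk_diff [simp]: "evk p (f - g) = evk p f - evk p g"
  using evk(1)[of p f "- g"] by simp
lemma evk_sum: "evk p (sum f A) = (\<Sum>x\<in>A. evk p (f x))"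
  by (induct A rule: infinite_finite_induct) auto
lemma subst_0 [simp]: "subst p 0 = 0" and subst_1 [simp]: "subst p 1 = 1"
  using subst_simps(3)[of p 0] subst_simps(3)[of p 1] by auto

lemma evk_subst: "evk p (subst q f) = evk (\<lambda>i. evk p (q i)) f"
  by (induct f rule: mp_induct) auto

lemma evk_cong: "f \<in> alg_gen V \<Longrightarrow> (\<And>i. i \<in> V \<Longrightarrow> p i = q i) \<Longrightarrow> evk p f = evk q f"
  by (induct rule: alg_gen.induct) auto

section \<open>Points of prime ideals\<close>

definition subring_set :: "'t::comm_ring_1 set \<Rightarrow> bool" where
  "subring_set B \<longleftrightarrow> 1 \<in> B \<and> (\<forall>a\<in>B. \<forall>b\<in>B. a + b \<in> B \<and> a * b \<in> B \<and> - a \<in> B)"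

definition prime_set :: "'t::comm_ring_1 set \<Rightarrow> bool" where
  "prime_set P \<longleftrightarrow> 0 \<in> P \<and> 1 \<notin> P \<and> (\<forall>a\<in>P. \<forall>b\<in>P. a + b \<in> P) \<and> (\<forall>a\<in>P. \<forall>t. t * a \<in> P) \<and>
     (\<forall>a b. a * b \<in> P \<longrightarrow> a \<in> P \<or> b \<in> P)"

text \<open>A point of the domain \<open>B / (B \<inter> P)\<close>, as a function on the ambient ring whose values outside \<open>B\<close>
  are irrelevant.\<close>

definition hom_mod :: "'t::comm_ring_1 set \<Rightarrow> 't set \<Rightarrow> ('t \<Rightarrow> 'k::comm_ring_1) \<Rightarrow> bool" where
  "hom_mod B P s \<longleftrightarrow> s 1 = 1 \<and> (\<forall>a\<in>B. \<forall>b\<in>B. s (a + b) = s a + s b \<and> s (a * b) = s a * s b) \<and>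
     (\<forall>a\<in>B \<inter> P. s a = 0)"

lemma primD:
  assumes "prime_set P"
  shows "0 \<in> P" "1 \<notin> P" "a \<in> P \<Longrightarrow> b \<in> P \<Longrightarrow> a + b \<in> P" "a \<in> P \<Longrightarrow> t * a \<in> P" "a \<in> P \<Longrightarrow> a * t \<in> P"
    "a * b \<in> P \<Longrightarrow> a \<in> P \<or> b \<in> P" "a \<in> P \<Longrightarrow> - a \<in> P" "a \<in> P \<Longrightarrow> b \<in> P \<Longrightarrow> a - b \<in> P"
proof -
  show *: "0 \<in> P" "1 \<notin> P" "a \<in> P \<Longrightarrow> b \<in> P \<Longrightarrow> a + b \<in> P" "a \<in> P \<Longrightarrow> t * a \<in> P"
    "a * b \<in> P \<Longrightarrow> a \<in> P \<or> b \<in> P" for a b t using assms by (auto simp: prime_set_def)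
  show "a \<in> P \<Longrightarrow> a * t \<in> P" for a t using *(4)[of a t] by (simp add: mult.commute)
  show **: "a \<in> P \<Longrightarrow> - a \<in> P" for a using *(4)[of a "- 1"] by simp
  show "a \<in> P \<Longrightarrow> b \<in> P \<Longrightarrow> a - b \<in> P" using *(3)[OF _ **, of a b] by simp
qed

lemma prime_set_sum: "prime_set P \<Longrightarrow> (\<And>x. x \<in> A \<Longrightarrow> f x \<in> P) \<Longrightarrow> sum f A \<in> P"
  by (induct A rule: infinite_finite_induct) (auto intro: primD)

lemma prime_set_power: "prime_set P \<Longrightarrow> a ^ n \<in> P \<Longrightarrow> a \<in> P"
  by (induct n) (auto dest: primD)

lemma subrD:
  assumes "subring_set B"
  shows "1 \<in> B" "0 \<in> B" "a \<in> B \<Longrightarrow> b \<in> B \<Longrightarrow> a + b \<in> B" "a \<in> B \<Longrightarrow> b \<in> B \<Longrightarrow> a * b \<in> B" "a \<in> B \<Longrightarrow> - a \<in> B"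
    "a \<in> B \<Longrightarrow> b \<in> B \<Longrightarrow> a - b \<in> B"
proof -
  show *: "1 \<in> B" "a \<in> B \<Longrightarrow> b \<in> B \<Longrightarrow> a + b \<in> B" "a \<in> B \<Longrightarrow> b \<in> B \<Longrightarrow> a * b \<in> B" "a \<in> B \<Longrightarrow> - a \<in> B" for a b
    using assms by (auto simp: subring_set_def)
  show "0 \<in> B" using *(2)[OF *(1) *(4)[OF *(1)]] by simp
  show "a \<in> B \<Longrightarrow> b \<in> B \<Longrightarrow> a - b \<in> B" using *(2)[OF _ *(4), of a b] by simp
qed

lemma subring_set_sum: "subring_set B \<Longrightarrow> (\<And>x. x \<in> A \<Longrightarrow> f x \<in> B) \<Longrightarrow> sum f A \<in> B"
  by (induct A rule: infinite_finite_induct) (auto intro: subrD)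

lemma subring_set_power: "subring_set B \<Longrightarrow> a \<in> B \<Longrightarrow> a ^ n \<in> B"
  by (induct n) (auto intro: subrD)

text \<open>For a subring the polynomials over it, for a prime ideal the polynomials that vanish modulo it.\<close>

definition poly_in :: "'t::zero set \<Rightarrow> 't poly \<Rightarrow> bool" where
  "poly_in B p \<longleftrightarrow> (\<forall>i. Polynomial.coeff p i \<in> B)"

lemma poly_in_B:
  assumes "subring_set B"
  shows "poly_in B p \<Longrightarrow> poly_in B q \<Longrightarrow> poly_in B (p + q)" "poly_in B p \<Longrightarrow> poly_in B q \<Longrightarrow> poly_in B (p - q)"
    "poly_in B p \<Longrightarrow> poly_in B q \<Longrightarrow> poly_in B (p * q)" "a \<in> B \<Longrightarrow> poly_in B p \<Longrightarrow> poly_in B (Polynomial.smult a p)"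
    "a \<in> B \<Longrightarrow> poly_in B (Polynomial.monom a n)" "poly_in B 0" "a \<in> B \<Longrightarrow> poly_in B [:a:]" "poly_in B [:0, 1:]" "poly_in B 1"
    "poly_in B p \<Longrightarrow> poly_in B (- p)"
  using assms
  by (auto simp: poly_in_def subrD coeff_mult coeff_pCons coeff_1 split: nat.splits intro!: subring_set_sum)

lemma poly_in_P:
  assumes "prime_set P"
  shows "poly_in P p \<Longrightarrow> poly_in P q \<Longrightarrow> poly_in P (p + q)" "poly_in P p \<Longrightarrow> poly_in P q \<Longrightarrow> poly_in P (p - q)"
    "poly_in P p \<Longrightarrow> poly_in P (q * p)" "poly_in P p \<Longrightarrow> poly_in P (Polynomial.smult a p)" "poly_in P 0"
    "poly_in P p \<Longrightarrow> poly p t \<in> P"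
  using assms
  by (auto simp: poly_in_def primD coeff_mult poly_altdef intro!: prime_set_sum)

text \<open>The leading coefficient is not invertible, so a power of it has to multiply the dividend.\<close>

lemma pseudo_div:
  assumes B: "subring_set B" and c: "poly_in B c" "degree c \<ge> 1" and p: "poly_in B p"
  shows "\<exists>q r e. poly_in B q \<and> poly_in B r \<and> Polynomial.smult (lead_coeff c ^ e) p = q * c + r \<and> degree r < degree c
            \<and> degree q \<le> degree p - degree c"
  using p
proof (induct "degree p" arbitrary: p rule: less_induct)
  case less
  show ?case
  proof (cases "degree p < degree c")
    case True
    then show ?thesis using less.prems poly_in_B[OF B]
      by (intro exI[of _ 0] exI[of _ p]) auto
  next
    case False
    let ?m = "Polynomial.monom (lead_coeff p) (degree p - degree c)"
    define p' where "p' = Polynomial.smult (lead_coeff c) p - ?m * c"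
    have lc: "lead_coeff c \<in> B" "lead_coeff p \<in> B" using c less.prems by (auto simp: poly_in_def)
    have pin': "poly_in B p'" unfolding p'_def using B c less.prems lc by (intro poly_in_B) auto
    have "degree (?m * c) \<le> degree p"
      using degree_mult_le[of ?m c] degree_monom_le[of "lead_coeff p" "degree p - degree c"] False by linarith
    then have "degree p' \<le> degree p" unfolding p'_def
      by (intro degree_diff_le) (auto simp: degree_smult_le intro: order_trans[OF degree_smult_le])
    moreover have "Polynomial.coeff p' (degree p) = 0"
      using False by (auto simp: p'_def coeff_monom_mult intro: mult.commute)
    moreover have "degree p > 0" using False c by linarith
    ultimately have deg: "degree p' < degree p"
      by (metis le_neq_implies_less leading_coeff_0_iff degree_0)
    obtain q r e where IH: "poly_in B q" "poly_in B r" "Polynomial.smult (lead_coeff c ^ e) p' = q * c + r" "degree r < degree c"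
       "degree q \<le> degree p' - degree c"
      using less.hyps[OF deg pin'] by blast
    let ?q = "q + Polynomial.smult (lead_coeff c ^ e) ?m"
    have "Polynomial.smult (lead_coeff c ^ Suc e) p = Polynomial.smult (lead_coeff c ^ e) (p' + ?m * c)"
      by (simp add: p'_def mult.commute)
    also have "\<dots> = ?q * c + r"
      by (simp add: smult_add_right IH(3) algebra_simps)
    finally have "Polynomial.smult (lead_coeff c ^ Suc e) p = ?q * c + r" .
    moreover have "poly_in B ?q" using B IH lc by (intro poly_in_B subring_set_power) auto
    moreover have "degree ?q \<le> degree p - degree c"
      by (intro degree_add_le) (use IH(5) deg in \<open>auto intro!: order_trans[OF degree_smult_le] degree_monom_le\<close>)
    ultimately show ?thesis using IH by blast
  qed
qed

definition adjoin :: "'t::comm_ring_1 set \<Rightarrow> 't \<Rightarrow> 't set" where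
  "adjoin B t = {poly p t | p. poly_in B p}"

lemma adjoin_subr: "subring_set B \<Longrightarrow> subring_set (adjoin B t)"
  unfolding adjoin_def
proof (subst subring_set_def, intro conjI ballI)
  assume B: "subring_set B"
  then show "1 \<in> {poly p t |p. poly_in B p}"
    by (intro CollectI exI[of _ "1"]) (auto intro: poly_in_B)
  fix a b assume "a \<in> {poly p t |p. poly_in B p}" "b \<in> {poly p t |p. poly_in B p}"
  then obtain p q where p: "a = poly p t" "poly_in B p" "b = poly q t" "poly_in B q" by blast
  show "a + b \<in> {poly p t |p. poly_in B p}" using p B by (auto intro!: exI[of _ "p + q"] poly_in_B)
  show "a * b \<in> {poly p t |p. poly_in B p}" using p B by (auto intro!: exI[of _ "p * q"] poly_in_B)
  show "- a \<in> {poly p t |p. poly_in B p}" using p poly_in_B(2)[OF B poly_in_B(6)[OF B] p(2)] by (auto intro!: exI[of _ "- p"])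
qed

context
  fixes B P :: "'t::comm_ring_1 set" and s :: "'t \<Rightarrow> 'k::comm_ring_1"
  assumes B: "subring_set B" and P: "prime_set P" and s: "hom_mod B P s"
begin

lemma phomD: "s 1 = 1" "a \<in> B \<Longrightarrow> b \<in> B \<Longrightarrow> s (a + b) = s a + s b" "a \<in> B \<Longrightarrow> b \<in> B \<Longrightarrow> s (a * b) = s a * s b"
  "a \<in> B \<Longrightarrow> a \<in> P \<Longrightarrow> s a = 0" "s 0 = 0"
  using s P B by (auto simp: hom_mod_def dest: primD(1) subrD(2))

lemma hom_mod_diff: "a \<in> B \<Longrightarrow> b \<in> B \<Longrightarrow> s (a - b) = s a - s b"
  using phomD(2)[of "a - b" b] subrD(6)[OF B] by (simp add: algebra_simps)

lemma hom_mod_sum: "(\<And>x. x \<in> A \<Longrightarrow> f x \<in> B) \<Longrightarrow> s (sum f A) = (\<Sum>x\<in>A. s (f x))"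
  by (induct A rule: infinite_finite_induct) (auto simp: phomD subring_set_sum[OF B])

lemma hom_mod_power: "a \<in> B \<Longrightarrow> s (a ^ n) = s a ^ n"
  by (induct n) (auto simp: phomD subring_set_power[OF B])

lemma map_poly_phom:
  "poly_in B p \<Longrightarrow> poly_in B q \<Longrightarrow> map_poly s (p + q) = map_poly s p + map_poly s q"
  "poly_in B p \<Longrightarrow> poly_in B q \<Longrightarrow> map_poly s (p - q) = map_poly s p - map_poly s q"
  "poly_in B p \<Longrightarrow> poly_in B q \<Longrightarrow> map_poly s (p * q) = map_poly s p * map_poly s q"
  "a \<in> B \<Longrightarrow> poly_in B p \<Longrightarrow> map_poly s (Polynomial.smult a p) = Polynomial.smult (s a) (map_poly s p)"
  "poly_in B p \<Longrightarrow> poly_in P p \<Longrightarrow> map_poly s p = 0"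
  by (intro poly_eqI; simp add: coeff_map_poly phomD hom_mod_diff hom_mod_sum coeff_mult poly_in_def subrD[OF B])+

text \<open>The value \<open>\<tau>\<close> may be prescribed at \<open>t\<close> as soon as it satisfies the specialised relations of \<open>t\<close>.\<close>

lemma lift_phom:
  assumes root: "\<And>p. poly_in B p \<Longrightarrow> poly p t \<in> P \<Longrightarrow> poly (map_poly s p) \<tau> = 0"
  shows "\<exists>s'. hom_mod (adjoin B t) P s' \<and> (\<forall>a\<in>B. s' a = s a) \<and> (\<forall>p. poly_in B p \<longrightarrow> s' (poly p t) = poly (map_poly s p) \<tau>)"
proof -
  define s' where "s' = (\<lambda>x. poly (map_poly s (SOME p. poly_in B p \<and> poly p t = x)) \<tau>)"
  have val: "s' (poly p t) = poly (map_poly s p) \<tau>" if p: "poly_in B p" for p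
  proof -
    define q where "q = (SOME q. poly_in B q \<and> poly q t = poly p t)"
    have q: "poly_in B q" "poly q t = poly p t" using someI[of "\<lambda>q. poly_in B q \<and> poly q t = poly p t" p] p by (auto simp: q_def)
    have "poly (map_poly s (q - p)) \<tau> = 0"
      by (rule root) (use B P p q in \<open>auto intro: poly_in_B primD\<close>)
    then show ?thesis using p q by (simp add: s'_def map_poly_phom flip: q_def)
  qed
  have ext: "s' a = s a" if "a \<in> B" for a
    using val[of "[:a:]"] that B by (simp add: poly_in_B map_poly_pCons phomD)
  have "hom_mod (adjoin B t) P s'"
    unfolding hom_mod_def adjoin_def
  proof (intro conjI ballI)
    show "s' 1 = 1" using ext[OF subrD(1)[OF B]] phomD(1) by simp
    fix a b assume "a \<in> {poly p t |p. poly_in B p}" "b \<in> {poly p t |p. poly_in B p}"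
    then obtain p q where p: "a = poly p t" "poly_in B p" "b = poly q t" "poly_in B q" by blast
    show "s' (a + b) = s' a + s' b" using val[of "p + q"] p B by (simp add: val poly_in_B map_poly_phom)
    show "s' (a * b) = s' a * s' b" using val[of "p * q"] p B by (simp add: val poly_in_B map_poly_phom)
  next
    fix a assume "a \<in> {poly p t |p. poly_in B p} \<inter> P"
    then show "s' a = 0" using val root by auto
  qed
  with val ext show ?thesis by blast
qed

end

text \<open>If \<open>t\<close> is transcendental modulo \<open>P\<close> then all values of \<open>t\<close> are possible, and a polynomial with a
  nonzero coefficient has a non-root. Otherwise let \<open>c\<close> be a relation of least degree. Where its leading
  coefficient survives, its roots are the possible values of \<open>t\<close>; as \<open>c\<close> is irreducible modulo \<open>P\<close>, a
  multiple of \<open>b'\<close> is a nonzero constant \<open>e\<close> modulo \<open>c\<close>, so \<open>b'\<close> survives wherever \<open>e\<close> does.\<close>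

lemma extend_hom_one:
  fixes B P :: "'t::comm_ring_1 set"
  assumes B: "subring_set B" and P: "prime_set P" and b': "b' \<in> adjoin B t" "b' \<notin> P"
  shows "\<exists>b\<in>B - P. \<forall>s :: 't \<Rightarrow> 'k::{alg_closed_field, field_char_0}. hom_mod B P s \<longrightarrow> s b \<noteq> 0 \<longrightarrow>
     (\<exists>s'. hom_mod (adjoin B t) P s' \<and> (\<forall>a\<in>B. s' a = s a) \<and> s' b' \<noteq> 0)"
proof -
  obtain p0 where p0: "poly_in B p0" "b' = poly p0 t" using b' by (auto simp: adjoin_def)
  show ?thesis
  proof (cases "\<forall>p. poly_in B p \<longrightarrow> poly p t \<in> P \<longrightarrow> poly_in P p")
    case True
    have "\<not> poly_in P p0" using poly_in_P(6)[OF P, of p0 t] p0 b' by auto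
    then obtain i where i: "Polynomial.coeff p0 i \<notin> P" by (auto simp: poly_in_def)
    have "\<exists>s'. hom_mod (adjoin B t) P s' \<and> (\<forall>a\<in>B. s' a = s a) \<and> s' b' \<noteq> 0"
      if s: "hom_mod B P s" "s (Polynomial.coeff p0 i) \<noteq> 0" for s :: "'t \<Rightarrow> 'k"
    proof -
      have "map_poly s p0 \<noteq> 0" using s phomD(5)[OF B P s(1)] by (metis coeff_0 coeff_map_poly)
      then have "finite {x. poly (map_poly s p0) x = 0}" by (rule poly_roots_finite)
      then obtain \<tau> where \<tau>: "poly (map_poly s p0) \<tau> \<noteq> 0"
        using infinite_UNIV_char_0[where 'a = 'k] by (metis (mono_tags, lifting) UNIV_eq_I mem_Collect_eq)
      have "poly (map_poly s p) \<tau> = 0" if "poly_in B p" "poly p t \<in> P" for p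
        using True that map_poly_phom(5)[OF B P s(1)] by auto
      then show ?thesis using lift_phom[OF B P s(1), of t \<tau>] \<tau> p0 by metis
    qed
    then show ?thesis using i p0 by (intro bexI[of _ "Polynomial.coeff p0 i"]) (auto simp: poly_in_def)
  next
    case False
    define C where "C = {p. poly_in B p \<and> poly p t \<in> P \<and> \<not> poly_in P p}"
    define c where "c = arg_min degree (\<lambda>p. p \<in> C)"
    have cC: "c \<in> C" and cmin: "\<And>p. p \<in> C \<Longrightarrow> degree c \<le> degree p"
      using False arg_min_natI[of "\<lambda>p. p \<in> C" _ degree] arg_min_nat_le[of "\<lambda>p. p \<in> C" _ degree]
      by (auto simp: c_def C_def)
    have c: "poly_in B c" "poly c t \<in> P" "\<not> poly_in P c" using cC by (auto simp: C_def)
    have small: "poly_in P p" if "poly_in B p" "poly p t \<in> P" "degree p < degree c" for p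
      using cmin[of p] that by (auto simp: C_def)
    have drop: "\<exists>p'. poly_in B p' \<and> p = p' + Polynomial.monom (lead_coeff p) (degree p) \<and> (degree p' < degree p \<or> p' = 0)"
      if "poly_in B p" for p
    proof -
      let ?p = "p - Polynomial.monom (lead_coeff p) (degree p)"
      have "poly_in B ?p" using that B by (intro poly_in_B) (auto simp: poly_in_def)
      moreover have "degree ?p \<le> degree p" by (intro degree_diff_le) (auto simp: degree_monom_le)
      moreover have "Polynomial.coeff ?p (degree p) = 0" by simp
      ultimately show ?thesis
        by (intro exI[of _ ?p]) (metis diff_add_cancel le_neq_implies_less leading_coeff_0_iff)
    qed
    have monP: "poly_in P (Polynomial.monom a n)" if "a \<in> P" for a n using that primD(1)[OF P] by (auto simp: poly_in_def)
    have lc: "lead_coeff c \<notin> P"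
    proof
      assume l: "lead_coeff c \<in> P"
      obtain p' where p': "poly_in B p'" "c = p' + Polynomial.monom (lead_coeff c) (degree c)" "degree p' < degree c \<or> p' = 0"
        using drop[OF c(1)] by blast
      have "poly c t = poly p' t + poly (Polynomial.monom (lead_coeff c) (degree c)) t"
        by (subst p'(2)) simp
      then have "poly p' t \<in> P" using primD(8)[OF P c(2) poly_in_P(6)[OF P monP[OF l], of "degree c" t]] by simp
      then have "poly_in P p'" using p' small poly_in_P(5)[OF P] by auto
      then have "poly_in P c" by (subst p'(2)) (rule poly_in_P(1)[OF P _ monP[OF l]])
      then show False using c by simp
    qed
    have lcB: "lead_coeff c \<in> B" using c by (auto simp: poly_in_def)
    have deg: "degree c \<ge> 1"
    proof (rule ccontr)
      assume "\<not> degree c \<ge> 1"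
      then obtain a where "c = [:a:]" by (metis One_nat_def degree_eq_zeroE less_one not_le)
      then show False using c lc by simp
    qed
    \<comment> \<open>combinations of \<open>c\<close> and \<open>p0\<close> modulo \<open>P\<close>; one of least degree divides \<open>c\<close> up to units, so is constant\<close>
    define W where "W = {w. poly_in B w \<and> \<not> poly_in P w \<and> degree w < degree c \<and> (\<exists>u v. poly_in B u \<and> poly_in B v \<and> poly_in P (w - u * c - v * p0))}"
    have W0: "\<exists>w. w \<in> W"
    proof -
      obtain q r e where qr: "poly_in B q" "poly_in B r" "Polynomial.smult (lead_coeff c ^ e) p0 = q * c + r" "degree r < degree c"
        using pseudo_div[OF B c(1) deg p0(1)] by blast
      have "\<not> poly_in P r"
      proof
        assume "poly_in P r"
        then have "poly (q * c + r) t \<in> P" using c P poly_in_P(6)[OF P, of r t] by (auto intro: primD)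
        then have "lead_coeff c ^ e * b' \<in> P" using p0 by (simp flip: qr(3))
        then show False using primD(6)[OF P] prime_set_power[OF P] lc b' by blast
      qed
      moreover have "poly_in P (r - (- q) * c - [:lead_coeff c ^ e:] * p0)"
      proof -
        have "r - (- q) * c - [:lead_coeff c ^ e:] * p0 = 0" using qr(3) by (simp add: algebra_simps)
        then show ?thesis using poly_in_P(5)[OF P] by (simp only:)
      qed
      moreover have "poly_in B (- q)" "poly_in B [:lead_coeff c ^ e:]" using qr B lcB by (auto intro!: poly_in_B subring_set_power)
      ultimately have "r \<in> W" unfolding W_def using qr by blast
      then show ?thesis by blast
    qed
    define w where "w = arg_min degree (\<lambda>p. p \<in> W)"
    have wW: "w \<in> W" and wmin: "\<And>p. p \<in> W \<Longrightarrow> degree w \<le> degree p"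
      using W0 arg_min_natI[of "\<lambda>p. p \<in> W" _ degree] arg_min_nat_le[of "\<lambda>p. p \<in> W" _ degree]
      by (auto simp: w_def)
    obtain u v where w: "poly_in B w" "\<not> poly_in P w" "degree w < degree c" "poly_in B u" "poly_in B v" "poly_in P (w - u * c - v * p0)"
      using wW by (auto simp: W_def)
    have lw: "lead_coeff w \<notin> P"
    proof
      assume l: "lead_coeff w \<in> P"
      obtain p' where p': "poly_in B p'" "w = p' + Polynomial.monom (lead_coeff w) (degree w)" "degree p' < degree w \<or> p' = 0"
        using drop[OF w(1)] by blast
      have np: "\<not> poly_in P p'" using w(2) p'(2) poly_in_P(1)[OF P _ monP[OF l], of p' "degree w"] by auto
      then have "degree p' < degree w" using p' poly_in_P(5)[OF P] by auto
      moreover have "poly_in P (p' - u * c - v * p0)"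
      proof -
        have pe: "p' = w - Polynomial.monom (lead_coeff w) (degree w)" using p'(2) by (metis add_diff_cancel_right')
        have "p' - u * c - v * p0 = (w - u * c - v * p0) - Polynomial.monom (lead_coeff w) (degree w)"
          unfolding pe by (simp add: algebra_simps)
        then show ?thesis using poly_in_P(2)[OF P w(6) monP[OF l], of "degree w"] by (simp only:)
      qed
      ultimately have "p' \<in> W" using p' np w unfolding W_def by auto
      then show False using wmin[of p'] \<open>degree p' < degree w\<close> by simp
    qed
    have "degree w = 0"
    proof (rule ccontr)
      assume "degree w \<noteq> 0"
      then have dw: "degree w \<ge> 1" by simp
      obtain q r e where qr: "poly_in B q" "poly_in B r" "Polynomial.smult (lead_coeff w ^ e) c = q * w + r" "degree r < degree w"
        "degree q \<le> degree c - degree w"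
        using pseudo_div[OF B w(1) dw c(1)] by blast
      have lwB: "lead_coeff w \<in> B" using w by (auto simp: poly_in_def)
      have "poly_in P r"
      proof (rule ccontr)
        assume nr: "\<not> poly_in P r"
        let ?u = "[:lead_coeff w ^ e:] - q * u" and ?v = "0 - q * v"
        have "r - ?u * c - ?v * p0 = 0 - q * (w - u * c - v * p0)"
          using qr(3) by (simp add: algebra_simps)
        then have "poly_in P (r - ?u * c - ?v * p0)" using w(6) P by (metis poly_in_P(2,3,5))
        moreover have "poly_in B ?u" "poly_in B ?v" using B w qr lwB by (auto intro!: poly_in_B(2,3,6,7,10) subring_set_power)
        ultimately have "r \<in> W" using nr qr w unfolding W_def by fastforce
        then show False using wmin[of r] qr by simp
      qed
      have "poly (Polynomial.smult (lead_coeff w ^ e) c) t \<in> P" using c P by (auto intro: primD)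
      moreover have "poly q t * poly w t = poly (Polynomial.smult (lead_coeff w ^ e) c) t - poly r t" by (simp add: qr(3))
      ultimately have "poly q t * poly w t \<in> P"
        using primD(8)[OF P _ poly_in_P(6)[OF P \<open>poly_in P r\<close>, of t]] by metis
      moreover have "poly w t \<notin> P" using small[of w] w by auto
      ultimately have "poly q t \<in> P" using primD(6)[OF P] by blast
      moreover have "degree q < degree c" using qr(5) dw w(3) by linarith
      ultimately have "poly_in P q" using small qr by blast
      then have "poly_in P (Polynomial.smult (lead_coeff w ^ e) c)"
        using poly_in_P[OF P] \<open>poly_in P r\<close> qr(3) by (metis mult.commute)
      then have "lead_coeff w ^ e * lead_coeff c \<in> P" unfolding poly_in_def by (metis coeff_smult)
      then show False using lw lc primD(6)[OF P] prime_set_power[OF P] by blast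
    qed
    then obtain e where we: "w = [:e:]" by (metis degree_eq_zeroE)
    have e: "e \<in> B" "e \<notin> P" using w lw we by (auto simp: poly_in_def dest: spec[of _ 0])
    have "\<exists>s'. hom_mod (adjoin B t) P s' \<and> (\<forall>a\<in>B. s' a = s a) \<and> s' b' \<noteq> 0"
      if s: "hom_mod B P s" "s (lead_coeff c * e) \<noteq> 0" for s :: "'t \<Rightarrow> 'k"
    proof -
      note [simp] = map_poly_phom[OF B P s(1)]
      have sl: "s (lead_coeff c) \<noteq> 0" "s e \<noteq> 0" using s(2) phomD(3)[OF B P s(1) lcB e(1)] by auto
      have "degree (map_poly s c) = degree c"
        using sl(1) by (intro antisym map_poly_degree_leq le_degree) (simp_all add: coeff_map_poly phomD[OF B P s(1)])
      then obtain \<tau> where \<tau>: "poly (map_poly s c) \<tau> = 0"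
        using alg_closed_imp_poly_has_root[of "map_poly s c"] deg by auto
      have "poly (map_poly s p) \<tau> = 0" if p: "poly_in B p" "poly p t \<in> P" for p
      proof -
        obtain q r k where qr: "poly_in B q" "poly_in B r" "Polynomial.smult (lead_coeff c ^ k) p = q * c + r" "degree r < degree c"
          using pseudo_div[OF B c(1) deg p(1)] by blast
        have "poly r t = lead_coeff c ^ k * poly p t - poly q t * poly c t"
          using arg_cong[OF qr(3), of "\<lambda>p. poly p t"] by simp
        then have "poly r t \<in> P" using p c P by (auto intro: primD)
        then have "poly_in P r" using small qr by blast
        then have "map_poly s r = 0" using qr by simp
        then have "map_poly s (Polynomial.smult (lead_coeff c ^ k) p) = map_poly s q * map_poly s c"
          using qr(1,2) c(1) B by (simp add: qr(3) poly_in_B)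
        then have "Polynomial.smult (s (lead_coeff c) ^ k) (map_poly s p) = map_poly s q * map_poly s c"
          using p B lcB by (simp add: subring_set_power hom_mod_power[OF B P s(1)])
        then have "s (lead_coeff c) ^ k * poly (map_poly s p) \<tau> = 0"
          using \<tau> by (metis mult_zero_right poly_mult poly_smult)
        then show ?thesis using sl by simp
      qed
      then obtain s' where s': "hom_mod (adjoin B t) P s'" "\<forall>a\<in>B. s' a = s a" "\<And>p. poly_in B p \<Longrightarrow> s' (poly p t) = poly (map_poly s p) \<tau>"
        using lift_phom[OF B P s(1), of t \<tau>] by blast
      have "map_poly s (w - u * c - v * p0) = 0"
        using w c p0 B by (intro map_poly_phom(5)[OF B P s(1)]) (auto intro!: poly_in_B)
      then have "map_poly s w = map_poly s u * map_poly s c + map_poly s v * map_poly s p0"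
        using w c p0 B by (simp add: poly_in_B algebra_simps)
      moreover have "map_poly s w = [:s e:]" by (simp add: we map_poly_pCons phomD[OF B P s(1)])
      ultimately have "poly [:s e:] \<tau> = poly (map_poly s u * map_poly s c + map_poly s v * map_poly s p0) \<tau>" by metis
      then have "s e = poly (map_poly s v) \<tau> * s' b'"
        using \<tau> s'(3)[OF p0(1)] p0(2) by simp
      then show ?thesis using s' sl by auto
    qed
    moreover have "lead_coeff c * e \<in> B - P" using lcB e lc B primD(6)[OF P] by (auto intro: subrD)
    ultimately show ?thesis by blast
  qed
qed

text \<open>An ideal that is maximal among those that contain \<open>J\<close> and miss \<open>S\<close> is prime.\<close>

lemma prime_avoiding:
  fixes J S :: "'t::comm_ring_1 set"
  assumes J: "0 \<in> J" "\<And>a b. a \<in> J \<Longrightarrow> b \<in> J \<Longrightarrow> a + b \<in> J" "\<And>a t. a \<in> J \<Longrightarrow> t * a \<in> J"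
    and S: "1 \<in> S" "\<And>a b. a \<in> S \<Longrightarrow> b \<in> S \<Longrightarrow> a * b \<in> S" and disj: "J \<inter> S = {}"
  shows "\<exists>P. prime_set P \<and> J \<subseteq> P \<and> P \<inter> S = {}"
proof -
  define idl where "idl = (\<lambda>I :: 't set. 0 \<in> I \<and> (\<forall>a\<in>I. \<forall>b\<in>I. a + b \<in> I) \<and> (\<forall>a\<in>I. \<forall>t. t * a \<in> I))"
  define A where "A = {I. idl I \<and> J \<subseteq> I \<and> I \<inter> S = {}}"
  have "\<exists>M\<in>A. \<forall>X\<in>A. M \<subseteq> X \<longrightarrow> X = M"
  proof (rule subset_Zorn_nonempty)
    have "J \<in> A" unfolding A_def idl_def using J disj by blast
    then show "A \<noteq> {}" by blast
    fix C assume C: "C \<noteq> {}" "subset.chain A C"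
    have CA: "C \<subseteq> A" using C(2) by (auto simp: subset.chain_def)
    have tot: "\<And>X Y. X \<in> C \<Longrightarrow> Y \<in> C \<Longrightarrow> X \<subseteq> Y \<or> Y \<subseteq> X" using C(2) by (auto simp: subset.chain_def)
    have mem: "idl X" if "X \<in> C" for X using CA that by (auto simp: A_def)
    have "idl (\<Union>C)"
      unfolding idl_def
    proof (intro conjI ballI allI)
      show "0 \<in> \<Union>C" using C(1) mem by (auto simp: idl_def)
      fix a assume "a \<in> \<Union>C"
      then obtain X where X: "X \<in> C" "a \<in> X" by auto
      show "t * a \<in> \<Union>C" for t using X(2) mem[OF X(1)] by (intro UnionI[OF X(1)]) (simp add: idl_def)
      fix b assume "b \<in> \<Union>C"
      then obtain Y where Y: "Y \<in> C" "b \<in> Y" by auto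
      show "a + b \<in> \<Union>C" using tot[OF X(1) Y(1)]
      proof
        assume "X \<subseteq> Y" then show ?thesis using X Y mem[OF Y(1)] by (intro UnionI[OF Y(1)]) (auto simp: idl_def)
      next
        assume "Y \<subseteq> X" then show ?thesis using X Y mem[OF X(1)] by (intro UnionI[OF X(1)]) (auto simp: idl_def)
      qed
    qed
    then show "\<Union>C \<in> A" using C(1) CA by (auto simp: A_def)
  qed
  then obtain P where PA: "P \<in> A" and max: "\<And>X. X \<in> A \<Longrightarrow> P \<subseteq> X \<Longrightarrow> X = P" by blast
  have P: "0 \<in> P" "\<And>a b. a \<in> P \<Longrightarrow> b \<in> P \<Longrightarrow> a + b \<in> P" "\<And>a t. a \<in> P \<Longrightarrow> t * a \<in> P" "J \<subseteq> P" "P \<inter> S = {}"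
    using PA by (auto simp: A_def idl_def)
  have meet: "\<exists>y\<in>P. \<exists>t. y + t * a \<in> S" if a: "a \<notin> P" for a
  proof (rule ccontr)
    assume no: "\<not> ?thesis"
    let ?I = "{y + t * a | y t. y \<in> P}"
    have 1: "\<exists>y''\<in>P. \<exists>t''. (y + t * a) + (y' + t' * a) = y'' + t'' * a" if "y \<in> P" "y' \<in> P" for y y' t t'
      using P(2)[OF that] by (intro bexI[of _ "y + y'"] exI[of _ "t + t'"]) (auto simp: algebra_simps)
    have 2: "\<exists>y''\<in>P. \<exists>t''. u * (y + t * a) = y'' + t'' * a" if "y \<in> P" for y t u
      using P(3)[OF that] by (intro bexI[of _ "u * y"] exI[of _ "u * t"]) (auto simp: algebra_simps)
    have inI: "y + t * a \<in> ?I" if "y \<in> P" for y t using that by blast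
    have sub: "P \<subseteq> ?I" using inI[of _ 0] by auto
    moreover have "idl ?I" unfolding idl_def
    proof (intro conjI ballI allI)
      show "0 \<in> ?I" using sub P(1) by blast
      fix x assume "x \<in> ?I"
      then obtain y t where x: "x = y + t * a" "y \<in> P" by blast
      show "u * x \<in> ?I" for u using 2[OF x(2), of u t] by (auto simp: x(1))
      fix x' assume "x' \<in> ?I"
      then obtain y' t' where x': "x' = y' + t' * a" "y' \<in> P" by blast
      show "x + x' \<in> ?I" using 1[OF x(2) x'(2), of t t'] by (auto simp: x(1) x'(1))
    qed
    ultimately have "?I \<in> A" using P(4) no by (auto simp: A_def)
    then have "?I = P" using max sub by blast
    moreover have "a \<in> ?I" using inI[OF P(1), of 1] by simp
    ultimately show False using a by simp
  qed
  have "prime_set P"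
    unfolding prime_set_def
  proof (intro conjI ballI allI impI)
    show "1 \<notin> P" using P(5) S(1) by auto
    fix a b assume ab: "a * b \<in> P"
    show "a \<in> P \<or> b \<in> P"
    proof (rule ccontr)
      assume n: "\<not> ?thesis"
      then obtain y t where y: "y \<in> P" "y + t * a \<in> S" using meet by blast
      obtain z u where z: "z \<in> P" "z + u * b \<in> S" using n meet by blast
      have "(y + t * a) * (z + u * b) = (z + u * b) * y + (t * a) * z + (t * u) * (a * b)" by (simp add: algebra_simps)
      also have "\<dots> \<in> P" using P(2)[OF P(2)[OF P(3)[OF y(1)] P(3)[OF z(1)]] P(3)[OF ab]] .
      finally show False using S(2)[OF y(2) z(2)] P(5) by auto
    qed
  qed (use P in auto)
  then show ?thesis using P by blast
qed

definition kpoint :: "'i set \<Rightarrow> (('i, 'k::comm_ring_1) mpol) set \<Rightarrow> ('i \<Rightarrow> 'k) \<Rightarrow> bool" where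
  "kpoint V P p \<longleftrightarrow> (\<forall>f\<in>alg_gen V \<inter> P. evk p f = 0)"

lemma kpoint_mono: "kpoint V P p \<Longrightarrow> W \<subseteq> V \<Longrightarrow> kpoint W P p"
  using alg_gen_mono by (fastforce simp: kpoint_def)

lemma subring_set_alg_gen: "subring_set (alg_gen V)"
  by (auto simp: subring_set_def alg_gen_1 alg_gen_uminus intro: alg_gen.intros)

lemma alg_gen_insert: "alg_gen (insert i V) = adjoin (alg_gen V) (mvar i :: ('i, 'k::comm_ring_1) mpol)" (is "?L = ?R")
proof
  have R: "subring_set ?R" by (intro adjoin_subr subring_set_alg_gen)
  have B: "alg_gen V \<subseteq> ?R"
  proof
    fix a :: "('i, 'k) mpol" assume "a \<in> alg_gen V"
    then have "poly_in (alg_gen V) [:a:]" by (intro poly_in_B subring_set_alg_gen)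
    then show "a \<in> ?R" by (auto simp: adjoin_def intro!: exI[of _ "[:a:]"])
  qed
  have t: "mvar i \<in> ?R"
    using poly_in_B(8)[OF subring_set_alg_gen, of V] by (auto simp: adjoin_def intro!: exI[of _ "[:0, 1:]"])
  show "?L \<subseteq> ?R"
  proof
    fix f assume "f \<in> ?L"
    then show "f \<in> ?R"
      by induct (use B t in \<open>auto intro: subrD[OF R] alg_gen.intros\<close>)
  qed
  show "?R \<subseteq> ?L"
  proof
    fix f assume "f \<in> ?R"
    then obtain p where p: "poly_in (alg_gen V) p" "f = poly p (mvar i)" by (auto simp: adjoin_def)
    have "Polynomial.coeff p j \<in> ?L" for j
      by (rule alg_gen_mono[of _ V]) (use p in \<open>auto simp: poly_in_def\<close>)
    then show "f \<in> ?L" unfolding p poly_altdef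
      by (intro alg_gen_sum alg_gen.mult alg_gen_power alg_gen.var insertI1)
  qed
qed

lemma extend_hom_finite:
  fixes P :: "(('i, 'k::{alg_closed_field, field_char_0}) mpol) set"
  assumes P: "prime_set P" and J: "finite J"
  shows "b' \<in> alg_gen (J \<union> V) - P \<Longrightarrow> \<exists>b\<in>alg_gen V - P. \<forall>s :: _ \<Rightarrow> 'k. hom_mod (alg_gen V) P s \<longrightarrow> s b \<noteq> 0 \<longrightarrow>
     (\<exists>s'. hom_mod (alg_gen (J \<union> V)) P s' \<and> (\<forall>a\<in>alg_gen V. s' a = s a) \<and> s' b' \<noteq> 0)"
  using J
proof (induct J arbitrary: b' rule: finite_induct)
  case empty
  then show ?case by auto
next
  case (insert x F)
  have eq: "alg_gen (insert x F \<union> V) = adjoin (alg_gen (F \<union> V)) (mvar x)" by (simp add: alg_gen_insert)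
  obtain b1 where b1: "b1 \<in> alg_gen (F \<union> V) - P" "\<And>s :: _ \<Rightarrow> 'k. hom_mod (alg_gen (F \<union> V)) P s \<Longrightarrow> s b1 \<noteq> 0 \<Longrightarrow>
     (\<exists>s'. hom_mod (adjoin (alg_gen (F \<union> V)) (mvar x)) P s' \<and> (\<forall>a\<in>alg_gen (F \<union> V). s' a = s a) \<and> s' b' \<noteq> 0)"
    using extend_hom_one[OF subring_set_alg_gen P, of b' "F \<union> V" "mvar x", where 'k = 'k] insert.prems unfolding eq by blast
  obtain b where b: "b\<in>alg_gen V - P" "\<And>s :: _ \<Rightarrow> 'k. hom_mod (alg_gen V) P s \<Longrightarrow> s b \<noteq> 0 \<Longrightarrow>
     (\<exists>s'. hom_mod (alg_gen (F \<union> V)) P s' \<and> (\<forall>a\<in>alg_gen V. s' a = s a) \<and> s' b1 \<noteq> 0)"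
    using insert.hyps(3)[OF b1(1)] by blast
  show ?case
  proof (intro bexI[OF _ b(1)] allI impI)
    fix s :: "_ \<Rightarrow> 'k" assume s: "hom_mod (alg_gen V) P s" "s b \<noteq> 0"
    obtain s' where s': "hom_mod (alg_gen (F \<union> V)) P s'" "\<forall>a\<in>alg_gen V. s' a = s a" "s' b1 \<noteq> 0" using b(2)[OF s] by blast
    obtain s'' where s'': "hom_mod (adjoin (alg_gen (F \<union> V)) (mvar x)) P s''" "\<forall>a\<in>alg_gen (F \<union> V). s'' a = s' a" "s'' b' \<noteq> 0"
      using b1(2)[OF s'(1,3)] by blast
    have sub: "a \<in> alg_gen (F \<union> V)" if "a \<in> alg_gen V" for a :: "('i, 'k) mpol"
      by (rule alg_gen_mono[OF that]) auto
    show "\<exists>s'. hom_mod (alg_gen (insert x F \<union> V)) P s' \<and> (\<forall>a\<in>alg_gen V. s' a = s a) \<and> s' b' \<noteq> 0"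
      unfolding eq using s' s'' sub by (intro exI[of _ s'']) metis
  qed
qed

text \<open>The geometric form of the extension of homomorphisms: the projection from the points over \<open>J \<union> V\<close> to
  those over \<open>V\<close> is dominant, and its image contains a nonempty open set.\<close>

lemma extend_point:
  fixes P :: "(('i, 'k::{alg_closed_field, field_char_0}) mpol) set"
  assumes P: "prime_set P" and J: "finite J" and f': "f' \<in> alg_gen (J \<union> V)" "f' \<notin> P"
  shows "\<exists>f\<in>alg_gen V - P. \<forall>p. kpoint V P p \<longrightarrow> evk p f \<noteq> 0 \<longrightarrow>
     (\<exists>p'. (\<forall>i\<in>V. p' i = p i) \<and> kpoint (J \<union> V) P p' \<and> evk p' f' \<noteq> 0)"
proof -
  obtain f where f: "f\<in>alg_gen V - P" "\<And>s :: _ \<Rightarrow> 'k. hom_mod (alg_gen V) P s \<Longrightarrow> s f \<noteq> 0 \<Longrightarrow>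
     (\<exists>s'. hom_mod (alg_gen (J \<union> V)) P s' \<and> (\<forall>a\<in>alg_gen V. s' a = s a) \<and> s' f' \<noteq> 0)"
    using extend_hom_finite[OF P J, of f' V] f' by blast
  show ?thesis
  proof (intro bexI[OF _ f(1)] allI impI)
    fix p assume p: "kpoint V P p" "evk p f \<noteq> 0"
    have "hom_mod (alg_gen V) P (evk p)" using p by (auto simp: hom_mod_def kpoint_def)
    then obtain s' where s': "hom_mod (alg_gen (J \<union> V)) P s'" "\<forall>a\<in>alg_gen V. s' a = evk p a" "s' f' \<noteq> 0" using f(2) p(2) by blast
    have eq: "evk (\<lambda>i. s' (mvar i)) h = s' h" if "h \<in> alg_gen (J \<union> V)" for h
      using that
    proof induct
      case (const c)
      then show ?case using s'(2) alg_gen.const[of c V] by simp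
    qed (use s'(1) in \<open>auto simp: hom_mod_def\<close>)
    show "\<exists>p'. (\<forall>i\<in>V. p' i = p i) \<and> kpoint (J \<union> V) P p' \<and> evk p' f' \<noteq> 0"
      using s' eq f' by (intro exI[of _ "\<lambda>i. s' (mvar i)"]) (auto simp: kpoint_def hom_mod_def alg_gen.var)
  qed
qed

text \<open>Points over the empty set of variables impose no condition, since \<open>P\<close> contains no nonzero constant.\<close>

lemma nullstellensatz:
  fixes P :: "(('i, 'k::{alg_closed_field, field_char_0}) mpol) set"
  assumes P: "prime_set P" and J: "finite J" and f': "f' \<in> alg_gen J" "f' \<notin> P"
  shows "\<exists>p. kpoint J P p \<and> evk p f' \<noteq> 0"
proof -
  have const: "\<exists>c. f = mconst c" if "f \<in> alg_gen {}" for f :: "('i, 'k) mpol"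
    using that by induct (auto simp flip: mconst_simps)
  have nz: "c = 0" if "mconst c \<in> P" for c
  proof (rule ccontr)
    assume "c \<noteq> 0"
    then have "mconst (inverse c) * mconst c = (1 :: ('i, 'k) mpol)" by (simp flip: mconst_simps(4))
    then show False using primD(2,4)[OF P] that by metis
  qed
  obtain f where f: "f\<in>alg_gen {} - P" "\<And>p. kpoint {} P p \<Longrightarrow> evk p f \<noteq> 0 \<Longrightarrow>
     (\<exists>p'. kpoint J P p' \<and> evk p' f' \<noteq> 0)"
    using extend_point[OF P J, of f' "{}"] f' by auto
  have "kpoint {} P p" for p using const nz by (fastforce simp: kpoint_def)
  moreover have "evk p f \<noteq> 0" for p using f(1) const[of f] primD(1)[OF P] by fastforce
  ultimately show ?thesis using f(2) by blast
qed

section \<open>Conjugation of matrices\<close>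

text \<open>This is \<open>Y B Y\<^sup>-\<^sup>1\<close>; the adjugate shows that its entries are polynomials in those of \<open>Y\<close> over the
  determinant.\<close>

definition conj_mat :: "'k::field mat \<Rightarrow> 'k mat \<Rightarrow> 'k mat" where
  "conj_mat Y B = inverse (det Y) \<cdot>\<^sub>m (Y * B * adj_mat Y)"

lemma smult_inverse: "a \<noteq> 0 \<Longrightarrow> inverse a \<cdot>\<^sub>m (a \<cdot>\<^sub>m A) = A" for a :: "'k::field"
  by (intro eq_matI) auto

context
  fixes n :: nat and Y :: "'k::field mat"
  assumes Y: "Y \<in> carrier_mat n n" and dY: "det Y \<noteq> 0"
begin

private lemma aY: "adj_mat Y \<in> carrier_mat n n" "Y * adj_mat Y = det Y \<cdot>\<^sub>m 1\<^sub>m n" "adj_mat Y * Y = det Y \<cdot>\<^sub>m 1\<^sub>m n"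
  using adj_mat[OF Y] by auto

lemma conj_carrier: "B \<in> carrier_mat n n \<Longrightarrow> conj_mat Y B \<in> carrier_mat n n"
  using Y aY(1) unfolding conj_mat_def by (intro smult_carrier_mat mult_carrier_mat)

lemma conj_mult_right: assumes B: "B \<in> carrier_mat n n" shows "conj_mat Y B * Y = Y * B"
proof -
  have YB: "Y * B \<in> carrier_mat n n" using Y B by simp
  have "conj_mat Y B * Y = inverse (det Y) \<cdot>\<^sub>m (Y * B * adj_mat Y * Y)"
    unfolding conj_mat_def using Y B aY(1) by (intro mult_smult_assoc_mat[of _ n n]) auto
  also have "Y * B * adj_mat Y * Y = Y * B * (adj_mat Y * Y)"
    by (rule assoc_mult_mat[OF YB aY(1) Y])
  also have "\<dots> = det Y \<cdot>\<^sub>m (Y * B)"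
    unfolding aY(3) using YB by (subst mult_smult_distrib[of _ n n _ n]) auto
  finally show ?thesis using dY by (simp add: smult_inverse)
qed

lemma conj_unique:
  assumes B: "B \<in> carrier_mat n n" and C: "C \<in> carrier_mat n n" and eq: "C * Y = Y * B"
  shows "C = conj_mat Y B"
proof -
  have "Y * B * adj_mat Y = C * (Y * adj_mat Y)"
    unfolding eq[symmetric] by (rule assoc_mult_mat[OF C Y aY(1)])
  also have "\<dots> = det Y \<cdot>\<^sub>m C"
    unfolding aY(2) using C by (subst mult_smult_distrib[of _ n n _ n]) auto
  finally show ?thesis using dY by (simp add: conj_mat_def smult_inverse)
qed

lemma conj_mult: assumes B: "B \<in> carrier_mat n n" and C: "C \<in> carrier_mat n n"
  shows "conj_mat Y (B * C) = conj_mat Y B * conj_mat Y C"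
proof (rule conj_unique[symmetric])
  show "B * C \<in> carrier_mat n n" using B C by simp
  have cB: "conj_mat Y B \<in> carrier_mat n n" and cC: "conj_mat Y C \<in> carrier_mat n n" using conj_carrier B C by auto
  show "conj_mat Y B * conj_mat Y C \<in> carrier_mat n n" using cB cC by simp
  have "conj_mat Y B * conj_mat Y C * Y = conj_mat Y B * (Y * C)"
    by (simp add: assoc_mult_mat[OF cB cC Y] conj_mult_right[OF C])
  also have "\<dots> = conj_mat Y B * Y * C" by (rule assoc_mult_mat[OF cB Y C, symmetric])
  also have "\<dots> = Y * (B * C)" unfolding conj_mult_right[OF B] by (rule assoc_mult_mat[OF Y B C])
  finally show "conj_mat Y B * conj_mat Y C * Y = Y * (B * C)" .
qed

lemma conj_add: assumes B: "B \<in> carrier_mat n n" and C: "C \<in> carrier_mat n n"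
  shows "conj_mat Y (B + C) = conj_mat Y B + conj_mat Y C"
proof (rule conj_unique[symmetric])
  show "B + C \<in> carrier_mat n n" using B C by simp
  have cB: "conj_mat Y B \<in> carrier_mat n n" and cC: "conj_mat Y C \<in> carrier_mat n n" using conj_carrier B C by auto
  show "conj_mat Y B + conj_mat Y C \<in> carrier_mat n n" using cB cC by simp
  show "(conj_mat Y B + conj_mat Y C) * Y = Y * (B + C)"
    by (simp add: add_mult_distrib_mat[OF cB cC Y] mult_add_distrib_mat[OF Y B C] conj_mult_right B C)
qed

lemma conj_smult: assumes B: "B \<in> carrier_mat n n" shows "conj_mat Y (k \<cdot>\<^sub>m B) = k \<cdot>\<^sub>m conj_mat Y B"
proof (rule conj_unique[symmetric])
  show "k \<cdot>\<^sub>m B \<in> carrier_mat n n" using B by simp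
  have cB: "conj_mat Y B \<in> carrier_mat n n" using conj_carrier B by auto
  show "k \<cdot>\<^sub>m conj_mat Y B \<in> carrier_mat n n" using cB by simp
  show "k \<cdot>\<^sub>m conj_mat Y B * Y = Y * (k \<cdot>\<^sub>m B)"
    by (simp add: mult_smult_assoc_mat[OF cB Y] mult_smult_distrib[OF Y B] conj_mult_right B)
qed

lemma conj_one: "conj_mat Y (1\<^sub>m n) = 1\<^sub>m n"
  by (rule conj_unique[symmetric]) (use Y in auto)

end

lemma conj_conj:
  fixes Y Z B :: "'k::field mat"
  assumes Y: "Y \<in> carrier_mat n n" "det Y \<noteq> 0" and Z: "Z \<in> carrier_mat n n" "det Z \<noteq> 0" and B: "B \<in> carrier_mat n n"
  shows "conj_mat Z (conj_mat Y B) = conj_mat (Z * Y) B"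
proof (rule conj_unique)
  have cB: "conj_mat Y B \<in> carrier_mat n n" by (rule conj_carrier[OF Y B])
  have cc: "conj_mat Z (conj_mat Y B) \<in> carrier_mat n n" by (rule conj_carrier[OF Z cB])
  show "Z * Y \<in> carrier_mat n n" "det (Z * Y) \<noteq> 0" using Z Y by (auto simp: det_mult)
  show "conj_mat Z (conj_mat Y B) \<in> carrier_mat n n" by (rule cc)
  have "conj_mat Z (conj_mat Y B) * (Z * Y) = Z * conj_mat Y B * Y"
    by (simp add: assoc_mult_mat[OF cc Z(1) Y(1), symmetric] conj_mult_right[OF Z cB])
  also have "\<dots> = Z * Y * B"
    by (simp add: assoc_mult_mat[OF Z(1) cB Y(1)] conj_mult_right[OF Y B] assoc_mult_mat[OF Z(1) Y(1) B])
  finally show "conj_mat Z (conj_mat Y B) * (Z * Y) = Z * Y * B" .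
qed (rule B)

lemma conj_inverse:
  fixes Y :: "'k::field mat"
  assumes Y: "Y \<in> carrier_mat n n" "det Y \<noteq> 0"
  shows "\<exists>Z. Z \<in> carrier_mat n n \<and> det Z \<noteq> 0 \<and> (\<forall>B\<in>carrier_mat n n. conj_mat Z (conj_mat Y B) = B)"
proof -
  let ?Z = "adj_mat Y"
  note aY = adj_mat[OF Y(1)]
  have d: "det (?Z * Y) = det Y ^ n" using aY(3) by (simp add: det_smult)
  then have dZ: "det ?Z \<noteq> 0" using Y det_mult[OF aY(1) Y(1)] by auto
  have "conj_mat ?Z (conj_mat Y B) = B" if B: "B \<in> carrier_mat n n" for B
  proof -
    have "B = conj_mat (?Z * Y) B"
    proof (rule conj_unique)
      show "?Z * Y \<in> carrier_mat n n" using aY(1) Y by simp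
      show "det (?Z * Y) \<noteq> 0" using d Y by simp
      show "B * (?Z * Y) = ?Z * Y * B" unfolding aY(3)
        using B by (simp add: mult_smult_distrib[OF B one_carrier_mat] mult_smult_assoc_mat[OF one_carrier_mat B])
    qed (use B in auto)
    then show ?thesis by (simp add: conj_conj[OF Y aY(1) dZ B])
  qed
  then show ?thesis using aY(1) dZ by blast
qed

section \<open>lines\<close>

definition polyfun :: "('k::field \<Rightarrow> 'k) \<Rightarrow> bool" where
  "polyfun g \<longleftrightarrow> (\<exists>q. \<forall>t. g t = poly q t)"

lemma polyfun_const: "polyfun (\<lambda>t. c)" by (auto simp: polyfun_def intro: exI[of _ "[:c:]"])
lemma polyfun_id: "polyfun (\<lambda>t. t)" by (auto simp: polyfun_def intro: exI[of _ "[:0, 1:]"])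
lemma polyfun_add: "polyfun f \<Longrightarrow> polyfun g \<Longrightarrow> polyfun (\<lambda>t. f t + g t)"
  unfolding polyfun_def by (metis poly_add)
lemma polyfun_mult: "polyfun f \<Longrightarrow> polyfun g \<Longrightarrow> polyfun (\<lambda>t. f t * g t)"
  unfolding polyfun_def by (metis poly_mult)
lemma polyfun_diff: "polyfun f \<Longrightarrow> polyfun g \<Longrightarrow> polyfun (\<lambda>t. f t - g t)"
  unfolding polyfun_def by (metis poly_diff)
lemma polyfun_sum: "(\<And>x. x \<in> A \<Longrightarrow> polyfun (f x)) \<Longrightarrow> polyfun (\<lambda>t. \<Sum>x\<in>A. f x t)"
  by (induct A rule: infinite_finite_induct) (auto intro: polyfun_const polyfun_add)
lemma polyfun_prod: "(\<And>x. x \<in> A \<Longrightarrow> polyfun (f x)) \<Longrightarrow> polyfun (\<lambda>t. \<Prod>x\<in>A. f x t)"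
  by (induct A rule: infinite_finite_induct) (auto intro: polyfun_const polyfun_mult)

lemma polyfun_det:
  assumes M: "\<And>t. M t \<in> carrier_mat n n" and e: "\<And>i j. i < n \<Longrightarrow> j < n \<Longrightarrow> polyfun (\<lambda>t. M t $$ (i, j))"
  shows "polyfun (\<lambda>t. det (M t))"
proof -
  have eq: "(\<lambda>t. det (M t)) = (\<lambda>t. \<Sum>p | p permutes {0..<n}. signof p * (\<Prod>i=0..<n. M t $$ (i, p i)))"
    by (rule ext) (rule det_def'[OF M])
  have "p i < n" if "p permutes {0..<n}" "i < n" for p i using permutes_in_image[OF that(1), of i] that(2) by simp
  then show ?thesis unfolding eq
    by (intro polyfun_sum polyfun_mult polyfun_const polyfun_prod e) auto
qed

lemma polyfun_adj:
  assumes M: "\<And>t. M t \<in> carrier_mat n n" and e: "\<And>i j. i < n \<Longrightarrow> j < n \<Longrightarrow> polyfun (\<lambda>t. M t $$ (i, j))"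
    and ij: "i < n" "j < n"
  shows "polyfun (\<lambda>t. adj_mat (M t) $$ (i, j))"
proof -
  have d: "dim_row (M t) = n" "dim_col (M t) = n" for t using M[of t] by auto
  have eq: "(\<lambda>t. adj_mat (M t) $$ (i, j)) = (\<lambda>t. (- 1) ^ (j + i) * det (mat_delete (M t) j i))"
    using ij by (auto simp: adj_mat_def cofactor_def fun_eq_iff d)
  show ?thesis unfolding eq
  proof (intro polyfun_mult polyfun_const polyfun_det[of _ "n - 1"])
    show "mat_delete (M t) j i \<in> carrier_mat (n - 1) (n - 1)" for t using M by (rule mat_delete_carrier)
    fix a b assume ab: "a < n - 1" "b < n - 1"
    have eq: "(\<lambda>t. mat_delete (M t) j i $$ (a, b)) = (\<lambda>t. M t $$ (if a < j then a else Suc a, if b < i then b else Suc b))"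
      using ab by (auto simp: mat_delete_def fun_eq_iff d)
    show "polyfun (\<lambda>t. mat_delete (M t) j i $$ (a, b))" unfolding eq using ab by (intro e) auto
  qed
qed

text \<open>Variables are decoded as positions \<open>(l, a, b)\<close>, the entry \<open>(a, b)\<close> of the matrix number \<open>l\<close>. Positions
  that do not exist get the value 0.\<close>

definition entries_at :: "('i \<Rightarrow> nat \<times> nat \<times> nat) \<Rightarrow> nat \<Rightarrow> nat \<Rightarrow> (nat \<Rightarrow> 'k::zero mat) \<Rightarrow> 'i \<Rightarrow> 'k" where
  "entries_at dec L n X i = (case dec i of (l, a, b) \<Rightarrow> if l < L \<and> a < n \<and> b < n then X l $$ (a, b) else 0)"

text \<open>On the line from \<open>Y0\<close> to \<open>Y1\<close> the two values and the determinant are rational functions of the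
  parameter, none of them zero, so they are nonzero simultaneously at some parameter.\<close>

lemma conjugates_irreducible:
  fixes B :: "nat \<Rightarrow> 'k::{field, field_char_0} mat"
  assumes B: "\<And>l. l < L \<Longrightarrow> B l \<in> carrier_mat n n"
    and Y0: "Y0 \<in> carrier_mat n n" "det Y0 \<noteq> 0" and Y1: "Y1 \<in> carrier_mat n n" "det Y1 \<noteq> 0"
    and f: "evk (entries_at dec L n (\<lambda>l. conj_mat Y0 (B l))) f \<noteq> 0"
    and h: "evk (entries_at dec L n (\<lambda>l. conj_mat Y1 (B l))) h \<noteq> 0"
  shows "\<exists>Y. Y \<in> carrier_mat n n \<and> det Y \<noteq> 0 \<and> evk (entries_at dec L n (\<lambda>l. conj_mat Y (B l))) f \<noteq> 0
     \<and> evk (entries_at dec L n (\<lambda>l. conj_mat Y (B l))) h \<noteq> 0"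
proof -
  define A where "A t = Matrix.mat n n (\<lambda>(i, j). (1 - t) * Y0 $$ (i, j) + t * Y1 $$ (i, j))" for t
  have A: "A t \<in> carrier_mat n n" for t by (simp add: A_def)
  have A01: "A 0 = Y0" "A 1 = Y1" using Y0 Y1 by (auto simp: A_def intro!: eq_matI)
  have Ae: "polyfun (\<lambda>t. A t $$ (i, j))" if "i < n" "j < n" for i j
    using that unfolding A_def by (auto intro!: polyfun_add polyfun_mult polyfun_diff polyfun_const polyfun_id)
  obtain d where d: "\<And>t. det (A t) = poly d t" using polyfun_det[OF A Ae] unfolding polyfun_def by blast
  define rat where "rat g \<longleftrightarrow> (\<exists>N q. \<forall>t. poly d t \<noteq> 0 \<longrightarrow> poly d t ^ N * g t = poly q t)" for g :: "'k \<Rightarrow> 'k"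
  have rat_poly: "rat g" if "polyfun g" for g
    using that unfolding polyfun_def rat_def by (metis mult_1 power_0)
  have rat_add: "rat (\<lambda>t. g t + g' t)" and rat_mult: "rat (\<lambda>t. g t * g' t)" if g: "rat g" and g': "rat g'" for g g'
  proof -
    obtain N q where q: "\<And>t. poly d t \<noteq> 0 \<Longrightarrow> poly d t ^ N * g t = poly q t" using g unfolding rat_def by blast
    obtain N' q' where q': "\<And>t. poly d t \<noteq> 0 \<Longrightarrow> poly d t ^ N' * g' t = poly q' t" using g' unfolding rat_def by blast
    have "poly d t ^ (N + N') * (g t + g' t) = poly (d ^ N' * q + d ^ N * q') t" if "poly d t \<noteq> 0" for t
      using q[OF that, symmetric] q'[OF that, symmetric] by (simp add: algebra_simps power_add)
    then show "rat (\<lambda>t. g t + g' t)" unfolding rat_def by blast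
    have "poly d t ^ (N + N') * (g t * g' t) = poly (q * q') t" if "poly d t \<noteq> 0" for t
      using q[OF that, symmetric] q'[OF that, symmetric] by (simp add: algebra_simps power_add)
    then show "rat (\<lambda>t. g t * g' t)" unfolding rat_def by blast
  qed
  have entry: "rat (\<lambda>t. conj_mat (A t) (B l) $$ (a, b))" if l: "l < L" and ab: "a < n" "b < n" for l a b
  proof -
    have aA: "adj_mat (A t) \<in> carrier_mat n n" for t using adj_mat[OF A] by blast
    have BA: "dim_row (B l) = n" "dim_col (B l) = n" "dim_row (A t) = n" "dim_col (A t) = n"
      "dim_row (adj_mat (A t)) = n" "dim_col (adj_mat (A t)) = n" for t
      using B[OF l] A[of t] aA[of t] by auto
    let ?g = "\<lambda>t. \<Sum>x=0..<n. (\<Sum>y=0..<n. A t $$ (a, y) * B l $$ (y, x)) * adj_mat (A t) $$ (x, b)"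
    have eq: "conj_mat (A t) (B l) $$ (a, b) = inverse (det (A t)) * ?g t" for t
      using ab BA by (simp add: conj_mat_def scalar_prod_def)
    have "polyfun ?g" using ab by (intro polyfun_sum polyfun_mult polyfun_const Ae polyfun_adj[OF A Ae]) auto
    then obtain q where q: "\<And>t. ?g t = poly q t" unfolding polyfun_def by blast
    have "poly d t ^ 1 * conj_mat (A t) (B l) $$ (a, b) = poly q t" if "poly d t \<noteq> 0" for t
      using that by (simp add: eq d flip: q)
    then show ?thesis unfolding rat_def by blast
  qed
  let ?v = "\<lambda>t. entries_at dec L n (\<lambda>l. conj_mat (A t) (B l))"
  have rat: "rat (\<lambda>t. evk (?v t) g)" for g
  proof (induct g rule: mp_induct)
    case (const c)
    then show ?case by (auto intro: rat_poly polyfun_const)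
  next
    case (var i)
    obtain l a b where i: "dec i = (l, a, b)" by (cases "dec i")
    show ?case
    proof (cases "l < L \<and> a < n \<and> b < n")
      case True
      then show ?thesis using entry[of l a b] by (simp add: entries_at_def i)
    next
      case False
      then have eq: "(\<lambda>t. evk (?v t) (mvar i)) = (\<lambda>t. 0)" by (auto simp: entries_at_def i)
      show ?thesis unfolding eq by (rule rat_poly[OF polyfun_const])
    qed
  qed (auto intro: rat_add rat_mult)
  obtain N q where q: "\<And>t. poly d t \<noteq> 0 \<Longrightarrow> poly d t ^ N * evk (?v t) f = poly q t" using rat[of f] unfolding rat_def by blast
  obtain N' q' where q': "\<And>t. poly d t \<noteq> 0 \<Longrightarrow> poly d t ^ N' * evk (?v t) h = poly q' t" using rat[of h] unfolding rat_def by blast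
  have "poly d 0 \<noteq> 0" "poly d 1 \<noteq> 0" using d[of 0] d[of 1] A01 Y0 Y1 by auto
  then have "poly q 0 \<noteq> 0" "poly q' 1 \<noteq> 0" "d \<noteq> 0" using q[of 0] q'[of 1] f h A01 by auto
  then have "d * q * q' \<noteq> 0" by auto
  then have "finite {t. poly (d * q * q') t = 0}" by (rule poly_roots_finite)
  then obtain t where t: "poly (d * q * q') t \<noteq> 0"
    using infinite_UNIV_char_0[where 'a = 'k] by (metis (mono_tags, lifting) UNIV_eq_I mem_Collect_eq)
  then have "poly d t \<noteq> 0" "evk (?v t) f \<noteq> 0" "evk (?v t) h \<noteq> 0" using q[of t] q'[of t] by auto
  then show ?thesis using A[of t] d[of t] by (intro exI[of _ "A t"]) auto
qed

section \<open>Finite-dimensional prime algebras\<close>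

locale vector_space_families = vector_space scale
  for scale :: "'a::field \<Rightarrow> 'b::ab_group_add \<Rightarrow> 'b" (infixr \<open>*s\<close> 75)
begin

definition fam_indep :: "('i \<Rightarrow> 'b) \<Rightarrow> 'i set \<Rightarrow> bool" where
  "fam_indep e I \<longleftrightarrow> (\<forall>t. (\<Sum>i\<in>I. t i *s e i) = 0 \<longrightarrow> (\<forall>i\<in>I. t i = 0))"

lemma fam_indepD: "fam_indep e I \<Longrightarrow> (\<Sum>i\<in>I. t i *s e i) = 0 \<Longrightarrow> i \<in> I \<Longrightarrow> t i = 0"
  by (auto simp: fam_indep_def)

lemma fam_indep_inj: assumes "finite I" "fam_indep e I" shows "inj_on e I"
proof (rule inj_onI, rule ccontr)
  fix i j assume ij: "i \<in> I" "j \<in> I" "e i = e j" "i \<noteq> j"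
  have "(\<Sum>l\<in>I. (if l = i then 1 else if l = j then - 1 else 0) *s e l) = (\<Sum>l\<in>{i, j}. (if l = i then 1 else if l = j then - 1 else 0) *s e l)"
    by (rule sum.mono_neutral_right) (use ij assms in auto)
  also have "\<dots> = 0" using ij by simp
  finally show False using fam_indepD[OF assms(2) _ ij(1)] by fastforce
qed

lemma fam_independent: assumes "finite I" "fam_indep e I" shows "independent (e ` I)"
proof (rule independent_if_scalars_zero)
  show "finite (e ` I)" using assms by simp
  fix f x assume "(\<Sum>x\<in>e ` I. f x *s x) = 0" "x \<in> e ` I"
  then show "f x = 0"
    using fam_indepD[OF assms(2), of "\<lambda>i. f (e i)"] by (auto simp: sum.reindex[OF fam_indep_inj[OF assms]])
qed

lemma fam_span: "finite I \<Longrightarrow> y \<in> span (e ` I) \<Longrightarrow> \<exists>t :: 'i \<Rightarrow> 'a. y = (\<Sum>i\<in>I. t i *s e i)"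
proof (induct I arbitrary: y rule: finite_induct)
  case (insert x F)
  obtain k where k: "y - k *s e x \<in> span (e ` F)" using insert.prems span_breakdown_eq[of y "e x" "e ` F"] by auto
  obtain t :: "'i \<Rightarrow> 'a" where t: "y - k *s e x = (\<Sum>i\<in>F. t i *s e i)" using insert.hyps(3)[OF k] by blast
  have "(\<Sum>i\<in>F. (t(x := k)) i *s e i) = (\<Sum>i\<in>F. t i *s e i)"
    by (rule sum.cong) (use insert.hyps in auto)
  then have "y = (\<Sum>i\<in>insert x F. (t(x := k)) i *s e i)"
    using insert.hyps t by (simp add: algebra_simps)
  then show ?case by blast
qed auto

lemma fam_dim: assumes "finite I" "fam_indep e I" "e ` I \<subseteq> U" "U \<subseteq> span (e ` I)" shows "dim U = card I"
  using dim_unique[OF assms(3,4) fam_independent[OF assms(1,2)]] card_image[OF fam_indep_inj[OF assms(1,2)]] by blast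

lemma fam_exists:
  assumes "finite E" "U \<subseteq> span E"
  shows "\<exists>(d::nat) w. (\<forall>i<d. w i \<in> U) \<and> fam_indep w {..<d} \<and> U \<subseteq> span (w ` {..<d}) \<and> d = dim U"
proof -
  obtain B where B: "B \<subseteq> U" "independent B" "U \<subseteq> span B" "card B = dim U" by (rule basis_exists)
  have fin: "finite B" using independent_span_bound[OF assms(1) B(2)] B(1) assms(2) by auto
  obtain w where w: "bij_betw w {..<card B} B" using ex_bij_betw_nat_finite[OF fin] by (auto simp: atLeast0LessThan)
  have "fam_indep w {..<card B}"
    unfolding fam_indep_def
  proof (intro allI impI ballI)
    fix t i assume t: "(\<Sum>i<card B. t i *s w i) = 0" and i: "i \<in> {..<card B}"
    define s where "s = (\<lambda>b. t (inv_into {..<card B} w b))"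
    have s: "s (w j) = t j" if "j < card B" for j
      using w that by (simp add: s_def bij_betw_def)
    have "(\<Sum>b\<in>B. s b *s b) = (\<Sum>i<card B. s (w i) *s w i)"
      by (rule sum.reindex_bij_betw[OF w, symmetric])
    then have "(\<Sum>b\<in>B. s b *s b) = 0" using t s by simp
    then show "t i = 0" using independentD[OF B(2) fin, of s "w i"] s i w by (auto simp: bij_betw_def)
  qed
  then show ?thesis using w B by (intro exI[of _ "card B"] exI[of _ w]) (auto simp: bij_betw_def)
qed

lemma subspace_eq_of_dim:
  assumes "finite E" "W \<subseteq> span E" "subspace U" "subspace W" "U \<subseteq> W" "dim W \<le> dim U"
  shows "U = W"
proof -
  obtain B where B: "B \<subseteq> U" "independent B" "U \<subseteq> span B" "card B = dim U" by (rule basis_exists)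
  obtain B' where B': "B \<subseteq> B'" "B' \<subseteq> W" "independent B'" "W \<subseteq> span B'"
    using maximal_independent_subset_extend[of B W] B assms by (metis subset_trans)
  have fin: "finite B'" using independent_span_bound[OF assms(1) B'(3)] B'(2) assms(2) by auto
  have "card B' \<le> card B" using basis_card_eq_dim[OF B'(2,4,3)] B(4) assms(6) by simp
  then have "B = B'" using card_seteq[OF fin B'(1)] by simp
  then show ?thesis using B B' assms span_minimal[of B U] by blast
qed

lemma fam_dep:
  assumes "finite E" "\<And>i. i \<le> card E \<Longrightarrow> v i \<in> span E"
  shows "\<not> fam_indep v {..card E}"
proof
  assume f: "fam_indep v {..card E}"
  have "card (v ` {..card E}) \<le> card E"
    using independent_span_bound[OF assms(1) fam_independent[OF _ f]] assms(2) by auto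
  then show False using card_image[OF fam_indep_inj[OF _ f]] by simp
qed

end

text \<open>A space of functions on a finite set that kills no nonzero linear functional is the whole space.\<close>

lemma separating_dual:
  fixes \<Phi> :: "('i \<Rightarrow> 'k::field) set"
  assumes fin: "finite I"
    and add: "\<And>f g. f \<in> \<Phi> \<Longrightarrow> g \<in> \<Phi> \<Longrightarrow> (\<lambda>i. f i + g i) \<in> \<Phi>" and sc: "\<And>c f. f \<in> \<Phi> \<Longrightarrow> (\<lambda>i. c * f i) \<in> \<Phi>"
    and zero: "(\<lambda>i. 0) \<in> \<Phi>"
    and sep: "\<And>t. (\<exists>i\<in>I. t i \<noteq> 0) \<Longrightarrow> \<exists>f\<in>\<Phi>. (\<Sum>i\<in>I. t i * f i) \<noteq> 0"
    and j: "j \<in> I"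
  shows "\<exists>f\<in>\<Phi>. \<forall>i\<in>I. f i = (if i = j then 1 else 0)"
  using fin sep j
proof (induct I arbitrary: j rule: finite_induct)
  case (insert x F)
  have sum_mem: "(\<lambda>i. \<Sum>l\<in>J. g l i) \<in> \<Phi>" if "\<And>l. l \<in> J \<Longrightarrow> g l \<in> \<Phi>" for J :: "'i set" and g
    using that by (induct J rule: infinite_finite_induct) (auto intro: add zero)
  have "\<exists>f\<in>\<Phi>. \<forall>i\<in>F. f i = (if i = l then 1 else 0)" if l: "l \<in> F" for l
  proof (rule insert.hyps(3)[OF _ l])
    fix t :: "'i \<Rightarrow> 'k" assume "\<exists>i\<in>F. t i \<noteq> 0"
    then obtain i where "i \<in> F" "t i \<noteq> 0" by blast
    then have "\<exists>i\<in>insert x F. (t(x := 0)) i \<noteq> 0" using insert.hyps by (intro bexI[of _ i]) auto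
    from insert.prems(1)[OF this] obtain f where "f \<in> \<Phi>" "(\<Sum>i\<in>insert x F. (t(x := 0)) i * f i) \<noteq> 0" by blast
    moreover have "(\<Sum>i\<in>insert x F. (t(x := 0)) i * f i) = (\<Sum>i\<in>F. t i * f i)"
      using insert.hyps by (auto intro!: sum.cong)
    ultimately show "\<exists>f\<in>\<Phi>. (\<Sum>i\<in>F. t i * f i) \<noteq> 0" by auto
  qed
  then obtain d where d: "\<And>l. l \<in> F \<Longrightarrow> d l \<in> \<Phi>" "\<And>l i. l \<in> F \<Longrightarrow> i \<in> F \<Longrightarrow> d l i = (if i = l then 1 else 0)" by metis
  define t where "t = (\<lambda>i. if i = x then 1 else - d i x)"
  have "\<exists>i\<in>insert x F. t i \<noteq> 0" by (auto simp: t_def)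
  from insert.prems(1)[OF this] obtain f where f: "f \<in> \<Phi>" "(\<Sum>i\<in>insert x F. t i * f i) \<noteq> 0" by blast
  define g where "g = (\<lambda>i. f i + (- 1) * (\<Sum>l\<in>F. f l * d l i))"
  have g: "g \<in> \<Phi>" unfolding g_def using f d by (intro add sc sum_mem) auto
  have gF: "g i = 0" if "i \<in> F" for i
  proof -
    have "(\<Sum>l\<in>F. f l * d l i) = (\<Sum>l\<in>F. if l = i then f l else 0)" using d that by (intro sum.cong) auto
    then show ?thesis using that insert.hyps by (simp add: g_def)
  qed
  have "g x = (\<Sum>i\<in>insert x F. t i * f i)"
  proof -
    have "(\<Sum>i\<in>F. t i * f i) = - (\<Sum>l\<in>F. f l * d l x)"
      unfolding sum_negf[symmetric] using insert.hyps by (intro sum.cong) (auto simp: t_def mult.commute)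
    then show ?thesis using insert.hyps by (simp add: g_def t_def)
  qed
  then have gx: "g x \<noteq> 0" using f by simp
  define h where "h = (\<lambda>i. inverse (g x) * g i)"
  have h: "h \<in> \<Phi>" "h x = 1" "\<And>i. i \<in> F \<Longrightarrow> h i = 0" using g gx gF by (auto simp: h_def intro: sc)
  show ?case
  proof (cases "j = x")
    case True
    then show ?thesis using h insert.hyps by (intro bexI[of _ h]) auto
  next
    case False
    then have jF: "j \<in> F" using insert.prems by auto
    have "(\<lambda>i. d j i + (- d j x) * h i) \<in> \<Phi>" using d jF h by (intro add sc) auto
    then show ?thesis using h d jF False insert.hyps by (intro bexI[of _ "\<lambda>i. d j i + (- d j x) * h i"]) auto
  qed
qed auto

locale prime_algebra = vector_space_families scale
  for scale :: "'k::{alg_closed_field, field_char_0} \<Rightarrow> 'v::ab_group_add \<Rightarrow> 'v" (infixr \<open>*s\<close> 75) +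
  fixes A :: "'v set" and mul :: "'v \<Rightarrow> 'v \<Rightarrow> 'v" (infixl \<open>\<star>\<close> 70) and one :: 'v and E :: "'v set"
  assumes sub: "subspace A" and E: "finite E" "A \<subseteq> span E"
    and closed: "a \<star> b \<in> A"
    and distr: "(a + b) \<star> c = a \<star> c + b \<star> c" "a \<star> (b + c) = a \<star> b + a \<star> c"
    and scl: "(k *s a) \<star> b = k *s (a \<star> b)" "a \<star> (k *s b) = k *s (a \<star> b)"
    and assoc: "(a \<star> b) \<star> c = a \<star> (b \<star> c)"
    and one: "one \<in> A" "one \<noteq> 0" "a \<in> A \<Longrightarrow> one \<star> a = a" "a \<in> A \<Longrightarrow> a \<star> one = a"
    and prime: "a \<in> A \<Longrightarrow> b \<in> A \<Longrightarrow> (\<And>y. y \<in> A \<Longrightarrow> a \<star> y \<star> b = 0) \<Longrightarrow> a = 0 \<or> b = 0"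
begin

lemma zero_mul: "0 \<star> b = 0" "b \<star> 0 = 0"
  using scl(1)[of 0 0 b] scl(2)[of b 0 0] by auto

lemma diff_mul: "(a - b) \<star> c = a \<star> c - b \<star> c" "c \<star> (a - b) = c \<star> a - c \<star> b"
  using distr(1)[of "a - b" b c] distr(2)[of c "a - b" b] by (auto simp: algebra_simps)

lemma sum_mul: "(\<Sum>i\<in>I. f i) \<star> c = (\<Sum>i\<in>I. f i \<star> c)" "c \<star> (\<Sum>i\<in>I. f i) = (\<Sum>i\<in>I. c \<star> f i)"
  by (induct I rule: infinite_finite_induct) (auto simp: zero_mul distr)

lemma A_ops: "a \<in> A \<Longrightarrow> b \<in> A \<Longrightarrow> a + b \<in> A" "a \<in> A \<Longrightarrow> k *s a \<in> A" "0 \<in> A" "a \<in> A \<Longrightarrow> b \<in> A \<Longrightarrow> a - b \<in> A"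
  using sub by (auto simp: subspace_add subspace_scale subspace_0 subspace_diff)

definition right_id :: "'v \<Rightarrow> 'v set" where "right_id x = (\<lambda>a. x \<star> a) ` A"
definition left_id :: "'v \<Rightarrow> 'v set" where "left_id x = (\<lambda>a. a \<star> x) ` A"

lemma right_id_subspace: "subspace (right_id x)"
  unfolding right_id_def subspace_def
proof (intro conjI ballI allI)
  show "0 \<in> (\<star>) x ` A" using A_ops(3) zero_mul by force
next
  fix a b assume "a \<in> (\<star>) x ` A" "b \<in> (\<star>) x ` A"
  then obtain a' b' where "a = x \<star> a'" "b = x \<star> b'" "a' \<in> A" "b' \<in> A" by auto
  then show "a + b \<in> (\<star>) x ` A" by (intro image_eqI[of _ _ "a' + b'"]) (auto simp: distr A_ops)
next
  fix k a assume "a \<in> (\<star>) x ` A"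
  then obtain a' where "a = x \<star> a'" "a' \<in> A" by auto
  then show "k *s a \<in> (\<star>) x ` A" by (intro image_eqI[of _ _ "k *s a'"]) (auto simp: scl A_ops)
qed

lemma left_id_subspace: "subspace (left_id x)"
  unfolding left_id_def subspace_def
proof (intro conjI ballI allI)
  show "0 \<in> (\<lambda>a. a \<star> x) ` A" using A_ops(3) zero_mul by force
next
  fix a b assume "a \<in> (\<lambda>a. a \<star> x) ` A" "b \<in> (\<lambda>a. a \<star> x) ` A"
  then obtain a' b' where "a = a' \<star> x" "b = b' \<star> x" "a' \<in> A" "b' \<in> A" by auto
  then show "a + b \<in> (\<lambda>a. a \<star> x) ` A" by (intro image_eqI[of _ _ "a' + b'"]) (auto simp: distr A_ops)
next
  fix k a assume "a \<in> (\<lambda>a. a \<star> x) ` A"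
  then obtain a' where "a = a' \<star> x" "a' \<in> A" by auto
  then show "k *s a \<in> (\<lambda>a. a \<star> x) ` A" by (intro image_eqI[of _ _ "k *s a'"]) (auto simp: scl A_ops)
qed

lemma right_id_sub: "right_id x \<subseteq> span E" and left_id_sub: "left_id x \<subseteq> span E" "left_id x \<subseteq> A"
  using closed E by (auto simp: right_id_def left_id_def)

text \<open>The powers of \<open>z\<close> applied to \<open>v\<close> are dependent, and the polynomial that expresses this splits.\<close>

lemma eigenvector:
  assumes v0: "v \<in> A" "v \<noteq> 0" and stable: "v \<in> U" "subspace U" "\<And>u. u \<in> U \<Longrightarrow> z \<star> u \<in> U" "U \<subseteq> A"
  shows "\<exists>l. \<exists>u\<in>U. u \<noteq> 0 \<and> z \<star> u = l *s u"
proof (rule ccontr)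
  assume no: "\<not> ?thesis"
  define pw where "pw i = ((\<star>) z ^^ i) v" for i
  have pwU: "pw i \<in> U" for i by (induct i) (auto simp: pw_def stable)
  define act where "act p = (\<Sum>i\<le>degree p. Polynomial.coeff p i *s pw i)" for p
  have act_bound: "act p = (\<Sum>i\<le>N. Polynomial.coeff p i *s pw i)" if "degree p \<le> N" for p N
    unfolding act_def by (rule sum.mono_neutral_left) (use that in \<open>auto simp: coeff_eq_0\<close>)
  have actU: "act p \<in> U" for p unfolding act_def using pwU stable by (intro subspace_sum subspace_scale) auto
  have act_shift: "z \<star> act q = act (pCons 0 q)" for q
  proof -
    have "z \<star> act q = (\<Sum>i\<le>degree q. Polynomial.coeff q i *s pw (Suc i))"
      by (simp add: act_def sum_mul scl pw_def)
    also have "\<dots> = (\<Sum>i\<le>Suc (degree q). Polynomial.coeff (pCons 0 q) i *s pw i)"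
      by (subst sum.atMost_Suc_shift) simp
    also have "\<dots> = act (pCons 0 q)" by (rule act_bound[symmetric]) (auto simp: degree_pCons_le)
    finally show ?thesis .
  qed
  have act_diff: "act (pCons 0 q - Polynomial.smult l q) = z \<star> act q - l *s act q" for q l
  proof -
    let ?N = "Suc (degree q)"
    have "act (pCons 0 q - Polynomial.smult l q) = (\<Sum>i\<le>?N. Polynomial.coeff (pCons 0 q - Polynomial.smult l q) i *s pw i)"
      by (rule act_bound) (intro degree_diff_le, auto simp: degree_pCons_le)
    also have "\<dots> = (\<Sum>i\<le>?N. Polynomial.coeff (pCons 0 q) i *s pw i) - l *s (\<Sum>i\<le>?N. Polynomial.coeff q i *s pw i)"
      by (simp only: coeff_diff coeff_smult scale_left_diff_distrib sum_subtractf scale_sum_right scale_scale)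
    also have "\<dots> = act (pCons 0 q) - l *s act q" by (simp only: act_bound[of "pCons 0 q" ?N] act_bound[of q ?N] degree_pCons_le le_SucI order_refl)
    finally show ?thesis by (simp add: act_shift)
  qed
  have nz: "act p \<noteq> 0" if "p \<noteq> 0" for p
    using that
  proof (induct "degree p" arbitrary: p)
    case 0
    then obtain c where "p = [:c:]" by (metis degree_eq_zeroE)
    then show ?case using 0 v0 by (auto simp: act_def pw_def)
  next
    case (Suc d)
    obtain l where "poly p l = 0" using alg_closed_imp_poly_has_root[of p] Suc by auto
    then have "[:- l, 1:] dvd p" by (simp add: poly_eq_0_iff_dvd)
    then obtain q where q: "p = [:- l, 1:] * q" by (rule dvdE)
    then have pq: "p = pCons 0 q - Polynomial.smult l q" by (simp add: algebra_simps)
    have "q \<noteq> 0" using q Suc by auto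
    then have "degree p = Suc (degree q)" using degree_mult_eq[of "[:- l, 1:]" q] by (simp add: pq)
    then have "act q \<noteq> 0" using Suc \<open>q \<noteq> 0\<close> by auto
    then have "z \<star> act q \<noteq> l *s act q" using no actU by blast
    then show ?case unfolding pq act_diff by simp
  qed
  have "\<not> fam_indep pw {..card E}" using pwU stable E by (intro fam_dep) auto
  then obtain t i where t: "(\<Sum>i\<le>card E. t i *s pw i) = 0" "i \<le> card E" "t i \<noteq> 0" by (auto simp: fam_indep_def)
  define p where "p = (\<Sum>i\<le>card E. Polynomial.monom (t i) i)"
  have cp: "Polynomial.coeff p j = (if j \<le> card E then t j else 0)" for j
    by (simp add: p_def coeff_sum)
  have "act p = (\<Sum>i\<le>card E. Polynomial.coeff p i *s pw i)"
    by (rule act_bound) (intro degree_le, auto simp: cp)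
  then have "act p = 0" using t by (simp add: cp)
  moreover have "p \<noteq> 0" using t cp[of i] by auto
  ultimately show False using nz by blast
qed

text \<open>Choose \<open>x\<close> with \<open>x A\<close> of least dimension. Left multiplication by \<open>x y\<close> has an eigenvector \<open>v\<close> in
  \<open>x A\<close>, and \<open>v A = x A\<close> by minimality; so \<open>x\<close>, a right multiple of \<open>v\<close>, is an eigenvector too.\<close>

lemma minimal_element:
  shows "\<exists>x\<in>A. x \<noteq> 0 \<and> (\<forall>y\<in>A. \<exists>\<beta>. x \<star> y \<star> x = \<beta> *s x)"
proof -
  define x where "x = arg_min (\<lambda>x. dim (right_id x)) (\<lambda>x. x \<in> A \<and> x \<noteq> 0)"
  have x: "x \<in> A" "x \<noteq> 0" and min: "\<And>v. v \<in> A \<Longrightarrow> v \<noteq> 0 \<Longrightarrow> dim (right_id x) \<le> dim (right_id v)"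
    using arg_min_natI[of "\<lambda>x. x \<in> A \<and> x \<noteq> 0" one "\<lambda>x. dim (right_id x)"] one
      arg_min_nat_le[of "\<lambda>x. x \<in> A \<and> x \<noteq> 0" _ "\<lambda>x. dim (right_id x)"] by (auto simp: x_def)
  have xr: "x \<in> right_id x" using x one by (auto simp: right_id_def intro: image_eqI[of _ _ one])
  have "\<exists>\<beta>. x \<star> y \<star> x = \<beta> *s x" if y: "y \<in> A" for y
  proof -
    have "(x \<star> y) \<star> u \<in> right_id x" if "u \<in> right_id x" for u
      using that closed by (auto simp: right_id_def assoc)
    moreover have "right_id x \<subseteq> A" using closed by (auto simp: right_id_def)
    ultimately obtain l v where v: "v \<in> right_id x" "v \<noteq> 0" "(x \<star> y) \<star> v = l *s v"
      using eigenvector[OF x xr right_id_subspace, of "x \<star> y"] by blast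
    have vA: "v \<in> A" using v closed by (auto simp: right_id_def)
    have "right_id v \<subseteq> right_id x" using v closed by (auto simp: right_id_def assoc)
    then have "right_id v = right_id x"
      using subspace_eq_of_dim[OF E(1) right_id_sub right_id_subspace right_id_subspace] min[OF vA v(2)] by blast
    then obtain b where b: "x = v \<star> b" using xr by (auto simp: right_id_def)
    have "(x \<star> y) \<star> x = l *s x" using v(3) by (subst (2 3) b) (simp add: scl flip: assoc)
    then show ?thesis by blast
  qed
  then show ?thesis using x by blast
qed

definition is_rep :: "nat \<Rightarrow> ('v \<Rightarrow> nat \<Rightarrow> nat \<Rightarrow> 'k) \<Rightarrow> bool" where
  "is_rep d V \<longleftrightarrow> (\<forall>a\<in>A. \<forall>b\<in>A. \<forall>i<d. \<forall>j<d. V (a + b) i j = V a i j + V b i j \<and> V (a \<star> b) i j = (\<Sum>l<d. V a i l * V b l j)) \<and>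
     (\<forall>k. \<forall>a\<in>A. \<forall>i<d. \<forall>j<d. V (k *s a) i j = k * V a i j) \<and>
     (\<forall>i<d. \<forall>j<d. V one i j = (if i = j then 1 else 0))"

lemma rep_sum: 
  assumes "is_rep d V" "i < d" "j < d" "\<And>l. l \<in> I \<Longrightarrow> f l \<in> A"
  shows "V (\<Sum>l\<in>I. f l) i j = (\<Sum>l\<in>I. V (f l) i j)"
proof -
  have z: "V 0 i j = 0" using assms(1-3) A_ops(3) unfolding is_rep_def by (metis mult_zero_left scale_zero_left)
  have s: "sum f J \<in> A" if "J \<subseteq> I" for J using assms(4) that sub by (intro subspace_sum) auto
  have "J \<subseteq> I \<Longrightarrow> V (\<Sum>l\<in>J. f l) i j = (\<Sum>l\<in>J. V (f l) i j)" for J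
  proof (induct J rule: infinite_finite_induct)
    case (insert x F)
    then show ?case using assms s[of F] by (simp add: is_rep_def)
  qed (use z in auto)
  then show ?thesis by blast
qed

text \<open>Wedderburn and Skolem-Noether together. With \<open>x\<close> from \<open>minimal_element\<close>, the module is the left ideal
  \<open>A x\<close> with basis \<open>w\<close>; elements \<open>u\<close> dual to \<open>w\<close> under \<open>(a, y) \<mapsto> x a y\<close> give matrix units \<open>w\<^sub>i u\<^sub>j\<close>
  that span \<open>A\<close>. If \<open>V'\<close> is another representation, then a nonzero column of \<open>V' x\<close> defines a map
  from \<open>A x\<close> to its space, the map \<open>y \<mapsto> V' y\<close> followed by taking the column; this is the intertwiner.\<close>

theorem wedderburn:
  "\<exists>d V. dim A = d * d \<and> is_rep d V \<and>
    (\<forall>V'. is_rep d V' \<longrightarrow> (\<exists>Y. det Y \<noteq> 0 \<and> Y \<in> carrier_mat d d \<and>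
       (\<forall>a\<in>A. \<forall>i<d. \<forall>j<d. (\<Sum>l<d. V' a i l * Y $$ (l, j)) = (\<Sum>l<d. Y $$ (i, l) * V a l j))))"
proof -
  obtain x where x: "x \<in> A" "x \<noteq> 0" and ex: "\<forall>y\<in>A. \<exists>\<beta>. x \<star> y \<star> x = \<beta> *s x" using minimal_element by blast
  then obtain \<beta> where \<beta>: "\<And>y. y \<in> A \<Longrightarrow> x \<star> y \<star> x = \<beta> y *s x" by metis
  have \<beta>_lin: "\<beta> (a + b) = \<beta> a + \<beta> b" "\<beta> (k *s a) = k * \<beta> a" if "a \<in> A" "b \<in> A" for a b k
  proof -
    have "\<beta> (a + b) *s x = (\<beta> a + \<beta> b) *s x"
      using that by (simp add: A_ops distr scale_left_distrib flip: \<beta>)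
    then show "\<beta> (a + b) = \<beta> a + \<beta> b" using x by simp
    have "\<beta> (k *s a) *s x = (k * \<beta> a) *s x"
      using that by (simp add: A_ops scl flip: \<beta> scale_scale)
    then show "\<beta> (k *s a) = k * \<beta> a" using x by simp
  qed
  obtain d :: nat and w where w: "\<And>i. i < d \<Longrightarrow> w i \<in> left_id x" "fam_indep w {..<d}" "left_id x \<subseteq> span (w ` {..<d})"
    using fam_exists[OF E(1) left_id_sub(1), of x] by blast
  have wA: "w i \<in> A" if "i < d" for i using w(1)[OF that] left_id_sub by auto
  define co where "co y = (SOME t. y = (\<Sum>i<d. t i *s w i))" for y
  have co: "y = (\<Sum>i<d. co y i *s w i)" if yl: "y \<in> left_id x" for y
  proof -
    obtain t where "y = (\<Sum>i<d. t i *s w i)" using fam_span[of "{..<d}" y w] w(3) yl by auto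
    then show ?thesis unfolding co_def by (rule someI[where P = "\<lambda>t. y = (\<Sum>i<d. t i *s w i)"])
  qed
  have co_unique: "co y i = t i" if "y \<in> left_id x" "y = (\<Sum>i<d. t i *s w i)" "i < d" for y t i
  proof -
    have "(\<Sum>i<d. (co y i - t i) *s w i) = 0"
      using co[OF that(1)] that(2) by (simp add: scale_left_diff_distrib sum_subtractf)
    then show ?thesis using fam_indepD[OF w(2), of "\<lambda>i. co y i - t i" i] that(3) by simp
  qed
  have lidL: "a \<star> y \<in> left_id x" if "y \<in> left_id x" "a \<in> A" for a y
    using that closed by (auto simp: left_id_def simp flip: assoc)
  define V where "V a i j = co (a \<star> w j) i" for a i j
  have V: "a \<star> w j = (\<Sum>i<d. V a i j *s w i)" if "a \<in> A" "j < d" for a j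
    unfolding V_def by (rule co[OF lidL]) (use w that in auto)
  have V_unique: "V a i j = t i" if "a \<in> A" "j < d" "i < d" "a \<star> w j = (\<Sum>i<d. t i *s w i)" for a i j t
    unfolding V_def by (rule co_unique[OF lidL]) (use w that in auto)
  have rep: "is_rep d V"
    unfolding is_rep_def
  proof (intro conjI ballI allI impI)
    fix a b i j assume a: "a \<in> A" "b \<in> A" and ij: "i < d" "j < d"
    show "V (a + b) i j = V a i j + V b i j"
      by (rule V_unique) (use a ij in \<open>auto simp: A_ops distr V scale_left_distrib sum.distrib\<close>)
    have "a \<star> b \<star> w j = (\<Sum>l<d. V b l j *s (a \<star> w l))" using a ij by (simp add: assoc V[of b j] sum_mul scl)
    also have "\<dots> = (\<Sum>l<d. \<Sum>i<d. (V a i l * V b l j) *s w i)"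
      using a by (intro sum.cong) (auto simp: V scale_sum_right mult.commute)
    also have "\<dots> = (\<Sum>i<d. (\<Sum>l<d. V a i l * V b l j) *s w i)"
      by (subst sum.swap) (simp add: scale_sum_left)
    finally show "V (a \<star> b) i j = (\<Sum>l<d. V a i l * V b l j)"
      using a ij closed by (intro V_unique) auto
  next
    fix k a i j assume "a \<in> A" "i < d" "j < d"
    then show "V (k *s a) i j = k * V a i j"
      by (intro V_unique) (auto simp: A_ops scl V scale_sum_right)
  next
    fix i j assume ij: "i < d" "j < d"
    have "(\<Sum>i<d. (if i = j then 1 else 0) *s w i) = (\<Sum>i<d. if i = j then w i else 0)"
      by (rule sum.cong) auto
    then show "V one i j = (if i = j then 1 else 0)"
      by (intro V_unique) (use ij one wA in auto)
  qed
  \<comment> \<open>primeness makes the pairing of \<open>A\<close> with \<open>A x\<close>, with values in \<open>k x\<close>, nondegenerate\<close>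
  have pair: "\<exists>a\<in>A. x \<star> a \<star> y \<noteq> 0" if "y \<in> A" "y \<noteq> 0" for y using prime[OF x(1) that(1)] x that by blast
  have pair_val: "\<exists>c. x \<star> a \<star> y = c *s x" if y: "y \<in> left_id x" and a: "a \<in> A" for a y
  proof -
    obtain b where "y = b \<star> x" "b \<in> A" using y by (auto simp: left_id_def)
    then have "x \<star> a \<star> y = x \<star> (a \<star> b) \<star> x" by (simp add: assoc)
    then show ?thesis using \<beta>[OF closed, of a b] by auto
  qed
  define pv where "pv a y = (SOME c. x \<star> a \<star> y = c *s x)" for a y
  have pv: "x \<star> a \<star> y = pv a y *s x" if "y \<in> left_id x" "a \<in> A" for y a
    unfolding pv_def by (rule someI_ex[OF pair_val[OF that]])
  define \<Phi> where "\<Phi> = {\<lambda>i. if i < d then pv a (w i) else 0 | a. a \<in> A}"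
  have pvadd: "pv (a + b) y = pv a y + pv b y" "pv (k *s a) y = k * pv a y" if "a \<in> A" "b \<in> A" "y \<in> left_id x" for a b y k
  proof -
    have "pv (a + b) y *s x = (pv a y + pv b y) *s x"
      using that by (simp add: A_ops distr scale_left_distrib flip: pv)
    then show "pv (a + b) y = pv a y + pv b y" using x by simp
    have "pv (k *s a) y *s x = (k * pv a y) *s x"
      using that by (simp add: A_ops scl flip: pv scale_scale)
    then show "pv (k *s a) y = k * pv a y" using x by simp
  qed
  have dual: "\<exists>f\<in>\<Phi>. \<forall>i\<in>{..<d}. f i = (if i = j then 1 else 0)" if j: "j \<in> {..<d}" for j
  proof (rule separating_dual[OF _ _ _ _ _ j])
    show "finite {..<d}" by simp
    fix f g assume "f \<in> \<Phi>" "g \<in> \<Phi>"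
    then obtain a b where ab: "a \<in> A" "b \<in> A" "f = (\<lambda>i. if i < d then pv a (w i) else 0)" "g = (\<lambda>i. if i < d then pv b (w i) else 0)"
      by (auto simp: \<Phi>_def)
    then have "(\<lambda>i. f i + g i) = (\<lambda>i. if i < d then pv (a + b) (w i) else 0)" by (auto simp: pvadd w)
    then show "(\<lambda>i. f i + g i) \<in> \<Phi>" using A_ops(1)[OF ab(1,2)] unfolding \<Phi>_def by blast
    fix k
    have "(\<lambda>i. k * f i) = (\<lambda>i. if i < d then pv (k *s a) (w i) else 0)" using ab by (auto simp: pvadd w)
    then show "(\<lambda>i. k * f i) \<in> \<Phi>" using A_ops(2)[OF ab(1)] unfolding \<Phi>_def by blast
  next
    have "(\<lambda>i. if i < d then pv (0 *s one) (w i) else 0) = (\<lambda>i. 0)" using pvadd(2)[OF one(1) one(1) w(1), of _ 0] by auto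
    moreover have "(\<lambda>i. if i < d then pv (0 *s one) (w i) else 0) \<in> \<Phi>" using A_ops(2)[OF one(1)] unfolding \<Phi>_def by blast
    ultimately show "(\<lambda>i. 0) \<in> \<Phi>" by (simp only:)
  next
    fix t :: "nat \<Rightarrow> 'k" assume t: "\<exists>i\<in>{..<d}. t i \<noteq> 0"
    let ?y = "\<Sum>i<d. t i *s w i"
    have "?y \<noteq> 0" using fam_indepD[OF w(2), of t] t by auto
    moreover have yl: "?y \<in> left_id x" using w by (intro subspace_sum subspace_scale left_id_subspace) auto
    ultimately obtain a where a: "a \<in> A" "x \<star> a \<star> ?y \<noteq> 0" using pair[OF subsetD[OF left_id_sub(2) yl]] by blast
    have "x \<star> a \<star> ?y = (\<Sum>i<d. t i * pv a (w i)) *s x"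
      using a w by (simp add: sum_mul scl pv scale_sum_left)
    then have "(\<Sum>i<d. t i * pv a (w i)) \<noteq> 0" using a by auto
    then show "\<exists>f\<in>\<Phi>. (\<Sum>i<d. t i * f i) \<noteq> 0" using a by (intro bexI[of _ "\<lambda>i. if i < d then pv a (w i) else 0"]) (auto simp: \<Phi>_def)
  qed
  have "\<exists>a\<in>A. \<forall>i<d. pv a (w i) = (if i = j then 1 else 0)" if j: "j < d" for j
  proof -
    obtain f where f: "f \<in> \<Phi>" "\<forall>i\<in>{..<d}. f i = (if i = j then 1 else 0)" using dual[of j] j by blast
    then obtain a where a: "a \<in> A" "f = (\<lambda>i. if i < d then pv a (w i) else 0)" unfolding \<Phi>_def by blast
    show ?thesis using f(2) a by (intro bexI[of _ a]) auto
  qed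
  then obtain u where u: "\<And>j. j < d \<Longrightarrow> u j \<in> A" "\<And>i j. i < d \<Longrightarrow> j < d \<Longrightarrow> pv (u j) (w i) = (if i = j then 1 else 0)" by metis
  have "\<exists>b\<in>A. w i = b \<star> x" if "i < d" for i using w(1)[OF that] by (auto simp: left_id_def)
  then obtain b where b: "\<And>i. i < d \<Longrightarrow> b i \<in> A" "\<And>i. i < d \<Longrightarrow> w i = b i \<star> x" by metis
  define e where "e = (\<lambda>(i, j). w i \<star> u j)"
  have e_act: "e (i, j) \<star> w l = (if l = j then w i else 0)" if "i < d" "j < d" "l < d" for i j l
  proof -
    have "e (i, j) \<star> w l = b i \<star> (x \<star> u j \<star> w l)" using b that by (simp add: e_def assoc)
    also have "\<dots> = (if l = j then w i else 0)" using u pv w b that by (auto simp: scl)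
    finally show ?thesis .
  qed
  have eA: "e ij \<in> A" for ij by (auto simp: e_def closed split: prod.splits)
  let ?I = "{..<d} \<times> {..<d}"
  have e_sum_act: "(\<Sum>ij\<in>?I. t ij *s e ij) \<star> w l = (\<Sum>i<d. t (i, l) *s w i)" if l: "l < d" for t l
  proof -
    have "(\<Sum>ij\<in>?I. t ij *s e ij) \<star> w l = (\<Sum>i<d. \<Sum>j<d. t (i, j) *s (e (i, j) \<star> w l))"
      unfolding sum_mul scl sum.cartesian_product by (rule sum.cong) auto
    also have "\<dots> = (\<Sum>i<d. \<Sum>j<d. if j = l then t (i, j) *s w i else 0)"
      using l by (intro sum.cong refl) (auto simp: e_act)
    finally show ?thesis using l by simp
  qed
  have kill: "a = 0" if a: "a \<in> A" "\<And>l. l < d \<Longrightarrow> a \<star> w l = 0" for a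
  proof -
    have "a \<star> y \<star> x = 0" if "y \<in> A" for y
    proof -
      have "y \<star> x = (\<Sum>i<d. co (y \<star> x) i *s w i)" using that by (intro co) (auto simp: left_id_def)
      from arg_cong[OF this, of "(\<star>) a"] have "a \<star> (y \<star> x) = (\<Sum>i<d. co (y \<star> x) i *s (a \<star> w i))"
        by (simp only: sum_mul scl)
      then show ?thesis using a by (simp add: assoc)
    qed
    then show ?thesis using prime[OF a(1) x(1)] x by blast
  qed
  have expand: "a = (\<Sum>ij\<in>?I. V a (fst ij) (snd ij) *s e ij)" if a: "a \<in> A" for a
  proof -
    have "a - (\<Sum>ij\<in>?I. V a (fst ij) (snd ij) *s e ij) = 0"
    proof (rule kill)
      show "a - (\<Sum>ij\<in>?I. V a (fst ij) (snd ij) *s e ij) \<in> A"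
        using a eA sub by (intro A_ops subspace_sum) auto
      fix l assume "l < d"
      then show "(a - (\<Sum>ij\<in>?I. V a (fst ij) (snd ij) *s e ij)) \<star> w l = 0"
        using e_sum_act[of l "\<lambda>ij. V a (fst ij) (snd ij)"] V[OF a] by (simp add: diff_mul)
    qed
    then show ?thesis by simp
  qed
  have "dim A = card ?I"
  proof (rule fam_dim)
    show "fam_indep e ?I"
      unfolding fam_indep_def
    proof (intro allI impI ballI)
      fix t ij assume t: "(\<Sum>ij\<in>?I. t ij *s e ij) = 0" and ij: "ij \<in> ?I"
      obtain i l where il: "ij = (i, l)" "i < d" "l < d" using ij by auto
      have "(\<Sum>i<d. t (i, l) *s w i) = 0" using e_sum_act[OF il(3), of t] t by (simp add: zero_mul)
      then show "t ij = 0" using fam_indepD[OF w(2), of "\<lambda>i. t (i, l)" i] il by simp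
    qed
    show "A \<subseteq> span (e ` ?I)"
    proof
      fix a assume "a \<in> A"
      then show "a \<in> span (e ` ?I)" by (subst expand) (simp, intro span_sum span_scale, rule span_base, simp)
    qed
  qed (use eA in auto)
  then have dimA: "dim A = d * d" by simp
  have "\<exists>Y. det Y \<noteq> 0 \<and> Y \<in> carrier_mat d d \<and>
       (\<forall>a\<in>A. \<forall>i<d. \<forall>j<d. (\<Sum>l<d. V' a i l * Y $$ (l, j)) = (\<Sum>l<d. Y $$ (i, l) * V a l j))" if V': "is_rep d V'" for V'
  proof -
    have V'_mul: "V' (a \<star> c) i j = (\<Sum>l<d. V' a i l * V' c l j)" if "a \<in> A" "c \<in> A" "i < d" "j < d" for a c i j
      using V' that by (auto simp: is_rep_def)
    \<comment> \<open>\<open>V'\<close> does not kill \<open>x\<close>, as the unit is a sum of multiples of \<open>x\<close>\<close>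
    have d0: "d > 0" using dimA one(2) kill[OF one(1)] by (cases d) auto
    have one_e: "one = (\<Sum>i<d. e (i, i))"
    proof -
      have "one = (\<Sum>ij\<in>?I. V one (fst ij) (snd ij) *s e ij)" by (rule expand[OF one(1)])
      also have "\<dots> = (\<Sum>i<d. \<Sum>j<d. V one i j *s e (i, j))" unfolding sum.cartesian_product by (rule sum.cong) auto
      also have "\<dots> = (\<Sum>i<d. \<Sum>j<d. if i = j then e (i, j) else 0)"
        using rep by (intro sum.cong refl) (auto simp: is_rep_def)
      finally show ?thesis by simp
    qed
    have "\<exists>i<d. \<exists>j<d. V' x i j \<noteq> 0"
    proof (rule ccontr)
      assume "\<not> ?thesis"
      then have z: "V' x i j = 0" if "i < d" "j < d" for i j using that by blast
      have "V' (e (i, i)) 0 0 = 0" if i: "i < d" for i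
      proof -
        have "e (i, i) = b i \<star> (x \<star> u i)" using b i by (simp add: e_def assoc)
        then show ?thesis using V'_mul[OF b(1)[OF i] closed d0 d0] V'_mul[OF x(1) u(1)[OF i]] z d0 by simp
      qed
      then have "V' one 0 0 = 0" using rep_sum[OF V' d0 d0, of "{..<d}" "\<lambda>i. e (i, i)"] eA by (simp add: one_e)
      then show False using V' d0 by (auto simp: is_rep_def)
    qed
    then obtain p q where pq: "p < d" "q < d" "V' x p q \<noteq> 0" by blast
    define Y where "Y = Matrix.mat d d (\<lambda>(i, j). V' (w j) i q)"
    have Y: "Y \<in> carrier_mat d d" by (simp add: Y_def)
    have Yij: "Y $$ (i, j) = V' (w j) i q" if "i < d" "j < d" for i j using that by (simp add: Y_def)
    have inter: "(\<Sum>l<d. V' a i l * Y $$ (l, j)) = (\<Sum>l<d. Y $$ (i, l) * V a l j)" if a: "a \<in> A" "i < d" "j < d" for a i j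
    proof -
      have "(\<Sum>l<d. V' a i l * Y $$ (l, j)) = V' (a \<star> w j) i q" using V'_mul[OF a(1) wA[OF a(3)] a(2) pq(2)] a by (simp add: Yij)
      also have "\<dots> = V' (\<Sum>l<d. V a l j *s w l) i q" using V[OF a(1,3)] by simp
      also have "\<dots> = (\<Sum>l<d. V' (V a l j *s w l) i q)" using a pq wA by (intro rep_sum[OF V']) (auto simp: A_ops)
      also have "\<dots> = (\<Sum>l<d. Y $$ (i, l) * V a l j)" using V' wA a pq by (intro sum.cong) (auto simp: is_rep_def Yij)
      finally show ?thesis .
    qed
    have "det Y \<noteq> 0"
    proof
      assume "det Y = 0"
      then obtain t where t: "t \<in> carrier_vec d" "t \<noteq> 0\<^sub>v d" "Y *\<^sub>v t = 0\<^sub>v d" using det_0_iff_vec_prod_zero_field[OF Y] by blast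
      let ?y = "\<Sum>j<d. (t $ j) *s w j"
      obtain j0 where j0: "j0 < d" "t $ j0 \<noteq> 0" using t by (metis eq_vecI carrier_vecD index_zero_vec)
      have "?y \<noteq> 0" using fam_indepD[OF w(2), of "\<lambda>j. t $ j" j0] j0 by auto
      moreover have yl: "?y \<in> left_id x" using w by (intro subspace_sum subspace_scale left_id_subspace) auto
      ultimately obtain a where a: "a \<in> A" "x \<star> a \<star> ?y \<noteq> 0" using pair[OF subsetD[OF left_id_sub(2) yl]] by blast
      have yA: "?y \<in> A" using yl left_id_sub by auto
      have Vy: "V' ?y i q = 0" if i: "i < d" for i
      proof -
        have "V' ?y i q = (\<Sum>j<d. V' ((t $ j) *s w j) i q)" using i pq wA by (intro rep_sum[OF V']) (auto simp: A_ops)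
        also have "\<dots> = (\<Sum>j<d. Y $$ (i, j) * t $ j)" using V' wA i pq by (intro sum.cong) (auto simp: is_rep_def Yij)
        also have "\<dots> = (Y *\<^sub>v t) $ i" using Y t(1) i by (simp add: scalar_prod_def atLeast0LessThan)
        finally show ?thesis using t i by simp
      qed
      have c: "x \<star> a \<star> ?y = pv a ?y *s x" "pv a ?y \<noteq> 0" using pv[OF yl a(1)] a by auto
      have "V' (x \<star> a \<star> ?y) p q = (\<Sum>l<d. V' (x \<star> a) p l * V' ?y l q)"
        using V'_mul[OF closed yA pq(1,2)] .
      also have "\<dots> = 0" using Vy by simp
      finally have "pv a ?y * V' x p q = 0" using V' pq x c by (simp add: is_rep_def)
      then show False using c pq by simp
    qed
    then show ?thesis using Y inter by blast
  qed
  then show ?thesis using dimA rep by blast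
qed

end

section \<open>Algebras given by structure constants\<close>

lemma sum_rot3: "(\<Sum>a\<in>A. \<Sum>b\<in>B. \<Sum>c\<in>C. f a b c) = (\<Sum>b\<in>B. \<Sum>c\<in>C. \<Sum>a\<in>A. f a b c)"
  by (subst sum.swap, intro sum.cong refl, rule sum.swap)

lemma sum_rot4: "(\<Sum>a\<in>A. \<Sum>b\<in>B. \<Sum>c\<in>C. \<Sum>d\<in>D. f a b c d) = (\<Sum>b\<in>B. \<Sum>c\<in>C. \<Sum>d\<in>D. \<Sum>a\<in>A. f a b c d)"
  by (subst sum.swap, intro sum.cong refl, rule sum_rot3)

text \<open>The algebra on \<open>k\<^sup>m\<close> with structure constants \<open>c\<close> and unit \<open>u\<close>. The elements \<open>w\<close> express the matrix units of
  \<open>End(k\<^sup>m)\<close> by multiplication maps. This forces the algebra to be simple and, in contrast to simplicity,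
  consists of equations, which are inherited by specialisations.\<close>

definition struct_alg :: "nat \<Rightarrow> (nat \<Rightarrow> nat \<Rightarrow> nat \<Rightarrow> 'k::comm_ring_1) \<Rightarrow> (nat \<Rightarrow> 'k) \<Rightarrow> (nat \<Rightarrow> nat \<Rightarrow> nat \<Rightarrow> nat \<Rightarrow> 'k) \<Rightarrow> bool" where
  "struct_alg m c u w \<longleftrightarrow>
    (\<forall>a<m. \<forall>b<m. \<forall>d<m. \<forall>e<m. (\<Sum>l<m. c a b l * c l d e) = (\<Sum>l<m. c b d l * c a l e)) \<and>
    (\<forall>a<m. \<forall>e<m. (\<Sum>l<m. u l * c l a e) = (if a = e then 1 else 0) \<and> (\<Sum>l<m. u l * c a l e) = (if a = e then 1 else 0)) \<and>
    (\<forall>p<m. \<forall>q<m. \<forall>x<m. \<forall>e<m. (\<Sum>a<m. \<Sum>b<m. w p q a b * (\<Sum>l<m. c a x l * c l b e)) = (if x = q \<and> e = p then 1 else 0))"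

definition struct_rep :: "nat \<Rightarrow> (nat \<Rightarrow> nat \<Rightarrow> nat \<Rightarrow> 'k::comm_ring_1) \<Rightarrow> (nat \<Rightarrow> 'k) \<Rightarrow> nat \<Rightarrow> (nat \<Rightarrow> nat \<Rightarrow> nat \<Rightarrow> 'k) \<Rightarrow> bool" where
  "struct_rep m c u n v \<longleftrightarrow>
    (\<forall>a<m. \<forall>b<m. \<forall>i<n. \<forall>j<n. (\<Sum>l<n. v a i l * v b l j) = (\<Sum>e<m. c a b e * v e i j)) \<and>
    (\<forall>i<n. \<forall>j<n. (\<Sum>a<m. u a * v a i j) = (if i = j then 1 else 0))"

context
  fixes m :: nat and c :: "nat \<Rightarrow> nat \<Rightarrow> nat \<Rightarrow> 'k::{alg_closed_field, field_char_0}" and u w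
  assumes sa: "struct_alg m c u w" and m0: "m > 0"
begin

private definition "vscale = (\<lambda>(k::'k) (f::nat \<Rightarrow> 'k) i. k * f i)"
private definition "A = {f :: nat \<Rightarrow> 'k. \<forall>i\<ge>m. f i = 0}"
private definition "mul = (\<lambda>f g e. if e < m then (\<Sum>a<m. \<Sum>b<m. f a * g b * c a b e) else 0)"
private definition "\<delta> = (\<lambda>a (i::nat). if i = a then 1 else (0::'k))"
private definition "unt = (\<lambda>i. if i < m then u i else 0)"

private lemmas sa' = sa[unfolded struct_alg_def]

private lemma assoc: "a < m \<Longrightarrow> b < m \<Longrightarrow> d < m \<Longrightarrow> e < m \<Longrightarrow> (\<Sum>l<m. c a b l * c l d e) = (\<Sum>l<m. c b d l * c a l e)"
  by (rule sa'[THEN conjunct1, rule_format])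
private lemma unit: 
    "a < m \<Longrightarrow> e < m \<Longrightarrow> (\<Sum>l<m. u l * c l a e) = (if a = e then 1 else 0)"
    "a < m \<Longrightarrow> e < m \<Longrightarrow> (\<Sum>l<m. u l * c a l e) = (if a = e then 1 else 0)"
  by (rule sa'[THEN conjunct2, THEN conjunct1, rule_format, THEN conjunct1]; assumption)
     (rule sa'[THEN conjunct2, THEN conjunct1, rule_format, THEN conjunct2]; assumption)
private lemma full: "p < m \<Longrightarrow> q < m \<Longrightarrow> x < m \<Longrightarrow> e < m \<Longrightarrow>
    (\<Sum>a<m. \<Sum>b<m. w p q a b * (\<Sum>l<m. c a x l * c l b e)) = (if x = q \<and> e = p then 1 else 0)"
  by (rule sa'[THEN conjunct2, THEN conjunct2, rule_format])

private lemma mul_assoc: "mul (mul f g) h = mul f (mul g h)"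
proof
  fix e
  show "mul (mul f g) h e = mul f (mul g h) e"
  proof (cases "e < m")
    case True
    have "mul (mul f g) h e = (\<Sum>l<m. \<Sum>d<m. (\<Sum>a<m. \<Sum>b<m. f a * g b * c a b l) * h d * c l d e)"
      using True by (simp add: mul_def)
    also have "\<dots> = (\<Sum>l<m. \<Sum>d<m. \<Sum>a<m. \<Sum>b<m. f a * g b * h d * (c a b l * c l d e))"
      by (simp only: sum_distrib_left sum_distrib_right, (simp only: mult_ac)?)
    also have "\<dots> = (\<Sum>a<m. \<Sum>b<m. \<Sum>d<m. \<Sum>l<m. f a * g b * h d * (c a b l * c l d e))"
      by (subst sum_rot4, subst sum_rot3) (rule refl)
    also have "\<dots> = (\<Sum>a<m. \<Sum>b<m. \<Sum>d<m. f a * g b * h d * (\<Sum>l<m. c b d l * c a l e))"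
      using True by (intro sum.cong refl) (simp add: assoc flip: sum_distrib_left)
    also have "\<dots> = (\<Sum>a<m. \<Sum>b<m. \<Sum>d<m. \<Sum>l<m. f a * (g b * h d * c b d l) * c a l e)"
      by (simp only: sum_distrib_left sum_distrib_right, (simp only: mult_ac)?)
    also have "\<dots> = (\<Sum>a<m. \<Sum>l<m. \<Sum>b<m. \<Sum>d<m. f a * (g b * h d * c b d l) * c a l e)"
      by (rule sum.cong[OF refl], rule sum_rot3[symmetric])
    also have "\<dots> = mul f (mul g h) e"
      using True by (simp add: mul_def sum_distrib_left sum_distrib_right)
    finally show ?thesis .
  qed (simp add: mul_def)
qed

private lemma sum_delta: "(\<Sum>a<m. \<delta> p a * f a) = (if p < m then f p else 0)"
  "(\<Sum>a<m. f a * \<delta> p a) = (if p < m then f p else 0)" 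
proof -
  have "(\<Sum>a<m. \<delta> p a * f a) = (\<Sum>a<m. if a = p then f a else 0)" by (rule sum.cong) (auto simp: \<delta>_def)
  then show "(\<Sum>a<m. \<delta> p a * f a) = (if p < m then f p else 0)" by simp
  then show "(\<Sum>a<m. f a * \<delta> p a) = (if p < m then f p else 0)" by (simp add: mult.commute)
qed

private lemma mul_delta:
  assumes "p < m" "e < m"
  shows "mul (\<delta> p) g e = (\<Sum>b<m. g b * c p b e)" "mul g (\<delta> p) e = (\<Sum>a<m. g a * c a p e)"
proof -
  have "mul (\<delta> p) g e = (\<Sum>a<m. \<delta> p a * (\<Sum>b<m. g b * c a b e))"
    using assms by (simp add: mul_def sum_distrib_left mult.assoc)
  then show "mul (\<delta> p) g e = (\<Sum>b<m. g b * c p b e)" using assms by (simp add: sum_delta)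
  have "mul g (\<delta> p) e = (\<Sum>a<m. \<Sum>b<m. (g a * c a b e) * \<delta> p b)"
    using assms by (simp add: mul_def mult_ac)
  then show "mul g (\<delta> p) e = (\<Sum>a<m. g a * c a p e)" using assms by (simp add: sum_delta)
qed

private lemma vs: "vector_space_families vscale"
  unfolding vector_space_families_def
  by unfold_locales (auto simp: vscale_def algebra_simps fun_eq_iff)

interpretation V: vector_space_families vscale by (rule vs)

private lemma sum_fun: "(\<Sum>x\<in>X. f x) i = (\<Sum>x\<in>X. f x i)" for f :: "'x \<Rightarrow> nat \<Rightarrow> 'k"
  by (induct X rule: infinite_finite_induct) auto

private lemma A_expand: "f \<in> A \<Longrightarrow> f = (\<Sum>a<m. vscale (f a) (\<delta> a))"
proof
  fix i assume f: "f \<in> A"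
  have "(\<Sum>a<m. vscale (f a) (\<delta> a)) i = (\<Sum>a<m. if a = i then f a else 0)"
    unfolding sum_fun by (rule sum.cong) (auto simp: vscale_def \<delta>_def)
  also have "\<dots> = f i" using f by (auto simp: A_def)
  finally show "f i = (\<Sum>a<m. vscale (f a) (\<delta> a)) i" ..
qed

private lemma delta_A: "a < m \<Longrightarrow> \<delta> a \<in> A" by (auto simp: \<delta>_def A_def)

private lemma A_span: "A \<subseteq> V.span (\<delta> ` {..<m})"
proof
  fix f assume "f \<in> A"
  then show "f \<in> V.span (\<delta> ` {..<m})"
    by (subst A_expand) (assumption, intro V.span_sum V.span_scale, rule V.span_base, simp)
qed

private lemma dim_A: "V.dim A = m"
proof -
  have "V.dim A = card {..<m}"
  proof (rule V.fam_dim[OF _ _ _ A_span])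
    show "V.fam_indep \<delta> {..<m}"
      unfolding V.fam_indep_def
    proof (intro allI impI ballI)
      fix t i assume t: "(\<Sum>i<m. vscale (t i) (\<delta> i)) = 0" and i: "i \<in> {..<m}"
      have "(\<Sum>a<m. vscale (t a) (\<delta> a)) i = (\<Sum>a<m. if a = i then t a else 0)"
        unfolding sum_fun by (rule sum.cong) (auto simp: vscale_def \<delta>_def)
      then show "t i = 0" using t i by simp
    qed
  qed (use delta_A in auto)
  then show ?thesis by simp
qed

private lemma mul_sum_left: "mul (\<Sum>x\<in>X. f x) g = (\<Sum>x\<in>X. mul (f x) g)" if "finite X" for f :: "'x \<Rightarrow> nat \<Rightarrow> 'k"
  using that
proof (induct X rule: finite_induct)
  case empty
  show ?case by (auto simp: mul_def fun_eq_iff)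
next
  case (insert x F)
  have "mul (f x + sum f F) g = mul (f x) g + mul (sum f F) g"
    by (auto simp: mul_def fun_eq_iff algebra_simps sum.distrib)
  then show ?case by (simp only: sum.insert[OF insert.hyps(1,2)] insert.hyps(3))
qed

private lemma mul_scl: "mul (vscale k f) g = vscale k (mul f g)" "mul f (vscale k g) = vscale k (mul f g)"
  by (auto simp: mul_def vscale_def fun_eq_iff sum_distrib_left mult_ac)

private lemma full_mul:
  assumes f: "f \<in> A" and p: "p < m" "q < m"
  shows "(\<Sum>a<m. \<Sum>b<m. vscale (w p q a b) (mul (mul (\<delta> a) f) (\<delta> b))) = vscale (f q) (\<delta> p)"
proof
  fix e
  show "(\<Sum>a<m. \<Sum>b<m. vscale (w p q a b) (mul (mul (\<delta> a) f) (\<delta> b))) e = vscale (f q) (\<delta> p) e"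
  proof (cases "e < m")
    case True
    have 1: "mul (mul (\<delta> a) f) (\<delta> b) e = (\<Sum>x<m. f x * (\<Sum>l<m. c a x l * c l b e))" if "a < m" "b < m" for a b
    proof -
      have "mul (mul (\<delta> a) f) (\<delta> b) e = (\<Sum>l<m. (\<Sum>x<m. f x * c a x l) * c l b e)"
        using that True by (simp add: mul_delta)
      also have "\<dots> = (\<Sum>l<m. \<Sum>x<m. f x * (c a x l * c l b e))" by (simp only: sum_distrib_left sum_distrib_right, (simp only: mult_ac)?)
      also have "\<dots> = (\<Sum>x<m. f x * (\<Sum>l<m. c a x l * c l b e))" by (subst sum.swap) (simp add: sum_distrib_left)
      finally show ?thesis .
    qed
    have "(\<Sum>a<m. \<Sum>b<m. vscale (w p q a b) (mul (mul (\<delta> a) f) (\<delta> b))) e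
      = (\<Sum>a<m. \<Sum>b<m. w p q a b * (\<Sum>x<m. f x * (\<Sum>l<m. c a x l * c l b e)))"
      unfolding sum_fun vscale_def by (intro sum.cong refl) (simp add: 1)
    also have "\<dots> = (\<Sum>a<m. \<Sum>b<m. \<Sum>x<m. f x * (w p q a b * (\<Sum>l<m. c a x l * c l b e)))"
      by (intro sum.cong refl) (subst sum_distrib_left, intro sum.cong refl, simp add: mult_ac)
    also have "\<dots> = (\<Sum>x<m. \<Sum>a<m. \<Sum>b<m. f x * (w p q a b * (\<Sum>l<m. c a x l * c l b e)))"
      by (rule sum_rot3[symmetric])
    also have "\<dots> = (\<Sum>x<m. f x * (if x = q \<and> e = p then 1 else 0))"
      using True p by (intro sum.cong refl) (simp add: full flip: sum_distrib_left)
    also have "\<dots> = (\<Sum>x<m. if x = q then (if e = p then f x else 0) else 0)" by (intro sum.cong) auto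
    also have "\<dots> = vscale (f q) (\<delta> p) e" using p by (simp add: vscale_def \<delta>_def)
    finally show ?thesis .
  next
    case False
    then show ?thesis using p unfolding sum_fun vscale_def by (auto simp: mul_def \<delta>_def)
  qed
qed

private lemma one_mul: "f \<in> A \<Longrightarrow> mul unt f = f" "f \<in> A \<Longrightarrow> mul f unt = f"
proof -
  assume f: "f \<in> A"
  have "mul unt f e = f e" if e: "e < m" for e
  proof -
    have "mul unt f e = (\<Sum>a<m. \<Sum>b<m. u a * f b * c a b e)" using e by (simp add: mul_def unt_def)
    also have "\<dots> = (\<Sum>b<m. f b * (\<Sum>a<m. u a * c a b e))" by (subst sum.swap) (simp only: sum_distrib_left sum_distrib_right, (simp only: mult_ac)?)
    also have "\<dots> = (\<Sum>b<m. if b = e then f b else 0)" using e by (intro sum.cong refl) (simp add: unit)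
    finally show ?thesis using e by simp
  qed
  then show "mul unt f = f" using f by (auto simp: fun_eq_iff A_def) (metis mul_def not_le)
  have "mul f unt e = f e" if e: "e < m" for e
  proof -
    have "mul f unt e = (\<Sum>a<m. \<Sum>b<m. f a * u b * c a b e)" using e by (simp add: mul_def unt_def)
    also have "\<dots> = (\<Sum>a<m. f a * (\<Sum>b<m. u b * c a b e))" by (simp only: sum_distrib_left sum_distrib_right, (simp only: mult_ac)?)
    also have "\<dots> = (\<Sum>a<m. if a = e then f a else 0)" using e by (intro sum.cong refl) (simp add: unit)
    finally show ?thesis using e by simp
  qed
  then show "mul f unt = f" using f by (auto simp: fun_eq_iff A_def) (metis mul_def not_le)
qed

private lemma pa: "prime_algebra vscale A mul unt (\<delta> ` {..<m})"
proof (intro prime_algebra.intro prime_algebra_axioms.intro vs)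
  show "V.subspace A" unfolding V.subspace_def by (auto simp: A_def vscale_def)
  show "finite (\<delta> ` {..<m})" by simp
  show "A \<subseteq> V.span (\<delta> ` {..<m})" by (rule A_span)
  show "mul a b \<in> A" for a b by (auto simp: A_def mul_def)
  show "mul (a + b) g = mul a g + mul b g" "mul a (b + g) = mul a b + mul a g" for a b g
    by (auto simp: mul_def fun_eq_iff algebra_simps sum.distrib)
  show "mul (vscale k a) b = vscale k (mul a b)" "mul a (vscale k b) = vscale k (mul a b)" for k a b by (rule mul_scl)+
  show "mul (mul a b) g = mul a (mul b g)" for a b g by (rule mul_assoc)
  show "unt \<in> A" by (auto simp: unt_def A_def)
  show "unt \<noteq> 0"
  proof
    assume o: "unt = 0"
    have "\<delta> 0 = mul unt (\<delta> 0)" using one_mul(1)[OF delta_A[OF m0]] by simp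
    also have "\<dots> = 0" unfolding o by (auto simp: mul_def fun_eq_iff)
    finally have "\<delta> 0 0 = 0" by simp
    then show False by (simp add: \<delta>_def)
  qed
  show "a \<in> A \<Longrightarrow> mul unt a = a" "a \<in> A \<Longrightarrow> mul a unt = a" for a by (rule one_mul; assumption)+
  fix f g assume f: "f \<in> A" and g: "g \<in> A" and z: "\<And>y. y \<in> A \<Longrightarrow> mul (mul f y) g = 0"
  show "f = 0 \<or> g = 0"
  proof (rule ccontr)
    assume "\<not> ?thesis"
    then obtain q where q: "f q \<noteq> 0" and g0: "g \<noteq> 0" by (auto simp: fun_eq_iff)
    have qm: "q < m" using q f by (auto simp: A_def not_less[symmetric])
    have "mul (\<delta> p) g = 0" if p: "p < m" for p
    proof -
      have "vscale (f q) (mul (\<delta> p) g) = mul (vscale (f q) (\<delta> p)) g" by (simp add: mul_scl)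
      also have "\<dots> = (\<Sum>a<m. \<Sum>b<m. vscale (w p q a b) (mul (\<delta> a) (mul (mul f (\<delta> b)) g)))"
        by (simp add: mul_sum_left mul_scl mul_assoc flip: full_mul[OF f p qm])
      also have "\<dots> = (\<Sum>a<m. \<Sum>b<m. vscale (w p q a b) 0)"
        by (intro sum.cong refl) (simp add: z delta_A, simp add: mul_def fun_eq_iff)
      also have "\<dots> = 0" by (auto simp: vscale_def fun_eq_iff sum_fun)
      finally have "vscale (f q) (mul (\<delta> p) g) = 0" .
      then show ?thesis using q by (simp add: vscale_def fun_eq_iff)
    qed
    then have kz: "vscale k (mul (\<delta> p) g) = 0" if "p < m" for k p using that by (simp add: vscale_def fun_eq_iff)
    have oA: "unt \<in> A" by (auto simp: unt_def A_def)
    have "mul unt g = mul (\<Sum>a<m. vscale (unt a) (\<delta> a)) g" by (rule arg_cong[OF A_expand[OF oA]])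
    also have "\<dots> = (\<Sum>a<m. vscale (unt a) (mul (\<delta> a) g))" by (simp only: mul_sum_left finite_lessThan mul_scl)
    also have "\<dots> = 0" by (rule sum.neutral) (simp add: kz)
    finally have "mul unt g = 0" .
    then show False using one_mul(1)[OF g] g0 by simp
  qed
qed

interpretation W: prime_algebra vscale A mul unt "\<delta> ` {..<m}" by (rule pa)

private lemma extend_rep:
  assumes v': "struct_rep m c u n v'"
  shows "W.is_rep n (\<lambda>f i j. \<Sum>a<m. f a * v' a i j)"
proof -
  define V' where "V' f i j = (\<Sum>a<m. f a * v' a i j)" for f i j
  have mult: "(\<Sum>l<n. v' a i l * v' b l j) = (\<Sum>e<m. c a b e * v' e i j)" if "a < m" "b < m" "i < n" "j < n" for a b i j
    using v' that by (auto simp: struct_rep_def)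
  have "W.is_rep n V'"
    unfolding W.is_rep_def
  proof (intro conjI ballI allI impI)
    fix f g i j assume h: "i < n" "j < n"
    show "V' (f + g) i j = V' f i j + V' g i j" by (simp add: V'_def algebra_simps sum.distrib)
    have "V' (mul f g) i j = (\<Sum>e<m. \<Sum>a<m. \<Sum>b<m. f a * g b * (c a b e * v' e i j))"
      by (simp add: V'_def mul_def sum_distrib_right mult.assoc)
    also have "\<dots> = (\<Sum>a<m. \<Sum>b<m. \<Sum>e<m. f a * g b * (c a b e * v' e i j))"
      by (rule sum_rot3)
    also have "\<dots> = (\<Sum>a<m. \<Sum>b<m. f a * g b * (\<Sum>l<n. v' a i l * v' b l j))"
      using h by (intro sum.cong refl) (simp add: mult flip: sum_distrib_left)
    also have "\<dots> = (\<Sum>a<m. \<Sum>b<m. \<Sum>l<n. (f a * v' a i l) * (g b * v' b l j))"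
      by (simp only: sum_distrib_left sum_distrib_right, (simp only: mult_ac)?)
    also have "\<dots> = (\<Sum>l<n. \<Sum>a<m. \<Sum>b<m. (f a * v' a i l) * (g b * v' b l j))"
      by (rule sum_rot3[symmetric])
    also have "\<dots> = (\<Sum>l<n. V' f i l * V' g l j)"
      by (simp add: V'_def sum_product)
    finally show "V' (mul f g) i j = (\<Sum>l<n. V' f i l * V' g l j)" .
  next
    fix k f i j show "V' (vscale k f) i j = k * V' f i j" by (simp add: V'_def vscale_def sum_distrib_left mult_ac)
  next
    fix i j assume h: "i < n" "j < n"
    show "V' unt i j = (if i = j then 1 else 0)" using v' h by (simp add: V'_def unt_def struct_rep_def)
  qed
  then show ?thesis unfolding V'_def .
qed

text \<open>Multiplication maps carry a linear relation between the \<open>v a\<close> to the vanishing of each of them.\<close>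

lemma struct_rep_indep:
  assumes v: "struct_rep m c u n v" and n: "n > 0" and t: "\<And>i j. i < n \<Longrightarrow> j < n \<Longrightarrow> (\<Sum>a<m. t a * v a i j) = 0" and q: "q < m"
  shows "t q = 0"
proof (rule ccontr)
  assume tq: "t q \<noteq> 0"
  define f where "f = (\<lambda>a. if a < m then t a else 0)"
  define V where "V g i j = (\<Sum>a<m. g a * v a i j)" for g i j
  have rep: "W.is_rep n V" using extend_rep[OF v] unfolding V_def .
  have fA: "f \<in> A" by (simp add: f_def A_def)
  have Vf: "V f i j = 0" if "i < n" "j < n" for i j using t[OF that] by (simp add: V_def f_def)
  have mult: "V (mul g h) i j = (\<Sum>l<n. V g i l * V h l j)" if "g \<in> A" "h \<in> A" "i < n" "j < n" for g h i j
    using rep that by (simp add: W.is_rep_def)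
  have z: "V (mul (mul (\<delta> a) f) (\<delta> b)) i j = 0" if "a < m" "b < m" "i < n" "j < n" for a b i j
    using that by (simp add: mult W.closed delta_A fA Vf)
  have sc: "V (vscale k g) i j = k * V g i j" if "g \<in> A" "i < n" "j < n" for k g i j
    using rep that by (simp add: W.is_rep_def)
  have "v p i j = 0" if p: "p < m" and ij: "i < n" "j < n" for p i j
  proof -
    have "f q * V (\<delta> p) i j = V (\<Sum>a<m. \<Sum>b<m. vscale (w p q a b) (mul (mul (\<delta> a) f) (\<delta> b))) i j"
      unfolding full_mul[OF fA p q] by (rule sc[OF delta_A[OF p] ij, symmetric])
    also have "\<dots> = (\<Sum>a<m. V (\<Sum>b<m. vscale (w p q a b) (mul (mul (\<delta> a) f) (\<delta> b))) i j)"
      by (rule W.rep_sum[OF rep ij]) (intro V.subspace_sum V.subspace_scale W.sub W.closed)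
    also have "\<dots> = (\<Sum>a<m. \<Sum>b<m. V (vscale (w p q a b) (mul (mul (\<delta> a) f) (\<delta> b))) i j)"
      by (intro sum.cong refl W.rep_sum[OF rep ij] V.subspace_scale W.sub W.closed)
    also have "\<dots> = 0" using ij by (simp add: sc W.closed z)
    finally have "V (\<delta> p) i j = 0" using tq q by (simp add: f_def)
    then show ?thesis using p by (simp add: V_def sum_delta)
  qed
  then have "(\<Sum>a<m. u a * v a 0 0) = 0" using n by simp
  then show False using v n by (auto simp: struct_rep_def)
qed

text \<open>If \<open>a y b = 0\<close> for all \<open>y\<close>, with \<open>b \<noteq> 0\<close>, then the matrix units applied to \<open>b\<close> show that \<open>a\<close> kills
  everything; so the algebra is prime, and \<open>wedderburn\<close> applies with \<open>d = n\<close>.\<close>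

theorem struct_rep_exists_unique:
  assumes mn: "m = n * n"
  shows "\<exists>v. struct_rep m c u n v \<and> (\<forall>v'. struct_rep m c u n v' \<longrightarrow> (\<exists>Y. det Y \<noteq> 0 \<and> Y \<in> carrier_mat n n \<and>
       (\<forall>a<m. \<forall>i<n. \<forall>j<n. (\<Sum>l<n. v' a i l * Y $$ (l, j)) = (\<Sum>l<n. Y $$ (i, l) * v a l j))))"
proof -
  obtain d V where dV: "V.dim A = d * d" "W.is_rep d V" and uniq: "\<And>V'. W.is_rep d V' \<Longrightarrow> (\<exists>Y. det Y \<noteq> 0 \<and> Y \<in> carrier_mat d d \<and>
       (\<forall>a\<in>A. \<forall>i<d. \<forall>j<d. (\<Sum>l<d. V' a i l * Y $$ (l, j)) = (\<Sum>l<d. Y $$ (i, l) * V a l j)))"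
    using W.wedderburn by blast
  have "n * n = d * d" using dV(1) dim_A mn by simp
  then have dn: "d = n" by (metis power2_eq_square power2_eq_imp_eq zero_le)
  note dV = dV(2)[unfolded dn] and uniq = uniq[unfolded dn]
  have prod: "mul (\<delta> a) (\<delta> b) = (\<Sum>e<m. vscale (c a b e) (\<delta> e))" if "a < m" "b < m" for a b
  proof -
    have "mul (\<delta> a) (\<delta> b) e = c a b e" if "e < m" for e
      using mul_delta(1)[OF \<open>a < m\<close> that] that \<open>b < m\<close> sum_delta(1)[of b "\<lambda>l. c a l e"] by simp
    moreover have "mul (\<delta> a) (\<delta> b) \<in> A" by (auto simp: A_def mul_def)
    ultimately show ?thesis by (subst A_expand) (auto intro!: sum.cong)
  qed
  have V_sum: "V (\<Sum>e<m. vscale (t e) (\<delta> e)) i j = (\<Sum>e<m. t e * V (\<delta> e) i j)" if "i < n" "j < n" for t i j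
  proof -
    have "V (\<Sum>e<m. vscale (t e) (\<delta> e)) i j = (\<Sum>e<m. V (vscale (t e) (\<delta> e)) i j)"
      by (rule W.rep_sum[OF dV that]) (use delta_A in \<open>auto intro: W.A_ops\<close>)
    also have "\<dots> = (\<Sum>e<m. t e * V (\<delta> e) i j)" using dV that delta_A by (intro sum.cong) (auto simp: W.is_rep_def)
    finally show ?thesis .
  qed
  have unt: "unt = (\<Sum>a<m. vscale (u a) (\<delta> a))"
    by (subst A_expand) (auto simp: unt_def A_def intro!: sum.cong)
  have struct_rep: "struct_rep m c u n (\<lambda>a. V (\<delta> a))"
    unfolding struct_rep_def
  proof (intro conjI allI impI)
    fix a b i j assume h: "a < m" "b < m" "i < n" "j < n"
    have "(\<Sum>l<n. V (\<delta> a) i l * V (\<delta> b) l j) = V (mul (\<delta> a) (\<delta> b)) i j"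
      using dV h delta_A by (auto simp: W.is_rep_def)
    then show "(\<Sum>l<n. V (\<delta> a) i l * V (\<delta> b) l j) = (\<Sum>e<m. c a b e * V (\<delta> e) i j)"
      using h by (simp add: prod V_sum)
  next
    fix i j assume h: "i < n" "j < n"
    show "(\<Sum>a<m. u a * V (\<delta> a) i j) = (if i = j then 1 else 0)"
      using V_sum[OF h, of u] dV h by (simp add: W.is_rep_def flip: unt)
  qed
  moreover have "\<exists>Y. det Y \<noteq> 0 \<and> Y \<in> carrier_mat n n \<and>
       (\<forall>a<m. \<forall>i<n. \<forall>j<n. (\<Sum>l<n. v' a i l * Y $$ (l, j)) = (\<Sum>l<n. Y $$ (i, l) * V (\<delta> a) l j))" if v': "struct_rep m c u n v'" for v'
  proof -
    define V' where "V' f i j = (\<Sum>a<m. f a * v' a i j)" for f i j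
    have "W.is_rep n V'" using extend_rep[OF v'] unfolding V'_def .
    then obtain Y where Y: "det Y \<noteq> 0" "Y \<in> carrier_mat n n"
      "\<forall>a\<in>A. \<forall>i<n. \<forall>j<n. (\<Sum>l<n. V' a i l * Y $$ (l, j)) = (\<Sum>l<n. Y $$ (i, l) * V a l j)" using uniq by blast
    have V'\<delta>: "V' (\<delta> a) = v' a" if "a < m" for a using that by (auto simp: V'_def sum_delta fun_eq_iff)
    show ?thesis
    proof (intro exI[of _ Y] conjI allI impI Y(1,2))
      fix a i j assume h: "a < m" "i < n" "j < n"
      show "(\<Sum>l<n. v' a i l * Y $$ (l, j)) = (\<Sum>l<n. Y $$ (i, l) * V (\<delta> a) l j)"
        using Y(3)[rule_format, OF delta_A[OF h(1)] h(2,3)] unfolding V'\<delta>[OF h(1)] .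
    qed
  qed
  ultimately show ?thesis by blast
qed

end

section \<open>Central simple algebras over their center\<close>

context ring
begin

lemma finsum_neg_eq: "\<lbrakk>f \<in> A \<rightarrow> carrier R\<rbrakk> \<Longrightarrow> (\<Oplus>i\<in>A. \<ominus> f i) = \<ominus> (\<Oplus>i\<in>A. f i)"
proof (induct A rule: infinite_finite_induct)
  case (insert x F)
  then show ?case by (auto simp: Pi_def minus_add)
qed auto

lemma combine_eq_finsum:
  "set Ks \<subseteq> carrier R \<Longrightarrow> set Us \<subseteq> carrier R \<Longrightarrow> length Ks = length Us \<Longrightarrow>
     combine Ks Us = (\<Oplus>i\<in>{..<length Us}. Ks ! i \<otimes> Us ! i)"
proof (induct Ks Us rule: combine.induct)
  case (1 k Ks u Us)
  have "(\<Oplus>i\<in>{..<length (u # Us)}. (k # Ks) ! i \<otimes> (u # Us) ! i)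
      = (\<Oplus>i\<in>insert 0 (Suc ` {..<length Us}). (k # Ks) ! i \<otimes> (u # Us) ! i)"
    by (simp add: lessThan_Suc_eq_insert_0)
  also have "\<dots> = k \<otimes> u \<oplus> (\<Oplus>i\<in>Suc ` {..<length Us}. (k # Ks) ! i \<otimes> (u # Us) ! i)"
    by (subst finsum_insert) (use 1 in \<open>auto simp: subset_eq\<close>)
  also have "(\<Oplus>i\<in>Suc ` {..<length Us}. (k # Ks) ! i \<otimes> (u # Us) ! i) = (\<Oplus>i\<in>{..<length Us}. Ks ! i \<otimes> Us ! i)"
    by (subst finsum_reindex) (use 1 in \<open>auto simp: subset_eq\<close>)
  also have "\<dots> = combine Ks Us" using 1 by simp
  finally show ?case by simp
qed auto

end

locale central_simple = ring Q for Q :: "('q, 'x) ring_scheme" (structure) +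
  fixes F :: "'q set" and m :: nat and e :: "nat \<Rightarrow> 'q"
  assumes F_center: "F = ring_center Q" and F_subfield: "subfield F Q" and simple: "simple_ring Q"
    and e_closed: "\<And>a. a < m \<Longrightarrow> e a \<in> carrier Q"
    and span: "\<And>q. q \<in> carrier Q \<Longrightarrow> \<exists>t. (\<forall>a. t a \<in> F) \<and> q = (\<Oplus>a\<in>{..<m}. t a \<otimes> e a)"
    and indep: "\<And>t a. (\<And>a. t a \<in> F) \<Longrightarrow> (\<Oplus>a\<in>{..<m}. t a \<otimes> e a) = \<zero> \<Longrightarrow> a < m \<Longrightarrow> t a = \<zero>"

lemma central_simple_exists:
  assumes "central_simple_of_degree Q n"
  shows "\<exists>e. central_simple Q (ring_center Q) (n * n) e"
proof -
  have simple: "simple_ring Q" and sf: "subfield (ring_center Q) Q" and dim: "ring.dimension Q (n ^ 2) (ring_center Q) (carrier Q)"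
    using assms by (auto simp: central_simple_of_degree_def)
  interpret ring Q using simple by (simp add: simple_ring_def)
  let ?F = "ring_center Q"
  have Fc: "?F \<subseteq> carrier Q" by (auto simp: ring_center_def)
  obtain Vs where Vs: "set Vs \<subseteq> carrier Q" "independent ?F Vs" "length Vs = n ^ 2" "Span ?F Vs = carrier Q"
    using exists_base[OF sf dim] by blast
  have len: "length Vs = n * n" using Vs by (simp add: power2_eq_square)
  have Vc: "Vs ! i \<in> carrier Q" if "i < n * n" for i using Vs(1) len that by (metis nth_mem subsetD)
  have zF: "\<zero>\<^bsub>Q\<^esub> \<in> ?F" using subringE(2)[OF subfieldE(1)[OF sf]] .
  have "central_simple Q ?F (n * n) (\<lambda>a. Vs ! a)"
  proof (intro central_simple.intro central_simple_axioms.intro ring_axioms refl sf simple)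
    show "a < n * n \<Longrightarrow> Vs ! a \<in> carrier Q" for a by (rule Vc)
    fix q assume "q \<in> carrier Q"
    then obtain Ks where Ks: "set Ks \<subseteq> ?F" "length Ks = length Vs" "q = combine Ks Vs"
      using Span_mem_iff_length_version[OF sf Vs(1)] Vs(4) by auto
    define t where "t a = (if a < n * n then Ks ! a else \<zero>\<^bsub>Q\<^esub>)" for a
    have KF: "Ks ! i \<in> ?F" if "i < n * n" for i using Ks len that by (metis nth_mem subsetD)
    then have tF: "\<forall>a. t a \<in> ?F" using zF by (auto simp: t_def)
    have "q = (\<Oplus>\<^bsub>Q\<^esub>a\<in>{..<n * n}. Ks ! a \<otimes>\<^bsub>Q\<^esub> Vs ! a)"
      using combine_eq_finsum[of Ks Vs] Ks Vs Fc len by auto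
    also have "\<dots> = (\<Oplus>\<^bsub>Q\<^esub>a\<in>{..<n * n}. t a \<otimes>\<^bsub>Q\<^esub> Vs ! a)"
    proof (rule finsum_cong')
      show "(\<lambda>a. t a \<otimes>\<^bsub>Q\<^esub> Vs ! a) \<in> {..<n * n} \<rightarrow> carrier Q"
        using tF Fc Vc by (intro Pi_I m_closed) auto
    qed (auto simp: t_def)
    finally show "\<exists>t. (\<forall>a. t a \<in> ?F) \<and> q = (\<Oplus>\<^bsub>Q\<^esub>a\<in>{..<n * n}. t a \<otimes>\<^bsub>Q\<^esub> Vs ! a)" using tF by blast
  next
    fix t a assume t: "\<And>a. t a \<in> ?F" "(\<Oplus>\<^bsub>Q\<^esub>a\<in>{..<n * n}. t a \<otimes>\<^bsub>Q\<^esub> Vs ! a) = \<zero>\<^bsub>Q\<^esub>" "a < n * n"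
    let ?Ks = "map t [0..<n * n]"
    have K: "set ?Ks \<subseteq> ?F" using t by auto
    have "combine ?Ks Vs = (\<Oplus>\<^bsub>Q\<^esub>a\<in>{..<n * n}. ?Ks ! a \<otimes>\<^bsub>Q\<^esub> Vs ! a)"
      using combine_eq_finsum[of ?Ks Vs] K Fc Vs len by auto
    also have "\<dots> = (\<Oplus>\<^bsub>Q\<^esub>a\<in>{..<n * n}. t a \<otimes>\<^bsub>Q\<^esub> Vs ! a)"
    proof (rule finsum_cong')
      show "(\<lambda>a. t a \<otimes>\<^bsub>Q\<^esub> Vs ! a) \<in> {..<n * n} \<rightarrow> carrier Q"
        using t(1) Fc Vc by (intro Pi_I m_closed) auto
    qed auto
    finally have "combine ?Ks Vs = \<zero>\<^bsub>Q\<^esub>" using t by simp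
    then have "set (take (length Vs) ?Ks) \<subseteq> {\<zero>\<^bsub>Q\<^esub>}" using independent_imp_trivial_combine[OF sf Vs(2) K] by blast
    moreover have "t a \<in> set (take (length Vs) ?Ks)" using t(3) len by simp
    ultimately show "t a = \<zero>\<^bsub>Q\<^esub>" by blast
  qed
  then show ?thesis by blast
qed

context central_simple
begin

lemma F: "z \<in> F \<Longrightarrow> z \<in> carrier Q" "z \<in> F \<Longrightarrow> x \<in> carrier Q \<Longrightarrow> x \<otimes> z = z \<otimes> x"
  "\<zero> \<in> F" "\<one> \<in> F" "z \<in> F \<Longrightarrow> y \<in> F \<Longrightarrow> z \<oplus> y \<in> F" "z \<in> F \<Longrightarrow> y \<in> F \<Longrightarrow> z \<otimes> y \<in> F" "z \<in> F \<Longrightarrow> \<ominus> z \<in> F"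
  "z \<in> F \<Longrightarrow> y \<in> F \<Longrightarrow> z \<ominus> y \<in> F"
proof -
  note S = subringE[OF subfieldE(1)[OF F_subfield]]
  show "z \<in> F \<Longrightarrow> z \<in> carrier Q" "z \<in> F \<Longrightarrow> x \<in> carrier Q \<Longrightarrow> x \<otimes> z = z \<otimes> x" by (simp_all add: F_center ring_center_def)
  show "\<zero> \<in> F" "\<one> \<in> F" by (rule S)+
  show "z \<in> F \<Longrightarrow> y \<in> F \<Longrightarrow> z \<oplus> y \<in> F" "z \<in> F \<Longrightarrow> y \<in> F \<Longrightarrow> z \<otimes> y \<in> F" "z \<in> F \<Longrightarrow> \<ominus> z \<in> F" by (rule S; assumption)+
  show "z \<in> F \<Longrightarrow> y \<in> F \<Longrightarrow> z \<ominus> y \<in> F" unfolding a_minus_def by (rule S(7)[OF _ S(5)])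
qed

definition co :: "'q \<Rightarrow> nat \<Rightarrow> 'q" where
  "co q = (SOME t. (\<forall>a. t a \<in> F) \<and> q = (\<Oplus>a\<in>{..<m}. t a \<otimes> e a))"

lemma co: assumes "q \<in> carrier Q" shows "co q a \<in> F" "q = (\<Oplus>a\<in>{..<m}. co q a \<otimes> e a)"
  using someI_ex[OF span[OF assms]] by (auto simp: co_def)

lemma smult_sum: "z \<in> F \<Longrightarrow> (\<And>a. t a \<in> F) \<Longrightarrow> z \<otimes> (\<Oplus>a\<in>{..<m}. t a \<otimes> e a) = (\<Oplus>a\<in>{..<m}. (z \<otimes> t a) \<otimes> e a)"
  by (subst finsum_rdistr) (auto simp: F e_closed m_assoc intro!: finsum_cong')

lemma add_sum: "(\<And>a. t a \<in> F) \<Longrightarrow> (\<And>a. s a \<in> F) \<Longrightarrow>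
  (\<Oplus>a\<in>{..<m}. t a \<otimes> e a) \<oplus> (\<Oplus>a\<in>{..<m}. s a \<otimes> e a) = (\<Oplus>a\<in>{..<m}. (t a \<oplus> s a) \<otimes> e a)"
proof -
  assume t: "\<And>a. t a \<in> F" and s: "\<And>a. s a \<in> F"
  have c: "t a \<in> carrier Q" "s a \<in> carrier Q" for a using t s F(1) by auto
  have "(\<Oplus>a\<in>{..<m}. (t a \<oplus> s a) \<otimes> e a) = (\<Oplus>a\<in>{..<m}. t a \<otimes> e a \<oplus> s a \<otimes> e a)"
    by (rule finsum_cong') (use c e_closed in \<open>auto simp: l_distr\<close>)
  also have "\<dots> = (\<Oplus>a\<in>{..<m}. t a \<otimes> e a) \<oplus> (\<Oplus>a\<in>{..<m}. s a \<otimes> e a)"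
    by (rule finsum_addf) (use c e_closed in auto)
  finally show ?thesis ..
qed

lemma sum_closed: "(\<And>a. t a \<in> F) \<Longrightarrow> (\<Oplus>a\<in>{..<m}. t a \<otimes> e a) \<in> carrier Q"
  by (rule finsum_closed) (use F(1) e_closed in auto)

lemma unique: assumes t: "\<And>a. t a \<in> F" and s: "\<And>a. s a \<in> F"
  and eq: "(\<Oplus>a\<in>{..<m}. t a \<otimes> e a) = (\<Oplus>a\<in>{..<m}. s a \<otimes> e a)" and a: "a < m"
  shows "t a = s a"
proof -
  have d: "t a \<ominus> s a \<in> F" for a using t s F(8) by blast
  have c: "t a \<in> carrier Q" "s a \<in> carrier Q" for a using t s F(1) by auto
  have "(\<Oplus>a\<in>{..<m}. (t a \<ominus> s a) \<otimes> e a) \<oplus> (\<Oplus>a\<in>{..<m}. s a \<otimes> e a) = (\<Oplus>a\<in>{..<m}. (t a \<ominus> s a \<oplus> s a) \<otimes> e a)"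
    by (rule add_sum[OF d s])
  also have "\<dots> = (\<Oplus>a\<in>{..<m}. t a \<otimes> e a)"
    by (rule finsum_cong') (use c e_closed in \<open>auto simp: a_minus_def a_assoc l_neg\<close>)
  also have "\<dots> = (\<Oplus>a\<in>{..<m}. s a \<otimes> e a)" by (rule eq)
  finally have "(\<Oplus>a\<in>{..<m}. (t a \<ominus> s a) \<otimes> e a) = \<zero>"
    using sum_closed[OF d] sum_closed[OF s] by (simp only: add.r_cancel_one)
  then have "t a \<ominus> s a = \<zero>" using indep[of "\<lambda>a. t a \<ominus> s a" a] d a by blast
  then show ?thesis using c by simp
qed

lemma co_unique: "q \<in> carrier Q \<Longrightarrow> (\<And>a. t a \<in> F) \<Longrightarrow> q = (\<Oplus>a\<in>{..<m}. t a \<otimes> e a) \<Longrightarrow> a < m \<Longrightarrow> co q a = t a"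
  by (rule unique) (use co in auto)

lemma co_add: assumes "q \<in> carrier Q" "q' \<in> carrier Q" "a < m" shows "co (q \<oplus> q') a = co q a \<oplus> co q' a"
proof (rule co_unique[OF _ _ _ assms(3)])
  show "q \<oplus> q' = (\<Oplus>a\<in>{..<m}. (co q a \<oplus> co q' a) \<otimes> e a)"
    by (subst add_sum[symmetric]) (use assms co in auto)
qed (use assms co F in auto)

lemma co_smult: assumes "z \<in> F" "q \<in> carrier Q" "a < m" shows "co (z \<otimes> q) a = z \<otimes> co q a"
proof (rule co_unique[OF _ _ _ assms(3)])
  show "z \<otimes> q = (\<Oplus>a\<in>{..<m}. (z \<otimes> co q a) \<otimes> e a)"
    by (subst smult_sum[symmetric]) (use assms co in auto)
qed (use assms co F in auto)

lemma co_zero: "a < m \<Longrightarrow> co \<zero> a = \<zero>"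
  using co_smult[of \<zero> \<zero> a] F(1)[OF co(1)[of \<zero> a]] F(3) by simp

lemma co_sum: assumes "\<And>i. i \<in> A \<Longrightarrow> f i \<in> carrier Q" "a < m" shows "co (\<Oplus>i\<in>A. f i) a = (\<Oplus>i\<in>A. co (f i) a)"
  using assms(1)
proof (induct A rule: infinite_finite_induct)
  case (insert x G)
  then show ?case using assms(2) co by (auto simp: Pi_def co_add F)
qed (use assms co_zero in auto)

lemma co_zero_imp: assumes "q \<in> carrier Q" "\<And>a. a < m \<Longrightarrow> co q a = \<zero>" shows "q = \<zero>"
proof -
  have "q = (\<Oplus>a\<in>{..<m}. co q a \<otimes> e a)" by (rule co[OF assms(1)])
  also have "\<dots> = (\<Oplus>a\<in>{..<m}. \<zero>)" using assms e_closed by (intro finsum_cong') auto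
  finally show ?thesis by simp
qed

text \<open>The multiplication algebra of \<open>Q\<close>. Only the values on the carrier count.\<close>

inductive Mop :: "('q \<Rightarrow> 'q) \<Rightarrow> bool" where
  base: "a \<in> carrier Q \<Longrightarrow> b \<in> carrier Q \<Longrightarrow> Mop (\<lambda>x. a \<otimes> x \<otimes> b)"
| add: "Mop S \<Longrightarrow> Mop T \<Longrightarrow> Mop (\<lambda>x. S x \<oplus> T x)"
| ext: "Mop S \<Longrightarrow> (\<And>x. x \<in> carrier Q \<Longrightarrow> T x = S x) \<Longrightarrow> Mop T"

lemma Mop_closed: "Mop T \<Longrightarrow> x \<in> carrier Q \<Longrightarrow> T x \<in> carrier Q"
  by (induct rule: Mop.induct) auto

lemma Mop_add: "Mop T \<Longrightarrow> x \<in> carrier Q \<Longrightarrow> y \<in> carrier Q \<Longrightarrow> T (x \<oplus> y) = T x \<oplus> T y"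
proof (induct rule: Mop.induct)
  case (add S T)
  then show ?case using Mop_closed by (simp add: a_ac)
qed (auto simp: l_distr r_distr)

lemma Mop_smult: "Mop T \<Longrightarrow> z \<in> F \<Longrightarrow> x \<in> carrier Q \<Longrightarrow> T (z \<otimes> x) = z \<otimes> T x"
proof (induct rule: Mop.induct)
  case (base a b)
  have "a \<otimes> (z \<otimes> x) = z \<otimes> (a \<otimes> x)" using base F(2)[of z a] by (simp add: F m_assoc[symmetric])
  then show ?case using base by (simp add: F m_assoc)
next
  case (add S T)
  then show ?case using Mop_closed by (simp add: F r_distr)
qed (auto simp: F)

lemma Mop_lmul: "Mop T \<Longrightarrow> c \<in> carrier Q \<Longrightarrow> Mop (\<lambda>x. c \<otimes> T x)"
proof (induct rule: Mop.induct)
  case (base a b)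
  show ?case by (rule Mop.ext[OF Mop.base[of "c \<otimes> a" b]]) (use base in \<open>auto simp: m_assoc\<close>)
next
  case (add S T)
  show ?case by (rule Mop.ext[OF Mop.add[OF add(2)[OF add(5)] add(4)[OF add(5)]]]) (use add Mop_closed in \<open>auto simp: r_distr\<close>)
next
  case (ext S T)
  show ?case by (rule Mop.ext[OF ext(2)[OF ext(4)]]) (use ext in auto)
qed

lemma Mop_rmul: "Mop T \<Longrightarrow> c \<in> carrier Q \<Longrightarrow> Mop (\<lambda>x. T x \<otimes> c)"
proof (induct rule: Mop.induct)
  case (base a b)
  show ?case by (rule Mop.ext[OF Mop.base[of a "b \<otimes> c"]]) (use base in \<open>auto simp: m_assoc\<close>)
next
  case (add S T)
  show ?case by (rule Mop.ext[OF Mop.add[OF add(2)[OF add(5)] add(4)[OF add(5)]]]) (use add Mop_closed in \<open>auto simp: l_distr\<close>)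
next
  case (ext S T)
  show ?case by (rule Mop.ext[OF ext(2)[OF ext(4)]]) (use ext in auto)
qed

lemma Mop_comp: "Mop S \<Longrightarrow> Mop T \<Longrightarrow> Mop (\<lambda>x. S (T x))"
proof (induct rule: Mop.induct)
  case (base a b)
  show ?case by (rule Mop_rmul[OF Mop_lmul[OF base(3,1)] base(2)])
next
  case (add S S')
  then show ?case by (intro Mop.add) auto
next
  case (ext S S')
  show ?case by (rule Mop.ext[OF ext(2)[OF ext(4)]]) (use ext Mop_closed in auto)
qed

lemma Mop_zero: "Mop (\<lambda>x. \<zero>)"
  by (rule Mop.ext[OF Mop.base[of \<zero> \<zero>]]) auto

lemma Mop_id: "Mop (\<lambda>x. x)"
  by (rule Mop.ext[OF Mop.base[of \<one> \<one>]]) auto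

lemma Mop_diff: "Mop S \<Longrightarrow> Mop T \<Longrightarrow> Mop (\<lambda>x. S x \<ominus> T x)"
  by (rule Mop.ext[OF Mop.add[OF _ Mop_lmul[of T "\<ominus> \<one>"]]]) (auto simp: a_minus_def l_minus Mop_closed)

lemma Mop_sum: "(\<And>j. j \<in> J \<Longrightarrow> Mop (S j)) \<Longrightarrow> Mop (\<lambda>x. \<Oplus>j\<in>J. S j x)"
proof (induct J rule: infinite_finite_induct)
  case (insert x G)
  have "Mop (S x)" "Mop (\<lambda>y. \<Oplus>j\<in>G. S j y)" using insert by auto
  from Mop.add[OF this] show ?case
    by (rule Mop.ext) (use insert Mop_closed in \<open>auto simp: Pi_def\<close>)
qed (auto simp: Mop_zero)

lemma Mop_expand:
  "Mop T \<Longrightarrow> \<exists>w. (\<forall>a b. w a b \<in> F) \<and> (\<forall>x\<in>carrier Q. T x = (\<Oplus>a\<in>{..<m}. \<Oplus>b\<in>{..<m}. w a b \<otimes> (e a \<otimes> x \<otimes> e b)))"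
proof (induct rule: Mop.induct)
  case (base s t)
  have "s \<otimes> x \<otimes> t = (\<Oplus>a\<in>{..<m}. \<Oplus>b\<in>{..<m}. (co s a \<otimes> co t b) \<otimes> (e a \<otimes> x \<otimes> e b))" if x: "x \<in> carrier Q" for x
  proof -
    have "s \<otimes> x \<otimes> t = (\<Oplus>a\<in>{..<m}. co s a \<otimes> e a \<otimes> x) \<otimes> t"
      by (subst (1) co(2)[OF base(1)], subst finsum_ldistr) (use x base co F e_closed in auto)
    also have "\<dots> = (\<Oplus>a\<in>{..<m}. co s a \<otimes> e a \<otimes> x \<otimes> t)"
      by (subst finsum_ldistr) (use x base co F e_closed in auto)
    also have "\<dots> = (\<Oplus>a\<in>{..<m}. \<Oplus>b\<in>{..<m}. (co s a \<otimes> co t b) \<otimes> (e a \<otimes> x \<otimes> e b))"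
    proof (rule finsum_cong')
      fix a assume a: "a \<in> {..<m}"
      have "co s a \<otimes> e a \<otimes> x \<otimes> t = (\<Oplus>b\<in>{..<m}. co s a \<otimes> e a \<otimes> x \<otimes> (co t b \<otimes> e b))"
        by (subst (1) co(2)[OF base(2)], subst finsum_rdistr) (use a x base co F e_closed in auto)
      also have "\<dots> = (\<Oplus>b\<in>{..<m}. (co s a \<otimes> co t b) \<otimes> (e a \<otimes> x \<otimes> e b))"
      proof (rule finsum_cong')
        fix b assume b: "b \<in> {..<m}"
        have c: "co s a \<in> carrier Q" "co t b \<in> carrier Q" "e a \<in> carrier Q" "e b \<in> carrier Q" using a b base co F e_closed by auto
        have "(e a \<otimes> x) \<otimes> co t b = co t b \<otimes> (e a \<otimes> x)" using F(2)[OF co(1)[OF base(2)]] x c by simp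
        then have "co s a \<otimes> ((e a \<otimes> x) \<otimes> co t b) \<otimes> e b = co s a \<otimes> (co t b \<otimes> (e a \<otimes> x)) \<otimes> e b" by simp
        then show "co s a \<otimes> e a \<otimes> x \<otimes> (co t b \<otimes> e b) = (co s a \<otimes> co t b) \<otimes> (e a \<otimes> x \<otimes> e b)"
          using x c by (simp add: m_assoc)
      qed (use a x base co F e_closed in auto)
      finally show "co s a \<otimes> e a \<otimes> x \<otimes> t = (\<Oplus>b\<in>{..<m}. (co s a \<otimes> co t b) \<otimes> (e a \<otimes> x \<otimes> e b))" .
    qed (use x base co F e_closed in \<open>auto intro!: finsum_closed\<close>)
    finally show ?thesis .
  qed
  moreover have "co s a \<otimes> co t b \<in> F" for a b using base co F by auto
  ultimately show ?case by (intro exI[of _ "\<lambda>a b. co s a \<otimes> co t b"]) auto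
next
  case (add S T)
  then obtain v w where v: "\<forall>a b. v a b \<in> F" "\<forall>x\<in>carrier Q. S x = (\<Oplus>a\<in>{..<m}. \<Oplus>b\<in>{..<m}. v a b \<otimes> (e a \<otimes> x \<otimes> e b))"
    and w: "\<forall>a b. w a b \<in> F" "\<forall>x\<in>carrier Q. T x = (\<Oplus>a\<in>{..<m}. \<Oplus>b\<in>{..<m}. w a b \<otimes> (e a \<otimes> x \<otimes> e b))" by blast
  have "S x \<oplus> T x = (\<Oplus>a\<in>{..<m}. \<Oplus>b\<in>{..<m}. (v a b \<oplus> w a b) \<otimes> (e a \<otimes> x \<otimes> e b))" if x: "x \<in> carrier Q" for x
  proof -
    have "S x \<oplus> T x = (\<Oplus>a\<in>{..<m}. (\<Oplus>b\<in>{..<m}. v a b \<otimes> (e a \<otimes> x \<otimes> e b)) \<oplus> (\<Oplus>b\<in>{..<m}. w a b \<otimes> (e a \<otimes> x \<otimes> e b)))"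
      using v w x by (simp, subst finsum_addf) (use v w x e_closed F in \<open>auto intro!: finsum_closed\<close>)
    also have "\<dots> = (\<Oplus>a\<in>{..<m}. \<Oplus>b\<in>{..<m}. (v a b \<oplus> w a b) \<otimes> (e a \<otimes> x \<otimes> e b))"
    proof (rule finsum_cong')
      fix a assume "a \<in> {..<m}"
      then have ea: "e a \<in> carrier Q" using e_closed by simp
      have vw: "v a b \<in> carrier Q" "w a b \<in> carrier Q" for b using v w F(1) by auto
      have "(\<Oplus>b\<in>{..<m}. (v a b \<oplus> w a b) \<otimes> (e a \<otimes> x \<otimes> e b)) = (\<Oplus>b\<in>{..<m}. v a b \<otimes> (e a \<otimes> x \<otimes> e b) \<oplus> w a b \<otimes> (e a \<otimes> x \<otimes> e b))"
        by (rule finsum_cong') (use vw ea x e_closed in \<open>auto simp: l_distr\<close>)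
      also have "\<dots> = (\<Oplus>b\<in>{..<m}. v a b \<otimes> (e a \<otimes> x \<otimes> e b)) \<oplus> (\<Oplus>b\<in>{..<m}. w a b \<otimes> (e a \<otimes> x \<otimes> e b))"
        by (rule finsum_addf) (use vw ea x e_closed in auto)
      finally show "(\<Oplus>b\<in>{..<m}. v a b \<otimes> (e a \<otimes> x \<otimes> e b)) \<oplus> (\<Oplus>b\<in>{..<m}. w a b \<otimes> (e a \<otimes> x \<otimes> e b)) = (\<Oplus>b\<in>{..<m}. (v a b \<oplus> w a b) \<otimes> (e a \<otimes> x \<otimes> e b))" ..
    qed (use v w x e_closed F in \<open>auto intro!: finsum_closed\<close>)
    finally show ?thesis .
  qed
  moreover have "\<forall>a b. v a b \<oplus> w a b \<in> F" using v w F by auto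
  ultimately show ?case by (intro exI[of _ "\<lambda>a b. v a b \<oplus> w a b"]) auto
qed auto

text \<open>The values of multiplication maps at \<open>y\<close> form a nonzero ideal.\<close>

lemma Mop_to_one:
  assumes y: "y \<in> carrier Q" "y \<noteq> \<zero>"
  shows "\<exists>S. Mop S \<and> S y = \<one>"
proof -
  let ?I = "{S y | S. Mop S}"
  have memI: "S y \<in> ?I" if "Mop S" for S using that by (intro CollectI exI[of _ S]) simp
  have "ideal ?I Q"
  proof (rule idealI[OF ring_axioms])
    show "subgroup ?I (add_monoid Q)"
    proof (rule add.subgroupI)
      show "?I \<subseteq> carrier Q" using Mop_closed y by auto
      show "?I \<noteq> {}" using memI[OF Mop_id] by auto
      fix a assume "a \<in> ?I"
      then obtain S where S: "Mop S" "a = S y" by blast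
      show "\<ominus> a \<in> ?I" using memI[OF Mop_lmul[OF S(1), of "\<ominus> \<one>"]] Mop_closed[OF S(1) y(1)] S(2) by (simp add: l_minus)
      fix b assume "b \<in> ?I"
      then obtain T where T: "Mop T" "b = T y" by blast
      show "a \<oplus> b \<in> ?I" using memI[OF Mop.add[OF S(1) T(1)]] S(2) T(2) by simp
    qed
    fix a x assume "a \<in> ?I" and x: "x \<in> carrier Q"
    then obtain S where S: "Mop S" "a = S y" by blast
    show "x \<otimes> a \<in> ?I" using memI[OF Mop_lmul[OF S(1) x]] S(2) by simp
    show "a \<otimes> x \<in> ?I" using memI[OF Mop_rmul[OF S(1) x]] S(2) by simp
  qed
  moreover have "y \<in> ?I" using memI[OF Mop_id] by simp
  ultimately have "?I = carrier Q" using simple y unfolding simple_ring_def by blast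
  then have "\<one> \<in> ?I" by simp
  then obtain S where S: "\<one> = S y" "Mop S" by (elim CollectE exE conjE)
  show ?thesis by (rule exI[of _ S]) (simp add: S)
qed

text \<open>The density theorem for \<open>Q\<close> as a simple module over its multiplication algebra. If every map that kills
  \<open>e i\<close> for \<open>i \<in> G\<close> killed \<open>e x\<close> as well, then \<open>e x\<close> would be a combination of the \<open>e i\<close>, with
  coefficients that commute with everything.\<close>

lemma density:
  assumes "finite J" "J \<subseteq> {..<m}" "j \<in> J"
  shows "\<exists>T. Mop T \<and> (\<forall>i\<in>J. T (e i) = (if i = j then \<one> else \<zero>))"
  using assms
proof (induct J arbitrary: j rule: finite_induct)
  case (insert x G)
  have xm: "x < m" and Gm: "G \<subseteq> {..<m}" using insert.prems by auto
  have ex: "e x \<in> carrier Q" and eG: "\<And>i. i \<in> G \<Longrightarrow> e i \<in> carrier Q" using xm Gm e_closed by auto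
  have "\<exists>T. Mop T \<and> (\<forall>i\<in>G. T (e i) = (if i = l then \<one> else \<zero>))" if "l \<in> G" for l
    using insert.hyps(3)[OF Gm that] .
  note ex_dual = this
  define D where "D l = (SOME T. Mop T \<and> (\<forall>i\<in>G. T (e i) = (if i = l then \<one> else \<zero>)))" for l
  have D: "Mop (D l)" "\<And>i. i \<in> G \<Longrightarrow> D l (e i) = (if i = l then \<one> else \<zero>)" if "l \<in> G" for l
    using someI_ex[OF ex_dual[OF that]] unfolding D_def by blast+
  have "\<exists>T. Mop T \<and> (\<forall>i\<in>G. T (e i) = \<zero>) \<and> T (e x) \<noteq> \<zero>"
  proof (rule ccontr)
    assume no: "\<not> ?thesis"
    define y where "y l = D l (e x)" for l
    have y: "y l \<in> carrier Q" if "l \<in> G" for l using Mop_closed[OF D(1)[OF that] ex] by (simp add: y_def)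
    have key: "T (e x) = (\<Oplus>l\<in>G. T (e l) \<otimes> y l)" if T: "Mop T" for T
    proof -
      let ?S = "\<lambda>z. T z \<ominus> (\<Oplus>l\<in>G. T (e l) \<otimes> D l z)"
      have S: "Mop ?S" using T D Mop_closed[OF T] eG by (intro Mop_diff Mop_sum Mop_lmul) auto
      have "?S (e i) = \<zero>" if i: "i \<in> G" for i
      proof -
        have "(\<Oplus>l\<in>G. T (e l) \<otimes> D l (e i)) = (\<Oplus>l\<in>G. if l = i then T (e i) else \<zero>)"
          by (rule finsum_cong') (use D i Mop_closed[OF T] eG in auto)
        also have "\<dots> = T (e i)"
          using add.finprod_singleton[OF i insert.hyps(1), of "\<lambda>_. T (e i)"] Mop_closed[OF T] eG i by (simp add: finsum_def eq_commute)
        finally show ?thesis using Mop_closed[OF T eG[OF i]] by (simp add: r_neg a_minus_def)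
      qed
      then have "?S (e x) = \<zero>" using no S by blast
      then show ?thesis using Mop_closed[OF T] ex eG y by (simp add: y_def Pi_def)
    qed
    \<comment> \<open>multiplying a map on the right by \<open>b\<close> gives a map of the same kind, to which \<open>key\<close> applies\<close>
    have yF: "y l \<in> F" if l: "l \<in> G" for l
    proof -
      have "y l \<otimes> b = b \<otimes> y l" if b: "b \<in> carrier Q" for b
      proof -
        have "y l \<otimes> b = (\<Oplus>i\<in>G. (D l (e i) \<otimes> b) \<otimes> y i)"
          using key[OF Mop_rmul[OF D(1)[OF l] b]] by (simp add: y_def)
        also have "\<dots> = (\<Oplus>i\<in>G. if i = l then b \<otimes> y l else \<zero>)"
          by (rule finsum_cong') (use D l b y in auto)
        also have "\<dots> = b \<otimes> y l"
          using add.finprod_singleton[OF l insert.hyps(1), of "\<lambda>_. b \<otimes> y l"] b y l by (simp add: finsum_def eq_commute)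
        finally show ?thesis .
      qed
      then show ?thesis using y[OF l] by (auto simp: F_center ring_center_def)
    qed
    have e1: "e x = (\<Oplus>l\<in>G. y l \<otimes> e l)"
    proof -
      have "(\<Oplus>l\<in>G. e l \<otimes> y l) = (\<Oplus>l\<in>G. y l \<otimes> e l)"
        by (rule finsum_cong') (use y eG F(2)[OF yF eG] in auto)
      then show ?thesis using key[OF Mop_id] by simp
    qed
    define t where "t a = (if a = x then \<one> else if a \<in> G then \<ominus> y a else \<zero>)" for a
    have tF: "t a \<in> F" for a using yF F by (auto simp: t_def)
    have "(\<Oplus>a\<in>{..<m}. t a \<otimes> e a) = (\<Oplus>a\<in>insert x G. t a \<otimes> e a)"
      by (rule add.finprod_mono_neutral_cong_right) (use tF F e_closed xm Gm in \<open>auto simp: t_def\<close>)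
    also have "\<dots> = e x \<oplus> (\<Oplus>a\<in>G. t a \<otimes> e a)"
      by (subst finsum_insert) (use insert.hyps tF F eG ex in \<open>auto simp: t_def\<close>)
    also have "(\<Oplus>a\<in>G. t a \<otimes> e a) = (\<Oplus>a\<in>G. \<ominus> (y a \<otimes> e a))"
      by (rule finsum_cong') (use insert.hyps yF F eG in \<open>auto simp: t_def l_minus\<close>)
    also have "\<dots> = \<ominus> e x" using yF F eG by (subst finsum_neg_eq) (auto simp flip: e1)
    finally have "(\<Oplus>a\<in>{..<m}. t a \<otimes> e a) = \<zero>" using ex by (simp add: r_neg)
    then have "t x = \<zero>" by (rule indep[OF tF _ xm])
    then have "\<one> = \<zero>" by (simp add: t_def)
    then have "x = \<zero>" if "x \<in> carrier Q" for x using r_one[OF that] r_null[OF that] by simp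
    then have "carrier Q = {\<zero>}" by auto
    then show False using simple by (simp add: simple_ring_def)
  qed
  then obtain T where T: "Mop T" "\<And>i. i \<in> G \<Longrightarrow> T (e i) = \<zero>" "T (e x) \<noteq> \<zero>" by blast
  obtain S where S: "Mop S" "S (T (e x)) = \<one>" using Mop_to_one[OF Mop_closed[OF T(1) ex] T(3)] by blast
  define Dx where "Dx = (\<lambda>z. S (T z))"
  have S0: "S \<zero> = \<zero>" using Mop_smult[OF S(1) F(3), of \<zero>] Mop_closed[OF S(1), of \<zero>] by simp
  have Dx: "Mop Dx" "Dx (e x) = \<one>" "\<And>i. i \<in> G \<Longrightarrow> Dx (e i) = \<zero>"
    using Mop_comp[OF S(1) T(1)] S T S0 by (auto simp: Dx_def)
  show ?case
  proof (cases "j = x")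
    case True
    then show ?thesis using Dx insert.hyps by (intro exI[of _ Dx]) auto
  next
    case False
    then have jG: "j \<in> G" using insert.prems by auto
    let ?T = "\<lambda>z. D j z \<ominus> D j (e x) \<otimes> Dx z"
    have Dj: "D j (e x) \<in> carrier Q" using Mop_closed[OF D(1)[OF jG] ex] .
    have "Mop ?T" using D jG Dx Dj by (intro Mop_diff Mop_lmul) auto
    moreover have "?T (e i) = (if i = j then \<one> else \<zero>)" if "i \<in> insert x G" for i
      using that D(2)[OF jG] Dx Dj False insert.hyps jG by (auto simp: a_minus_def r_neg)
    ultimately show ?thesis by blast
  qed
qed auto

lemma matrix_units_in_mult_algebra:
  "\<exists>w. \<forall>p q a b. w p q a b \<in> F \<and> (p < m \<longrightarrow> q < m \<longrightarrow> (\<forall>x<m.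
     (\<Oplus>a\<in>{..<m}. \<Oplus>b\<in>{..<m}. w p q a b \<otimes> (e a \<otimes> e x \<otimes> e b)) = (if x = q then e p else \<zero>)))"
proof -
  have "\<exists>w. (\<forall>a b. w a b \<in> F) \<and> (p < m \<longrightarrow> q < m \<longrightarrow> (\<forall>x<m.
     (\<Oplus>a\<in>{..<m}. \<Oplus>b\<in>{..<m}. w a b \<otimes> (e a \<otimes> e x \<otimes> e b)) = (if x = q then e p else \<zero>)))" for p q
  proof (cases "p < m \<and> q < m")
    case True
    obtain T where T: "Mop T" "\<And>i. i < m \<Longrightarrow> T (e i) = (if i = q then \<one> else \<zero>)"
      using density[of "{..<m}" q] True by auto
    have "Mop (\<lambda>x. e p \<otimes> T x)" using True e_closed T by (intro Mop_lmul) auto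
    from Mop_expand[OF this] obtain w where w: "\<forall>a b. w a b \<in> F" "\<forall>x\<in>carrier Q. e p \<otimes> T x = (\<Oplus>a\<in>{..<m}. \<Oplus>b\<in>{..<m}. w a b \<otimes> (e a \<otimes> x \<otimes> e b))" by blast
    have "(\<Oplus>a\<in>{..<m}. \<Oplus>b\<in>{..<m}. w a b \<otimes> (e a \<otimes> e x \<otimes> e b)) = (if x = q then e p else \<zero>)" if "x < m" for x
    proof -
      have "e p \<otimes> T (e x) = (if x = q then e p else \<zero>)" using True e_closed by (simp add: T(2)[OF that])
      then show ?thesis unfolding w(2)[rule_format, OF e_closed[OF that]] .
    qed
    then show ?thesis using w(1) by blast
  next
    case False
    then show ?thesis using F by (intro exI[of _ "\<lambda>a b. \<zero>"]) auto
  qed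
  note ex = this
  define w where "w p q = (SOME w. (\<forall>a b. w a b \<in> F) \<and> (p < m \<longrightarrow> q < m \<longrightarrow> (\<forall>x<m.
     (\<Oplus>a\<in>{..<m}. \<Oplus>b\<in>{..<m}. w a b \<otimes> (e a \<otimes> e x \<otimes> e b)) = (if x = q then e p else \<zero>))))" for p q
  have "(\<forall>a b. w p q a b \<in> F) \<and> (p < m \<longrightarrow> q < m \<longrightarrow> (\<forall>x<m.
     (\<Oplus>a\<in>{..<m}. \<Oplus>b\<in>{..<m}. w p q a b \<otimes> (e a \<otimes> e x \<otimes> e b)) = (if x = q then e p else \<zero>)))" for p q
    unfolding w_def by (rule someI_ex[OF ex])
  then show ?thesis by (intro exI[of _ w] allI) simp
qed

end

section \<open>Rings of fractions\<close>

locale fraction_ring = R?: ring R + Q: ring Q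
  for R :: "('r, 'm) ring_scheme" (structure) and Q :: "('q, 'l) ring_scheme" +
  fixes \<iota> :: "'r \<Rightarrow> 'q"
  assumes frac: "total_ring_of_fractions R Q \<iota>"
begin

abbreviation mulQ (infixl \<open>\<cdot>\<close> 70) where "x \<cdot> y \<equiv> x \<otimes>\<^bsub>Q\<^esub> y"
abbreviation "Reg \<equiv> regular_elements R"

lemma \<iota>_hom: "r \<in> carrier R \<Longrightarrow> \<iota> r \<in> carrier Q"
  "r \<in> carrier R \<Longrightarrow> s \<in> carrier R \<Longrightarrow> \<iota> (r \<otimes> s) = \<iota> r \<cdot> \<iota> s"
  "r \<in> carrier R \<Longrightarrow> s \<in> carrier R \<Longrightarrow> \<iota> (r \<oplus> s) = \<iota> r \<oplus>\<^bsub>Q\<^esub> \<iota> s" "\<iota> \<one> = \<one>\<^bsub>Q\<^esub>"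
  "r \<in> carrier R \<Longrightarrow> s \<in> carrier R \<Longrightarrow> \<iota> r = \<iota> s \<Longrightarrow> r = s"
proof -
  have h: "\<iota> \<in> Ring.ring_hom R Q" and inj: "inj_on \<iota> (carrier R)" using frac by (simp_all add: total_ring_of_fractions_def)
  show "r \<in> carrier R \<Longrightarrow> \<iota> r \<in> carrier Q"
    "r \<in> carrier R \<Longrightarrow> s \<in> carrier R \<Longrightarrow> \<iota> (r \<otimes> s) = \<iota> r \<cdot> \<iota> s"
    "r \<in> carrier R \<Longrightarrow> s \<in> carrier R \<Longrightarrow> \<iota> (r \<oplus> s) = \<iota> r \<oplus>\<^bsub>Q\<^esub> \<iota> s" "\<iota> \<one> = \<one>\<^bsub>Q\<^esub>"
    by (rule ring_hom_closed[OF h] ring_hom_mult[OF h] ring_hom_add[OF h] ring_hom_one[OF h]; assumption?)+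
  show "r \<in> carrier R \<Longrightarrow> s \<in> carrier R \<Longrightarrow> \<iota> r = \<iota> s \<Longrightarrow> r = s"
    using inj by (rule inj_onD)
qed

lemma Reg: "s \<in> Reg \<Longrightarrow> s \<in> carrier R" "s \<in> Reg \<Longrightarrow> \<iota> s \<in> Units Q"
proof -
  show "s \<in> Reg \<Longrightarrow> s \<in> carrier R" unfolding regular_elements_def by (elim CollectE conjE)
  have "\<forall>s\<in>Reg. \<iota> s \<in> Units Q" using frac unfolding total_ring_of_fractions_def by (elim conjE)
  then show "s \<in> Reg \<Longrightarrow> \<iota> s \<in> Units Q" by blast
qed

lemma Reg_mult: "s \<in> Reg \<Longrightarrow> t \<in> Reg \<Longrightarrow> s \<otimes> t \<in> Reg"
proof -
  assume s: "s \<in> Reg" and t: "t \<in> Reg"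
  have c: "s \<in> carrier R" "t \<in> carrier R" using s t Reg by auto
  have l: "x \<in> carrier R \<Longrightarrow> s \<otimes> x = \<zero> \<Longrightarrow> x = \<zero>" "x \<in> carrier R \<Longrightarrow> t \<otimes> x = \<zero> \<Longrightarrow> x = \<zero>"
    "x \<in> carrier R \<Longrightarrow> x \<otimes> s = \<zero> \<Longrightarrow> x = \<zero>" "x \<in> carrier R \<Longrightarrow> x \<otimes> t = \<zero> \<Longrightarrow> x = \<zero>" for x
    using s t unfolding regular_elements_def by blast+
  show ?thesis
    unfolding regular_elements_def
  proof (intro CollectI conjI ballI impI)
    show "s \<otimes> t \<in> carrier R" using c by simp
    fix x assume x: "x \<in> carrier R"
    show "x = \<zero>" if "s \<otimes> t \<otimes> x = \<zero>" using l(2)[OF x] l(1)[of "t \<otimes> x"] that c x by (simp add: m_assoc)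
    show "x = \<zero>" if "x \<otimes> (s \<otimes> t) = \<zero>" using l(3)[OF x] l(4)[of "x \<otimes> s"] that c x by (simp add: m_assoc)
  qed
qed

lemma Reg_one: "\<one> \<in> Reg" by (auto simp: regular_elements_def)

lemma Reg_cancel: "s \<in> Reg \<Longrightarrow> x \<in> carrier Q \<Longrightarrow> y \<in> carrier Q \<Longrightarrow> x \<cdot> \<iota> s = y \<cdot> \<iota> s \<Longrightarrow> x = y"
  using Q.Units_r_inv[OF Reg(2)] Q.Units_inv_closed[OF Reg(2)] \<iota>_hom(1)[OF Reg(1)]
  by (metis Q.m_assoc Q.r_one)

lemma right_frac: "q \<in> carrier Q \<Longrightarrow> \<exists>a\<in>carrier R. \<exists>s\<in>Reg. q \<cdot> \<iota> s = \<iota> a"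
proof -
  assume "q \<in> carrier Q"
  then obtain a s where as: "a \<in> carrier R" "s \<in> Reg" "q = \<iota> a \<cdot> inv\<^bsub>Q\<^esub> (\<iota> s)"
    using frac unfolding total_ring_of_fractions_def by metis
  have "q \<cdot> \<iota> s = \<iota> a"
    using as Q.Units_l_inv[OF Reg(2)] Q.Units_inv_closed[OF Reg(2)] \<iota>_hom(1)[OF Reg(1)] \<iota>_hom(1)[OF as(1)]
    by (simp add: Q.m_assoc)
  then show ?thesis using as by blast
qed

text \<open>A left fraction can be rewritten as a right fraction.\<close>

lemma ore:
  assumes "a \<in> carrier R" "s \<in> Reg"
  shows "\<exists>c\<in>carrier R. \<exists>d\<in>Reg. a \<otimes> d = s \<otimes> c"
proof -
  have u: "\<iota> s \<in> Units Q" "inv\<^bsub>Q\<^esub> (\<iota> s) \<in> carrier Q" "\<iota> s \<in> carrier Q" using Reg assms Q.Units_inv_closed \<iota>_hom(1) by auto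
  obtain c d where cd: "c \<in> carrier R" "d \<in> Reg" "(inv\<^bsub>Q\<^esub> (\<iota> s) \<cdot> \<iota> a) \<cdot> \<iota> d = \<iota> c"
    using right_frac[of "inv\<^bsub>Q\<^esub> (\<iota> s) \<cdot> \<iota> a"] u \<iota>_hom(1)[OF assms(1)] by auto
  have c: "\<iota> a \<in> carrier Q" "\<iota> d \<in> carrier Q" using \<iota>_hom(1) assms cd Reg by auto
  have "\<iota> (s \<otimes> c) = \<iota> s \<cdot> (inv\<^bsub>Q\<^esub> (\<iota> s) \<cdot> \<iota> a \<cdot> \<iota> d)" using \<iota>_hom(2) assms cd Reg by simp
  also have "\<dots> = (\<iota> s \<cdot> inv\<^bsub>Q\<^esub> (\<iota> s)) \<cdot> (\<iota> a \<cdot> \<iota> d)" using u c by (metis Q.m_assoc Q.m_closed)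
  also have "\<dots> = \<iota> (a \<otimes> d)" using u c Q.Units_r_inv \<iota>_hom(2) assms cd Reg by simp
  finally show ?thesis using \<iota>_hom(5) assms cd Reg by (metis m_closed)
qed

context
  fixes \<phi> :: "'r \<Rightarrow> 'r"
  assumes \<phi>: "\<phi> \<in> Ring.ring_hom R R" and bij: "bij_betw \<phi> (carrier R) (carrier R)"
begin

private lemma \<phi>_simps: "r \<in> carrier R \<Longrightarrow> \<phi> r \<in> carrier R" "r \<in> carrier R \<Longrightarrow> s \<in> carrier R \<Longrightarrow> \<phi> (r \<otimes> s) = \<phi> r \<otimes> \<phi> s"
  "r \<in> carrier R \<Longrightarrow> s \<in> carrier R \<Longrightarrow> \<phi> (r \<oplus> s) = \<phi> r \<oplus> \<phi> s" "\<phi> \<one> = \<one>"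
  by (rule ring_hom_closed[OF \<phi>] ring_hom_mult[OF \<phi>] ring_hom_add[OF \<phi>] ring_hom_one[OF \<phi>]; assumption?)+

private lemma \<phi>_zero: "\<phi> \<zero> = \<zero>"
  using \<phi>_simps(3)[of \<zero> \<zero>] \<phi>_simps(1)[of \<zero>] by simp

private lemma \<phi>_surj: "r \<in> carrier R \<Longrightarrow> \<exists>r'\<in>carrier R. \<phi> r' = r"
  using bij unfolding bij_betw_def by (metis imageE)

private lemma \<phi>_inj0: "r \<in> carrier R \<Longrightarrow> \<phi> r = \<zero> \<Longrightarrow> r = \<zero>"
  using bij \<phi>_zero by (auto simp: bij_betw_def inj_on_def)

private lemma \<phi>_Reg: "s \<in> Reg \<Longrightarrow> \<phi> s \<in> Reg"
  unfolding regular_elements_def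
proof (intro CollectI conjI ballI impI; elim CollectE conjE)
  assume s: "s \<in> carrier R" and r: "\<forall>x\<in>carrier R. (s \<otimes> x = \<zero> \<longrightarrow> x = \<zero>) \<and> (x \<otimes> s = \<zero> \<longrightarrow> x = \<zero>)"
  show "\<phi> s \<in> carrier R" using s \<phi>_simps by simp
  fix y assume y: "y \<in> carrier R"
  obtain x where x: "x \<in> carrier R" "\<phi> x = y" using \<phi>_surj[OF y] by blast
  show "y = \<zero>" if "\<phi> s \<otimes> y = \<zero>"
  proof -
    have "\<phi> (s \<otimes> x) = \<zero>" using that x \<phi>_simps(2)[OF s x(1)] by simp
    then have "s \<otimes> x = \<zero>" using \<phi>_inj0 s x by simp
    then have "x = \<zero>" using r x by blast
    then show ?thesis using x \<phi>_zero by simp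
  qed
  show "y = \<zero>" if "y \<otimes> \<phi> s = \<zero>"
  proof -
    have "\<phi> (x \<otimes> s) = \<zero>" using that x \<phi>_simps(2)[OF x(1) s] by simp
    then have "x \<otimes> s = \<zero>" using \<phi>_inj0 s x by simp
    then have "x = \<zero>" using r x by blast
    then show ?thesis using x \<phi>_zero by simp
  qed
qed

private lemma Reg_preimage: "s \<in> Reg \<Longrightarrow> \<exists>t\<in>Reg. \<phi> t = s"
proof -
  assume s: "s \<in> Reg"
  obtain t where t: "t \<in> carrier R" "\<phi> t = s" using \<phi>_surj[OF Reg(1)[OF s]] by blast
  have "t \<in> Reg"
    unfolding regular_elements_def
  proof (intro CollectI conjI ballI impI t(1))
    fix y assume y: "y \<in> carrier R"
    have r: "x = \<zero>" if "x \<in> carrier R" "s \<otimes> x = \<zero> \<or> x \<otimes> s = \<zero>" for x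
      using s that unfolding regular_elements_def by blast
    show "y = \<zero>" if "t \<otimes> y = \<zero>"
      using r[OF \<phi>_simps(1)[OF y]] \<phi>_simps(2)[OF t(1) y] \<phi>_inj0[OF y] that t \<phi>_zero by simp
    show "y = \<zero>" if "y \<otimes> t = \<zero>"
      using r[OF \<phi>_simps(1)[OF y]] \<phi>_simps(2)[OF y t(1)] \<phi>_inj0[OF y] that t \<phi>_zero by simp
  qed
  then show ?thesis using t by blast
qed

text \<open>The graph of the extension of \<open>\<phi>\<close> to fractions. It is single-valued because two right fractions have a
  common denominator.\<close>

private definition \<Gamma> :: "'q \<Rightarrow> 'q \<Rightarrow> bool" where
  "\<Gamma> q q' \<longleftrightarrow> q \<in> carrier Q \<and> q' \<in> carrier Q \<and> (\<exists>a\<in>carrier R. \<exists>s\<in>Reg. q \<cdot> \<iota> s = \<iota> a \<and> q' \<cdot> \<iota> (\<phi> s) = \<iota> (\<phi> a))"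

private lemma \<Gamma>_expand:
  assumes "q \<in> carrier Q" "q' \<in> carrier Q" "a \<in> carrier R" "s \<in> Reg" "c \<in> carrier R"
    "q \<cdot> \<iota> s = \<iota> a" "q' \<cdot> \<iota> (\<phi> s) = \<iota> (\<phi> a)"
  shows "q \<cdot> \<iota> (s \<otimes> c) = \<iota> (a \<otimes> c)" "q' \<cdot> \<iota> (\<phi> (s \<otimes> c)) = \<iota> (\<phi> (a \<otimes> c))"
proof -
  have s: "s \<in> carrier R" using assms Reg by blast
  show "q \<cdot> \<iota> (s \<otimes> c) = \<iota> (a \<otimes> c)"
    using assms s \<iota>_hom(1)[OF s] \<iota>_hom(1)[OF assms(5)] by (simp add: \<iota>_hom(2) flip: Q.m_assoc)
  show "q' \<cdot> \<iota> (\<phi> (s \<otimes> c)) = \<iota> (\<phi> (a \<otimes> c))"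
    using assms s \<iota>_hom(1)[OF \<phi>_simps(1)[OF s]] \<iota>_hom(1)[OF \<phi>_simps(1)[OF assms(5)]]
    by (simp add: \<iota>_hom(2) \<phi>_simps flip: Q.m_assoc)
qed

private lemma \<Gamma>_ex: "q \<in> carrier Q \<Longrightarrow> \<exists>q'. \<Gamma> q q'"
proof -
  assume q: "q \<in> carrier Q"
  obtain a s where as: "a \<in> carrier R" "s \<in> Reg" "q \<cdot> \<iota> s = \<iota> a" using right_frac[OF q] by blast
  have u: "\<iota> (\<phi> s) \<in> Units Q" using Reg \<phi>_Reg as by blast
  have c: "\<iota> (\<phi> a) \<in> carrier Q" using as \<iota>_hom(1) \<phi>_simps(1) by blast
  have "\<Gamma> q (\<iota> (\<phi> a) \<cdot> inv\<^bsub>Q\<^esub> (\<iota> (\<phi> s)))"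
    unfolding \<Gamma>_def using as q u c Q.Units_l_inv[OF u] Q.Units_inv_closed[OF u] Q.Units_closed[OF u]
    by (intro conjI bexI[of _ a] bexI[of _ s]) (auto simp: Q.m_assoc)
  then show ?thesis by blast
qed

private lemma common:
  assumes "s \<in> Reg" "t \<in> Reg"
  shows "\<exists>c\<in>carrier R. \<exists>d\<in>carrier R. s \<otimes> c \<in> Reg \<and> s \<otimes> c = t \<otimes> d"
proof -
  obtain c d where cd: "c \<in> carrier R" "d \<in> Reg" "t \<otimes> d = s \<otimes> c" using ore[OF Reg(1)[OF assms(2)] assms(1)] by blast
  have "s \<otimes> c \<in> Reg" using Reg_mult[OF assms(2) cd(2)] cd by simp
  then show ?thesis using cd Reg by metis
qed

private lemma \<Gamma>_unique: "\<Gamma> q q' \<Longrightarrow> \<Gamma> q q'' \<Longrightarrow> q' = q''"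
proof -
  assume "\<Gamma> q q'" "\<Gamma> q q''"
  then obtain a s b t where h: "q \<in> carrier Q" "q' \<in> carrier Q" "q'' \<in> carrier Q" "a \<in> carrier R" "s \<in> Reg" "q \<cdot> \<iota> s = \<iota> a" "q' \<cdot> \<iota> (\<phi> s) = \<iota> (\<phi> a)"
    "b \<in> carrier R" "t \<in> Reg" "q \<cdot> \<iota> t = \<iota> b" "q'' \<cdot> \<iota> (\<phi> t) = \<iota> (\<phi> b)" unfolding \<Gamma>_def by blast
  obtain c d where cd: "c \<in> carrier R" "d \<in> carrier R" "s \<otimes> c \<in> Reg" "s \<otimes> c = t \<otimes> d" using common[OF h(5,9)] by blast
  note 1 = \<Gamma>_expand[OF h(1,2,4,5) cd(1) h(6,7)] and 2 = \<Gamma>_expand[OF h(1,3,8,9) cd(2) h(10,11)]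
  have "\<iota> (a \<otimes> c) = \<iota> (b \<otimes> d)" using 1 2 cd(4) by metis
  then have "a \<otimes> c = b \<otimes> d" using \<iota>_hom(5) h cd by (metis m_closed)
  then have "q' \<cdot> \<iota> (\<phi> (s \<otimes> c)) = q'' \<cdot> \<iota> (\<phi> (s \<otimes> c))" using 1 2 cd(4) by metis
  then show "q' = q''" using Reg_cancel[OF \<phi>_Reg[OF cd(3)] h(2,3)] by blast
qed

private lemma \<Gamma>_add: "\<Gamma> p p' \<Longrightarrow> \<Gamma> q q' \<Longrightarrow> \<Gamma> (p \<oplus>\<^bsub>Q\<^esub> q) (p' \<oplus>\<^bsub>Q\<^esub> q')"
proof -
  assume "\<Gamma> p p'" "\<Gamma> q q'"
  then obtain a s b t where h: "p \<in> carrier Q" "p' \<in> carrier Q" "a \<in> carrier R" "s \<in> Reg" "p \<cdot> \<iota> s = \<iota> a" "p' \<cdot> \<iota> (\<phi> s) = \<iota> (\<phi> a)"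
    "q \<in> carrier Q" "q' \<in> carrier Q" "b \<in> carrier R" "t \<in> Reg" "q \<cdot> \<iota> t = \<iota> b" "q' \<cdot> \<iota> (\<phi> t) = \<iota> (\<phi> b)" unfolding \<Gamma>_def by blast
  obtain c d where cd: "c \<in> carrier R" "d \<in> carrier R" "s \<otimes> c \<in> Reg" "s \<otimes> c = t \<otimes> d" using common[OF h(4,10)] by blast
  note 1 = \<Gamma>_expand[OF h(1,2,3,4) cd(1) h(5,6)] and 2 = \<Gamma>_expand[OF h(7,8,9,10) cd(2) h(11,12), folded cd(4)]
  have r: "s \<otimes> c \<in> carrier R" "\<phi> (s \<otimes> c) \<in> carrier R" "a \<otimes> c \<in> carrier R" "b \<otimes> d \<in> carrier R" using cd Reg \<phi>_simps h by auto
  show ?thesis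
    unfolding \<Gamma>_def
    by (intro conjI bexI[of _ "a \<otimes> c \<oplus> b \<otimes> d"] bexI[of _ "s \<otimes> c"])
      (use h 1 2 r cd \<iota>_hom(1)[OF r(1)] \<iota>_hom(1)[OF r(2)] in \<open>auto simp: Q.l_distr \<iota>_hom(3) \<phi>_simps(1,3)\<close>)
qed

private lemma \<Gamma>_mult: "\<Gamma> p p' \<Longrightarrow> \<Gamma> q q' \<Longrightarrow> \<Gamma> (p \<cdot> q) (p' \<cdot> q')"
proof -
  assume "\<Gamma> p p'" "\<Gamma> q q'"
  then obtain a s b t where h: "p \<in> carrier Q" "p' \<in> carrier Q" "a \<in> carrier R" "s \<in> Reg" "p \<cdot> \<iota> s = \<iota> a" "p' \<cdot> \<iota> (\<phi> s) = \<iota> (\<phi> a)"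
    "q \<in> carrier Q" "q' \<in> carrier Q" "b \<in> carrier R" "t \<in> Reg" "q \<cdot> \<iota> t = \<iota> b" "q' \<cdot> \<iota> (\<phi> t) = \<iota> (\<phi> b)" unfolding \<Gamma>_def by blast
  obtain c d where cd: "c \<in> carrier R" "d \<in> Reg" "b \<otimes> d = s \<otimes> c" using ore[OF h(9,4)] by blast
  have dR: "d \<in> carrier R" using cd Reg by blast
  note 1 = \<Gamma>_expand[OF h(1,2,3,4) cd(1) h(5,6)] and 2 = \<Gamma>_expand[OF h(7,8,9,10) dR h(11,12), unfolded cd(3)]
  have r: "t \<otimes> d \<in> Reg" using Reg_mult h cd by blast
  have c: "\<iota> (t \<otimes> d) \<in> carrier Q" "\<iota> (\<phi> (t \<otimes> d)) \<in> carrier Q" using \<iota>_hom(1) \<phi>_simps(1) Reg r by auto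
  show ?thesis
    unfolding \<Gamma>_def
    by (intro conjI bexI[of _ "a \<otimes> c"] bexI[of _ "t \<otimes> d"])
      (use h 1 2 r cd c in \<open>auto simp: Q.m_assoc\<close>)
qed

private lemma \<Gamma>_\<iota>: "r \<in> carrier R \<Longrightarrow> \<Gamma> (\<iota> r) (\<iota> (\<phi> r))"
  unfolding \<Gamma>_def by (intro conjI bexI[of _ r] bexI[of _ \<one>]) (auto simp: \<iota>_hom \<phi>_simps Reg_one)

lemma extend_automorphism:
  "\<exists>\<Phi>. \<Phi> \<in> Ring.ring_hom Q Q \<and> \<Phi> ` carrier Q = carrier Q \<and> (\<forall>r\<in>carrier R. \<Phi> (\<iota> r) = \<iota> (\<phi> r))"
proof -
  define \<Phi> where "\<Phi> q = (SOME q'. \<Gamma> q q')" for q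
  have \<Phi>: "\<Gamma> q (\<Phi> q)" if "q \<in> carrier Q" for q unfolding \<Phi>_def by (rule someI_ex[OF \<Gamma>_ex[OF that]])
  have \<Phi>_eq: "\<Phi> q = q'" if "\<Gamma> q q'" for q q'
    using \<Gamma>_unique[OF \<Phi> that] that by (simp add: \<Gamma>_def)
  have c: "\<Phi> q \<in> carrier Q" if "q \<in> carrier Q" for q using \<Phi>[OF that] by (simp add: \<Gamma>_def)
  have "\<Phi> \<in> Ring.ring_hom Q Q"
    using \<Gamma>_\<iota>[OF R.one_closed] by (intro ring_hom_memI c \<Phi>_eq \<Gamma>_add \<Gamma>_mult \<Phi>) (auto simp: \<iota>_hom(4) \<phi>_simps(4))
  moreover have "\<Phi> ` carrier Q = carrier Q"
  proof
    show "\<Phi> ` carrier Q \<subseteq> carrier Q" using c by auto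
    show "carrier Q \<subseteq> \<Phi> ` carrier Q"
    proof
      fix q assume q: "q \<in> carrier Q"
      obtain a s where as: "a \<in> carrier R" "s \<in> Reg" "q \<cdot> \<iota> s = \<iota> a" using right_frac[OF q] by blast
      obtain a' where a': "a' \<in> carrier R" "\<phi> a' = a" using \<phi>_surj[OF as(1)] by blast
      obtain s' where s': "s' \<in> Reg" "\<phi> s' = s" using Reg_preimage[OF as(2)] by blast
      have u: "\<iota> s' \<in> Units Q" using Reg s' by blast
      let ?p = "\<iota> a' \<cdot> inv\<^bsub>Q\<^esub> (\<iota> s')"
      have p: "?p \<in> carrier Q" "?p \<cdot> \<iota> s' = \<iota> a'"
        using u a' \<iota>_hom(1)[OF a'(1)] Q.Units_l_inv[OF u] Q.Units_inv_closed[OF u] Q.Units_closed[OF u] by (auto simp: Q.m_assoc)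
      have "\<Gamma> ?p q" unfolding \<Gamma>_def using p q as a' s' by (intro conjI bexI[of _ a'] bexI[of _ s']) auto
      then show "q \<in> \<Phi> ` carrier Q" using \<Phi>_eq p by (metis image_eqI)
    qed
  qed
  ultimately show ?thesis using \<Phi>_eq[OF \<Gamma>_\<iota>] by blast
qed

end

lemma central_of_commutes:
  assumes z: "z \<in> carrier R" "\<And>r. r \<in> carrier R \<Longrightarrow> z \<otimes> r = r \<otimes> z"
  shows "\<iota> z \<in> ring_center Q"
proof -
  have "\<iota> z \<cdot> q = q \<cdot> \<iota> z" if q: "q \<in> carrier Q" for q
  proof -
    obtain a s where as: "a \<in> carrier R" "s \<in> Reg" "q \<cdot> \<iota> s = \<iota> a" using right_frac[OF q] by blast
    have s: "s \<in> carrier R" using as Reg by blast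
    have c: "\<iota> z \<in> carrier Q" "\<iota> s \<in> carrier Q" using z s \<iota>_hom by auto
    have "(\<iota> z \<cdot> q) \<cdot> \<iota> s = \<iota> (z \<otimes> a)" using as q c z(1) by (simp add: Q.m_assoc \<iota>_hom(2))
    also have "\<dots> = \<iota> a \<cdot> \<iota> z" using z(2)[OF as(1)] as(1) z(1) by (simp add: \<iota>_hom(2))
    also have "\<dots> = q \<cdot> (\<iota> s \<cdot> \<iota> z)" using q c by (simp flip: as(3) add: Q.m_assoc)
    also have "\<iota> s \<cdot> \<iota> z = \<iota> z \<cdot> \<iota> s" using z(2)[OF s] z(1) s by (simp flip: \<iota>_hom(2))
    also have "q \<cdot> (\<iota> z \<cdot> \<iota> s) = (q \<cdot> \<iota> z) \<cdot> \<iota> s" using q c by (simp add: Q.m_assoc)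
    finally show ?thesis using Reg_cancel[OF as(2)] q c by simp
  qed
  then show ?thesis using \<iota>_hom(1)[OF z(1)] by (auto simp: ring_center_def)
qed

end

section \<open>An order and its specialisations\<close>

lemma conj_entry:
  fixes Y B :: "'k::field mat"
  assumes Y: "Y \<in> carrier_mat n n" and B: "B \<in> carrier_mat n n" and ij: "i < n" "j < n"
  shows "conj_mat Y B $$ (i, j) = inverse (det Y) * (\<Sum>t<n. (\<Sum>s<n. Y $$ (i, s) * B $$ (s, t)) * adj_mat Y $$ (t, j))"
proof -
  have d: "dim_row Y = n" "dim_col Y = n" "dim_row B = n" "dim_col B = n" "dim_row (adj_mat Y) = n" "dim_col (adj_mat Y) = n"
    using Y B adj_mat(1)[OF Y] by auto
  show ?thesis using ij by (simp add: conj_mat_def scalar_prod_def d atLeast0LessThan)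
qed

lemma subst_alg_gen: "f \<in> alg_gen U \<Longrightarrow> (\<And>i. i \<in> U \<Longrightarrow> q i \<in> alg_gen V) \<Longrightarrow> subst q f \<in> alg_gen V"
  by (induct rule: alg_gen.induct) (auto intro: alg_gen.intros)

lemma alg_gen_finite_support: "f \<in> alg_gen U \<Longrightarrow> \<exists>V. finite V \<and> V \<subseteq> U \<and> f \<in> alg_gen V"
proof (induct rule: alg_gen.induct)
  case (const c)
  show ?case by (intro exI[of _ "{}"]) (auto intro: alg_gen.const)
next
  case (var i)
  then show ?case by (intro exI[of _ "{i}"]) (auto intro: alg_gen.var)
next
  case (add f g)
  then obtain V W where "finite V" "V \<subseteq> U" "f \<in> alg_gen V" "finite W" "W \<subseteq> U" "g \<in> alg_gen W" by blast
  then show ?case by (intro exI[of _ "V \<union> W"]) (auto intro: alg_gen.add alg_gen_mono[of f V] alg_gen_mono[of g W])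
next
  case (mult f g)
  then obtain V W where "finite V" "V \<subseteq> U" "f \<in> alg_gen V" "finite W" "W \<subseteq> U" "g \<in> alg_gen W" by blast
  then show ?case by (intro exI[of _ "V \<union> W"]) (auto intro: alg_gen.mult alg_gen_mono[of f V] alg_gen_mono[of g W])
qed

text \<open>The situation of the theorem, without the group: \<open>Q\<close> is the ring of fractions of \<open>R\<close>, of dimension
  \<open>n\<^sup>2\<close> over its center \<open>F\<close>, and the \<open>r l\<close> generate \<open>R\<close> as an algebra.\<close>

locale pi_setup = central_simple Q F m e + fr: fraction_ring R Q \<iota>
  for Q :: "'q ring" (structure) and F m e and R :: "('k::{alg_closed_field, field_char_0}, 'r) module" and \<iota> +
  fixes n L :: nat and r :: "nat \<Rightarrow> 'r"
  assumes alg: "is_algebra R" and mn: "m = n * n" and r: "\<And>l. l < L \<Longrightarrow> r l \<in> carrier R"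
    and gen: "\<And>T. subring T R \<Longrightarrow> submodule (class_ring :: 'k ring) T R \<Longrightarrow> r ` {..<L} \<subseteq> T \<Longrightarrow> T = carrier R"
begin

lemma one_neq_zero: "\<one> \<noteq> \<zero>"
proof
  assume "\<one> = \<zero>"
  then have "x = \<zero>" if "x \<in> carrier Q" for x using r_one[OF that] r_null[OF that] by simp
  then show False using simple by (auto simp: simple_ring_def)
qed

lemma m_pos: "m > 0"
proof (rule ccontr)
  assume "\<not> m > 0"
  then show False using co(2)[OF one_closed] one_neq_zero by simp
qed

lemma n_pos: "n > 0" using m_pos mn by simp

lemma vsR: "vectorspace (class_ring :: 'k ring) R" using alg by (simp add: is_algebra_def)

interpretation VR: vectorspace "class_ring :: 'k ring" R by (rule vsR)

lemma smult_R: "x \<in> carrier R \<Longrightarrow> c \<odot>\<^bsub>R\<^esub> x \<in> carrier R"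
  "x \<in> carrier R \<Longrightarrow> (c + d) \<odot>\<^bsub>R\<^esub> x = c \<odot>\<^bsub>R\<^esub> x \<oplus>\<^bsub>R\<^esub> d \<odot>\<^bsub>R\<^esub> x"
  "x \<in> carrier R \<Longrightarrow> (c * d) \<odot>\<^bsub>R\<^esub> x = c \<odot>\<^bsub>R\<^esub> (d \<odot>\<^bsub>R\<^esub> x)"
  "x \<in> carrier R \<Longrightarrow> 1 \<odot>\<^bsub>R\<^esub> x = x"
  "x \<in> carrier R \<Longrightarrow> y \<in> carrier R \<Longrightarrow> (c \<odot>\<^bsub>R\<^esub> x) \<otimes>\<^bsub>R\<^esub> y = c \<odot>\<^bsub>R\<^esub> (x \<otimes>\<^bsub>R\<^esub> y)"
  "x \<in> carrier R \<Longrightarrow> y \<in> carrier R \<Longrightarrow> x \<otimes>\<^bsub>R\<^esub> (c \<odot>\<^bsub>R\<^esub> y) = c \<odot>\<^bsub>R\<^esub> (x \<otimes>\<^bsub>R\<^esub> y)"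
  using VR.smult_closed[of c x] VR.smult_l_distr[of c d x] VR.smult_assoc1[of c d x] VR.smult_one[of x] alg
  by (auto simp: is_algebra_def)

lemma uminus_R: assumes x: "x \<in> carrier R" shows "\<ominus>\<^bsub>R\<^esub> x = (- 1) \<odot>\<^bsub>R\<^esub> x"
proof -
  have "(- 1) \<odot>\<^bsub>R\<^esub> x \<oplus>\<^bsub>R\<^esub> x = 0 \<odot>\<^bsub>R\<^esub> x" using smult_R(2)[OF x, of "- 1" 1] smult_R(4)[OF x] by simp
  also have "\<dots> = \<zero>\<^bsub>R\<^esub>" using VR.smult_l_null[OF x] by simp
  finally show ?thesis using x smult_R(1)[OF x] by (metis fr.R.minus_equality)
qed

definition \<kappa> :: "'k \<Rightarrow> 'q" where "\<kappa> c = \<iota> (c \<odot>\<^bsub>R\<^esub> \<one>\<^bsub>R\<^esub>)"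

lemma \<kappa>_F: "\<kappa> c \<in> F"
  unfolding \<kappa>_def F_center by (rule fr.central_of_commutes) (auto simp: smult_R)

lemma \<kappa>_smult: "x \<in> carrier R \<Longrightarrow> \<iota> (c \<odot>\<^bsub>R\<^esub> x) = \<kappa> c \<otimes> \<iota> x"
  by (simp add: \<kappa>_def smult_R flip: fr.\<iota>_hom(2))

lemma \<kappa>_hom: "coeff_hom \<kappa> (Q\<lparr>carrier := F\<rparr>)"
  unfolding coeff_hom_def
proof (intro conjI allI)
  show "\<kappa> c \<in> carrier (Q\<lparr>carrier := F\<rparr>)" for c using \<kappa>_F by simp
  show "\<kappa> 1 = \<one>\<^bsub>Q\<lparr>carrier := F\<rparr>\<^esub>" by (simp add: \<kappa>_def smult_R fr.\<iota>_hom)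
  show "\<kappa> (a + b) = \<kappa> a \<oplus>\<^bsub>Q\<lparr>carrier := F\<rparr>\<^esub> \<kappa> b" for a b by (simp add: \<kappa>_def smult_R fr.\<iota>_hom)
  show "\<kappa> (a * b) = \<kappa> a \<otimes>\<^bsub>Q\<lparr>carrier := F\<rparr>\<^esub> \<kappa> b" for a b
    using smult_R(5)[of "\<one>\<^bsub>R\<^esub>" "b \<odot>\<^bsub>R\<^esub> \<one>\<^bsub>R\<^esub>" a] smult_R(1,3)[of "\<one>\<^bsub>R\<^esub>"]
      fr.\<iota>_hom(2)[of "a \<odot>\<^bsub>R\<^esub> \<one>\<^bsub>R\<^esub>" "b \<odot>\<^bsub>R\<^esub> \<one>\<^bsub>R\<^esub>"] by (simp add: \<kappa>_def)
qed

lemma field_F: "field (Q\<lparr>carrier := F\<rparr>)" by (rule subfield_iff(2)[OF F_subfield])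

lemma cring_F: "cring (Q\<lparr>carrier := F\<rparr>)"
  using field_F by (simp add: field_def domain_def)

lemma F_integral: "x \<in> F \<Longrightarrow> y \<in> F \<Longrightarrow> x \<otimes> y = \<zero> \<Longrightarrow> x = \<zero> \<or> y = \<zero>"
  using domain.integral[of "Q\<lparr>carrier := F\<rparr>" x y] field_F by (simp add: field_def)

text \<open>A variable \<open>Inl q\<close> stands for the constant \<open>q\<close> of the center, a variable \<open>Inr (a, i, j)\<close> for the entry
  \<open>(i, j)\<close> of the matrix representing \<open>e a\<close>. Only constants have a value in \<open>F\<close>, so entries are sent to 0.\<close>

definition evF :: "(('q + nat \<times> nat \<times> nat, 'k) mpol) \<Rightarrow> 'q" where
  "evF f = peval (Q\<lparr>carrier := F\<rparr>) \<kappa> (\<lambda>i. case i of Inl q \<Rightarrow> if q \<in> F then q else \<zero> | Inr _ \<Rightarrow> \<zero>) f"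

lemma evF: "evF f \<in> F" "evF (f + g) = evF f \<oplus> evF g" "evF (f * g) = evF f \<otimes> evF g" "evF (mconst c) = \<kappa> c"
  "q \<in> F \<Longrightarrow> evF (mvar (Inl q)) = q"
proof -
  let ?p = "\<lambda>i :: 'q + nat \<times> nat \<times> nat. case i of Inl q \<Rightarrow> if q \<in> F then q else \<zero> | Inr _ \<Rightarrow> \<zero>"
  have p: "?p i \<in> carrier (Q\<lparr>carrier := F\<rparr>)" for i using F by (auto split: sum.splits)
  note [simp] = evF_def
  show "evF f \<in> F" using peval_closed[OF cring_F \<kappa>_hom p] by simp
  show "evF (f + g) = evF f \<oplus> evF g" using peval_add[OF cring_F \<kappa>_hom p] by simp
  show "evF (f * g) = evF f \<otimes> evF g" using peval_mult[OF cring_F \<kappa>_hom p] by simp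
  show "evF (mconst c) = \<kappa> c" using peval_const[OF cring_F \<kappa>_hom p] by simp
  show "q \<in> F \<Longrightarrow> evF (mvar (Inl q)) = q" using peval_var[OF cring_F \<kappa>_hom, where p = ?p and i = "Inl q", OF p] by simp
qed

lemma \<kappa>_one: "\<kappa> 1 = \<one>" and \<kappa>_zero: "\<kappa> 0 = \<zero>"
proof -
  show "\<kappa> 1 = \<one>" using \<kappa>_hom by (simp add: coeff_hom_def)
  have "\<kappa> 0 \<oplus> \<kappa> 0 = \<kappa> 0" using \<kappa>_hom by (simp add: coeff_hom_def) (metis add_0)
  then show "\<kappa> 0 = \<zero>" using F(1)[OF \<kappa>_F] by (simp only: add.r_cancel_one)
qed

lemma evF_zero: "evF 0 = \<zero>" and evF_one: "evF 1 = \<one>"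
  using evF(4)[of 0] evF(4)[of 1] by (simp_all add: \<kappa>_zero \<kappa>_one)

lemma evF_diff: "evF (f - g) = evF f \<ominus> evF g"
proof -
  have "evF (f - g) \<oplus> evF g = evF f" using evF(2)[of "f - g" g] by simp
  then show ?thesis using F(1)[OF evF(1)] by (metis a_minus_def a_assoc add.inv_closed r_neg r_zero)
qed

definition "cideal = {f. evF f = \<zero>}"

lemma prime_set_PF: "prime_set cideal"
  unfolding prime_set_def cideal_def
  using F(1)[OF evF(1)] F_integral[OF evF(1) evF(1)] one_neq_zero by (auto simp: evF evF_zero evF_one)

definition zring where "zring Z = evF ` alg_gen (Inl ` Z)"
definition center_pt where "center_pt Z p \<longleftrightarrow> kpoint (Inl ` Z) cideal p"
text \<open>A point of the subalgebra \<open>zring Z\<close> of \<open>F\<close> evaluates its elements through any polynomial that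
  expresses them; \<open>center_pt\<close> makes the choice irrelevant.\<close>

definition spec where "spec Z p z = evk p (SOME g. g \<in> alg_gen (Inl ` Z) \<and> evF g = z)"

lemma zring_F: "z \<in> zring Z \<Longrightarrow> z \<in> F" by (auto simp: zring_def evF)

lemma spec_ev: "center_pt Z p \<Longrightarrow> g \<in> alg_gen (Inl ` Z) \<Longrightarrow> spec Z p (evF g) = evk p g"
proof -
  assume p: "center_pt Z p" and g: "g \<in> alg_gen (Inl ` Z)"
  define h where "h = (SOME h. h \<in> alg_gen (Inl ` Z) \<and> evF h = evF g)"
  have h: "h \<in> alg_gen (Inl ` Z)" "evF h = evF g" using someI[of "\<lambda>h. h \<in> alg_gen (Inl ` Z) \<and> evF h = evF g" g] g by (auto simp: h_def)
  have "evF (h - g) = \<zero>" using h F(1)[OF evF(1)] by (simp add: evF_diff a_minus_def r_neg)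
  then have "evk p (h - g) = 0" using p alg_gen_diff[OF h(1) g] unfolding center_pt_def kpoint_def cideal_def by blast
  then show ?thesis by (simp add: spec_def flip: h_def)
qed

lemma zring: "x \<in> zring Z \<Longrightarrow> y \<in> zring Z \<Longrightarrow> x \<oplus> y \<in> zring Z" "x \<in> zring Z \<Longrightarrow> y \<in> zring Z \<Longrightarrow> x \<otimes> y \<in> zring Z"
  "\<kappa> c \<in> zring Z" "\<zero> \<in> zring Z" "\<one> \<in> zring Z" "Z \<subseteq> F \<Longrightarrow> z \<in> Z \<Longrightarrow> z \<in> zring Z"
proof -
  have I: "g \<in> alg_gen (Inl ` Z) \<Longrightarrow> evF g = z \<Longrightarrow> z \<in> zring Z" for g z unfolding zring_def by (rule image_eqI) auto
  show "x \<in> zring Z \<Longrightarrow> y \<in> zring Z \<Longrightarrow> x \<oplus> y \<in> zring Z"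
    unfolding zring_def[of Z] by (elim imageE, rule I[unfolded zring_def, OF alg_gen.add]) (simp_all add: evF(2))
  show "x \<in> zring Z \<Longrightarrow> y \<in> zring Z \<Longrightarrow> x \<otimes> y \<in> zring Z"
    unfolding zring_def[of Z] by (elim imageE, rule I[unfolded zring_def, OF alg_gen.mult]) (simp_all add: evF(3))
  show "\<kappa> c \<in> zring Z" for c by (rule I[OF alg_gen.const evF(4)])
  from this[of 0] this[of 1] show "\<zero> \<in> zring Z" "\<one> \<in> zring Z" by (simp_all add: \<kappa>_zero \<kappa>_one)
  show "Z \<subseteq> F \<Longrightarrow> z \<in> Z \<Longrightarrow> z \<in> zring Z" by (rule I[OF alg_gen.var evF(5)]) auto
qed

lemma zring_sum: "(\<And>i. i \<in> A \<Longrightarrow> f i \<in> zring Z) \<Longrightarrow> (\<Oplus>i\<in>A. f i) \<in> zring Z"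
proof (induct A rule: infinite_finite_induct)
  case (insert x G)
  then show ?case using zring_F F(1) by (subst finsum_insert) (auto intro: zring)
qed (auto intro: zring)

context
  fixes Z p
  assumes p: "center_pt Z p"
begin

lemma spec_add: "x \<in> zring Z \<Longrightarrow> y \<in> zring Z \<Longrightarrow> spec Z p (x \<oplus> y) = spec Z p x + spec Z p y"
  and spec_mult: "x \<in> zring Z \<Longrightarrow> y \<in> zring Z \<Longrightarrow> spec Z p (x \<otimes> y) = spec Z p x * spec Z p y"
  and spec_const: "spec Z p (\<kappa> c) = c" and spec_zero: "spec Z p \<zero> = 0" and spec_one: "spec Z p \<one> = 1"
  and spec_var: "Z \<subseteq> F \<Longrightarrow> z \<in> Z \<Longrightarrow> spec Z p z = p (Inl z)"
proof -
  show "x \<in> zring Z \<Longrightarrow> y \<in> zring Z \<Longrightarrow> spec Z p (x \<oplus> y) = spec Z p x + spec Z p y"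
    unfolding zring_def by (auto simp: spec_ev[OF p] alg_gen.add simp flip: evF(2))
  show "x \<in> zring Z \<Longrightarrow> y \<in> zring Z \<Longrightarrow> spec Z p (x \<otimes> y) = spec Z p x * spec Z p y"
    unfolding zring_def by (auto simp: spec_ev[OF p] alg_gen.mult simp flip: evF(3))
  show *: "spec Z p (\<kappa> c) = c" for c using spec_ev[OF p alg_gen.const, of c] by (simp add: evF)
  show "spec Z p \<zero> = 0" "spec Z p \<one> = 1" using *[of 0] *[of 1] by (auto simp: \<kappa>_zero \<kappa>_one)
  assume "Z \<subseteq> F" "z \<in> Z"
  then show "spec Z p z = p (Inl z)" using spec_ev[OF p alg_gen.var[of "Inl z" "Inl ` Z"]] evF(5)[of z] by auto
qed

lemma spec_sum: "(\<And>i. i \<in> A \<Longrightarrow> f i \<in> zring Z) \<Longrightarrow> spec Z p (\<Oplus>i\<in>A. f i) = (\<Sum>i\<in>A. spec Z p (f i))"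
proof (induct A rule: infinite_finite_induct)
  case (insert x G)
  then show ?case using zring_F F(1) by (subst finsum_insert) (auto simp: spec_add zring_sum)
qed (auto simp: spec_zero)

lemma spec_mono: assumes "center_pt Z' p" "Z \<subseteq> Z'" "z \<in> zring Z" shows "spec Z' p z = spec Z p z"
proof -
  obtain g where g: "g \<in> alg_gen (Inl ` Z)" "z = evF g" using assms(3) by (auto simp: zring_def)
  then have "g \<in> alg_gen (Inl ` Z')" using assms(2) by (auto intro: alg_gen_mono)
  then show ?thesis using g spec_ev[OF p] spec_ev[OF assms(1)] by simp
qed

end

text \<open>The structure constants of \<open>Q\<close>, the coordinates of its unit, and the coefficients of the matrix units of
  its multiplication algebra.\<close>

definition "cc a b = co (e a \<otimes> e b)"
definition "uu = co \<one>"
definition "ww = (SOME w. \<forall>p q a b. w p q a b \<in> F \<and> (p < m \<longrightarrow> q < m \<longrightarrow> (\<forall>x<m.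
     (\<Oplus>a\<in>{..<m}. \<Oplus>b\<in>{..<m}. w p q a b \<otimes> (e a \<otimes> e x \<otimes> e b)) = (if x = q then e p else \<zero>))))"

lemma ww: "ww p q a b \<in> F" "p < m \<Longrightarrow> q < m \<Longrightarrow> x < m \<Longrightarrow>
  (\<Oplus>a\<in>{..<m}. \<Oplus>b\<in>{..<m}. ww p q a b \<otimes> (e a \<otimes> e x \<otimes> e b)) = (if x = q then e p else \<zero>)"
  using someI_ex[OF matrix_units_in_mult_algebra] unfolding ww_def by blast+

lemma cc_F: "a < m \<Longrightarrow> b < m \<Longrightarrow> cc a b l \<in> F" by (auto simp: cc_def intro!: co e_closed)
lemma uu_F: "uu l \<in> F" by (auto simp: uu_def intro!: co)

lemma co_e: assumes "a < m" "b < m" shows "co (e a) b = (if a = b then \<one> else \<zero>)"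
proof (rule co_unique[OF e_closed[OF assms(1)] _ _ assms(2)])
  show "(if a = b then \<one> else \<zero>) \<in> F" for b using F by auto
  have "(\<Oplus>b\<in>{..<m}. (if a = b then \<one> else \<zero>) \<otimes> e b) = (\<Oplus>b\<in>{..<m}. if b = a then e a else \<zero>)"
    by (rule finsum_cong') (use e_closed assms in auto)
  also have "\<dots> = e a"
    using add.finprod_singleton[of a "{..<m}" "\<lambda>_. e a"] e_closed assms by (simp add: finsum_def eq_commute)
  finally show "e a = (\<Oplus>b\<in>{..<m}. (if a = b then \<one> else \<zero>) \<otimes> e b)" ..
qed

lemma co_mult_right: assumes x: "x \<in> carrier Q" and d: "d < m" and l: "l < m"
  shows "co (x \<otimes> e d) l = (\<Oplus>a\<in>{..<m}. co x a \<otimes> cc a d l)"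
proof -
  have c: "co x a \<in> carrier Q" for a using F(1)[OF co(1)[OF x]] .
  have "x \<otimes> e d = (\<Oplus>a\<in>{..<m}. co x a \<otimes> e a) \<otimes> e d" using co(2)[OF x] by simp
  also have "\<dots> = (\<Oplus>a\<in>{..<m}. co x a \<otimes> (e a \<otimes> e d))"
    by (subst finsum_ldistr) (use c e_closed d in \<open>auto intro!: finsum_cong' simp: m_assoc\<close>)
  finally have "co (x \<otimes> e d) l = (\<Oplus>a\<in>{..<m}. co (co x a \<otimes> (e a \<otimes> e d)) l)"
    by (simp only:, intro co_sum l m_closed c e_closed d) auto
  also have "\<dots> = (\<Oplus>a\<in>{..<m}. co x a \<otimes> cc a d l)"
    by (rule finsum_cong') (use c e_closed d l x cc_F F(1) in \<open>auto simp: co_smult[OF co(1)] cc_def\<close>)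
  finally show ?thesis .
qed

lemma co_mult: assumes x: "x \<in> carrier Q" and y: "y \<in> carrier Q" and l: "l < m"
  shows "co (x \<otimes> y) l = (\<Oplus>b\<in>{..<m}. co y b \<otimes> (\<Oplus>a\<in>{..<m}. co x a \<otimes> cc a b l))"
proof -
  have c: "co x a \<in> carrier Q" "co y a \<in> carrier Q" for a using F(1)[OF co(1)[OF x]] F(1)[OF co(1)[OF y]] by auto
  have sc: "(\<Oplus>a\<in>{..<m}. co x a \<otimes> cc a b l) \<in> carrier Q" if "b < m" for b
    by (rule finsum_closed) (use that c F(1)[OF cc_F] in auto)
  have "x \<otimes> y = x \<otimes> (\<Oplus>b\<in>{..<m}. co y b \<otimes> e b)" using co(2)[OF y] by simp
  also have "\<dots> = (\<Oplus>b\<in>{..<m}. x \<otimes> (co y b \<otimes> e b))"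
    by (subst finsum_rdistr) (use c e_closed x in auto)
  also have "\<dots> = (\<Oplus>b\<in>{..<m}. co y b \<otimes> (x \<otimes> e b))"
    by (rule finsum_cong') (use c e_closed x F(2)[OF co(1)[OF y] x] in \<open>auto simp: m_assoc[symmetric]\<close>)
  finally have "co (x \<otimes> y) l = (\<Oplus>b\<in>{..<m}. co (co y b \<otimes> (x \<otimes> e b)) l)"
    by (simp only:, intro co_sum l m_closed c e_closed x) auto
  also have "\<dots> = (\<Oplus>b\<in>{..<m}. co y b \<otimes> (\<Oplus>a\<in>{..<m}. co x a \<otimes> cc a b l))"
    by (rule finsum_cong') (use c e_closed l x y sc in \<open>auto simp: co_smult[OF co(1)] co_mult_right\<close>)
  finally show ?thesis .
qed

lemma co_mult_left: assumes y: "y \<in> carrier Q" and a: "a < m" and l: "l < m"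
  shows "co (e a \<otimes> y) l = (\<Oplus>b\<in>{..<m}. co y b \<otimes> cc a b l)"
proof -
  have c: "co y b \<in> carrier Q" for b using F(1)[OF co(1)[OF y]] by auto
  have "(\<Oplus>a'\<in>{..<m}. co (e a) a' \<otimes> cc a' b l) = cc a b l" if b: "b < m" for b
    using co_mult_right[OF e_closed[OF a] b l] by (simp add: cc_def)
  then show ?thesis
    unfolding co_mult[OF e_closed[OF a] y l]
    by (intro finsum_cong') (use c a l F(1)[OF cc_F] in auto)
qed

definition "Z0 = (\<lambda>(a, b, l). cc a b l) ` ({..<m} \<times> {..<m} \<times> {..<m}) \<union> uu ` {..<m}
   \<union> (\<lambda>(p, q, a, b). ww p q a b) ` ({..<m} \<times> {..<m} \<times> {..<m} \<times> {..<m})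
   \<union> (\<lambda>(l, a). co (\<iota> (r l)) a) ` ({..<L} \<times> {..<m})"

lemma Z0_fin: "finite Z0" by (simp add: Z0_def)

lemma Z0_mem: "a < m \<Longrightarrow> b < m \<Longrightarrow> l < m \<Longrightarrow> cc a b l \<in> Z0" "a < m \<Longrightarrow> uu a \<in> Z0"
  "p < m \<Longrightarrow> q < m \<Longrightarrow> a < m \<Longrightarrow> b < m \<Longrightarrow> ww p q a b \<in> Z0" "i < L \<Longrightarrow> a < m \<Longrightarrow> co (\<iota> (r i)) a \<in> Z0"
proof -
  assume "a < m"
  then show "uu a \<in> Z0" unfolding Z0_def by blast
  show "b < m \<Longrightarrow> l < m \<Longrightarrow> cc a b l \<in> Z0"
    unfolding Z0_def using \<open>a < m\<close> by (intro UnI1 image_eqI[of _ _ "(a, b, l)"]) auto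
  show "p < m \<Longrightarrow> q < m \<Longrightarrow> b < m \<Longrightarrow> ww p q a b \<in> Z0"
    unfolding Z0_def using \<open>a < m\<close> by (intro UnI1 UnI2[of _ "(\<lambda>(p, q, a, b). ww p q a b) ` _"] image_eqI[of _ _ "(p, q, a, b)"]) auto
  show "i < L \<Longrightarrow> co (\<iota> (r i)) a \<in> Z0"
    unfolding Z0_def using \<open>a < m\<close> by (intro UnI2[of _ "(\<lambda>(l, a). co (\<iota> (r l)) a) ` _"] image_eqI[of _ _ "(i, a)"]) auto
qed

lemma \<iota>_closed: "x \<in> carrier R \<Longrightarrow> \<iota> x \<in> carrier Q" by (rule fr.\<iota>_hom)

lemma Z0_F: "Z0 \<subseteq> F"
  unfolding Z0_def by (auto simp: cc_F uu_F ww intro!: co \<iota>_closed r)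

abbreviation "pc p \<equiv> \<lambda>a b l. p (Inl (cc a b l))"
abbreviation "pu p \<equiv> \<lambda>a. p (Inl (uu a))"
abbreviation "pw p \<equiv> \<lambda>i j a b. p (Inl (ww i j a b))"

context
  fixes Z p
  assumes Z: "Z0 \<subseteq> Z" "Z \<subseteq> F" and p: "center_pt Z p"
begin

lemma Zmem: "a < m \<Longrightarrow> b < m \<Longrightarrow> l < m \<Longrightarrow> cc a b l \<in> zring Z" "a < m \<Longrightarrow> uu a \<in> zring Z"
  "i < m \<Longrightarrow> j < m \<Longrightarrow> a < m \<Longrightarrow> b < m \<Longrightarrow> ww i j a b \<in> zring Z"
  by (intro zring(6)[OF Z(2)] subsetD[OF Z(1)] Z0_mem; assumption)+

lemma spec_c: "a < m \<Longrightarrow> b < m \<Longrightarrow> l < m \<Longrightarrow> p (Inl (cc a b l)) = spec Z p (cc a b l)" "a < m \<Longrightarrow> p (Inl (uu a)) = spec Z p (uu a)"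
  "i < m \<Longrightarrow> j < m \<Longrightarrow> a < m \<Longrightarrow> b < m \<Longrightarrow> p (Inl (ww i j a b)) = spec Z p (ww i j a b)"
  by (intro spec_var[OF p Z(2), symmetric] subsetD[OF Z(1)] Z0_mem; assumption)+

lemma sb2: assumes "\<And>i. i < m \<Longrightarrow> f i \<in> zring Z" "\<And>i. i < m \<Longrightarrow> g i \<in> zring Z"
  shows "spec Z p (\<Oplus>i\<in>{..<m}. f i \<otimes> g i) = (\<Sum>i<m. spec Z p (f i) * spec Z p (g i))"
  using assms by (subst spec_sum[OF p]) (auto simp: spec_mult[OF p] intro!: zring(2))

text \<open>All conditions are equations between constants that hold in \<open>F\<close>.\<close>

lemma struct_alg_point: "struct_alg m (pc p) (pu p) (pw p)"
  unfolding struct_alg_def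
proof (intro conjI allI impI)
  fix a b d l assume h: "a < m" "b < m" "d < m" "l < m"
  have ab: "e a \<otimes> e b \<in> carrier Q" "e b \<otimes> e d \<in> carrier Q" using e_closed h by auto
  have "(\<Oplus>i\<in>{..<m}. cc a b i \<otimes> cc i d l) = co (e a \<otimes> e b \<otimes> e d) l"
    using co_mult_right[OF ab(1) h(3,4)] by (simp add: cc_def)
  also have "\<dots> = (\<Oplus>i\<in>{..<m}. cc b d i \<otimes> cc a i l)"
    using co_mult_left[OF ab(2) h(1,4)] h e_closed by (simp add: cc_def m_assoc)
  finally have "spec Z p (\<Oplus>i\<in>{..<m}. cc a b i \<otimes> cc i d l) = spec Z p (\<Oplus>i\<in>{..<m}. cc b d i \<otimes> cc a i l)" by simp
  then show "(\<Sum>i<m. p (Inl (cc a b i)) * p (Inl (cc i d l))) = (\<Sum>i<m. p (Inl (cc b d i)) * p (Inl (cc a i l)))"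
    using h by (simp add: sb2 Zmem spec_c)
next
  fix a l assume h: "a < m" "l < m"
  have 1: "(\<Oplus>i\<in>{..<m}. uu i \<otimes> cc i a l) = (if a = l then \<one> else \<zero>)"
    using co_mult_right[OF one_closed h] h e_closed by (simp add: uu_def co_e)
  have "(\<Sum>i<m. p (Inl (uu i)) * p (Inl (cc i a l))) = spec Z p (\<Oplus>i\<in>{..<m}. uu i \<otimes> cc i a l)"
    using h by (simp add: sb2 Zmem spec_c)
  then show "(\<Sum>i<m. p (Inl (uu i)) * p (Inl (cc i a l))) = (if a = l then 1 else 0)"
    unfolding 1 by (simp add: spec_one[OF p] spec_zero[OF p])
  have 1: "(\<Oplus>i\<in>{..<m}. uu i \<otimes> cc a i l) = (if a = l then \<one> else \<zero>)"
    using co_mult_left[OF one_closed h] h e_closed by (simp add: uu_def co_e)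
  have "(\<Sum>i<m. p (Inl (uu i)) * p (Inl (cc a i l))) = spec Z p (\<Oplus>i\<in>{..<m}. uu i \<otimes> cc a i l)"
    using h by (simp add: sb2 Zmem spec_c)
  then show "(\<Sum>i<m. p (Inl (uu i)) * p (Inl (cc a i l))) = (if a = l then 1 else 0)"
    unfolding 1 by (simp add: spec_one[OF p] spec_zero[OF p])
next
  fix i j x l assume h: "i < m" "j < m" "x < m" "l < m"
  have c: "e a \<otimes> e x \<otimes> e b \<in> carrier Q" if "a < m" "b < m" for a b using that h e_closed by simp
  have cw: "ww i j a b \<in> carrier Q" for a b using ww(1) F(1) by blast
  have "(\<Oplus>a\<in>{..<m}. \<Oplus>b\<in>{..<m}. ww i j a b \<otimes> (\<Oplus>q\<in>{..<m}. cc a x q \<otimes> cc q b l))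
     = (\<Oplus>a\<in>{..<m}. \<Oplus>b\<in>{..<m}. co (ww i j a b \<otimes> (e a \<otimes> e x \<otimes> e b)) l)"
  proof (intro finsum_cong')
    fix a b assume ab: "a \<in> {..<m}" "b \<in> {..<m}"
    have "e a \<otimes> e x \<in> carrier Q" using ab h e_closed by simp
    from co_mult_right[OF this, of b l] show "ww i j a b \<otimes> (\<Oplus>q\<in>{..<m}. cc a x q \<otimes> cc q b l) = co (ww i j a b \<otimes> (e a \<otimes> e x \<otimes> e b)) l"
      using ab h c by (simp add: co_smult[OF ww(1)] cc_def)
  qed (use c cw in \<open>auto intro!: F(1)[OF co(1)] finsum_closed\<close>)
  also have "\<dots> = (\<Oplus>a\<in>{..<m}. co (\<Oplus>b\<in>{..<m}. ww i j a b \<otimes> (e a \<otimes> e x \<otimes> e b)) l)"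
    by (intro finsum_cong' co_sum[symmetric]) (use c cw h in \<open>auto intro!: F(1)[OF co(1)] finsum_closed\<close>)
  also have "\<dots> = co (\<Oplus>a\<in>{..<m}. \<Oplus>b\<in>{..<m}. ww i j a b \<otimes> (e a \<otimes> e x \<otimes> e b)) l"
    by (intro co_sum[symmetric]) (use c cw h in \<open>auto intro!: finsum_closed\<close>)
  also have "\<dots> = (if x = j \<and> l = i then \<one> else \<zero>)"
    using h by (simp add: ww co_e co_zero)
  finally have eq: "(\<Oplus>a\<in>{..<m}. \<Oplus>b\<in>{..<m}. ww i j a b \<otimes> (\<Oplus>q\<in>{..<m}. cc a x q \<otimes> cc q b l)) = (if x = j \<and> l = i then \<one> else \<zero>)" .
  have "(\<Sum>a<m. \<Sum>b<m. p (Inl (ww i j a b)) * (\<Sum>q<m. p (Inl (cc a x q)) * p (Inl (cc q b l))))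
    = spec Z p (\<Oplus>a\<in>{..<m}. \<Oplus>b\<in>{..<m}. ww i j a b \<otimes> (\<Oplus>q\<in>{..<m}. cc a x q \<otimes> cc q b l))"
  proof -
    have q: "(\<Oplus>q\<in>{..<m}. cc a x q \<otimes> cc q b l) \<in> zring Z" if "a < m" "b < m" for a b
      by (intro zring_sum zring(2) Zmem) (use h that in auto)
    have "(\<Oplus>b\<in>{..<m}. ww i j a b \<otimes> (\<Oplus>q\<in>{..<m}. cc a x q \<otimes> cc q b l)) \<in> zring Z" if "a < m" for a
      by (intro zring_sum zring(2) Zmem q) (use h that in auto)
    then show ?thesis using h q by (subst spec_sum[OF p]) (auto simp: sb2 Zmem spec_c)
  qed
  then show "(\<Sum>a<m. \<Sum>b<m. p (Inl (ww i j a b)) * (\<Sum>q<m. p (Inl (cc a x q)) * p (Inl (cc q b l)))) = (if x = j \<and> l = i then 1 else 0)"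
    unfolding eq by (simp add: spec_one[OF p] spec_zero[OF p])
qed

end

text \<open>The order spanned by the basis over the constants \<open>Z\<close>, and the extension of a representation of its
  basis.\<close>

definition "Lam Z = {x \<in> carrier Q. \<forall>a<m. co x a \<in> zring Z}"
definition "rentry Z p v x i j = (\<Sum>a<m. spec Z p (co x a) * v a i j)"

lemma Lam_carrier: "x \<in> Lam Z \<Longrightarrow> x \<in> carrier Q" by (simp add: Lam_def)

lemma Lam_add: "x \<in> Lam Z \<Longrightarrow> y \<in> Lam Z \<Longrightarrow> x \<oplus> y \<in> Lam Z"
  by (simp add: Lam_def co_add zring)

lemma Lam_smult: "z \<in> zring Z \<Longrightarrow> x \<in> Lam Z \<Longrightarrow> z \<otimes> x \<in> Lam Z"
  using zring_F F(1) by (simp add: Lam_def co_smult zring)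

lemma Lam_e: "a < m \<Longrightarrow> e a \<in> Lam Z"
  using e_closed by (simp add: Lam_def co_e zring)

lemma Lam_mult: assumes "Z0 \<subseteq> Z" "Z \<subseteq> F" "x \<in> Lam Z" "y \<in> Lam Z" shows "x \<otimes> y \<in> Lam Z"
proof -
  have "co (x \<otimes> y) l \<in> zring Z" if l: "l < m" for l
  proof -
    have "cc a b l \<in> zring Z" if "a < m" "b < m" for a b
      by (intro zring(6)[OF assms(2)] subsetD[OF assms(1)] Z0_mem that l)
    moreover have "co x a \<in> zring Z" "co y a \<in> zring Z" if "a < m" for a using assms that by (auto simp: Lam_def)
    ultimately show ?thesis
      unfolding co_mult[OF Lam_carrier[OF assms(3)] Lam_carrier[OF assms(4)] l] by (intro zring_sum zring(2)) auto
  qed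
  then show ?thesis using assms by (simp add: Lam_def)
qed

lemma Lam_one: assumes "Z0 \<subseteq> Z" "Z \<subseteq> F" shows "\<one> \<in> Lam Z"
  unfolding Lam_def using zring(6)[OF assms(2) subsetD[OF assms(1) Z0_mem(2)]] by (auto simp: uu_def)

lemma Lam_sum: "(\<And>i. i \<in> A \<Longrightarrow> f i \<in> Lam Z) \<Longrightarrow> (\<Oplus>i\<in>A. f i) \<in> Lam Z"
proof -
  assume L: "\<And>i. i \<in> A \<Longrightarrow> f i \<in> Lam Z"
  then have c: "f i \<in> carrier Q" "a < m \<Longrightarrow> co (f i) a \<in> zring Z" if "i \<in> A" for i a using that by (auto simp: Lam_def)
  have "(\<Oplus>i\<in>A. f i) \<in> carrier Q" using c by (auto intro!: finsum_closed)
  moreover have "co (\<Oplus>i\<in>A. f i) a \<in> zring Z" if "a < m" for a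
    using co_sum[of A f a] c(1) that zring_sum[of A "\<lambda>i. co (f i) a" Z] c(2) by simp
  ultimately show ?thesis by (simp add: Lam_def)
qed

text \<open>The order is a subalgebra that contains the generators of \<open>R\<close>.\<close>

lemma \<iota>_Lam: assumes "x \<in> carrier R" shows "\<iota> x \<in> Lam Z0"
proof -
  let ?T = "{x \<in> carrier R. \<iota> x \<in> Lam Z0}"
  note Z = subset_refl[of Z0] Z0_F
  have "?T = carrier R"
  proof (rule gen)
    have sm: "\<iota> (c \<odot>\<^bsub>R\<^esub> x) \<in> Lam Z0" if "x \<in> ?T" for c x
      using that by (simp add: \<kappa>_smult Lam_smult zring)
    show "subring ?T R"
    proof (rule fr.R.subringI)
      show "\<one>\<^bsub>R\<^esub> \<in> ?T" using Lam_one[OF Z] by (simp add: fr.\<iota>_hom)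
      show "\<ominus>\<^bsub>R\<^esub> h \<in> ?T" if "h \<in> ?T" for h using that sm[OF that, of "- 1"] uminus_R by simp
      show "h1 \<otimes>\<^bsub>R\<^esub> h2 \<in> ?T" if "h1 \<in> ?T" "h2 \<in> ?T" for h1 h2 using that Lam_mult[OF Z] by (simp add: fr.\<iota>_hom)
      show "h1 \<oplus>\<^bsub>R\<^esub> h2 \<in> ?T" if "h1 \<in> ?T" "h2 \<in> ?T" for h1 h2 using that Lam_add by (simp add: fr.\<iota>_hom)
    qed auto
    have z: "\<iota> \<zero>\<^bsub>R\<^esub> \<in> Lam Z0" using sm[of "\<one>\<^bsub>R\<^esub>" 0] Lam_one[OF Z] VR.smult_l_null[of "\<one>\<^bsub>R\<^esub>"] by (simp add: fr.\<iota>_hom)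
    show "submodule (class_ring :: 'k ring) ?T R"
      by unfold_locales (use sm z in \<open>auto simp: fr.\<iota>_hom Lam_add smult_R\<close>)
    show "r ` {..<L} \<subseteq> ?T"
      using r \<iota>_closed zring(6)[OF Z0_F Z0_mem(4)] by (auto simp: Lam_def)
  qed
  then show ?thesis using assms by blast
qed

context
  fixes Z p v
  assumes Z: "Z0 \<subseteq> Z" "Z \<subseteq> F" and p: "center_pt Z p" and v: "struct_rep m (pc p) (pu p) n v"
begin

lemma rentry_add: "x \<in> Lam Z \<Longrightarrow> y \<in> Lam Z \<Longrightarrow> rentry Z p v (x \<oplus> y) i j = rentry Z p v x i j + rentry Z p v y i j"
  by (simp add: rentry_def Lam_def co_add spec_add[OF p] algebra_simps sum.distrib)

lemma rentry_smult: "z \<in> zring Z \<Longrightarrow> x \<in> Lam Z \<Longrightarrow> rentry Z p v (z \<otimes> x) i j = spec Z p z * rentry Z p v x i j"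
  using zring_F by (simp add: rentry_def Lam_def co_smult spec_mult[OF p] sum_distrib_left mult.assoc)

lemma rentry_one: "i < n \<Longrightarrow> j < n \<Longrightarrow> rentry Z p v \<one> i j = (if i = j then 1 else 0)"
  using v by (simp add: rentry_def struct_rep_def spec_c[OF Z p] flip: uu_def)

lemma rentry_mult: assumes "x \<in> Lam Z" "y \<in> Lam Z" "i < n" "j < n"
  shows "rentry Z p v (x \<otimes> y) i j = (\<Sum>l<n. rentry Z p v x i l * rentry Z p v y l j)"
proof -
  let ?s = "spec Z p"
  have c: "spec Z p (co (x \<otimes> y) l) = (\<Sum>b<m. \<Sum>a<m. ?s (co x a) * ?s (co y b) * pc p a b l)" if l: "l < m" for l
  proof -
    have "spec Z p (co (x \<otimes> y) l) = (\<Sum>b<m. ?s (co y b) * (\<Sum>a<m. ?s (co x a) * ?s (cc a b l)))"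
    proof -
      have xy: "co x a \<in> zring Z" "co y a \<in> zring Z" if "a < m" for a using assms that by (auto simp: Lam_def)
      have "(\<Oplus>a\<in>{..<m}. co x a \<otimes> cc a b l) \<in> zring Z" if "b < m" for b
        by (intro zring_sum zring(2) xy Zmem[OF Z p]) (use l that in auto)
      then show ?thesis using l unfolding co_mult[OF Lam_carrier[OF assms(1)] Lam_carrier[OF assms(2)] l]
        by (simp add: sb2[OF Z p] xy Zmem[OF Z p])
    qed
    also have "\<dots> = (\<Sum>b<m. \<Sum>a<m. ?s (co x a) * ?s (co y b) * pc p a b l)"
      using l by (intro sum.cong refl) (simp add: sum_distrib_left mult_ac spec_c[OF Z p])
    finally show ?thesis .
  qed
  have "rentry Z p v (x \<otimes> y) i j = (\<Sum>l<m. \<Sum>b<m. \<Sum>a<m. ?s (co x a) * ?s (co y b) * (pc p a b l * v l i j))"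
    by (simp add: rentry_def c sum_distrib_right mult.assoc)
  also have "\<dots> = (\<Sum>b<m. \<Sum>a<m. \<Sum>l<m. ?s (co x a) * ?s (co y b) * (pc p a b l * v l i j))"
    by (rule sum_rot3)
  also have "\<dots> = (\<Sum>b<m. \<Sum>a<m. ?s (co x a) * ?s (co y b) * (\<Sum>l<n. v a i l * v b l j))"
    using v assms(3,4) by (intro sum.cong refl) (simp add: struct_rep_def flip: sum_distrib_left)
  also have "\<dots> = (\<Sum>b<m. \<Sum>a<m. \<Sum>l<n. (?s (co x a) * v a i l) * (?s (co y b) * v b l j))"
    by (simp only: sum_distrib_left, simp only: mult_ac)
  also have "\<dots> = (\<Sum>l<n. \<Sum>b<m. \<Sum>a<m. (?s (co x a) * v a i l) * (?s (co y b) * v b l j))"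
    by (rule sum_rot3[symmetric])
  also have "\<dots> = (\<Sum>l<n. rentry Z p v x i l * rentry Z p v y l j)"
    by (intro sum.cong refl, subst sum.swap) (simp add: rentry_def sum_product)
  finally show ?thesis .
qed

lemma rentry_sum: "(\<And>a. a \<in> A \<Longrightarrow> f a \<in> Lam Z) \<Longrightarrow> rentry Z p v (\<Oplus>a\<in>A. f a) i j = (\<Sum>a\<in>A. rentry Z p v (f a) i j)"
proof (induct A rule: infinite_finite_induct)
  case (insert x G)
  then show ?case using Lam_carrier by (subst finsum_insert) (auto simp: rentry_add Lam_sum)
qed (simp_all add: rentry_def co_zero spec_zero[OF p])

lemma rentry_nonzero:
  assumes x: "x \<in> Lam Z" and a: "a < m" "spec Z p (co x a) \<noteq> 0"
  shows "\<exists>i<n. \<exists>j<n. rentry Z p v x i j \<noteq> 0"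
proof (rule ccontr)
  assume no: "\<not> ?thesis"
  have t0: "rentry Z p v x i j = 0" if "i < n" "j < n" for i j
    by (rule ccontr) (use no that in blast)
  have "(\<Sum>a<m. spec Z p (co x a) * v a i j) = 0" if "i < n" "j < n" for i j
    using t0[OF that] by (simp only: rentry_def)
  then have "spec Z p (co x a) = 0"
    using struct_rep_indep[OF struct_alg_point[OF Z p] m_pos v n_pos, of "\<lambda>a. spec Z p (co x a)" a] a(1) by blast
  then show False using a(2) by simp
qed

end

end

section \<open>An irreducible family of representations\<close>

text \<open>Both representations are conjugate to the one of \<open>struct_rep_exists_unique\<close>.\<close>

lemma struct_rep_conj:
  fixes v v' :: "nat \<Rightarrow> nat \<Rightarrow> nat \<Rightarrow> 'k::{alg_closed_field, field_char_0}"
  assumes sa: "struct_alg m c u w" "m > 0" "m = n * n" and v: "struct_rep m c u n v" and v': "struct_rep m c u n v'"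
  shows "\<exists>W. W \<in> carrier_mat n n \<and> det W \<noteq> 0 \<and>
    (\<forall>a<m. Matrix.mat n n (\<lambda>(i, j). v' a i j) = conj_mat W (Matrix.mat n n (\<lambda>(i, j). v a i j)))"
proof -
  define M where "M z a = Matrix.mat n n (\<lambda>(i, j). z a i j)" for z :: "nat \<Rightarrow> nat \<Rightarrow> nat \<Rightarrow> 'k" and a
  have M: "M z a \<in> carrier_mat n n" for z a by (simp add: M_def)
  obtain V where V: "\<And>z. struct_rep m c u n z \<Longrightarrow> \<exists>Y. det Y \<noteq> 0 \<and> Y \<in> carrier_mat n n \<and>
       (\<forall>a<m. \<forall>i<n. \<forall>j<n. (\<Sum>l<n. z a i l * Y $$ (l, j)) = (\<Sum>l<n. Y $$ (i, l) * V a l j))"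
    using struct_rep_exists_unique[OF sa] by blast
  have *: "\<exists>Y. Y \<in> carrier_mat n n \<and> det Y \<noteq> 0 \<and> (\<forall>a<m. M z a = conj_mat Y (M V a))" if z: "struct_rep m c u n z" for z
  proof -
    obtain Y where Y: "Y \<in> carrier_mat n n" "det Y \<noteq> 0"
      and eq: "\<And>a i j. a < m \<Longrightarrow> i < n \<Longrightarrow> j < n \<Longrightarrow> (\<Sum>l<n. z a i l * Y $$ (l, j)) = (\<Sum>l<n. Y $$ (i, l) * V a l j)"
      using V[OF z] by blast
    have "M z a = conj_mat Y (M V a)" if a: "a < m" for a
    proof (rule conj_unique[OF Y M M], rule eq_matI)
      show "(M z a * Y) $$ (i, j) = (Y * M V a) $$ (i, j)" if "i < dim_row (Y * M V a)" "j < dim_col (Y * M V a)" for i j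
        using that Y eq[OF a, of i j] by (simp add: M_def scalar_prod_def atLeast0LessThan)
    qed (use Y in \<open>auto simp: M_def\<close>)
    then show ?thesis using Y by blast
  qed
  obtain Y where Y: "Y \<in> carrier_mat n n" "det Y \<noteq> 0" "\<And>a. a < m \<Longrightarrow> M v a = conj_mat Y (M V a)" using *[OF v] by blast
  obtain Y' where Y': "Y' \<in> carrier_mat n n" "det Y' \<noteq> 0" "\<And>a. a < m \<Longrightarrow> M v' a = conj_mat Y' (M V a)" using *[OF v'] by blast
  obtain X where X: "X \<in> carrier_mat n n" "det X \<noteq> 0" "\<And>B. B \<in> carrier_mat n n \<Longrightarrow> conj_mat X (conj_mat Y B) = B"
    using conj_inverse[OF Y(1,2)] by blast
  have "M v' a = conj_mat (Y' * X) (M v a)" if "a < m" for a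
    using conj_conj[OF X(1,2) Y'(1,2) M[of v a]] X(3)[OF M[of V a]] Y(3)[OF that] Y'(3)[OF that] by simp
  moreover have "Y' * X \<in> carrier_mat n n" "det (Y' * X) \<noteq> 0" using X Y' det_mult[OF Y'(1) X(1)] by auto
  ultimately show ?thesis unfolding M_def by blast
qed

lemma conj_one_mat:
  fixes B :: "'k::field mat"
  assumes "B \<in> carrier_mat n n" shows "conj_mat (1\<^sub>m n) B = B"
  by (rule conj_unique[symmetric]) (use assms in auto)

context pi_setup
begin

definition "entry_vars = {..<m} \<times> {..<n} \<times> {..<n}"
definition "rep_vars Z = Inl ` Z \<union> Inr ` entry_vars"
definition "is_rep_pt p \<longleftrightarrow> struct_rep m (pc p) (pu p) n (\<lambda>a i j. p (Inr (a, i, j)))" for p :: "'q + nat \<times> nat \<times> nat \<Rightarrow> 'k"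
text \<open>A polynomial belongs to this ideal if it vanishes at all representations over a nonempty open set of
  points of the center: it is a relation of the generic representation. The set of constants on which the
  representation is defined may grow with the polynomial.\<close>

definition "rep_ideal = {f. \<exists>Z a. finite Z \<and> Z \<subseteq> F \<and> a \<in> alg_gen (Inl ` F) - cideal \<and>
   (\<forall>p. center_pt Z p \<longrightarrow> is_rep_pt p \<longrightarrow> evk p a \<noteq> 0 \<longrightarrow> evk p f = 0)}"
definition "nz_consts = alg_gen (Inl ` F) - cideal"

lemma rep_ideal_I: "finite Z \<Longrightarrow> Z \<subseteq> F \<Longrightarrow> a \<in> alg_gen (Inl ` F) \<Longrightarrow> a \<notin> cideal \<Longrightarrow>
   (\<And>p. center_pt Z p \<Longrightarrow> is_rep_pt p \<Longrightarrow> evk p a \<noteq> 0 \<Longrightarrow> evk p f = 0) \<Longrightarrow> f \<in> rep_ideal"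
  unfolding rep_ideal_def by blast

lemma rep_ideal_E:
  assumes "f \<in> rep_ideal"
  obtains Z a where "finite Z" "Z \<subseteq> F" "a \<in> alg_gen (Inl ` F)" "a \<notin> cideal"
    "\<And>p. center_pt Z p \<Longrightarrow> is_rep_pt p \<Longrightarrow> evk p a \<noteq> 0 \<Longrightarrow> evk p f = 0"
  using assms unfolding rep_ideal_def mem_Collect_eq by (elim exE conjE DiffE) metis

lemma center_pt_mono: "center_pt Z p \<Longrightarrow> Z' \<subseteq> Z \<Longrightarrow> center_pt Z' p"
  unfolding center_pt_def by (erule kpoint_mono) auto

lemma finite_constants:
  assumes "f \<in> alg_gen (Inl ` F)"
  shows "\<exists>Z. finite Z \<and> Z \<subseteq> F \<and> f \<in> alg_gen (Inl ` Z)"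
proof -
  obtain V where V: "finite V" "V \<subseteq> Inl ` F" "f \<in> alg_gen V" using alg_gen_finite_support[OF assms] by blast
  then obtain Z where "Z \<subseteq> F" "finite Z" "V = Inl ` Z" by (meson finite_subset_image)
  then show ?thesis using V by blast
qed

text \<open>A nonzero function of the constants is nonzero at some point, and over every point a representation
  exists.\<close>

lemma rep_ideal_disjoint: "rep_ideal \<inter> nz_consts = {}"
proof (rule ccontr)
  assume "\<not> ?thesis"
  then obtain f where f: "f \<in> rep_ideal" "f \<in> alg_gen (Inl ` F)" "f \<notin> cideal" by (auto simp: nz_consts_def)
  then obtain Z a where Z: "finite Z" "Z \<subseteq> F" and a: "a \<in> alg_gen (Inl ` F)" "a \<notin> cideal"
    and imp: "\<And>p. center_pt Z p \<Longrightarrow> is_rep_pt p \<Longrightarrow> evk p a \<noteq> 0 \<Longrightarrow> evk p f = 0" using rep_ideal_E[OF f(1)] by metis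
  have af: "a * f \<in> alg_gen (Inl ` F)" using a f by (intro alg_gen.mult)
  have af': "a * f \<notin> cideal" using a f primD(6)[OF prime_set_PF] by blast
  obtain Zf where Zf: "finite Zf" "Zf \<subseteq> F" "a * f \<in> alg_gen (Inl ` Zf)" using finite_constants[OF af] by blast
  define Y where "Y = Z \<union> Zf \<union> Z0"
  have Y: "finite Y" "Y \<subseteq> F" using Z Zf Z0_fin Z0_F by (auto simp: Y_def)
  have "a * f \<in> alg_gen (Inl ` Y)" by (rule alg_gen_mono[OF Zf(3)]) (auto simp: Y_def)
  then obtain p :: "'q + nat \<times> nat \<times> nat \<Rightarrow> 'k" where p: "kpoint (Inl ` Y) cideal p" "evk p (a * f) \<noteq> 0"
    using nullstellensatz[OF prime_set_PF _ _ af'] Y(1) by blast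
  have pY: "center_pt Y p" using p by (simp add: center_pt_def)
  have sa: "struct_alg m (pc p) (pu p) (pw p)" by (rule struct_alg_point[OF _ Y(2) pY]) (auto simp: Y_def)
  obtain v where v: "struct_rep m (pc p) (pu p) n v" using struct_rep_exists_unique[OF sa m_pos mn] by blast
  define p' where "p' = (\<lambda>i. case i of Inl q \<Rightarrow> p (Inl q) | Inr (a, i, j) \<Rightarrow> v a i j)"
  have ev: "evk p' g = evk p g" if "g \<in> alg_gen (Inl ` F)" for g
    by (rule evk_cong[OF that]) (auto simp: p'_def)
  have "center_pt Y p'" unfolding center_pt_def kpoint_def
  proof
    fix g :: "('q + nat \<times> nat \<times> nat, 'k) mpol" assume g: "g \<in> alg_gen (Inl ` Y) \<inter> cideal"
    then have "g \<in> alg_gen (Inl ` F)" using Y(2) alg_gen_mono[of g "Inl ` Y" "Inl ` F"] by blast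
    then show "evk p' g = 0" using ev p(1) g by (auto simp: kpoint_def)
  qed
  then have "center_pt Z p'" by (rule center_pt_mono) (auto simp: Y_def)
  moreover have "is_rep_pt p'" using v by (simp add: is_rep_pt_def p'_def)
  moreover have "evk p' a \<noteq> 0" using ev[OF a(1)] p(2) by auto
  ultimately have "evk p' f = 0" by (rule imp)
  then show False using ev[OF f(2)] p(2) by simp
qed

text \<open>A component of the family of representations that dominates the center.\<close>

definition "rep_prime = (SOME P. prime_set P \<and> rep_ideal \<subseteq> P \<and> P \<inter> nz_consts = {})"

lemma rep_prime: "prime_set rep_prime" "f \<in> rep_ideal \<Longrightarrow> f \<in> rep_prime" "f \<in> alg_gen (Inl ` F) \<Longrightarrow> f \<in> rep_prime \<longleftrightarrow> evF f = \<zero>"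
proof -
  have "\<exists>P. prime_set P \<and> rep_ideal \<subseteq> P \<and> P \<inter> nz_consts = {}"
  proof (rule prime_avoiding)
    have 1: "(1 :: ('q + nat \<times> nat \<times> nat, 'k) mpol) \<notin> cideal" using prime_set_PF by (simp add: prime_set_def)
    show "0 \<in> rep_ideal" by (rule rep_ideal_I[of "{}" 1]) (use 1 alg_gen_1 in auto)
    show "a + b \<in> rep_ideal" if ab: "a \<in> rep_ideal" "b \<in> rep_ideal" for a b
    proof -
      obtain Z x where Z: "finite Z" "Z \<subseteq> F" and x: "x \<in> alg_gen (Inl ` F)" "x \<notin> cideal"
        and xi: "\<And>p. center_pt Z p \<Longrightarrow> is_rep_pt p \<Longrightarrow> evk p x \<noteq> 0 \<Longrightarrow> evk p a = 0" using rep_ideal_E[OF ab(1)] by metis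
      obtain Z' x' where Z': "finite Z'" "Z' \<subseteq> F" and x': "x' \<in> alg_gen (Inl ` F)" "x' \<notin> cideal"
        and xi': "\<And>p. center_pt Z' p \<Longrightarrow> is_rep_pt p \<Longrightarrow> evk p x' \<noteq> 0 \<Longrightarrow> evk p b = 0" using rep_ideal_E[OF ab(2)] by metis
      show ?thesis
      proof (rule rep_ideal_I[of "Z \<union> Z'" "x * x'"])
        show "x * x' \<notin> cideal" using x x' primD(6)[OF prime_set_PF] by blast
        fix p assume "center_pt (Z \<union> Z') p" and r: "is_rep_pt p" "evk p (x * x') \<noteq> 0"
        then have "center_pt Z p" "center_pt Z' p" using center_pt_mono by blast+
        then show "evk p (a + b) = 0" using xi xi' r by simp
      qed (use Z Z' x x' alg_gen.mult in auto)
    qed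
    show "t * a \<in> rep_ideal" if "a \<in> rep_ideal" for a t using that unfolding rep_ideal_def by auto
    show "1 \<in> nz_consts" using 1 alg_gen_1 by (simp add: nz_consts_def)
    show "a * b \<in> nz_consts" if "a \<in> nz_consts" "b \<in> nz_consts" for a b using that alg_gen.mult primD(6)[OF prime_set_PF, of a b] by (auto simp: nz_consts_def)
    show "rep_ideal \<inter> nz_consts = {}" by (rule rep_ideal_disjoint)
  qed
  from someI_ex[OF this] have P: "prime_set rep_prime" "rep_ideal \<subseteq> rep_prime" "rep_prime \<inter> nz_consts = {}" by (simp_all add: rep_prime_def)
  show "prime_set rep_prime" by (rule P)
  show J: "f \<in> rep_ideal \<Longrightarrow> f \<in> rep_prime" for f using P by blast
  assume f: "f \<in> alg_gen (Inl ` F)"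
  show "f \<in> rep_prime \<longleftrightarrow> evF f = \<zero>"
  proof
    assume "f \<in> rep_prime" then show "evF f = \<zero>" using P(3) f by (auto simp: nz_consts_def cideal_def)
  next
    assume f0: "evF f = \<zero>"
    obtain Z where Z: "finite Z" "Z \<subseteq> F" "f \<in> alg_gen (Inl ` Z)" using finite_constants[OF f] by blast
    show "f \<in> rep_prime"
    proof (rule J, rule rep_ideal_I[of Z 1])
      fix p assume "center_pt Z p"
      then show "evk p f = 0" using Z(3) f0 by (auto simp: center_pt_def kpoint_def cideal_def)
    qed (use Z alg_gen_1 primD(2)[OF prime_set_PF] in auto)
  qed
qed

definition "rep_pt Z p \<longleftrightarrow> kpoint (rep_vars Z) rep_prime p"

lemma rep_pt_mono: "rep_pt Z p \<Longrightarrow> Z' \<subseteq> Z \<Longrightarrow> rep_pt Z' p"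
  unfolding rep_pt_def by (erule kpoint_mono) (auto simp: rep_vars_def)

lemma rep_pt_pt: assumes "rep_pt Z p" "Z \<subseteq> F" shows "center_pt Z p"
  unfolding center_pt_def kpoint_def
proof
  fix g :: "('q + nat \<times> nat \<times> nat, 'k) mpol" assume g: "g \<in> alg_gen (Inl ` Z) \<inter> cideal"
  then have "g \<in> alg_gen (Inl ` F)" "g \<in> alg_gen (rep_vars Z)"
    using assms(2) alg_gen_mono[of g "Inl ` Z" "Inl ` F"] alg_gen_mono[of g "Inl ` Z" "rep_vars Z"] by (auto simp: rep_vars_def)
  moreover have "evF g = \<zero>" using g by (simp add: cideal_def)
  ultimately show "evk p g = 0" using assms(1) rep_prime(3) by (auto simp: rep_pt_def kpoint_def)
qed

text \<open>The defining equations of a representation lie in \<open>rep_prime\<close>.\<close>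

lemma rep_pt_isrep: assumes p: "rep_pt Z p" and Z: "Z0 \<subseteq> Z" shows "is_rep_pt p"
proof -
  have JP: "evk p g = 0" if "g \<in> alg_gen (rep_vars Z)" "\<And>q. is_rep_pt q \<Longrightarrow> evk q g = 0" for g
  proof -
    have "g \<in> rep_prime"
      by (rule rep_prime(2), rule rep_ideal_I[of "{}" 1]) (use that alg_gen_1 primD(2)[OF prime_set_PF] in auto)
    then show ?thesis using p that(1) by (auto simp: rep_pt_def kpoint_def)
  qed
  have I: "mvar (Inl z) \<in> alg_gen (rep_vars Z)" if "z \<in> Z0" for z using that Z by (intro alg_gen.var) (auto simp: rep_vars_def)
  have X: "mvar (Inr (a, i, j)) \<in> alg_gen (rep_vars Z)" if "a < m" "i < n" "j < n" for a i j
    using that by (intro alg_gen.var) (auto simp: rep_vars_def entry_vars_def)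
  have 1: "(\<Sum>l<n. p (Inr (a, i, l)) * p (Inr (b, l, j))) = (\<Sum>e<m. p (Inl (cc a b e)) * p (Inr (e, i, j)))"
    if h: "a < m" "b < m" "i < n" "j < n" for a b i j
  proof -
    let ?g = "(\<Sum>l<n. mvar (Inr (a, i, l)) * mvar (Inr (b, l, j))) - (\<Sum>e<m. mvar (Inl (cc a b e)) * mvar (Inr (e, i, j)))"
    have "evk p ?g = 0"
    proof (rule JP)
      show "?g \<in> alg_gen (rep_vars Z)" using h by (intro alg_gen_diff alg_gen_sum alg_gen.mult I X Z0_mem) auto
      show "evk q ?g = 0" if "is_rep_pt q" for q using that h by (simp add: evk_sum is_rep_pt_def struct_rep_def)
    qed
    then show ?thesis by (simp add: evk_sum)
  qed
  have 2: "(\<Sum>a<m. p (Inl (uu a)) * p (Inr (a, i, j))) = (if i = j then 1 else 0)"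
    if h: "i < n" "j < n" for i j
  proof -
    let ?g = "(\<Sum>a<m. mvar (Inl (uu a)) * mvar (Inr (a, i, j))) - mconst (if i = j then 1 else 0)"
    have "evk p ?g = 0"
    proof (rule JP)
      show "?g \<in> alg_gen (rep_vars Z)" using h by (intro alg_gen_diff alg_gen_sum alg_gen.mult alg_gen.const I X Z0_mem) auto
      show "evk q ?g = 0" if "is_rep_pt q" for q using that h by (simp add: evk_sum is_rep_pt_def struct_rep_def del: mconst_simps)
    qed
    then show ?thesis by (simp add: evk_sum del: mconst_simps)
  qed
  show ?thesis unfolding is_rep_pt_def struct_rep_def using 1 2 by blast
qed

definition "rmat Z p x = Matrix.mat n n (\<lambda>(i, j). rentry Z p (\<lambda>a i j. p (Inr (a, i, j))) x i j)"

lemma rmat_carrier: "rmat Z p x \<in> carrier_mat n n" by (simp add: rmat_def)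

lemma rmat_entry: "i < n \<Longrightarrow> j < n \<Longrightarrow> rmat Z p x $$ (i, j) = (\<Sum>a<m. spec Z p (co x a) * p (Inr (a, i, j)))"
  by (simp add: rmat_def rentry_def)

context
  fixes Z p
  assumes Z: "Z0 \<subseteq> Z" "Z \<subseteq> F" and p: "rep_pt Z p"
begin

lemma rmat_add: "x \<in> Lam Z \<Longrightarrow> y \<in> Lam Z \<Longrightarrow> rmat Z p (x \<oplus> y) = rmat Z p x + rmat Z p y"
  using rentry_add[OF Z rep_pt_pt[OF p Z(2)] rep_pt_isrep[OF p Z(1), unfolded is_rep_pt_def]] by (intro eq_matI) (auto simp: rmat_def)

lemma rmat_smult: "z \<in> zring Z \<Longrightarrow> x \<in> Lam Z \<Longrightarrow> rmat Z p (z \<otimes> x) = spec Z p z \<cdot>\<^sub>m rmat Z p x"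
  using rentry_smult[OF Z rep_pt_pt[OF p Z(2)] rep_pt_isrep[OF p Z(1), unfolded is_rep_pt_def]] by (intro eq_matI) (auto simp: rmat_def)

lemma rmat_one: "rmat Z p \<one> = 1\<^sub>m n"
  using rentry_one[OF Z rep_pt_pt[OF p Z(2)] rep_pt_isrep[OF p Z(1), unfolded is_rep_pt_def]] by (intro eq_matI) (auto simp: rmat_def)

lemma rmat_mult: "x \<in> Lam Z \<Longrightarrow> y \<in> Lam Z \<Longrightarrow> rmat Z p (x \<otimes> y) = rmat Z p x * rmat Z p y"
  using rentry_mult[OF Z rep_pt_pt[OF p Z(2)] rep_pt_isrep[OF p Z(1), unfolded is_rep_pt_def]]
  by (intro eq_matI) (auto simp: rmat_def scalar_prod_def atLeast0LessThan)

end

text \<open>The representations of \<open>R\<close> at the points of \<open>rep_prime\<close>, together with all conjugates: without these the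
  family would not be stable under automorphisms of \<open>R\<close>.\<close>

definition "conj_rep p Y x i j = conj_mat Y (rmat Z0 p (\<iota> x)) $$ (i, j)"
definition "Theta = {conj_rep p Y |p Y. rep_pt Z0 p \<and> Y \<in> carrier_mat n n \<and> det Y \<noteq> 0}"

lemma Theta_I: "rep_pt Z0 p \<Longrightarrow> Y \<in> carrier_mat n n \<Longrightarrow> det Y \<noteq> 0 \<Longrightarrow> conj_rep p Y \<in> Theta"
  unfolding Theta_def by blast

lemma Theta_hom:
  assumes "\<theta> \<in> Theta" and x: "x \<in> carrier R" and y: "y \<in> carrier R" and ij: "i < n" "j < n"
  shows "\<theta> (x \<oplus>\<^bsub>R\<^esub> y) i j = \<theta> x i j + \<theta> y i j"
    "\<theta> (x \<otimes>\<^bsub>R\<^esub> y) i j = (\<Sum>l<n. \<theta> x i l * \<theta> y l j)"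
    "\<theta> (c \<odot>\<^bsub>R\<^esub> x) i j = c * \<theta> x i j"
    "\<theta> \<one>\<^bsub>R\<^esub> i j = (if i = j then 1 else 0)"
proof -
  obtain p Y where p: "rep_pt Z0 p" and Y: "Y \<in> carrier_mat n n" "det Y \<noteq> 0" and \<theta>: "\<theta> = conj_rep p Y"
    using assms(1) unfolding Theta_def by blast
  note Z = subset_refl[of Z0] Z0_F
  note L = \<iota>_Lam[OF x] \<iota>_Lam[OF y]
  have cc: "conj_mat Y (rmat Z0 p q) \<in> carrier_mat n n" for q by (rule conj_carrier[OF Y rmat_carrier])
  have d: "dim_row (conj_mat Y (rmat Z0 p q)) = n" "dim_col (conj_mat Y (rmat Z0 p q)) = n" for q using cc[of q] by auto
  show "\<theta> (x \<oplus>\<^bsub>R\<^esub> y) i j = \<theta> x i j + \<theta> y i j"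
    using rmat_add[OF Z p L] conj_add[OF Y rmat_carrier rmat_carrier] ij d x y by (simp add: \<theta> conj_rep_def fr.\<iota>_hom)
  show "\<theta> (x \<otimes>\<^bsub>R\<^esub> y) i j = (\<Sum>l<n. \<theta> x i l * \<theta> y l j)"
    using rmat_mult[OF Z p L] conj_mult[OF Y rmat_carrier rmat_carrier] ij d x y
    by (simp add: \<theta> conj_rep_def fr.\<iota>_hom scalar_prod_def atLeast0LessThan)
  show "\<theta> (c \<odot>\<^bsub>R\<^esub> x) i j = c * \<theta> x i j"
    using rmat_smult[OF Z p zring(3) L(1), of c] conj_smult[OF Y rmat_carrier] ij d x
    by (simp add: \<theta> conj_rep_def \<kappa>_smult spec_const[OF rep_pt_pt[OF p Z(2)]])
  show "\<theta> \<one>\<^bsub>R\<^esub> i j = (if i = j then 1 else 0)"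
    using rmat_one[OF Z p] conj_one[OF Y] ij by (simp add: \<theta> conj_rep_def fr.\<iota>_hom)
qed

text \<open>For fixed \<open>Y\<close>, a polynomial in the entries of the represented elements is a polynomial in the coordinates
  of the point. This transports questions on the family to \<open>rep_prime\<close>.\<close>

lemma conj_rep_polynomial:
  fixes f :: "('i, 'k) mpol"
  assumes x: "\<And>l. l < L \<Longrightarrow> x l \<in> Lam Z0" and Y: "Y \<in> carrier_mat n n"
  shows "\<exists>g\<in>alg_gen (rep_vars Z0). \<forall>p. rep_pt Z0 p \<longrightarrow>
     evk p g = evk (entries_at dec L n (\<lambda>l. conj_mat Y (rmat Z0 p (x l)))) f"
proof -
  define z :: "nat \<Rightarrow> nat \<Rightarrow> ('q + nat \<times> nat \<times> nat, 'k) mpol"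
    where "z l a = (SOME g. g \<in> alg_gen (Inl ` Z0) \<and> evF g = co (x l) a)" for l a
  have z: "z l a \<in> alg_gen (Inl ` Z0) \<and> evF (z l a) = co (x l) a" if "l < L" "a < m" for l a
  proof -
    have "co (x l) a \<in> zring Z0" using x that by (simp add: Lam_def)
    then have "\<exists>g. g \<in> alg_gen (Inl ` Z0) \<and> evF g = co (x l) a" by (auto simp: zring_def)
    then show ?thesis unfolding z_def by (rule someI_ex)
  qed
  define q :: "'i \<Rightarrow> ('q + nat \<times> nat \<times> nat, 'k) mpol"
    where "q i = (case dec i of (l, a, b) \<Rightarrow> if l < L \<and> a < n \<and> b < n then
      mconst (inverse (det Y)) * (\<Sum>t<n. (\<Sum>s<n. mconst (Y $$ (a, s)) * (\<Sum>c<m. z l c * mvar (Inr (c, s, t)))) * mconst (adj_mat Y $$ (t, b))) else 0)" for i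
  have zW: "z l a \<in> alg_gen (rep_vars Z0)" if "l < L" "a < m" for l a
    by (rule alg_gen_mono[OF z[OF that, THEN conjunct1]]) (auto simp: rep_vars_def)
  have X: "mvar (Inr (a, i, j)) \<in> alg_gen (rep_vars Z0)" if "a < m" "i < n" "j < n" for a i j
    using that by (intro alg_gen.var) (auto simp: rep_vars_def entry_vars_def)
  have "q i \<in> alg_gen (rep_vars Z0)" for i
    by (auto simp: q_def split: prod.splits intro!: alg_gen_0 alg_gen.mult alg_gen_sum alg_gen.const X zW)
  then have 1: "subst q f \<in> alg_gen (rep_vars Z0)" by (rule subst_alg_gen[OF alg_gen_UNIV])
  moreover have "evk p (subst q f) = evk (entries_at dec L n (\<lambda>l. conj_mat Y (rmat Z0 p (x l)))) f" if p: "rep_pt Z0 p" for p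
  proof -
    have "evk p (q i) = entries_at dec L n (\<lambda>l. conj_mat Y (rmat Z0 p (x l))) i" for i
    proof -
      obtain l a b where d: "dec i = (l, a, b)" by (cases "dec i") auto
      show ?thesis
      proof (cases "l < L \<and> a < n \<and> b < n")
        case True
        have sbz: "evk p (z l c) = spec Z0 p (co (x l) c)" if "c < m" for c
          using spec_ev[OF rep_pt_pt[OF p Z0_F], of "z l c"] z[of l c] True that by auto
        show ?thesis using True conj_entry[OF Y rmat_carrier, of a b Z0 p "x l"]
          by (simp add: q_def entries_at_def d evk_sum sbz rmat_entry)
      qed (auto simp: q_def entries_at_def d)
    qed
    then show ?thesis by (simp add: evk_subst)
  qed
  ultimately show ?thesis by blast
qed

definition "eval_at dec f \<theta> = evk (entries_at dec L n (\<lambda>l. Matrix.mat n n (\<lambda>(i, j). \<theta> (r l) i j))) f"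
  for dec :: "'i \<Rightarrow> nat \<times> nat \<times> nat" and f :: "('i, 'k) mpol" and \<theta> :: "'r \<Rightarrow> nat \<Rightarrow> nat \<Rightarrow> 'k"

lemma conj_rep_mat: assumes Y: "Y \<in> carrier_mat n n" "det Y \<noteq> 0"
  shows "Matrix.mat n n (\<lambda>(i, j). conj_rep p Y x i j) = conj_mat Y (rmat Z0 p (\<iota> x))"
  using conj_carrier[OF Y rmat_carrier, of Z0 p "\<iota> x"] by (intro eq_matI) (auto simp: conj_rep_def)

lemma eval_at_th: "Y \<in> carrier_mat n n \<Longrightarrow> det Y \<noteq> 0 \<Longrightarrow>
   eval_at dec f (conj_rep p Y) = evk (entries_at dec L n (\<lambda>l. conj_mat Y (rmat Z0 p (\<iota> (r l))))) f"
  by (simp add: eval_at_def conj_rep_mat)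

lemma finite_WW: "finite Z \<Longrightarrow> finite (rep_vars Z)" by (simp add: rep_vars_def entry_vars_def)

text \<open>Some coordinate of \<open>x\<close> is a nonzero constant, and it stays nonzero at a suitable point.\<close>

theorem Theta_separates:
  assumes x: "x \<in> carrier R" "x \<noteq> \<zero>\<^bsub>R\<^esub>"
  shows "\<exists>\<theta>\<in>Theta. \<exists>i<n. \<exists>j<n. \<theta> x i j \<noteq> 0"
proof -
  have "\<iota> \<zero>\<^bsub>R\<^esub> \<oplus> \<iota> \<zero>\<^bsub>R\<^esub> = \<iota> \<zero>\<^bsub>R\<^esub>" using fr.\<iota>_hom(3)[of "\<zero>\<^bsub>R\<^esub>" "\<zero>\<^bsub>R\<^esub>"] by simp
  then have "\<iota> \<zero>\<^bsub>R\<^esub> = \<zero>" using \<iota>_closed[of "\<zero>\<^bsub>R\<^esub>"] by (metis add.l_cancel_one fr.R.zero_closed)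
  then have "\<iota> x \<noteq> \<zero>" using x fr.\<iota>_hom(5)[of x "\<zero>\<^bsub>R\<^esub>"] by auto
  then obtain a where a: "a < m" "co (\<iota> x) a \<noteq> \<zero>" using co_zero_imp[OF \<iota>_closed[OF x(1)]] by blast
  have "co (\<iota> x) a \<in> zring Z0" using \<iota>_Lam[OF x(1)] a by (simp add: Lam_def)
  then obtain g :: "('q + nat \<times> nat \<times> nat, 'k) mpol" where g: "g \<in> alg_gen (Inl ` Z0)" "evF g = co (\<iota> x) a" by (auto simp: zring_def)
  have gF: "g \<in> alg_gen (Inl ` F)" using g Z0_F alg_gen_mono[of g "Inl ` Z0" "Inl ` F"] by auto
  then have "g \<notin> rep_prime" using g a rep_prime(3) by simp
  moreover have "g \<in> alg_gen (rep_vars Z0)" by (rule alg_gen_mono[OF g(1)]) (auto simp: rep_vars_def)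
  ultimately obtain p :: "'q + nat \<times> nat \<times> nat \<Rightarrow> 'k" where p: "rep_pt Z0 p" "evk p g \<noteq> 0"
    using nullstellensatz[OF rep_prime(1) finite_WW[OF Z0_fin]] unfolding rep_pt_def by blast
  have "spec Z0 p (co (\<iota> x) a) \<noteq> 0" using p g spec_ev[OF rep_pt_pt[OF p(1) Z0_F], of g] by simp
  from rentry_nonzero[OF subset_refl Z0_F rep_pt_pt[OF p(1) Z0_F] rep_pt_isrep[OF p(1) subset_refl, unfolded is_rep_pt_def] \<iota>_Lam[OF x(1)] a(1) this]
  obtain i j where ij: "i < n" "j < n" "rmat Z0 p (\<iota> x) $$ (i, j) \<noteq> 0" by (auto simp: rmat_def)
  have "conj_rep p (1\<^sub>m n) x i j \<noteq> 0" using ij by (simp add: conj_rep_def conj_one_mat[OF rmat_carrier])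
  moreover have "conj_rep p (1\<^sub>m n) \<in> Theta" using p(1) by (intro Theta_I) auto
  ultimately show ?thesis using ij by blast
qed

text \<open>Primality moves both conditions to one point, where only the conjugating matrices differ.\<close>

theorem Theta_irreducible:
  assumes "\<theta> \<in> Theta" "\<theta>' \<in> Theta" "eval_at dec f \<theta> \<noteq> 0" "eval_at dec h \<theta>' \<noteq> 0"
  shows "\<exists>\<theta>''\<in>Theta. eval_at dec f \<theta>'' \<noteq> 0 \<and> eval_at dec h \<theta>'' \<noteq> 0"
proof -
  obtain p Y where p: "rep_pt Z0 p" and Y: "Y \<in> carrier_mat n n" "det Y \<noteq> 0" and \<theta>: "\<theta> = conj_rep p Y"
    using assms(1) unfolding Theta_def by blast
  obtain p' Y' where p': "rep_pt Z0 p'" and Y': "Y' \<in> carrier_mat n n" "det Y' \<noteq> 0" and \<theta>': "\<theta>' = conj_rep p' Y'"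
    using assms(2) unfolding Theta_def by blast
  have L: "\<iota> (r l) \<in> Lam Z0" if "l < L" for l by (rule \<iota>_Lam[OF r[OF that]])
  obtain g where g: "g \<in> alg_gen (rep_vars Z0)"
    "\<And>p. rep_pt Z0 p \<Longrightarrow> evk p g = evk (entries_at dec L n (\<lambda>l. conj_mat Y (rmat Z0 p (\<iota> (r l))))) f"
    using conj_rep_polynomial[OF L Y(1), of "\<lambda>l. l" dec f] by blast
  obtain g' where g': "g' \<in> alg_gen (rep_vars Z0)"
    "\<And>p. rep_pt Z0 p \<Longrightarrow> evk p g' = evk (entries_at dec L n (\<lambda>l. conj_mat Y' (rmat Z0 p (\<iota> (r l))))) h"
    using conj_rep_polynomial[OF L Y'(1), of "\<lambda>l. l" dec h] by blast
  have "g \<notin> rep_prime" using assms(3) g p by (auto simp: \<theta> eval_at_th[OF Y] rep_pt_def kpoint_def)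
  moreover have "g' \<notin> rep_prime" using assms(4) g' p' by (auto simp: \<theta>' eval_at_th[OF Y'] rep_pt_def kpoint_def)
  ultimately have "g * g' \<notin> rep_prime" using primD(6)[OF rep_prime(1)] by blast
  then obtain q :: "'q + nat \<times> nat \<times> nat \<Rightarrow> 'k" where q: "rep_pt Z0 q" "evk q (g * g') \<noteq> 0"
    using nullstellensatz[OF rep_prime(1) finite_WW[OF Z0_fin] alg_gen.mult[OF g(1) g'(1)]] unfolding rep_pt_def by blast
  have "evk (entries_at dec L n (\<lambda>l. conj_mat Y (rmat Z0 q (\<iota> (r l))))) f \<noteq> 0"
    "evk (entries_at dec L n (\<lambda>l. conj_mat Y' (rmat Z0 q (\<iota> (r l))))) h \<noteq> 0" using q g(2) g'(2) by auto
  from conjugates_irreducible[OF rmat_carrier Y Y' this]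
  obtain U where U: "U \<in> carrier_mat n n" "det U \<noteq> 0"
    "eval_at dec f (conj_rep q U) \<noteq> 0" "eval_at dec h (conj_rep q U) \<noteq> 0" by (auto simp: eval_at_th)
  then show ?thesis using Theta_I[OF q(1)] by blast
qed

context
  fixes \<Phi>
  assumes \<Phi>: "\<Phi> \<in> Ring.ring_hom Q Q" and surj: "\<Phi> ` carrier Q = carrier Q"
    and \<Phi>\<kappa>: "\<And>c. \<Phi> (\<kappa> c) = \<kappa> c"
begin

lemma \<Phi>_simps: "x \<in> carrier Q \<Longrightarrow> \<Phi> x \<in> carrier Q"
  "x \<in> carrier Q \<Longrightarrow> y \<in> carrier Q \<Longrightarrow> \<Phi> (x \<oplus> y) = \<Phi> x \<oplus> \<Phi> y"
  "x \<in> carrier Q \<Longrightarrow> y \<in> carrier Q \<Longrightarrow> \<Phi> (x \<otimes> y) = \<Phi> x \<otimes> \<Phi> y"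
  "\<Phi> \<one> = \<one>" "\<Phi> \<zero> = \<zero>"
  using ring_hom_closed[OF \<Phi>] ring_hom_add[OF \<Phi>] ring_hom_mult[OF \<Phi>] ring_hom_one[OF \<Phi>] \<Phi>\<kappa>[of 0] by (simp_all add: \<kappa>_zero)

lemma \<Phi>_F: assumes x: "x \<in> F" shows "\<Phi> x \<in> F"
proof -
  have xc: "x \<in> carrier Q" by (rule F(1)[OF x])
  have "\<Phi> x \<otimes> y = y \<otimes> \<Phi> x" if y: "y \<in> carrier Q" for y
  proof -
    obtain z where z: "z \<in> carrier Q" "y = \<Phi> z" using surj y by blast
    show ?thesis using F(2)[OF x z(1)] \<Phi>_simps(3)[OF xc z(1)] \<Phi>_simps(3)[OF z(1) xc] z(2) by simp
  qed
  then show ?thesis using \<Phi>_simps(1)[OF xc] unfolding F_center ring_center_def by blast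
qed

lemma \<Phi>_inj: assumes x: "x \<in> F" "\<Phi> x = \<zero>" shows "x = \<zero>"
proof (rule ccontr)
  assume "x \<noteq> \<zero>"
  then obtain y where y: "y \<in> F" "x \<otimes> y = \<one>"
    using field.field_Units[OF field_F] x(1) by (auto simp: Units_def)
  then have "\<one> = \<Phi> x \<otimes> \<Phi> y" using \<Phi>_simps(3,4) F(1) x(1) by metis
  then show False using x(2) \<Phi>_simps(1)[OF F(1)[OF y(1)]] one_neq_zero by simp
qed

lemma \<Phi>_sum: "(\<And>i. i \<in> A \<Longrightarrow> f i \<in> carrier Q) \<Longrightarrow> \<Phi> (\<Oplus>i\<in>A. f i) = (\<Oplus>i\<in>A. \<Phi> (f i))"
proof (induct A rule: infinite_finite_induct)
  case (insert x G)
  then have "(\<Oplus>i\<in>G. f i) \<in> carrier Q" by (auto intro!: finsum_closed)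
  then show ?case using insert by (simp add: \<Phi>_simps Pi_def)
qed (simp_all add: \<Phi>_simps)

text \<open>Renaming constants along the automorphism \<open>\<Phi>\<close> of \<open>Q\<close> turns a point into its twist.\<close>

definition "twist i = (case i of Inl q \<Rightarrow> mvar (Inl (\<Phi> q)) | Inr x \<Rightarrow> mvar (Inr x))"
  for i :: "'q + nat \<times> nat \<times> nat"

lemma twist_gen: "g \<in> alg_gen (Inl ` Z) \<Longrightarrow> \<Phi> ` Z \<subseteq> Z' \<Longrightarrow> subst twist g \<in> alg_gen (Inl ` Z')"
  by (erule subst_alg_gen) (force simp: twist_def intro!: alg_gen.var)

lemma twist_evF: "g \<in> alg_gen (Inl ` F) \<Longrightarrow> evF (subst twist g) = \<Phi> (evF g)"
proof (induct rule: alg_gen.induct)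
  case (var i)
  then show ?case using \<Phi>_F by (auto simp: twist_def evF(5))
qed (simp_all add: evF \<Phi>\<kappa> \<Phi>_simps F(1)[OF evF(1)])

text \<open>If \<open>p3\<close> reads the constants as \<open>p1\<close> reads their images under \<open>\<Phi>\<close>, then \<open>e a \<mapsto> \<Phi> (e a)\<close> followed by the
  representation at \<open>p1\<close> is a representation for the constants of \<open>p3\<close>, hence conjugate to that at \<open>p3\<close>.
  The images of the basis have new coordinates, which is why \<open>p1\<close> must be defined on more constants.\<close>

lemma twisted_point:
  assumes Z1: "Z0 \<union> \<Phi> ` Z0 \<union> (\<lambda>(a, b). co (\<Phi> (e a)) b) ` ({..<m} \<times> {..<m}) \<subseteq> Z1" "Z1 \<subseteq> F"
    and p1: "rep_pt Z1 p1" and p3: "rep_pt Z0 p3" and p13: "\<And>z. z \<in> Z0 \<Longrightarrow> p3 (Inl z) = p1 (Inl (\<Phi> z))"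
  shows "\<exists>W. W \<in> carrier_mat n n \<and> det W \<noteq> 0 \<and>
    (\<forall>x\<in>Lam Z0. \<Phi> x \<in> Lam Z0 \<longrightarrow> rmat Z0 p1 (\<Phi> x) = conj_mat W (rmat Z0 p3 x))"
proof -
  define v1 where "v1 = (\<lambda>a i j. p1 (Inr (a, i, j)))"
  define v3 where "v3 = (\<lambda>a i j. p3 (Inr (a, i, j)))"
  have ZZ: "Z0 \<subseteq> Z1" "\<Phi> ` Z0 \<subseteq> Z1" using Z1(1) by auto
  note Z = ZZ(1) Z1(2)
  have pt1: "center_pt Z1 p1" by (rule rep_pt_pt[OF p1 Z(2)])
  have pt3: "center_pt Z0 p3" by (rule rep_pt_pt[OF p3 Z0_F])
  have r1: "struct_rep m (pc p1) (pu p1) n v1" using rep_pt_isrep[OF p1 Z(1)] by (simp add: is_rep_pt_def v1_def)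
  have r3: "struct_rep m (pc p3) (pu p3) n v3" using rep_pt_isrep[OF p3 subset_refl] by (simp add: is_rep_pt_def v3_def)
  have tr: "spec Z1 p1 (\<Phi> z) = spec Z0 p3 z \<and> \<Phi> z \<in> zring Z1" if z: "z \<in> zring Z0" for z
  proof -
    obtain h :: "('q + nat \<times> nat \<times> nat, 'k) mpol" where h: "h \<in> alg_gen (Inl ` Z0)" "evF h = z" using z by (auto simp: zring_def)
    have hF: "h \<in> alg_gen (Inl ` F)" by (rule alg_gen_mono[OF h(1)]) (use Z0_F in auto)
    have t: "subst twist h \<in> alg_gen (Inl ` Z1)" by (rule twist_gen[OF h(1) ZZ(2)])
    have e: "evF (subst twist h) = \<Phi> z" using twist_evF[OF hF] h(2) by simp
    have "spec Z1 p1 (\<Phi> z) = evk p1 (subst twist h)" using spec_ev[OF pt1 t] e by simp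
    also have "\<dots> = evk p3 h" unfolding evk_subst
      by (rule evk_cong[OF h(1)]) (auto simp: twist_def p13)
    also have "\<dots> = spec Z0 p3 z" using spec_ev[OF pt3 h(1)] h(2) by simp
    finally show ?thesis using t e unfolding zring_def by (metis imageI)
  qed
  have \<Phi>e: "\<Phi> (e a) \<in> Lam Z1" if a: "a < m" for a
  proof -
    have "co (\<Phi> (e a)) b \<in> Z1" if "b < m" for b using a that by (intro subsetD[OF Z1(1)] UnI2 image_eqI[of _ _ "(a, b)"]) auto
    then show ?thesis using \<Phi>_simps(1)[OF e_closed[OF a]] zring(6)[OF Z(2)] by (auto simp: Lam_def)
  qed
  \<comment> \<open>the representation at \<open>p1\<close> of the images of the basis\<close>
  define v' where "v' = (\<lambda>a. rentry Z1 p1 v1 (\<Phi> (e a)))"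
  have exp: "rentry Z1 p1 v1 (\<Phi> x) i j = (\<Sum>a<m. spec Z0 p3 (co x a) * v' a i j)" if x: "x \<in> Lam Z0" for x i j
  proof -
    have xc: "x \<in> carrier Q" by (rule Lam_carrier[OF x])
    have cF: "co x a \<in> carrier Q" for a by (rule F(1)[OF co(1)[OF xc]])
    have cz: "co x a \<in> zring Z0" if "a < m" for a using x that by (simp add: Lam_def)
    have "\<Phi> x = \<Phi> (\<Oplus>a\<in>{..<m}. co x a \<otimes> e a)" using co(2)[OF xc] by simp
    also have "\<dots> = (\<Oplus>a\<in>{..<m}. \<Phi> (co x a \<otimes> e a))" by (rule \<Phi>_sum) (use cF e_closed in auto)
    also have "\<dots> = (\<Oplus>a\<in>{..<m}. \<Phi> (co x a) \<otimes> \<Phi> (e a))"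
      by (rule finsum_cong') (use cF e_closed \<Phi>_simps in auto)
    finally have "rentry Z1 p1 v1 (\<Phi> x) i j = rentry Z1 p1 v1 (\<Oplus>a\<in>{..<m}. \<Phi> (co x a) \<otimes> \<Phi> (e a)) i j" by simp
    also have "\<dots> = (\<Sum>a<m. rentry Z1 p1 v1 (\<Phi> (co x a) \<otimes> \<Phi> (e a)) i j)"
      by (rule rentry_sum[OF Z pt1 r1], rule Lam_smult) (use tr cz \<Phi>e in auto)
    also have "\<dots> = (\<Sum>a<m. spec Z0 p3 (co x a) * v' a i j)"
      unfolding v'_def by (intro sum.cong refl) (use rentry_smult[OF Z pt1 r1] tr cz \<Phi>e in auto)
    finally show ?thesis .
  qed
  have eL: "e a \<otimes> e b \<in> Lam Z0" if "a < m" "b < m" for a b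
    by (rule Lam_mult[OF subset_refl Z0_F Lam_e Lam_e]) fact+
  have c3: "spec Z0 p3 (cc a b l) = p3 (Inl (cc a b l))" if "a < m" "b < m" "l < m" for a b l
    using spec_c(1)[OF subset_refl Z0_F pt3 that] by simp
  have u3: "spec Z0 p3 (uu l) = p3 (Inl (uu l))" if "l < m" for l
    using spec_c(2)[OF subset_refl Z0_F pt3 that] by simp
  have "struct_rep m (pc p3) (pu p3) n v'"
    unfolding struct_rep_def
  proof (intro conjI allI impI)
    fix a b i j assume h: "a < m" "b < m" "i < n" "j < n"
    have "(\<Sum>l<n. v' a i l * v' b l j) = rentry Z1 p1 v1 (\<Phi> (e a) \<otimes> \<Phi> (e b)) i j"
      unfolding v'_def using rentry_mult[OF Z pt1 r1 \<Phi>e \<Phi>e, of a b i j] h by simp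
    also have "\<dots> = rentry Z1 p1 v1 (\<Phi> (e a \<otimes> e b)) i j" using h e_closed by (simp add: \<Phi>_simps)
    also have "\<dots> = (\<Sum>l<m. p3 (Inl (cc a b l)) * v' l i j)"
      unfolding exp[OF eL[OF h(1,2)]] using h c3 by (simp flip: cc_def)
    finally show "(\<Sum>l<n. v' a i l * v' b l j) = (\<Sum>l<m. p3 (Inl (cc a b l)) * v' l i j)" .
  next
    fix i j assume h: "i < n" "j < n"
    have "(\<Sum>a<m. p3 (Inl (uu a)) * v' a i j) = rentry Z1 p1 v1 (\<Phi> \<one>) i j"
      unfolding exp[OF Lam_one[OF subset_refl Z0_F]] using u3 by (simp flip: uu_def)
    also have "\<dots> = (if i = j then 1 else 0)" using rentry_one[OF Z pt1 r1 h] by (simp add: \<Phi>_simps)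
    finally show "(\<Sum>a<m. p3 (Inl (uu a)) * v' a i j) = (if i = j then 1 else 0)" .
  qed
  from struct_rep_conj[OF struct_alg_point[OF subset_refl Z0_F pt3] m_pos mn r3 this]
  obtain W where W: "W \<in> carrier_mat n n" "det W \<noteq> 0"
    and Wc: "\<And>a. a < m \<Longrightarrow> Matrix.mat n n (\<lambda>(i, j). v' a i j) = conj_mat W (Matrix.mat n n (\<lambda>(i, j). v3 a i j))" by blast
  have inter: "(\<Sum>l<n. v' a i l * W $$ (l, j)) = (\<Sum>l<n. W $$ (i, l) * v3 a l j)" if h: "a < m" "i < n" "j < n" for a i j
  proof -
    have "Matrix.mat n n (\<lambda>(i, j). v' a i j) * W = W * Matrix.mat n n (\<lambda>(i, j). v3 a i j)"
      unfolding Wc[OF h(1)] by (rule conj_mult_right[OF W]) simp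
    then have "(Matrix.mat n n (\<lambda>(i, j). v' a i j) * W) $$ (i, j) = (W * Matrix.mat n n (\<lambda>(i, j). v3 a i j)) $$ (i, j)" by simp
    then show ?thesis using h W by (simp add: scalar_prod_def atLeast0LessThan)
  qed
  have "rmat Z0 p1 (\<Phi> x) = conj_mat W (rmat Z0 p3 x)" if x: "x \<in> Lam Z0" "\<Phi> x \<in> Lam Z0" for x
  proof (rule conj_unique[OF W rmat_carrier rmat_carrier], rule eq_matI)
    fix i j assume "i < dim_row (W * rmat Z0 p3 x)" "j < dim_col (W * rmat Z0 p3 x)"
    then have ij: "i < n" "j < n" using W rmat_carrier[of Z0 p3 x] by auto
    let ?s = "\<lambda>a. spec Z0 p3 (co x a)"
    have M1: "rmat Z0 p1 (\<Phi> x) $$ (i, l) = (\<Sum>a<m. ?s a * v' a i l)" if "l < n" for l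
    proof -
      have "rmat Z0 p1 (\<Phi> x) $$ (i, l) = rentry Z1 p1 v1 (\<Phi> x) i l"
        using x(2) spec_mono[OF rep_pt_pt[OF rep_pt_mono[OF p1 Z(1)] Z0_F] pt1 Z(1)] that ij(1) by (simp add: rmat_def rentry_def v1_def Lam_def)
      then show ?thesis using exp[OF x(1)] by simp
    qed
    have "(rmat Z0 p1 (\<Phi> x) * W) $$ (i, j) = (\<Sum>l<n. (\<Sum>a<m. ?s a * v' a i l) * W $$ (l, j))"
      using ij W rmat_carrier[of Z0 p1 "\<Phi> x"] by (simp add: scalar_prod_def atLeast0LessThan M1)
    also have "\<dots> = (\<Sum>a<m. ?s a * (\<Sum>l<n. v' a i l * W $$ (l, j)))"
      by (simp only: sum_distrib_left sum_distrib_right mult.assoc) (rule sum.swap)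
    also have "\<dots> = (\<Sum>a<m. ?s a * (\<Sum>l<n. W $$ (i, l) * v3 a l j))" using inter ij by simp
    also have "\<dots> = (\<Sum>l<n. W $$ (i, l) * (\<Sum>a<m. ?s a * v3 a l j))"
      by (simp only: sum_distrib_left mult.left_commute) (rule sum.swap)
    also have "\<dots> = (W * rmat Z0 p3 x) $$ (i, j)"
      using ij W rmat_carrier[of Z0 p3 x] by (simp add: scalar_prod_def atLeast0LessThan rmat_entry v3_def)
    finally show "(rmat Z0 p1 (\<Phi> x) * W) $$ (i, j) = (W * rmat Z0 p3 x) $$ (i, j)" .
  qed (use W rmat_carrier[of Z0 p3 x] rmat_carrier[of Z0 p1 "\<Phi> x"] in auto)
  then show ?thesis using W by blast
qed

text \<open>The polynomial in question does not vanish generically, so it is nonzero at a point \<open>p1\<close> that is defined on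
  the larger set of constants and whose twist extends to a point \<open>p3\<close> of \<open>rep_prime\<close>.\<close>

lemma Theta_stable_aux:
  assumes \<phi>: "\<And>x. x \<in> carrier R \<Longrightarrow> \<phi> x \<in> carrier R \<and> \<Phi> (\<iota> x) = \<iota> (\<phi> x)"
    and \<theta>: "\<theta> \<in> Theta" and f: "eval_at dec f (\<lambda>x. \<theta> (\<phi> x)) \<noteq> 0"
  shows "\<exists>\<theta>'\<in>Theta. eval_at dec f \<theta>' \<noteq> 0"
proof -
  obtain p0 Y where p0: "rep_pt Z0 p0" and Y: "Y \<in> carrier_mat n n" "det Y \<noteq> 0" and \<theta>eq: "\<theta> = conj_rep p0 Y"
    using \<theta> unfolding Theta_def by blast
  have L: "\<iota> (r l) \<in> Lam Z0" "\<iota> (\<phi> (r l)) \<in> Lam Z0" if "l < L" for l using \<iota>_Lam r[OF that] \<phi> by auto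
  obtain g where g: "g \<in> alg_gen (rep_vars Z0)"
    "\<And>p. rep_pt Z0 p \<Longrightarrow> evk p g = evk (entries_at dec L n (\<lambda>l. conj_mat Y (rmat Z0 p (\<iota> (\<phi> (r l)))))) f"
    using conj_rep_polynomial[OF L(2) Y(1), of "\<lambda>l. l" dec f] by blast
  have "evk p0 g \<noteq> 0" using f g(2)[OF p0] by (simp add: \<theta>eq eval_at_def conj_rep_mat[OF Y])
  then have gP: "g \<notin> rep_prime" using p0 g(1) by (auto simp: rep_pt_def kpoint_def)
  have "finite (Inr ` entry_vars :: ('q + nat \<times> nat \<times> nat) set)" by (simp add: entry_vars_def)
  from extend_point[OF rep_prime(1) this alg_gen_1 primD(2)[OF rep_prime(1)], of "Inl ` Z0"]
  obtain b where b0: "b \<in> alg_gen (Inl ` Z0) - rep_prime"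
    and ext0: "\<forall>p. kpoint (Inl ` Z0) rep_prime p \<longrightarrow> evk p b \<noteq> 0 \<longrightarrow>
      (\<exists>p'. (\<forall>i\<in>Inl ` Z0. p' i = p i) \<and> kpoint (Inr ` entry_vars \<union> Inl ` Z0) rep_prime p' \<and> evk p' 1 \<noteq> 0)" by (rule bexE)
  have b: "b \<in> alg_gen (Inl ` Z0)" "b \<notin> rep_prime" using b0 by auto
  have ext: "\<exists>p'. (\<forall>i\<in>Inl ` Z0. p' i = p i) \<and> kpoint (Inr ` entry_vars \<union> Inl ` Z0) rep_prime p'"
    if "kpoint (Inl ` Z0) rep_prime p" "evk p b \<noteq> 0" for p
    using ext0[rule_format, OF that] by blast
  define Z1 where "Z1 = Z0 \<union> \<Phi> ` Z0 \<union> (\<lambda>(a, b). co (\<Phi> (e a)) b) ` ({..<m} \<times> {..<m})"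
  have Z1: "finite Z1" "Z1 \<subseteq> F" "Z0 \<subseteq> Z1" "\<Phi> ` Z0 \<subseteq> Z1"
  proof -
    show "finite Z1" "Z0 \<subseteq> Z1" "\<Phi> ` Z0 \<subseteq> Z1" using Z0_fin by (auto simp: Z1_def)
    have "co (\<Phi> (e a)) b \<in> F" if "a < m" for a b by (rule co(1)[OF \<Phi>_simps(1)[OF e_closed[OF that]]])
    then have "(\<lambda>(a, b). co (\<Phi> (e a)) b) ` ({..<m} \<times> {..<m}) \<subseteq> F" by force
    moreover have "\<Phi> ` Z0 \<subseteq> F" using \<Phi>_F Z0_F by blast
    ultimately show "Z1 \<subseteq> F" unfolding Z1_def using Z0_F by (intro Un_least)
  qed
  have F0: "h \<in> alg_gen (Inl ` F)" if "h \<in> alg_gen (Inl ` Z0)" for h :: "('q + nat \<times> nat \<times> nat, 'k) mpol"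
    by (rule alg_gen_mono[OF that]) (use Z0_F in auto)
  have tF: "subst twist h \<in> alg_gen (Inl ` F)" if "h \<in> alg_gen (Inl ` Z0)" for h
    by (rule twist_gen[OF that]) (use Z0_F \<Phi>_F in auto)
  have tb: "subst twist b \<notin> rep_prime"
    using rep_prime(3)[OF tF[OF b(1)]] rep_prime(3)[OF F0[OF b(1)]] b(2) twist_evF[OF F0[OF b(1)]] \<Phi>_inj[OF evF(1), of b] by auto
  have gb: "g * subst twist b \<notin> rep_prime" using primD(6)[OF rep_prime(1)] gP tb by blast
  have gW: "g * subst twist b \<in> alg_gen (rep_vars Z1)"
    by (intro alg_gen.mult alg_gen_mono[OF g(1)] alg_gen_mono[OF twist_gen[OF b(1) Z1(4)]]) (use Z1(3) in \<open>auto simp: rep_vars_def\<close>)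
  obtain p1 :: "'q + nat \<times> nat \<times> nat \<Rightarrow> 'k" where p1: "rep_pt Z1 p1" "evk p1 (g * subst twist b) \<noteq> 0"
    using nullstellensatz[OF rep_prime(1) finite_WW[OF Z1(1)] gW gb] unfolding rep_pt_def by blast
  \<comment> \<open>the twist of \<open>p1\<close>; so far it satisfies the relations between constants only\<close>
  define p2 where "p2 i = evk p1 (twist i)" for i
  have p2: "evk p2 h = evk p1 (subst twist h)" for h unfolding evk_subst p2_def[abs_def] ..
  have "kpoint (Inl ` Z0) rep_prime p2"
    unfolding kpoint_def
  proof
    fix h :: "('q + nat \<times> nat \<times> nat, 'k) mpol" assume h: "h \<in> alg_gen (Inl ` Z0) \<inter> rep_prime"
    then have "evF h = \<zero>" using rep_prime(3)[OF F0] by blast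
    then have "evF (subst twist h) = \<zero>" using twist_evF[OF F0, of h] h \<Phi>_simps(5) by simp
    then have "subst twist h \<in> rep_prime" using rep_prime(3)[OF tF] h by blast
    moreover have "subst twist h \<in> alg_gen (rep_vars Z1)" using h twist_gen[OF _ Z1(4), of h] alg_gen_mono[of "subst twist h" "Inl ` Z1" "rep_vars Z1"] by (auto simp: rep_vars_def)
    ultimately show "evk p2 h = 0" using p1(1) unfolding p2 rep_pt_def kpoint_def by blast
  qed
  moreover have "evk p2 b \<noteq> 0" using p1(2) by (auto simp: p2)
  ultimately obtain p3 where p3: "\<And>i. i \<in> Inl ` Z0 \<Longrightarrow> p3 i = p2 i" "kpoint (Inr ` entry_vars \<union> Inl ` Z0) rep_prime p3" using ext by blast
  have gp3: "rep_pt Z0 p3" using p3(2) by (simp add: rep_pt_def rep_vars_def Un_commute)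
  have "p3 (Inl z) = p1 (Inl (\<Phi> z))" if "z \<in> Z0" for z using p3(1)[of "Inl z"] that by (simp add: p2_def twist_def)
  from twisted_point[OF _ Z1(2) p1(1) gp3 this]
  obtain W where W: "W \<in> carrier_mat n n" "det W \<noteq> 0"
    "\<And>x. x\<in>Lam Z0 \<Longrightarrow> \<Phi> x \<in> Lam Z0 \<Longrightarrow> rmat Z0 p1 (\<Phi> x) = conj_mat W (rmat Z0 p3 x)" by (auto simp: Z1_def)
  have conj: "conj_mat Y (rmat Z0 p1 (\<iota> (\<phi> (r l)))) = conj_mat (Y * W) (rmat Z0 p3 (\<iota> (r l)))" if "l < L" for l
    using W(3)[OF L(1)[OF that]] L(2)[OF that] \<phi>[OF r[OF that]] conj_conj[OF W(1,2) Y rmat_carrier] by simp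
  have YW: "Y * W \<in> carrier_mat n n" "det (Y * W) \<noteq> 0" using Y W det_mult[OF Y(1) W(1)] by auto
  have "evk (entries_at dec L n (\<lambda>l. conj_mat Y (rmat Z0 p1 (\<iota> (\<phi> (r l)))))) f = eval_at dec f (conj_rep p3 (Y * W))"
    unfolding eval_at_th[OF YW] by (rule arg_cong[of _ _ "\<lambda>v. evk v f"]) (auto simp: entries_at_def conj split: prod.splits)
  moreover have "evk p1 g \<noteq> 0" using p1(2) by auto
  ultimately have "eval_at dec f (conj_rep p3 (Y * W)) \<noteq> 0" using g(2)[OF rep_pt_mono[OF p1(1) Z1(3)]] by simp
  then show ?thesis using Theta_I[OF gp3 YW] by blast
qed

end

theorem Theta_stable:
  assumes \<phi>: "\<phi> \<in> alg_hom R R" "bij_betw \<phi> (carrier R) (carrier R)"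
    and \<theta>: "\<theta> \<in> Theta" and f: "eval_at dec f (\<lambda>x. \<theta> (\<phi> x)) \<noteq> 0"
  shows "\<exists>\<theta>'\<in>Theta. eval_at dec f \<theta>' \<noteq> 0"
proof -
  have \<phi>R: "\<phi> \<in> Ring.ring_hom R R" and \<phi>c: "\<phi> x \<in> carrier R" "\<phi> (c \<odot>\<^bsub>R\<^esub> x) = c \<odot>\<^bsub>R\<^esub> \<phi> x" if "x \<in> carrier R" for x c
    using \<phi>(1) that ring_hom_closed[of \<phi> R R] unfolding alg_hom_def by blast+
  have one: "\<phi> \<one>\<^bsub>R\<^esub> = \<one>\<^bsub>R\<^esub>" using \<phi>(1) ring_hom_one[of \<phi> R R] by (simp add: alg_hom_def)
  obtain \<Phi> where \<Phi>: "\<Phi> \<in> Ring.ring_hom Q Q" "\<Phi> ` carrier Q = carrier Q" "\<And>x. x \<in> carrier R \<Longrightarrow> \<Phi> (\<iota> x) = \<iota> (\<phi> x)"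
    using fr.extend_automorphism[OF _ \<phi>(2)] \<phi>(1) unfolding alg_hom_def by blast
  have "\<Phi> (\<kappa> c) = \<kappa> c" for c
    using \<Phi>(3)[of "c \<odot>\<^bsub>R\<^esub> \<one>\<^bsub>R\<^esub>"] by (simp add: \<kappa>_def smult_R \<phi>c one)
  from Theta_stable_aux[OF \<Phi>(1,2) this _ \<theta> f] show ?thesis using \<Phi>(3) \<phi>c by auto
qed

end

section \<open>Rational representations\<close>

lemma GL_carrier: "X \<in> carrier (GL N :: 'k::field mat monoid) \<longleftrightarrow> X \<in> carrier_mat N N \<and> det X \<noteq> 0"
proof
  assume "X \<in> carrier (GL N)"
  then obtain Y where X: "X \<in> carrier_mat N N" and Y: "Y \<in> carrier_mat N N" "X * Y = 1\<^sub>m N"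
    by (auto simp: GL_def units_of_def Units_def ring_mat_def)
  then have "det X * det Y = 1" by (metis det_mult det_one)
  then show "X \<in> carrier_mat N N \<and> det X \<noteq> 0" using X by auto
next
  assume X: "X \<in> carrier_mat N N \<and> det X \<noteq> 0"
  let ?Y = "inverse (det X) \<cdot>\<^sub>m adj_mat X"
  have "?Y \<in> carrier_mat N N" "X * ?Y = 1\<^sub>m N" "?Y * X = 1\<^sub>m N"
    using X adj_mat[of X N] by (auto simp: mult_smult_distrib mult_smult_assoc_mat intro!: eq_matI)
  then show "X \<in> carrier (GL N)" using X by (auto simp: GL_def units_of_def Units_def ring_mat_def)
qed

lemma GL_ops: "X \<otimes>\<^bsub>GL N\<^esub> Y = X * Y" "\<one>\<^bsub>GL N\<^esub> = 1\<^sub>m N"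
  by (simp_all add: GL_def units_of_def ring_mat_def)

lemma GL_group: "group (GL N :: 'k::field mat monoid)"
  unfolding GL_def by (rule monoid.units_group) (rule ring.is_monoid[OF ring_mat])

lemma GL_inv: assumes "X \<in> carrier (GL N :: 'k::field mat monoid)"
  shows "inv\<^bsub>GL N\<^esub> X = inverse (det X) \<cdot>\<^sub>m adj_mat X"
proof (rule group.inv_equality[OF GL_group _ assms])
  have X: "X \<in> carrier_mat N N" "det X \<noteq> 0" using assms GL_carrier by auto
  show 1: "inverse (det X) \<cdot>\<^sub>m adj_mat X \<otimes>\<^bsub>GL N\<^esub> X = \<one>\<^bsub>GL N\<^esub>"
    using X adj_mat[of X N] by (auto simp: GL_ops mult_smult_assoc_mat intro!: eq_matI)
  have "det (inverse (det X) \<cdot>\<^sub>m adj_mat X) * det X = 1"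
    using 1 X adj_mat[of X N] unfolding GL_ops by (metis det_mult det_one smult_carrier_mat)
  then have "det (inverse (det X) \<cdot>\<^sub>m adj_mat X) \<noteq> 0" by (metis mult_zero_left zero_neq_one)
  then show "inverse (det X) \<cdot>\<^sub>m adj_mat X \<in> carrier (GL N)"
    using X adj_mat[of X N] by (subst GL_carrier) auto
qed

lemma GLf_sum: "(\<And>x. x \<in> A \<Longrightarrow> p x \<in> GL_functions N) \<Longrightarrow> (\<lambda>X. \<Sum>x\<in>A. p x X) \<in> GL_functions N"
  by (induct A rule: infinite_finite_induct) (auto intro: GL_functions.const GL_functions.add)

lemma GLf_prod: "(\<And>x. x \<in> A \<Longrightarrow> p x \<in> GL_functions N) \<Longrightarrow> (\<lambda>X. \<Prod>x\<in>A. p x X) \<in> GL_functions N"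
  by (induct A rule: infinite_finite_induct) (auto intro: GL_functions.const GL_functions.mult)

lemma GLf_det:
  assumes M: "\<And>X. M X \<in> carrier_mat n n" and e: "\<And>i j. i < n \<Longrightarrow> j < n \<Longrightarrow> (\<lambda>X. M X $$ (i, j)) \<in> GL_functions N"
  shows "(\<lambda>X. det (M X)) \<in> GL_functions N"
proof -
  have eq: "(\<lambda>X. det (M X)) = (\<lambda>X. \<Sum>p | p permutes {0..<n}. signof p * (\<Prod>i=0..<n. M X $$ (i, p i)))"
    using det_def'[OF M] by (intro ext) auto
  show ?thesis unfolding eq
  proof (intro GLf_sum GL_functions.mult GL_functions.const GLf_prod e)
    fix p i assume "p \<in> {p. p permutes {0..<n}}" "i \<in> {0..<n}"
    then show "p i < n" using permutes_in_image[of p "{0..<n}" i] by auto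
  qed auto
qed

text \<open>The entries of the inverse are cofactors divided by the determinant.\<close>

lemma GLf_inverse:
  assumes "f \<in> GL_functions N"
  shows "\<exists>f'\<in>GL_functions N. \<forall>X\<in>carrier (GL N). f' X = f (inv\<^bsub>GL N\<^esub> X)"
  using assms
proof induct
  case (const c)
  show ?case by (intro bexI[of _ "\<lambda>_. c"]) (auto intro: GL_functions.const)
next
  case (entry i j)
  define T where "T X = Matrix.mat N N (\<lambda>(a, b). X $$ (a, b))" for X :: "'a mat"
  let ?f = "\<lambda>X. inverse (det X) * cofactor (T X) j i"
  have "(\<lambda>X. mat_delete (T X) j i $$ (a, b)) \<in> GL_functions N" if "a < N - 1" "b < N - 1" for a b
    using that entry by (auto simp: mat_delete_def T_def intro!: GL_functions.entry)
  then have "?f \<in> GL_functions N"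
    unfolding cofactor_def
    by (intro GL_functions.mult GL_functions.inv_det GL_functions.const GLf_det[of _ "N - 1"]) (auto simp: mat_delete_def T_def)
  moreover have "?f X = (inv\<^bsub>GL N\<^esub> X) $$ (i, j)" if X: "X \<in> carrier (GL N)" for X
  proof -
    have Xc: "X \<in> carrier_mat N N" using X GL_carrier by auto
    have "T X = X" using Xc by (auto simp: T_def)
    then show ?thesis using Xc entry by (simp add: GL_inv[OF X] adj_mat_def)
  qed
  ultimately show ?case by (intro bexI[of _ ?f]) auto
next
  case inv_det
  define T where "T X = Matrix.mat N N (\<lambda>(a, b). X $$ (a, b))" for X :: "'a mat"
  have "(\<lambda>X. det (T X)) \<in> GL_functions N" by (rule GLf_det) (auto simp: T_def intro: GL_functions.entry)
  moreover have "det (T X) = inverse (det (inv\<^bsub>GL N\<^esub> X))" if X: "X \<in> carrier (GL N)" for X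
  proof -
    have Xc: "X \<in> carrier_mat N N" and Y: "inv\<^bsub>GL N\<^esub> X \<in> carrier_mat N N"
      using X group.inv_closed[OF GL_group X] GL_carrier by auto
    have T: "T X = X" using Xc by (auto simp: T_def)
    have "X * inv\<^bsub>GL N\<^esub> X = 1\<^sub>m N" using group.r_inv[OF GL_group X] by (simp add: GL_ops)
    then have "det X * det (inv\<^bsub>GL N\<^esub> X) = 1" using det_mult[OF Xc Y] by simp
    then show ?thesis unfolding T by (metis inverse_unique mult.commute)
  qed
  ultimately show ?case by (intro bexI[of _ "\<lambda>X. det (T X)"]) auto
next
  case (add p q)
  then obtain p' q' where "p' \<in> GL_functions N" "\<forall>X\<in>carrier (GL N). p' X = p (inv\<^bsub>GL N\<^esub> X)"
    "q' \<in> GL_functions N" "\<forall>X\<in>carrier (GL N). q' X = q (inv\<^bsub>GL N\<^esub> X)" by blast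
  then show ?case by (intro bexI[of _ "\<lambda>X. p' X + q' X"]) (auto intro: GL_functions.add)
next
  case (mult p q)
  then obtain p' q' where "p' \<in> GL_functions N" "\<forall>X\<in>carrier (GL N). p' X = p (inv\<^bsub>GL N\<^esub> X)"
    "q' \<in> GL_functions N" "\<forall>X\<in>carrier (GL N). q' X = q (inv\<^bsub>GL N\<^esub> X)" by blast
  then show ?case by (intro bexI[of _ "\<lambda>X. p' X * q' X"]) (auto intro: GL_functions.mult)
qed

locale kspace = vectorspace "class_ring :: 'k ring" M for M :: "('k::field, 'a) module" (structure)
begin

definition lc :: "('i \<Rightarrow> 'k) \<Rightarrow> ('i \<Rightarrow> 'a) \<Rightarrow> 'i set \<Rightarrow> 'a" where
  "lc c b A = (\<Oplus>i\<in>A. c i \<odot> b i)"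

lemma smult_k: "x \<in> carrier M \<Longrightarrow> c \<odot> x \<in> carrier M"
  "x \<in> carrier M \<Longrightarrow> (c + d) \<odot> x = c \<odot> x \<oplus> d \<odot> x"
  "x \<in> carrier M \<Longrightarrow> y \<in> carrier M \<Longrightarrow> c \<odot> (x \<oplus> y) = c \<odot> x \<oplus> c \<odot> y"
  "x \<in> carrier M \<Longrightarrow> (c * d) \<odot> x = c \<odot> (d \<odot> x)"
  "x \<in> carrier M \<Longrightarrow> 1 \<odot> x = x" "x \<in> carrier M \<Longrightarrow> 0 \<odot> x = \<zero>" "c \<odot> \<zero> = \<zero>"
  using smult_closed[of c x] smult_l_distr[of c d x] smult_r_distr[of c x y] smult_assoc1[of c d x] smult_one[of x]
    smult_l_null[of x] smult_r_null[of c] by auto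

lemma lc_closed: "(\<And>i. i \<in> A \<Longrightarrow> b i \<in> carrier M) \<Longrightarrow> lc c b A \<in> carrier M"
  unfolding lc_def by (rule finsum_closed) (auto intro: smult_k)

lemma lc_empty: "lc c b {} = \<zero>" by (simp add: lc_def)

lemma lc_insert: "finite A \<Longrightarrow> x \<notin> A \<Longrightarrow> (\<And>i. i \<in> insert x A \<Longrightarrow> b i \<in> carrier M) \<Longrightarrow>
   lc c b (insert x A) = c x \<odot> b x \<oplus> lc c b A"
  unfolding lc_def by (rule finsum_insert) (auto intro: smult_k)

lemma lc_cong: "(\<And>i. i \<in> A \<Longrightarrow> b i \<in> carrier M) \<Longrightarrow> (\<And>i. i \<in> A \<Longrightarrow> c i = c' i \<and> b i = b' i) \<Longrightarrow> lc c b A = lc c' b' A"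
  unfolding lc_def by (rule finsum_cong') (auto intro: smult_k)

lemma lc_add: "(\<And>i. i \<in> A \<Longrightarrow> b i \<in> carrier M) \<Longrightarrow> lc (\<lambda>i. c i + d i) b A = lc c b A \<oplus> lc d b A"
proof -
  assume b: "\<And>i. i \<in> A \<Longrightarrow> b i \<in> carrier M"
  have "lc c b A \<oplus> lc d b A = (\<Oplus>i\<in>A. c i \<odot> b i \<oplus> d i \<odot> b i)"
    unfolding lc_def by (rule finsum_addf[symmetric]) (use b smult_k in auto)
  also have "\<dots> = lc (\<lambda>i. c i + d i) b A"
    unfolding lc_def by (rule finsum_cong') (use b smult_k in auto)
  finally show ?thesis ..
qed

lemma lc_zero: "(\<And>i. i \<in> A \<Longrightarrow> b i \<in> carrier M) \<Longrightarrow> lc (\<lambda>i. 0) b A = \<zero>"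
  unfolding lc_def by (rule add.finprod_one_eqI) (simp add: smult_k)

lemma lc_smult: "finite A \<Longrightarrow> (\<And>i. i \<in> A \<Longrightarrow> b i \<in> carrier M) \<Longrightarrow> lc (\<lambda>i. a * c i) b A = a \<odot> lc c b A"
proof (induct A rule: finite_induct)
  case (insert x G)
  have "lc c b G \<in> carrier M" "b x \<in> carrier M" using insert by (auto intro: lc_closed)
  moreover have "lc c' b (insert x G) = c' x \<odot> b x \<oplus> lc c' b G" for c'
    by (rule lc_insert) (use insert in auto)
  ultimately show ?case using insert by (simp add: smult_k)
qed (simp add: lc_empty smult_k)

lemma lc_lc: "finite A \<Longrightarrow> finite B \<Longrightarrow> (\<And>i. i \<in> B \<Longrightarrow> b i \<in> carrier M) \<Longrightarrow>
   lc c (\<lambda>y. lc (d y) b B) A = lc (\<lambda>i. \<Sum>y\<in>A. c y * d y i) b B"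
proof (induct A rule: finite_induct)
  case empty
  then show ?case using lc_zero[of B b] by (simp add: lc_empty)
next
  case (insert x G)
  have "lc c (\<lambda>y. lc (d y) b B) (insert x G) = c x \<odot> lc (d x) b B \<oplus> lc (\<lambda>i. \<Sum>y\<in>G. c y * d y i) b B"
    using insert by (simp add: lc_insert lc_closed)
  also have "\<dots> = lc (\<lambda>i. c x * d x i + (\<Sum>y\<in>G. c y * d y i)) b B"
    using insert by (simp add: lc_add lc_smult)
  finally show ?case using insert by simp
qed

lemma lc_delta: assumes "finite A" "j \<in> A" "\<And>i. i \<in> A \<Longrightarrow> b i \<in> carrier M"
  shows "lc (\<lambda>i. if i = j then 1 else 0) b A = b j"
proof -
  have "lc (\<lambda>i. if i = j then 1 else 0) b A = (\<Oplus>i\<in>A. if j = i then b i else \<zero>)"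
    unfolding lc_def by (rule finsum_cong') (use assms smult_k in auto)
  also have "\<dots> = b j" by (rule add.finprod_singleton) (use assms in auto)
  finally show ?thesis .
qed

lemma span_lc: assumes "finite U" "U \<subseteq> carrier M"
  shows "x \<in> span U \<longleftrightarrow> (\<exists>c. x = lc c (\<lambda>u. u) U)"
  unfolding finite_span[OF assms] lincomb_def lc_def by auto

lemma span_fd: assumes "finite U" "U \<subseteq> carrier M" shows "fin_dim_subspace M (span U)"
proof
  show 1: "VectorSpace.subspace class_ring (span U) M" by (rule span_is_subspace[OF assms(2)])
  interpret W: vectorspace class_ring "M\<lparr>carrier := span U\<rparr>" by (rule subspace_is_vs[OF 1])
  have sub: "U \<subseteq> span U" by (rule in_own_span[OF assms(2)])
  have "W.span U = span U"
    using span_li_not_depend(1)[OF sub] span_is_submodule[OF assms(2)] by simp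
  then show "W.fin_dim" unfolding W.fin_dim_def using assms sub by auto
qed

definition coord_basis :: "'a set \<Rightarrow> 'a list \<Rightarrow> bool" where
  "coord_basis W bs \<longleftrightarrow> distinct bs \<and> set bs \<subseteq> W \<and> W \<subseteq> carrier M \<and>
    vectorspace.basis class_ring (M\<lparr>carrier := W\<rparr>) (set bs) \<and>
    (\<forall>x\<in>W. \<exists>c. x = lc c (\<lambda>i. bs ! i) {..<length bs}) \<and>
    (\<forall>c d. lc c (\<lambda>i. bs ! i) {..<length bs} = lc d (\<lambda>i. bs ! i) {..<length bs} \<longrightarrow> (\<forall>i<length bs. c i = d i))"

lemma fd_basis:
  assumes "fin_dim_subspace M W"
  shows "\<exists>bs. coord_basis W bs"
proof -
  have sub: "VectorSpace.subspace class_ring W M" and fd: "vectorspace.fin_dim class_ring (M\<lparr>carrier := W\<rparr>)" using assms by auto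
  interpret W: vectorspace class_ring "M\<lparr>carrier := W\<rparr>" by (rule subspace_is_vs[OF sub])
  have sm: "submodule class_ring W M" using sub by (simp add: subspace_def)
  have WM: "W \<subseteq> carrier M" using sm by (simp add: submodule_def)
  obtain \<beta> where \<beta>: "finite \<beta>" "W.basis \<beta>" using W.finite_basis_exists[OF fd] by blast
  then have b: "W.gen_set \<beta>" "W.lin_indpt \<beta>" "\<beta> \<subseteq> W" by (auto simp: W.basis_def)
  obtain bs where bs: "set bs = \<beta>" "distinct bs" using finite_distinct_list[OF \<beta>(1)] by blast
  have \<beta>M: "\<beta> \<subseteq> carrier M" using b WM by auto
  have sp: "span \<beta> = W" using b(1) span_li_not_depend(1)[OF b(3) sm] by simp
  have li: "lin_indpt \<beta>" using b(2) span_li_not_depend(2)[OF b(3) sm] by simp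
  have bij: "bij_betw (\<lambda>i. bs ! i) {..<length bs} \<beta>" using bij_betw_nth[OF bs(2) refl] bs(1) by simp
  have re: "lc c (\<lambda>u. u) \<beta> = lc (\<lambda>i. c (bs ! i)) (\<lambda>i. bs ! i) {..<length bs}" for c
  proof -
    have "(\<Oplus>u\<in>(\<lambda>i. bs ! i) ` {..<length bs}. c u \<odot> u) = (\<Oplus>i\<in>{..<length bs}. c (bs ! i) \<odot> bs ! i)"
      by (rule finsum_reindex) (use bij \<beta>M smult_k in \<open>auto simp: bij_betw_def\<close>)
    then show ?thesis using bij by (simp add: lc_def bij_betw_def)
  qed
  show ?thesis
    unfolding coord_basis_def
  proof (rule exI[of _ bs], intro conjI ballI allI impI)
    show "\<exists>c. x = lc c (\<lambda>i. bs ! i) {..<length bs}" if "x \<in> W" for x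
    proof -
      have "x \<in> span \<beta>" using that sp by simp
      then have "\<exists>c. x = lc c (\<lambda>u. u) \<beta>" by (rule iffD1[OF span_lc[OF \<beta>(1) \<beta>M]])
      then obtain c where "x = lc c (\<lambda>u. u) \<beta>" by (rule exE)
      then have "x = lc (\<lambda>i. c (bs ! i)) (\<lambda>i. bs ! i) {..<length bs}" using re[of c] by (rule trans)
      then show ?thesis by (rule exI[of _ "\<lambda>i. c (bs ! i)"])
    qed
    fix c d i assume eq: "lc c (\<lambda>i. bs ! i) {..<length bs} = lc d (\<lambda>i. bs ! i) {..<length bs}" and i: "i < length bs"
    define ix where "ix = inv_into {..<length bs} (\<lambda>i. bs ! i)"
    have ix: "ix (bs ! i) = i" if "i < length bs" for i
      unfolding ix_def using bij that by (intro inv_into_f_f) (auto simp: bij_betw_def)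
    have bc: "bs ! i \<in> carrier M" if "i \<in> {..<length bs}" for i using that bs \<beta>M by (auto simp: set_conv_nth)
    have "lc (\<lambda>u. c (ix u) + (- 1) * d (ix u)) (\<lambda>u. u) \<beta> = lc (\<lambda>i. c i + (- 1) * d i) (\<lambda>i. bs ! i) {..<length bs}"
      unfolding re by (rule lc_cong) (use bc ix in auto)
    also have "\<dots> = lc c (\<lambda>i. bs ! i) {..<length bs} \<oplus> (- 1) \<odot> lc d (\<lambda>i. bs ! i) {..<length bs}"
      using lc_add[of "{..<length bs}" "\<lambda>i. bs ! i" c "\<lambda>i. (-1) * d i"] lc_smult[of "{..<length bs}" "\<lambda>i. bs ! i" "-1" d] bc by simp
    also have "\<dots> = lc (\<lambda>i. d i + (- 1) * d i) (\<lambda>i. bs ! i) {..<length bs}"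
      unfolding eq using lc_add[of "{..<length bs}" "\<lambda>i. bs ! i" d "\<lambda>i. (-1) * d i"] lc_smult[of "{..<length bs}" "\<lambda>i. bs ! i" "-1" d] bc by simp
    also have "\<dots> = \<zero>" using lc_zero[of "{..<length bs}" "\<lambda>i. bs ! i"] bc by simp
    finally have "lincomb (\<lambda>u. c (ix u) + (- 1) * d (ix u)) \<beta> = \<zero>" by (simp add: lincomb_def lc_def)
    then have "c (ix u) + (- 1) * d (ix u) = 0" if "u \<in> \<beta>" for u
      using not_lindepD[OF li \<beta>(1) subset_refl, of "\<lambda>u. c (ix u) + (- 1) * d (ix u)"] that by auto
    from this[of "bs ! i"] show "c i = d i" using ix[OF i] bs i by auto
  qed (use bs b WM \<beta> in auto)
qed

text \<open>Expanding in a basis of the span, the matrix entries of the action are combinations of the given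
  coefficients. The inverse of the determinant is regular because it is the determinant at the inverse group
  element.\<close>

lemma rational_span:
  assumes G: "subgroup G (GL N)"
    and U: "finite U" "U \<subseteq> carrier M"
    and pp: "\<And>x y. pp x y \<in> GL_functions N"
    and \<gamma>U: "\<And>g y. g \<in> G \<Longrightarrow> y \<in> U \<Longrightarrow> \<gamma> g y = lc (\<lambda>x. pp x y g) (\<lambda>x. x) U"
    and \<gamma>: "\<And>g x. g \<in> G \<Longrightarrow> x \<in> carrier M \<Longrightarrow> \<gamma> g x \<in> carrier M"
      "\<And>g x y. g \<in> G \<Longrightarrow> x \<in> carrier M \<Longrightarrow> y \<in> carrier M \<Longrightarrow> \<gamma> g (x \<oplus> y) = \<gamma> g x \<oplus> \<gamma> g y"
      "\<And>g c x. g \<in> G \<Longrightarrow> x \<in> carrier M \<Longrightarrow> \<gamma> g (c \<odot> x) = c \<odot> \<gamma> g x"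
      "\<And>x. x \<in> carrier M \<Longrightarrow> \<gamma> (1\<^sub>m N) x = x"
      "\<And>g h x. g \<in> G \<Longrightarrow> h \<in> G \<Longrightarrow> x \<in> carrier M \<Longrightarrow> \<gamma> (g * h) x = \<gamma> g (\<gamma> h x)"
  shows "fin_dim_subspace M (span U) \<and> (\<forall>g\<in>G. \<gamma> g ` span U \<subseteq> span U) \<and> algebraic_representation_on N G M \<gamma> (span U)"
proof (intro conjI)
  show fd: "VectorSpace.subspace class_ring (span U) M" "vectorspace.fin_dim class_ring (M\<lparr>carrier := span U\<rparr>)"
    using span_fd[OF U] by auto
  have Uc: "u \<in> carrier M" if "u \<in> U" for u using that U by auto
  have \<gamma>0: "\<gamma> g \<zero> = \<zero>" if "g \<in> G" for g
    using \<gamma>(3)[OF that, of \<zero> 0] \<gamma>(1)[OF that, of \<zero>] by (simp add: smult_k)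
  have \<gamma>lc: "\<gamma> g (lc c b A) = lc c (\<lambda>i. \<gamma> g (b i)) A" if g: "g \<in> G" and "finite A" "\<And>i. i \<in> A \<Longrightarrow> b i \<in> carrier M" for g c and b :: "'i \<Rightarrow> 'a" and A
    using that(2,3)
  proof (induct A rule: finite_induct)
    case empty
    then show ?case using \<gamma>0[OF g] by (simp add: lc_empty)
  next
    case (insert x H)
    have 1: "lc c b (insert x H) = c x \<odot> b x \<oplus> lc c b H" by (rule lc_insert) (use insert in auto)
    have 2: "lc c (\<lambda>i. \<gamma> g (b i)) (insert x H) = c x \<odot> \<gamma> g (b x) \<oplus> lc c (\<lambda>i. \<gamma> g (b i)) H" by (rule lc_insert) (use insert \<gamma>(1)[OF g] in auto)
    have cc: "b x \<in> carrier M" "lc c b H \<in> carrier M" using insert by (auto intro: lc_closed)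
    show ?case unfolding 1 2 using insert cc g by (simp add: \<gamma> smult_k)
  qed
  obtain bs where "coord_basis (span U) bs" using fd_basis[OF span_fd[OF U]] by (rule exE)
  then have bs: "distinct bs" "set bs \<subseteq> span U" "span U \<subseteq> carrier M"
    and basis: "vectorspace.basis class_ring (M\<lparr>carrier := span U\<rparr>) (set bs)"
    and ex: "\<And>x. x \<in> span U \<Longrightarrow> \<exists>c. x = lc c (\<lambda>i. bs ! i) {..<length bs}"
    and un: "\<And>c d i. lc c (\<lambda>i. bs ! i) {..<length bs} = lc d (\<lambda>i. bs ! i) {..<length bs} \<Longrightarrow> i < length bs \<Longrightarrow> c i = d i"
    unfolding coord_basis_def by blast+
  define L where "L = length bs"
  note ex = ex[folded L_def] and un = un[folded L_def]
  have bc: "bs ! i \<in> carrier M" if "i \<in> {..<L}" for i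
  proof -
    have "bs ! i \<in> set bs" using that by (simp add: L_def)
    then show ?thesis using bs(2,3) by blast
  qed
  define D where "D x = (SOME c. x = lc c (\<lambda>i. bs ! i) {..<L})" for x
  have D: "u = lc (D u) (\<lambda>i. bs ! i) {..<L}" if "u \<in> U" for u
  proof -
    have "u \<in> span U" using in_own_span[OF U(2)] that by auto
    from someI_ex[OF ex[OF this]] show ?thesis unfolding D_def .
  qed
  define C where "C j = (SOME c. bs ! j = lc c (\<lambda>u. u) U)" for j
  have C: "bs ! j = lc (C j) (\<lambda>u. u) U" if "j < L" for j
  proof -
    have "bs ! j \<in> span U" using bs that by (auto simp: L_def)
    from someI_ex[OF iffD1[OF span_lc[OF U] this]] show ?thesis unfolding C_def .
  qed
  define \<rho> where "\<rho> g = Matrix.mat L L (\<lambda>(i, j). \<Sum>y\<in>U. C j y * (\<Sum>x\<in>U. pp x y g * D x i))" for g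
  have \<rho>c: "\<rho> g \<in> carrier_mat L L" for g by (simp add: \<rho>_def)
  have \<gamma>y: "\<gamma> g y = lc (\<lambda>i. \<Sum>x\<in>U. pp x y g * D x i) (\<lambda>i. bs ! i) {..<L}" if g: "g \<in> G" and y: "y \<in> U" for g y
  proof -
    have "\<gamma> g y = lc (\<lambda>x. pp x y g) (\<lambda>x. lc (D x) (\<lambda>i. bs ! i) {..<L}) U"
      unfolding \<gamma>U[OF g y] by (rule lc_cong) (use Uc D in auto)
    also have "\<dots> = lc (\<lambda>i. \<Sum>x\<in>U. pp x y g * D x i) (\<lambda>i. bs ! i) {..<L}" by (rule lc_lc) (use U bc in auto)
    finally show ?thesis .
  qed
  have \<gamma>b: "\<gamma> g (bs ! j) = lc (\<lambda>i. \<rho> g $$ (i, j)) (\<lambda>i. bs ! i) {..<L}" if g: "g \<in> G" and j: "j < L" for g j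
  proof -
    have "\<gamma> g (bs ! j) = lc (C j) (\<lambda>y. \<gamma> g y) U"
      unfolding C[OF j] using \<gamma>lc[OF g U(1), of "\<lambda>u. u"] Uc by simp
    also have "\<dots> = lc (C j) (\<lambda>y. lc (\<lambda>i. \<Sum>x\<in>U. pp x y g * D x i) (\<lambda>i. bs ! i) {..<L}) U"
      by (rule lc_cong) (blast intro: \<gamma>(1)[OF g] Uc, use \<gamma>y[OF g] in auto)
    also have "\<dots> = lc (\<lambda>i. \<Sum>y\<in>U. C j y * (\<Sum>x\<in>U. pp x y g * D x i)) (\<lambda>i. bs ! i) {..<L}" by (rule lc_lc) (use U bc in auto)
    also have "\<dots> = lc (\<lambda>i. \<rho> g $$ (i, j)) (\<lambda>i. bs ! i) {..<L}" by (rule lc_cong) (use bc j in \<open>auto simp: \<rho>_def\<close>)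
    finally show ?thesis .
  qed
  have \<rho>1: "\<rho> (1\<^sub>m N) = 1\<^sub>m L"
  proof (rule eq_matI)
    fix i j assume "i < dim_row (1\<^sub>m L :: 'k mat)" "j < dim_col (1\<^sub>m L :: 'k mat)"
    then have ij: "i < L" "j < L" by auto
    have "1\<^sub>m N \<in> G" using subgroup.one_closed[OF G] by (simp add: GL_ops)
    from \<gamma>b[OF this ij(2)] have "lc (\<lambda>i. \<rho> (1\<^sub>m N) $$ (i, j)) (\<lambda>i. bs ! i) {..<L} = bs ! j" using \<gamma>(4) bc ij by simp
    also have "\<dots> = lc (\<lambda>i. if i = j then 1 else 0) (\<lambda>i. bs ! i) {..<L}" by (rule lc_delta[symmetric]) (use bc ij in auto)
    finally have "lc (\<lambda>i. \<rho> (1\<^sub>m N) $$ (i, j)) (\<lambda>i. bs ! i) {..<L} = lc (\<lambda>i. if i = j then 1 else 0) (\<lambda>i. bs ! i) {..<L}" .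
    from un[OF this ij(1)] show "\<rho> (1\<^sub>m N) $$ (i, j) = 1\<^sub>m L $$ (i, j)" using ij by simp
  qed (use \<rho>c in auto)
  have \<rho>m: "\<rho> (g * h) = \<rho> g * \<rho> h" if g: "g \<in> G" and h: "h \<in> G" for g h
  proof (rule eq_matI)
    fix i j assume "i < dim_row (\<rho> g * \<rho> h)" "j < dim_col (\<rho> g * \<rho> h)"
    then have ij: "i < L" "j < L" using \<rho>c by (auto simp: \<rho>_def)
    have gh: "g * h \<in> G" using subgroup.m_closed[OF G g h] by (simp add: GL_ops)
    have "lc (\<lambda>i. \<rho> (g * h) $$ (i, j)) (\<lambda>i. bs ! i) {..<L} = \<gamma> g (\<gamma> h (bs ! j))"
      unfolding \<gamma>b[OF gh ij(2), symmetric] using \<gamma>(5)[OF g h] bc ij by simp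
    also have "\<dots> = lc (\<lambda>i. \<rho> h $$ (i, j)) (\<lambda>l. \<gamma> g (bs ! l)) {..<L}"
      unfolding \<gamma>b[OF h ij(2)] by (rule \<gamma>lc[OF g]) (use bc in auto)
    also have "\<dots> = lc (\<lambda>l. \<rho> h $$ (l, j)) (\<lambda>l. lc (\<lambda>i. \<rho> g $$ (i, l)) (\<lambda>i. bs ! i) {..<L}) {..<L}"
      by (rule lc_cong) (blast intro: \<gamma>(1)[OF g] bc, use \<gamma>b[OF g] in auto)
    also have "\<dots> = lc (\<lambda>i. \<Sum>l<L. \<rho> h $$ (l, j) * \<rho> g $$ (i, l)) (\<lambda>i. bs ! i) {..<L}" by (rule lc_lc) (use bc in auto)
    finally have "\<rho> (g * h) $$ (i, j) = (\<Sum>l<L. \<rho> h $$ (l, j) * \<rho> g $$ (i, l))" using un[OF _ ij(1)] by blast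
    then show "\<rho> (g * h) $$ (i, j) = (\<rho> g * \<rho> h) $$ (i, j)"
      using ij \<rho>c[of g] \<rho>c[of h] by (simp add: scalar_prod_def atLeast0LessThan mult.commute)
  qed (use \<rho>c in \<open>auto simp: \<rho>_def\<close>)
  have GG: "g \<in> carrier (GL N)" if "g \<in> G" for g using subgroup.mem_carrier[OF G that] .
  have inv: "inv\<^bsub>GL N\<^esub> g \<in> G" "g * inv\<^bsub>GL N\<^esub> g = 1\<^sub>m N" if "g \<in> G" for g
    using subgroup.m_inv_closed[OF G that] group.r_inv[OF GL_group GG[OF that]] by (auto simp: GL_ops)
  have det: "det (\<rho> g) * det (\<rho> (inv\<^bsub>GL N\<^esub> g)) = 1" if "g \<in> G" for g
  proof -
    have "\<rho> g * \<rho> (inv\<^bsub>GL N\<^esub> g) = 1\<^sub>m L"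
      unfolding \<rho>m[OF that inv(1)[OF that], symmetric] inv(2)[OF that] by (rule \<rho>1)
    then show ?thesis using det_mult[OF \<rho>c \<rho>c, of g "inv\<^bsub>GL N\<^esub> g"] by simp
  qed
  then have \<rho>GL: "\<rho> g \<in> carrier (GL L)" if "g \<in> G" for g
    using \<rho>c[of g] that unfolding GL_carrier by (metis mult_zero_left zero_neq_one)
  have ent: "(\<lambda>X. \<rho> X $$ (i, j)) \<in> GL_functions N" if "i < L" "j < L" for i j
    unfolding \<rho>_def using that pp by (auto intro!: GLf_sum GL_functions.mult GL_functions.const)
  have reg: "q \<circ> \<rho> \<in> regular_functions N G" if q: "q \<in> regular_functions L (carrier (GL L))" for q
  proof -
    obtain p where p: "p \<in> GL_functions L" "\<And>X. X \<in> carrier (GL L) \<Longrightarrow> q X = p X" using q by (auto simp: regular_functions_def)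
    have "\<exists>f\<in>GL_functions N. \<forall>X\<in>G. p (\<rho> X) = f X" using p(1)
    proof induct
      case (const c)
      show ?case by (rule bexI[OF _ GL_functions.const[of c]]) simp
    next
      case (entry i j)
      show ?case by (rule bexI[OF _ ent[OF entry]]) simp
    next
      case inv_det
      have "(\<lambda>X. det (\<rho> X)) \<in> GL_functions N" by (rule GLf_det[OF \<rho>c ent])
      from GLf_inverse[OF this] obtain f where f: "f \<in> GL_functions N" "\<And>X. X \<in> carrier (GL N) \<Longrightarrow> f X = det (\<rho> (inv\<^bsub>GL N\<^esub> X))" by auto
      have "inverse (det (\<rho> X)) = f X" if "X \<in> G" for X
        using det[OF that] f(2)[OF GG[OF that]] by (metis inverse_unique)
      then show ?case using f(1) by (intro bexI[of _ f]) auto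
    next
      case (add p q)
      then obtain f f' where "f \<in> GL_functions N" "\<forall>X\<in>G. p (\<rho> X) = f X" "f' \<in> GL_functions N" "\<forall>X\<in>G. q (\<rho> X) = f' X" by blast
      then show ?case by (intro bexI[of _ "\<lambda>X. f X + f' X"]) (auto intro: GL_functions.add)
    next
      case (mult p q)
      then obtain f f' where "f \<in> GL_functions N" "\<forall>X\<in>G. p (\<rho> X) = f X" "f' \<in> GL_functions N" "\<forall>X\<in>G. q (\<rho> X) = f' X" by blast
      then show ?case by (intro bexI[of _ "\<lambda>X. f X * f' X"]) (auto intro: GL_functions.mult)
    qed
    then show ?thesis using p(2)[OF \<rho>GL] by (auto simp: regular_functions_def)
  qed
  have "algebraic_group_hom N G L (carrier (GL L)) \<rho>"
    unfolding algebraic_group_hom_def using reg \<rho>GL \<rho>m by (auto simp: hom_def GL_ops)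
  then show "algebraic_representation_on N G M \<gamma> (span U)"
    unfolding algebraic_representation_on_def using bs(1) basis \<gamma>b
    by (intro exI[of _ bs] exI[of _ \<rho>]) (auto simp: L_def lc_def)
  show "\<forall>g\<in>G. \<gamma> g ` span U \<subseteq> span U"
  proof (intro ballI subsetI, elim imageE)
    fix g y x assume g: "g \<in> G" and y: "y = \<gamma> g x" and x: "x \<in> span U"
    obtain c where c: "x = lc c (\<lambda>u. u) U" using iffD1[OF span_lc[OF U] x] by (rule exE)
    have "y = lc c (\<lambda>y. \<gamma> g y) U" unfolding y c using \<gamma>lc[OF g U(1), of "\<lambda>u. u"] Uc by simp
    also have "\<dots> = lc c (\<lambda>y. lc (\<lambda>x. pp x y g) (\<lambda>x. x) U) U"
      by (rule lc_cong) (blast intro: \<gamma>(1)[OF g] Uc, use \<gamma>U[OF g] in auto)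
    also have "\<dots> = lc (\<lambda>x. \<Sum>y\<in>U. c y * pp x y g) (\<lambda>x. x) U" by (rule lc_lc) (use U Uc in auto)
    finally show "y \<in> span U" by (intro iffD2[OF span_lc[OF U]] exI)
  qed
qed

end

section \<open>Coordinate algebras with a linear group action\<close>

text \<open>A set of points whose Zariski closure is irreducible; only finitely many coordinates are nonzero on it.\<close>

locale point_set =
  fixes Pts :: "(nat \<Rightarrow> 'k::{alg_closed_field, field_char_0}) set" and V :: "nat set"
  assumes fin: "finite V" and out: "\<And>p i. p \<in> Pts \<Longrightarrow> i \<notin> V \<Longrightarrow> p i = 0" and ne: "Pts \<noteq> {}"
    and irred: "\<And>p q f h. p \<in> Pts \<Longrightarrow> q \<in> Pts \<Longrightarrow> evk p f \<noteq> 0 \<Longrightarrow> evk q h \<noteq> 0 \<Longrightarrow>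
      \<exists>t\<in>Pts. evk t f \<noteq> 0 \<and> evk t h \<noteq> 0"
begin

text \<open>The class of \<open>f\<close> consists of all polynomials with the same values as \<open>f\<close> on the given points.\<close>

definition cls :: "((nat, 'k) mpol) \<Rightarrow> ((nat, 'k) mpol) set" where
  "cls f = {h. \<forall>p\<in>Pts. evk p h = evk p f}"

definition rp :: "((nat, 'k) mpol) set \<Rightarrow> (nat, 'k) mpol" where "rp X = (SOME f. f \<in> X)"

definition vl :: "(nat \<Rightarrow> 'k) \<Rightarrow> ((nat, 'k) mpol) set \<Rightarrow> 'k" where "vl p X = evk p (rp X)"

definition CC :: "'k fg_comm_alg" where
  "CC = \<lparr>carrier = range cls, mult = (\<lambda>X Y. cls (rp X * rp Y)), one = cls 1, zero = cls 0,
     add = (\<lambda>X Y. cls (rp X + rp Y)), smult = (\<lambda>c X. cls (mconst c * rp X))\<rparr>"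

lemma cls_eq: "cls f = cls h \<longleftrightarrow> (\<forall>p\<in>Pts. evk p f = evk p h)"
  unfolding cls_def by (auto simp: set_eq_iff)

lemma rp_cls: "p \<in> Pts \<Longrightarrow> evk p (rp (cls f)) = evk p f"
proof -
  assume "p \<in> Pts"
  have "f \<in> cls f" by (simp add: cls_def)
  then have "rp (cls f) \<in> cls f" unfolding rp_def by (rule someI)
  then show ?thesis using \<open>p \<in> Pts\<close> by (simp add: cls_def)
qed

lemma vl: "p \<in> Pts \<Longrightarrow> vl p (cls f) = evk p f" by (simp add: vl_def rp_cls)

lemma CC_carrier: "X \<in> carrier CC \<longleftrightarrow> X \<in> range cls" and cls_closed: "cls f \<in> carrier CC"
  by (auto simp: CC_def)

lemma CC_eqI: "X \<in> carrier CC \<Longrightarrow> Y \<in> carrier CC \<Longrightarrow> (\<And>p. p \<in> Pts \<Longrightarrow> vl p X = vl p Y) \<Longrightarrow> X = Y"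
proof -
  assume "X \<in> carrier CC" "Y \<in> carrier CC" and v: "\<And>p. p \<in> Pts \<Longrightarrow> vl p X = vl p Y"
  then obtain f h where "X = cls f" "Y = cls h" by (auto simp: CC_carrier)
  then show "X = Y" using v by (simp add: cls_eq vl)
qed

lemma cls_rp: "X \<in> carrier CC \<Longrightarrow> cls (rp X) = X"
proof -
  assume "X \<in> carrier CC"
  then obtain f where "X = cls f" by (auto simp: CC_carrier)
  then show ?thesis by (simp add: cls_eq rp_cls)
qed

lemma CC_simps: "X \<otimes>\<^bsub>CC\<^esub> Y = cls (rp X * rp Y)" "X \<oplus>\<^bsub>CC\<^esub> Y = cls (rp X + rp Y)" "\<one>\<^bsub>CC\<^esub> = cls 1" "\<zero>\<^bsub>CC\<^esub> = cls 0"
  "c \<odot>\<^bsub>CC\<^esub> X = cls (mconst c * rp X)"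
  by (simp_all add: CC_def)

lemma CC_closed: "X \<otimes>\<^bsub>CC\<^esub> Y \<in> carrier CC" "X \<oplus>\<^bsub>CC\<^esub> Y \<in> carrier CC" "\<one>\<^bsub>CC\<^esub> \<in> carrier CC" "\<zero>\<^bsub>CC\<^esub> \<in> carrier CC"
  "c \<odot>\<^bsub>CC\<^esub> X \<in> carrier CC"
  by (simp_all add: CC_simps cls_closed)

lemma CC_vl: "p \<in> Pts \<Longrightarrow> vl p (X \<otimes>\<^bsub>CC\<^esub> Y) = vl p X * vl p Y" "p \<in> Pts \<Longrightarrow> vl p (X \<oplus>\<^bsub>CC\<^esub> Y) = vl p X + vl p Y"
  "p \<in> Pts \<Longrightarrow> vl p \<one>\<^bsub>CC\<^esub> = 1" "p \<in> Pts \<Longrightarrow> vl p \<zero>\<^bsub>CC\<^esub> = 0" "p \<in> Pts \<Longrightarrow> vl p (c \<odot>\<^bsub>CC\<^esub> X) = c * vl p X"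
  by (simp_all add: CC_simps vl) (simp_all add: vl_def)

lemma cls_hom: "cls f \<otimes>\<^bsub>CC\<^esub> cls h = cls (f * h)" "cls f \<oplus>\<^bsub>CC\<^esub> cls h = cls (f + h)" "c \<odot>\<^bsub>CC\<^esub> cls f = cls (mconst c * f)"
  by (simp_all add: CC_simps cls_eq rp_cls)

lemma CC_abelian: "abelian_group CC"
proof (rule abelian_groupI)
  fix X assume X: "X \<in> carrier CC"
  show "\<exists>Y\<in>carrier CC. Y \<oplus>\<^bsub>CC\<^esub> X = \<zero>\<^bsub>CC\<^esub>"
    by (rule bexI[of _ "(- 1) \<odot>\<^bsub>CC\<^esub> X"], rule CC_eqI) (simp_all add: CC_closed CC_vl)
qed ((rule CC_eqI)?; simp add: CC_closed CC_vl algebra_simps)+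

lemma CC_cring: "cring CC"
proof (rule cringI[OF CC_abelian])
  show "comm_monoid CC" by (rule comm_monoidI; (rule CC_eqI)?; simp add: CC_closed CC_vl algebra_simps)
qed (rule CC_eqI; simp add: CC_closed CC_vl algebra_simps)

lemma CC_domain: "domain CC"
proof (rule domain.intro[OF CC_cring], unfold_locales)
  show "\<one>\<^bsub>CC\<^esub> \<noteq> \<zero>\<^bsub>CC\<^esub>" using ne by (auto simp: CC_simps cls_eq)
  fix X Y assume XY: "X \<otimes>\<^bsub>CC\<^esub> Y = \<zero>\<^bsub>CC\<^esub>" "X \<in> carrier CC" "Y \<in> carrier CC"
  obtain f h where fh: "X = cls f" "Y = cls h" using XY by (auto simp: CC_carrier)
  have 0: "evk p f * evk p h = 0" if "p \<in> Pts" for p using XY(1) that by (auto simp: fh cls_hom CC_simps(4) cls_eq)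
  show "X = \<zero>\<^bsub>CC\<^esub> \<or> Y = \<zero>\<^bsub>CC\<^esub>"
  proof (rule ccontr)
    assume "\<not> ?thesis"
    then obtain p q where "p \<in> Pts" "q \<in> Pts" "evk p f \<noteq> 0" "evk q h \<noteq> 0" by (auto simp: fh CC_simps(4) cls_eq)
    from irred[OF this] 0 show False by auto
  qed
qed

lemma CC_kspace: "kspace CC"
proof -
  have "Module.module (class_ring :: 'k ring) CC"
    by (rule moduleI[OF cring_class_ring CC_abelian]; (rule CC_eqI)?; simp add: CC_closed CC_vl algebra_simps)
  then show ?thesis unfolding kspace_def vectorspace_def using class_field.field_axioms by auto
qed

lemma CC_algebra: "is_algebra CC"
  unfolding is_algebra_def
proof (intro conjI ballI allI)
  show "ring CC" using CC_cring by (simp add: cring_def)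
  show "vectorspace (class_ring :: 'k ring) CC" using CC_kspace by (simp add: kspace_def)
qed (rule CC_eqI; simp add: CC_closed CC_vl algebra_simps)+

lemma CC_fg: "finitely_generated_algebra CC"
  unfolding finitely_generated_algebra_def
proof (intro exI conjI allI impI)
  let ?S = "(\<lambda>i. cls (mvar i)) ` V"
  show "finite ?S" using fin by simp
  show "?S \<subseteq> carrier CC" using cls_closed by auto
  fix T assume T: "subring T CC \<and> submodule (class_ring :: 'k ring) T CC \<and> ?S \<subseteq> T"
  then interpret T: subring T CC by simp
  have sm: "c \<odot>\<^bsub>CC\<^esub> x \<in> T" if "x \<in> T" for c x using T that unfolding submodule_def by auto
  have "cls f \<in> T" for f
  proof (induct f rule: mp_induct)
    case (const c)
    have "c \<odot>\<^bsub>CC\<^esub> \<one>\<^bsub>CC\<^esub> \<in> T" by (rule sm) (rule T.one_closed)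
    then show ?case by (simp add: CC_simps(3) cls_hom)
  next
    case (var i)
    show ?case
    proof (cases "i \<in> V")
      case False
      then have "cls (mvar i) = 0 \<odot>\<^bsub>CC\<^esub> \<one>\<^bsub>CC\<^esub>" using out by (simp add: CC_simps(3) cls_hom cls_eq)
      then show ?thesis using sm[OF T.one_closed, of 0] by simp
    qed (use T in auto)
  next
    case (add f g)
    then show ?case using subringE(7)[OF T.subring_axioms, of "cls f" "cls g"] by (simp add: cls_hom)
  next
    case (mult f g)
    then show ?case using T.m_closed[of "cls f" "cls g"] by (simp add: cls_hom)
  qed
  then show "T = carrier CC" using T.subset by (auto simp: CC_carrier)
qed

end

sublocale point_set \<subseteq> C: kspace CC by (rule CC_kspace)

context point_set
begin

lemma vl_lc: assumes "p \<in> Pts" "finite A" "\<And>i. i \<in> A \<Longrightarrow> b i \<in> carrier CC"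
  shows "vl p (C.lc c b A) = (\<Sum>i\<in>A. c i * vl p (b i))"
  using assms(2,3)
proof (induct A rule: finite_induct)
  case (insert x G)
  have "C.lc c b (insert x G) = c x \<odot>\<^bsub>CC\<^esub> b x \<oplus>\<^bsub>CC\<^esub> C.lc c b G" by (rule C.lc_insert) (use insert in auto)
  then show ?case using insert assms(1) by (simp add: CC_vl)
qed (use assms(1) in \<open>simp add: C.lc_empty CC_vl\<close>)

end

text \<open>The group moves points by linear maps with regular coefficients \<open>cf\<close>. The points need not be permuted: it
  is enough that moved points stay in the Zariski closure.\<close>

locale point_action = point_set Pts V
  for Pts :: "(nat \<Rightarrow> 'k::{alg_closed_field, field_char_0}) set" and V +
  fixes N :: nat and G :: "'k mat set" and cf :: "nat \<Rightarrow> nat \<Rightarrow> 'k mat \<Rightarrow> 'k"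
  assumes G: "subgroup G (GL N)" and cf: "\<And>i j. cf i j \<in> GL_functions N"
    and stable: "\<And>g p f. g \<in> G \<Longrightarrow> p \<in> Pts \<Longrightarrow> evk (\<lambda>i. \<Sum>j\<in>V. cf i j g * p j) f \<noteq> 0 \<Longrightarrow> \<exists>q\<in>Pts. evk q f \<noteq> 0"
    and act_one: "\<And>p i. p \<in> Pts \<Longrightarrow> (\<Sum>j\<in>V. cf i j (1\<^sub>m N) * p j) = p i"
    and act_mult: "\<And>g h p i. g \<in> G \<Longrightarrow> h \<in> G \<Longrightarrow> p \<in> Pts \<Longrightarrow>
      (\<Sum>j\<in>V. cf i j (g * h) * p j) = (\<Sum>j\<in>V. cf i j h * (\<Sum>l\<in>V. cf j l g * p l))"
begin

definition "mv g p = (\<lambda>i. \<Sum>j\<in>V. cf i j g * p j)"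
definition sg :: "'k mat \<Rightarrow> nat \<Rightarrow> (nat, 'k) mpol" where "sg g i = (\<Sum>j\<in>V. mconst (cf i j g) * mvar j)"
definition \<gamma> where "\<gamma> g X = (if X \<in> carrier CC then cls (subst (sg g) (rp X)) else undefined)"

lemma evk_sg: "evk p (subst (sg g) f) = evk (mv g p) f"
  by (simp add: evk_subst sg_def mv_def evk_sum)

text \<open>Moved points satisfy the relations of the given points, by \<open>stable\<close>.\<close>

lemma mv_eq: assumes "g \<in> G" "p \<in> Pts" "\<And>q. q \<in> Pts \<Longrightarrow> evk q f = evk q h" shows "evk (mv g p) f = evk (mv g p) h"
proof (rule ccontr)
  assume "\<not> ?thesis"
  then have "evk (\<lambda>i. \<Sum>j\<in>V. cf i j g * p j) (f - h) \<noteq> 0" by (simp add: mv_def)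
  from stable[OF assms(1,2) this] assms(3) show False by auto
qed

lemma \<gamma>_cls: "g \<in> G \<Longrightarrow> \<gamma> g (cls f) = cls (subst (sg g) f)"
  unfolding \<gamma>_def by (simp add: cls_closed cls_eq evk_sg) (intro ballI mv_eq rp_cls)

lemma vl_\<gamma>: "g \<in> G \<Longrightarrow> p \<in> Pts \<Longrightarrow> X \<in> carrier CC \<Longrightarrow> vl p (\<gamma> g X) = evk (mv g p) (rp X)"
  by (simp add: \<gamma>_def vl evk_sg)

lemma G_one: "1\<^sub>m N \<in> G" and G_mult: "g \<in> G \<Longrightarrow> h \<in> G \<Longrightarrow> g * h \<in> G"
  using subgroup.one_closed[OF G] subgroup.m_closed[OF G, of g h] by (auto simp: GL_ops)

lemma \<gamma>_one: "X \<in> carrier CC \<Longrightarrow> \<gamma> (1\<^sub>m N) X = X"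
proof -
  assume "X \<in> carrier CC"
  then obtain f where f: "X = cls f" by (auto simp: CC_carrier)
  have "mv (1\<^sub>m N) p = p" if "p \<in> Pts" for p using act_one[OF that] by (simp add: mv_def)
  then show ?thesis by (simp add: f \<gamma>_cls[OF G_one] cls_eq evk_sg)
qed

lemma \<gamma>_mult: "g \<in> G \<Longrightarrow> h \<in> G \<Longrightarrow> X \<in> carrier CC \<Longrightarrow> \<gamma> (g * h) X = \<gamma> g (\<gamma> h X)"
proof -
  assume gh: "g \<in> G" "h \<in> G" and "X \<in> carrier CC"
  then obtain f where f: "X = cls f" by (auto simp: CC_carrier)
  have "mv (g * h) p = mv h (mv g p)" if "p \<in> Pts" for p using act_mult[OF gh that] by (simp add: mv_def)
  then show ?thesis by (simp add: f \<gamma>_cls gh G_mult cls_eq evk_sg)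
qed

lemma \<gamma>_closed: "g \<in> G \<Longrightarrow> X \<in> carrier CC \<Longrightarrow> \<gamma> g X \<in> carrier CC" by (simp add: \<gamma>_def cls_closed)

lemma \<gamma>_ops:
  assumes g: "g \<in> G" and XY: "X \<in> carrier CC" "Y \<in> carrier CC"
  shows "\<gamma> g (X \<otimes>\<^bsub>CC\<^esub> Y) = \<gamma> g X \<otimes>\<^bsub>CC\<^esub> \<gamma> g Y" "\<gamma> g (X \<oplus>\<^bsub>CC\<^esub> Y) = \<gamma> g X \<oplus>\<^bsub>CC\<^esub> \<gamma> g Y" "\<gamma> g (c \<odot>\<^bsub>CC\<^esub> X) = c \<odot>\<^bsub>CC\<^esub> \<gamma> g X"
proof -
  obtain f h where "X = cls f" "Y = cls h" using XY by (auto simp: CC_carrier)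
  then show "\<gamma> g (X \<otimes>\<^bsub>CC\<^esub> Y) = \<gamma> g X \<otimes>\<^bsub>CC\<^esub> \<gamma> g Y" "\<gamma> g (X \<oplus>\<^bsub>CC\<^esub> Y) = \<gamma> g X \<oplus>\<^bsub>CC\<^esub> \<gamma> g Y"
    "\<gamma> g (c \<odot>\<^bsub>CC\<^esub> X) = c \<odot>\<^bsub>CC\<^esub> \<gamma> g X" by (simp_all add: cls_hom \<gamma>_cls[OF g])
qed

lemma \<gamma>_hom: "g \<in> G \<Longrightarrow> \<gamma> g \<in> alg_hom CC CC"
  unfolding alg_hom_def using \<gamma>_closed[of g] \<gamma>_ops[of g] CC_closed
  by (auto intro!: ring_hom_memI simp: CC_simps(3) \<gamma>_cls)

lemma group_action_criterion:
  assumes closed: "\<And>g x. g \<in> G \<Longrightarrow> x \<in> E \<Longrightarrow> f g x \<in> E" and ext: "\<And>g x. g \<in> G \<Longrightarrow> x \<notin> E \<Longrightarrow> f g x = undefined"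
    and one: "\<And>x. x \<in> E \<Longrightarrow> f (1\<^sub>m N) x = x" and mult: "\<And>g h x. g \<in> G \<Longrightarrow> h \<in> G \<Longrightarrow> x \<in> E \<Longrightarrow> f (g * h) x = f g (f h x)"
  shows "group_action (GL N\<lparr>carrier := G\<rparr>) E f"
proof -
  have inv: "inv\<^bsub>GL N\<^esub> g \<in> G" "g * inv\<^bsub>GL N\<^esub> g = 1\<^sub>m N" "inv\<^bsub>GL N\<^esub> g * g = 1\<^sub>m N" if "g \<in> G" for g
    using subgroup.m_inv_closed[OF G that] group.r_inv[OF GL_group subgroup.mem_carrier[OF G that]]
      group.l_inv[OF GL_group subgroup.mem_carrier[OF G that]] by (auto simp: GL_ops)
  have bij: "f g \<in> Bij E" if g: "g \<in> G" for g
    unfolding Bij_def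
  proof (intro IntI CollectI)
    show "f g \<in> extensional E" using ext[OF g] by (simp add: extensional_def)
    show "bij_betw (f g) E E"
      by (rule bij_betw_byWitness[of _ "f (inv\<^bsub>GL N\<^esub> g)"])
         (use closed g inv[OF g] one mult[OF g inv(1)[OF g]] mult[OF inv(1)[OF g] g] in \<open>auto simp flip: \<close>)
  qed
  have "group (GL N\<lparr>carrier := G\<rparr>)" by (rule subgroup.subgroup_is_group[OF G GL_group])
  moreover have "f \<in> hom (GL N\<lparr>carrier := G\<rparr>) (BijGroup E)"
  proof (rule homI)
    fix g h assume "g \<in> carrier (GL N\<lparr>carrier := G\<rparr>)" "h \<in> carrier (GL N\<lparr>carrier := G\<rparr>)"
    then have gh: "g \<in> G" "h \<in> G" by auto
    have "f (g * h) = compose E (f g) (f h)"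
      using mult[OF gh] ext[OF G_mult[OF gh]] by (auto simp: compose_def)
    then show "f (g \<otimes>\<^bsub>GL N\<lparr>carrier := G\<rparr>\<^esub> h) = f g \<otimes>\<^bsub>BijGroup E\<^esub> f h"
      using bij gh by (simp add: GL_ops BijGroup_def)
  qed (use bij in \<open>auto simp: BijGroup_def\<close>)
  ultimately show ?thesis
    by (intro group_action.intro group_hom.intro group_hom_axioms.intro group_BijGroup)
qed

lemma \<gamma>_action: "algebra_action (GL N\<lparr>carrier := G\<rparr>) CC \<gamma>"
  unfolding algebra_action_def
  using group_action_criterion[of "carrier CC" \<gamma>] \<gamma>_closed \<gamma>_one \<gamma>_mult \<gamma>_hom by (simp add: \<gamma>_def)

text \<open>Finite sets of polynomials that the group maps into their span, with regular coefficients. They are sets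
  rather than lists, so that unions and products are again of this kind without bookkeeping.\<close>

definition stable_coeffs :: "((nat, 'k) mpol) set \<Rightarrow> (((nat, 'k) mpol) \<Rightarrow> ((nat, 'k) mpol) \<Rightarrow> 'k mat \<Rightarrow> 'k) \<Rightarrow> bool" where
  "stable_coeffs U pp \<longleftrightarrow> finite U \<and> (\<forall>x y. pp x y \<in> GL_functions N) \<and>
     (\<forall>g\<in>G. \<forall>y\<in>U. \<forall>p\<in>Pts. evk (mv g p) y = (\<Sum>x\<in>U. pp x y g * evk p x))"

definition stable_fam :: "((nat, 'k) mpol) set \<Rightarrow> bool" where
  "stable_fam U \<longleftrightarrow> (\<exists>pp. stable_coeffs U pp)"

lemma stable_fam_I: "finite U \<Longrightarrow> (\<And>x y. pp x y \<in> GL_functions N) \<Longrightarrow>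
    (\<And>g y p. g \<in> G \<Longrightarrow> y \<in> U \<Longrightarrow> p \<in> Pts \<Longrightarrow> evk (mv g p) y = (\<Sum>x\<in>U. pp x y g * evk p x)) \<Longrightarrow> stable_fam U"
  unfolding stable_fam_def stable_coeffs_def by blast

lemma goodcD: assumes "stable_coeffs U pp"
  shows "finite U" "pp x y \<in> GL_functions N"
    "g \<in> G \<Longrightarrow> y \<in> U \<Longrightarrow> p \<in> Pts \<Longrightarrow> evk (mv g p) y = (\<Sum>x\<in>U. pp x y g * evk p x)"
  using assms unfolding stable_coeffs_def by auto

lemma stable_fam_finite: "stable_fam U \<Longrightarrow> finite U"
  unfolding stable_fam_def stable_coeffs_def by blast

lemma stable_fam_const: "stable_fam {mconst c}"
  by (rule stable_fam_I[of _ "\<lambda>x y g. 1"]) (auto intro: GL_functions.const)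

lemma inj_mvar: "inj (mvar :: nat \<Rightarrow> (nat, 'k) mpol)"
proof (rule injI)
  fix i j assume "mvar i = (mvar j :: (nat, 'k) mpol)"
  then have "evk (\<lambda>l. if l = i then 1 else 0) (mvar i) = (evk (\<lambda>l. if l = i then 1 else 0) (mvar j) :: 'k)" by simp
  then show "i = j" by (auto split: if_splits)
qed

lemma stable_fam_vars: "stable_fam (mvar ` V)"
proof (rule stable_fam_I[of _ "\<lambda>x y. cf (inv_into UNIV mvar y) (inv_into UNIV mvar x)"])
  fix g and y :: "(nat, 'k) mpol" and p assume "g \<in> G" "y \<in> mvar ` V" "p \<in> Pts"
  then obtain i where i: "i \<in> V" "y = mvar i" by auto
  show "evk (mv g p) y = (\<Sum>x\<in>mvar ` V. cf (inv_into UNIV mvar y) (inv_into UNIV mvar x) g * evk p x)"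
    by (subst sum.reindex) (use inj_mvar in \<open>auto simp: i mv_def intro: inj_on_subset\<close>)
qed (use fin cf in auto)

lemma stable_fam_Un: assumes "stable_fam U" "stable_fam W" shows "stable_fam (U \<union> W)"
proof -
  obtain pp where "stable_coeffs U pp" using assms(1) unfolding stable_fam_def by (rule exE)
  note U = goodcD[OF this]
  obtain qq where "stable_coeffs W qq" using assms(2) unfolding stable_fam_def by (rule exE)
  note W = goodcD[OF this]
  define ss where "ss x y = (if y \<in> U then (if x \<in> U then pp x y else (\<lambda>_. 0)) else (if x \<in> W then qq x y else (\<lambda>_. 0)))" for x y
  show ?thesis
  proof (rule stable_fam_I[of _ ss])
    fix g y p assume h: "g \<in> G" "y \<in> U \<union> W" "p \<in> Pts"
    show "evk (mv g p) y = (\<Sum>x\<in>U \<union> W. ss x y g * evk p x)"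
    proof (cases "y \<in> U")
      case True
      then show ?thesis unfolding U(3)[OF h(1) True h(3)]
        by (intro sum.mono_neutral_cong_left) (use U(1) W(1) in \<open>auto simp: ss_def\<close>)
    next
      case False
      then have "y \<in> W" using h by auto
      then show ?thesis unfolding W(3)[OF h(1) \<open>y \<in> W\<close> h(3)]
        by (intro sum.mono_neutral_cong_left) (use U(1) W(1) False in \<open>auto simp: ss_def\<close>)
    qed
  qed (use U W in \<open>auto simp: ss_def intro: GL_functions.const\<close>)
qed

text \<open>A product may arise from several pairs, so a factorisation \<open>fc\<close> is chosen and the coefficients of equal
  products are added up.\<close>

lemma stable_fam_mult: assumes "stable_fam U" "stable_fam W" shows "stable_fam ((\<lambda>(u, w). u * w) ` (U \<times> W))"
proof -
  obtain pp where "stable_coeffs U pp" using assms(1) unfolding stable_fam_def by (rule exE)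
  note U = goodcD[OF this]
  obtain qq where "stable_coeffs W qq" using assms(2) unfolding stable_fam_def by (rule exE)
  note W = goodcD[OF this]
  define m where "m = (\<lambda>(u, w). u * w :: (nat, 'k) mpol)"
  define fc where "fc y = (SOME z. z \<in> U \<times> W \<and> m z = y)" for y
  have fc: "fc y \<in> U \<times> W \<and> m (fc y) = y" if "y \<in> m ` (U \<times> W)" for y
  proof -
    have "\<exists>z. z \<in> U \<times> W \<and> m z = y" using that by auto
    then show ?thesis unfolding fc_def by (rule someI_ex)
  qed
  define ss where "ss x y = (\<lambda>g. \<Sum>z\<in>{z\<in>U \<times> W. m z = x}. pp (fst z) (fst (fc y)) g * qq (snd z) (snd (fc y)) g)" for x y
  have "stable_fam (m ` (U \<times> W))"
  proof (rule stable_fam_I[of _ ss])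
    fix g y p assume h: "g \<in> G" "y \<in> m ` (U \<times> W)" "p \<in> Pts"
    obtain u w where uw: "fc y = (u, w)" "u \<in> U" "w \<in> W" "y = u * w" using fc[OF h(2)] by (cases "fc y") (auto simp: m_def)
    have "evk (mv g p) y = (\<Sum>a\<in>U. pp a u g * evk p a) * (\<Sum>b\<in>W. qq b w g * evk p b)"
      using U(3)[OF h(1) uw(2) h(3)] W(3)[OF h(1) uw(3) h(3)] by (simp add: uw(4))
    also have "\<dots> = (\<Sum>z\<in>U \<times> W. (pp (fst z) u g * qq (snd z) w g) * evk p (m z))"
      by (simp add: sum_product sum.cartesian_product m_def case_prod_beta mult_ac)
    also have "\<dots> = (\<Sum>x\<in>m ` (U \<times> W). \<Sum>z\<in>{z\<in>U \<times> W. m z = x}. (pp (fst z) u g * qq (snd z) w g) * evk p (m z))"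
      by (rule sum.image_gen) (use U W in auto)
    also have "\<dots> = (\<Sum>x\<in>m ` (U \<times> W). ss x y g * evk p x)"
      by (intro sum.cong refl) (simp add: ss_def uw(1) sum_distrib_right)
    finally show "evk (mv g p) y = (\<Sum>x\<in>m ` (U \<times> W). ss x y g * evk p x)" .
  qed (use U W in \<open>auto simp: ss_def intro!: GLf_sum GL_functions.mult\<close>)
  then show ?thesis by (simp add: m_def)
qed

definition in_span :: "((nat, 'k) mpol) \<Rightarrow> ((nat, 'k) mpol) set \<Rightarrow> bool" where
  "in_span f U \<longleftrightarrow> (\<exists>c. \<forall>p\<in>Pts. evk p f = (\<Sum>x\<in>U. c x * evk p x))"

lemma in_span_I: "(\<And>p. p \<in> Pts \<Longrightarrow> evk p f = (\<Sum>x\<in>U. c x * evk p x)) \<Longrightarrow> in_span f U"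
  unfolding in_span_def by blast

lemma in_span_mem: assumes "finite U" "f \<in> U" shows "in_span f U"
proof (rule in_span_I[where c = "\<lambda>x. if x = f then 1 else 0"])
  fix p assume "p \<in> Pts"
  have "(\<Sum>x\<in>U. (if x = f then 1 else 0) * evk p x) = (\<Sum>x\<in>U. if x = f then evk p x else 0)"
    by (intro sum.cong) auto
  then show "evk p f = (\<Sum>x\<in>U. (if x = f then 1 else 0) * evk p x)" using assms by simp
qed

lemma in_span_mono: assumes "in_span f U" "U \<subseteq> W" "finite W" shows "in_span f W"
proof -
  obtain c where c: "\<forall>p\<in>Pts. evk p f = (\<Sum>x\<in>U. c x * evk p x)" using assms(1) unfolding in_span_def by (rule exE)
  show ?thesis
  proof (rule in_span_I[where c = "\<lambda>x. if x \<in> U then c x else 0"])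
    fix p assume "p \<in> Pts"
    then have "evk p f = (\<Sum>x\<in>U. c x * evk p x)" using c by blast
    also have "\<dots> = (\<Sum>x\<in>W. (if x \<in> U then c x else 0) * evk p x)"
      by (intro sum.mono_neutral_cong_left) (use assms in auto)
    finally show "evk p f = (\<Sum>x\<in>W. (if x \<in> U then c x else 0) * evk p x)" .
  qed
qed

lemma in_span_add: assumes "in_span f U" "in_span h U" shows "in_span (f + h) U"
proof -
  obtain c where c: "\<forall>p\<in>Pts. evk p f = (\<Sum>x\<in>U. c x * evk p x)" using assms(1) unfolding in_span_def by (rule exE)
  obtain d where d: "\<forall>p\<in>Pts. evk p h = (\<Sum>x\<in>U. d x * evk p x)" using assms(2) unfolding in_span_def by (rule exE)
  show ?thesis by (rule in_span_I[where c = "\<lambda>x. c x + d x"]) (use c d in \<open>simp add: distrib_right sum.distrib\<close>)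
qed

lemma in_span_mult: assumes "in_span f U" "in_span h W" "finite U" "finite W" shows "in_span (f * h) ((\<lambda>(u, w). u * w) ` (U \<times> W))"
proof -
  obtain c where c: "\<forall>p\<in>Pts. evk p f = (\<Sum>x\<in>U. c x * evk p x)" using assms(1) unfolding in_span_def by (rule exE)
  obtain d where d: "\<forall>p\<in>Pts. evk p h = (\<Sum>x\<in>W. d x * evk p x)" using assms(2) unfolding in_span_def by (rule exE)
  define m where "m = (\<lambda>(u, w). u * w :: (nat, 'k) mpol)"
  have "in_span (f * h) (m ` (U \<times> W))"
  proof (rule in_span_I[where c = "\<lambda>x. \<Sum>z\<in>{z\<in>U \<times> W. m z = x}. c (fst z) * d (snd z)"])
    fix p assume p: "p \<in> Pts"
    have "evk p (f * h) = (\<Sum>a\<in>U. c a * evk p a) * (\<Sum>b\<in>W. d b * evk p b)" using c d p by simp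
    also have "\<dots> = (\<Sum>z\<in>U \<times> W. (c (fst z) * d (snd z)) * evk p (m z))"
      by (simp add: sum_product sum.cartesian_product m_def case_prod_beta mult_ac)
    also have "\<dots> = (\<Sum>x\<in>m ` (U \<times> W). \<Sum>z\<in>{z\<in>U \<times> W. m z = x}. (c (fst z) * d (snd z)) * evk p (m z))"
      by (rule sum.image_gen) (use assms in auto)
    also have "\<dots> = (\<Sum>x\<in>m ` (U \<times> W). (\<Sum>z\<in>{z\<in>U \<times> W. m z = x}. c (fst z) * d (snd z)) * evk p x)"
      by (intro sum.cong refl) (simp add: sum_distrib_right)
    finally show "evk p (f * h) = (\<Sum>x\<in>m ` (U \<times> W). (\<Sum>z\<in>{z\<in>U \<times> W. m z = x}. c (fst z) * d (snd z)) * evk p x)" .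
  qed
  then show ?thesis by (simp add: m_def)
qed

text \<open>Every polynomial is built from constants and variables, which form such sets.\<close>

lemma stable_fam_span: "\<exists>U. stable_fam U \<and> in_span f U"
proof (induct f rule: mp_induct)
  case (const c)
  show ?case using stable_fam_const[of c] in_span_mem[of "{mconst c}" "mconst c"] by blast
next
  case (var i)
  show ?case
  proof (cases "i \<in> V")
    case True
    then show ?thesis using stable_fam_vars in_span_mem[OF stable_fam_finite[OF stable_fam_vars], of "mvar i"] by blast
  next
    case False
    have "in_span (mvar i) {mconst 0}" by (rule in_span_I[where c = "\<lambda>_. 0"]) (use out False in auto)
    then show ?thesis using stable_fam_const by blast
  qed
next
  case (add f h)
  then obtain U W where U: "stable_fam U" "in_span f U" and W: "stable_fam W" "in_span h W" by blast
  have "in_span (f + h) (U \<union> W)"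
    by (intro in_span_add in_span_mono[OF U(2)] in_span_mono[OF W(2)]) (use U W stable_fam_finite in auto)
  then show ?case using stable_fam_Un[OF U(1) W(1)] by blast
next
  case (mult f h)
  then obtain U W where U: "stable_fam U" "in_span f U" and W: "stable_fam W" "in_span h W" by blast
  show ?case using stable_fam_mult[OF U(1) W(1)] in_span_mult[OF U(2) W(2) stable_fam_finite[OF U(1)] stable_fam_finite[OF W(1)]] by blast
qed

lemma stable_fam_contains:
  assumes "finite S"
  shows "\<exists>U. stable_fam U \<and> (\<forall>f\<in>S. in_span f U)"
  using assms
proof (induct S rule: finite_induct)
  case empty
  show ?case using stable_fam_const[of 0] by blast
next
  case (insert f S)
  then obtain U where U: "stable_fam U" "\<And>f. f \<in> S \<Longrightarrow> in_span f U" by blast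
  obtain W where W: "stable_fam W" "in_span f W" using stable_fam_span[of f] by blast
  have g: "stable_fam (U \<union> W)" by (rule stable_fam_Un[OF U(1) W(1)])
  have "in_span h (U \<union> W)" if "h \<in> insert f S" for h
  proof (cases "h = f")
    case True
    then show ?thesis using in_span_mono[OF W(2) _ stable_fam_finite[OF g]] by blast
  next
    case False
    then show ?thesis using in_span_mono[OF U(2) _ stable_fam_finite[OF g], of h] that by blast
  qed
  then show ?case using g by blast
qed

theorem \<gamma>_regular: "regular_action N G CC \<gamma>"
  unfolding regular_action_def
proof (intro conjI allI impI \<gamma>_action)
  fix W assume W: "fin_dim_subspace CC W"
  obtain bs where "C.coord_basis W bs" using C.fd_basis[OF W] by (rule exE)
  note cb = this[unfolded C.coord_basis_def]
  have bsW: "set bs \<subseteq> W" using cb by (elim conjE)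
  have "W \<subseteq> carrier CC" using cb by (elim conjE)
  note bs = bsW this
  have ex0: "\<forall>x\<in>W. \<exists>c. x = C.lc c (\<lambda>i. bs ! i) {..<length bs}" using cb by (elim conjE)
  note ex = ex0[rule_format]
  have "finite (rp ` set bs)" by simp
  from stable_fam_contains[OF this] obtain U where U: "stable_fam U" "\<And>f. f \<in> rp ` set bs \<Longrightarrow> in_span f U" by blast
  obtain pp where "stable_coeffs U pp" using U(1) unfolding stable_fam_def by (rule exE)
  note Uf = goodcD(1)[OF this] and pp = goodcD(2)[OF this] and tr = goodcD(3)[OF this]
  define K where "K = cls ` U"
  have K: "finite K" "K \<subseteq> carrier CC" using Uf cls_closed by (auto simp: K_def)
  have regroup: "C.lc (\<lambda>X. \<Sum>x\<in>{x\<in>U. cls x = X}. c x) (\<lambda>X. X) K = cls f"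
    if eq: "\<And>p. p \<in> Pts \<Longrightarrow> evk p f = (\<Sum>x\<in>U. c x * evk p x)" for c f
  proof (rule CC_eqI)
    show "C.lc (\<lambda>X. \<Sum>x\<in>{x\<in>U. cls x = X}. c x) (\<lambda>X. X) K \<in> carrier CC" by (rule C.lc_closed) (use K in auto)
    fix p assume p: "p \<in> Pts"
    have "vl p (C.lc (\<lambda>X. \<Sum>x\<in>{x\<in>U. cls x = X}. c x) (\<lambda>X. X) K) = (\<Sum>X\<in>K. (\<Sum>x\<in>{x\<in>U. cls x = X}. c x) * vl p X)"
      by (rule vl_lc[OF p K(1)]) (use K in auto)
    also have "\<dots> = (\<Sum>X\<in>K. \<Sum>x\<in>{x\<in>U. cls x = X}. c x * evk p x)"
      by (intro sum.cong refl) (auto simp: sum_distrib_right vl[OF p] intro!: sum.cong)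
    also have "\<dots> = (\<Sum>x\<in>U. c x * evk p x)" unfolding K_def by (rule sum.image_gen[symmetric, OF Uf])
    finally show "vl p (C.lc (\<lambda>X. \<Sum>x\<in>{x\<in>U. cls x = X}. c x) (\<lambda>X. X) K) = vl p (cls f)" using eq[OF p] p by (simp add: vl)
  qed (rule cls_closed)
  define pk where "pk X Y = (\<lambda>g. \<Sum>x\<in>{x\<in>U. cls x = X}. pp x (SOME y. y \<in> U \<and> cls y = Y) g)" for X Y
  have "\<gamma> g Y = C.lc (\<lambda>X. pk X Y g) (\<lambda>X. X) K" if g: "g \<in> G" and Y: "Y \<in> K" for g Y
  proof -
    have "\<exists>y. y \<in> U \<and> cls y = Y" using Y by (auto simp: K_def)
    then have y: "(SOME y. y \<in> U \<and> cls y = Y) \<in> U \<and> cls (SOME y. y \<in> U \<and> cls y = Y) = Y" by (rule someI_ex)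
    define y where "y = (SOME y. y \<in> U \<and> cls y = Y)"
    have y': "y \<in> U" "cls y = Y" using y by (auto simp: y_def)
    have "\<gamma> g Y = cls (subst (sg g) y)" using \<gamma>_cls[OF g, of y] y' by simp
    also have "\<dots> = C.lc (\<lambda>X. pk X Y g) (\<lambda>X. X) K"
      unfolding pk_def y_def[symmetric] by (rule regroup[symmetric]) (use tr[OF g y'(1)] in \<open>simp add: evk_sg\<close>)
    finally show ?thesis .
  qed
  moreover have "pk X Y \<in> GL_functions N" for X Y unfolding pk_def by (intro GLf_sum pp)
  ultimately have rat: "fin_dim_subspace CC (C.span K) \<and> (\<forall>g\<in>G. \<gamma> g ` C.span K \<subseteq> C.span K) \<and> algebraic_representation_on N G CC \<gamma> (C.span K)"
    by (intro C.rational_span[OF G K, of pk]) (simp_all add: \<gamma>_closed \<gamma>_ops \<gamma>_one \<gamma>_mult)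
  have "W \<subseteq> C.span K"
  proof
    fix X assume "X \<in> W"
    from ex[OF this] obtain c where c: "X = C.lc c (\<lambda>i. bs ! i) {..<length bs}" by (rule exE)
    define d where "d i = (SOME d. \<forall>p\<in>Pts. evk p (rp (bs ! i)) = (\<Sum>x\<in>U. d x * evk p x))" for i
    have d: "bs ! i = C.lc (\<lambda>X. \<Sum>x\<in>{x\<in>U. cls x = X}. d i x) (\<lambda>X. X) K" if "i < length bs" for i
    proof -
      have "\<exists>d. \<forall>p\<in>Pts. evk p (rp (bs ! i)) = (\<Sum>x\<in>U. d x * evk p x)" using U(2)[of "rp (bs ! i)"] that by (simp add: in_span_def)
      then have "\<forall>p\<in>Pts. evk p (rp (bs ! i)) = (\<Sum>x\<in>U. d i x * evk p x)" unfolding d_def by (rule someI_ex)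
      then have "C.lc (\<lambda>X. \<Sum>x\<in>{x\<in>U. cls x = X}. d i x) (\<lambda>X. X) K = cls (rp (bs ! i))" by (intro regroup) blast
      moreover have "bs ! i \<in> carrier CC" using that bs nth_mem[OF that] by blast
      ultimately show ?thesis by (simp add: cls_rp)
    qed
    have "X = C.lc c (\<lambda>i. C.lc (\<lambda>X. \<Sum>x\<in>{x\<in>U. cls x = X}. d i x) (\<lambda>X. X) K) {..<length bs}"
      unfolding c
    proof (rule C.lc_cong)
      fix i assume "i \<in> {..<length bs}"
      then show "bs ! i \<in> carrier CC" using bs nth_mem[of i bs] by blast
    qed (use d in auto)
    also have "\<dots> = C.lc (\<lambda>X. \<Sum>i<length bs. c i * (\<Sum>x\<in>{x\<in>U. cls x = X}. d i x)) (\<lambda>X. X) K"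
      by (rule C.lc_lc) (use K in auto)
    finally show "X \<in> C.span K" by (intro iffD2[OF C.span_lc[OF K]] exI)
  qed
  then show "\<exists>V. fin_dim_subspace CC V \<and> W \<subseteq> V \<and> (\<forall>g\<in>G. \<gamma> g ` V \<subseteq> V) \<and> algebraic_representation_on N G CC \<gamma> V"
    using rat by blast
qed

end

section \<open>The free algebra on a product of monoids\<close>

definition scl :: "'k \<Rightarrow> ('x \<Rightarrow>\<^sub>0 'k) \<Rightarrow> 'x \<Rightarrow>\<^sub>0 'k::field" where "scl c f = Poly_Mapping.map ((*) c) f"

lemma lookup_scl: "lookup (scl c f) x = c * lookup f x"
  by (simp add: scl_def Poly_Mapping.map.rep_eq when_def)

lemma scl_sum: "scl c (sum h X) = (\<Sum>x\<in>X. scl c (h x))"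
  by (rule poly_mapping_eqI) (simp add: lookup_scl lookup_sum sum_distrib_left)

lemma scl_single: "scl c (single x d) = single x (c * d)"
  by (rule poly_mapping_eqI) (simp add: lookup_scl lookup_single when_def)

lemma scl_minus: "scl (- 1) f = - f"
  by (rule poly_mapping_eqI) (simp add: lookup_scl lookup_uminus)

lemma scl_diff: "scl c (f - g) = scl c f - scl c g"
  by (rule poly_mapping_eqI) (simp add: lookup_scl lookup_minus algebra_simps)

lemma scl_keys: "keys (scl c f) \<subseteq> keys f"
  by (auto simp: in_keys_iff lookup_scl)

lemma keys_sum_sub: "(\<And>i. i \<in> A \<Longrightarrow> keys (f i) \<subseteq> K) \<Longrightarrow> keys (sum f A) \<subseteq> K"
  using keys_sum[of f A] by blast

text \<open>The free tensor algebra is the monoid algebra of \<open>A \<times> B\<close>, but for monoids with a carrier; its laws follow by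
  bilinear expansion into single basis elements.\<close>

locale free_prod = A: monoid A + B: monoid B
  for A :: "('k::field, 'a) module" (structure) and B :: "('k, 'b) module"
begin

abbreviation "FT \<equiv> free_tensor A B"
abbreviation "car \<equiv> {f. keys f \<subseteq> carrier A \<times> carrier B}"

definition pp :: "'a \<times> 'b \<Rightarrow> 'a \<times> 'b \<Rightarrow> 'a \<times> 'b" where
  "pp p q = (fst p \<otimes>\<^bsub>A\<^esub> fst q, snd p \<otimes>\<^bsub>B\<^esub> snd q)"

definition fm :: "('a \<times> 'b \<Rightarrow>\<^sub>0 'k) \<Rightarrow> ('a \<times> 'b \<Rightarrow>\<^sub>0 'k) \<Rightarrow> 'a \<times> 'b \<Rightarrow>\<^sub>0 'k" where
  "fm f g = (\<Sum>p\<in>keys f. \<Sum>q\<in>keys g.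
     single (pp p q) (lookup f p * lookup g q))"

lemma FT_simps: "carrier FT = car" "mult FT = fm" "one FT = single (\<one>\<^bsub>A\<^esub>, \<one>\<^bsub>B\<^esub>) 1"
  "zero FT = 0" "add FT = (+)" "smult FT = scl"
  by (auto simp: free_tensor_def fm_def pp_def scl_def fun_eq_iff)

lemma fm_super: assumes "finite X" "keys f \<subseteq> X" "finite Y" "keys g \<subseteq> Y"
  shows "fm f g = (\<Sum>p\<in>X. \<Sum>q\<in>Y. single (pp p q) (lookup f p * lookup g q))"
proof -
  have "fm f g = (\<Sum>p\<in>keys f. \<Sum>q\<in>Y. single (pp p q) (lookup f p * lookup g q))"
    unfolding fm_def
    by (intro sum.cong sum.mono_neutral_left refl) (use assms in \<open>auto simp: in_keys_iff\<close>)
  also have "\<dots> = (\<Sum>p\<in>X. \<Sum>q\<in>Y. single (pp p q) (lookup f p * lookup g q))"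
    by (intro sum.mono_neutral_left) (use assms in \<open>auto simp: in_keys_iff\<close>)
  finally show ?thesis .
qed

lemma fm_add: "fm (f + f') g = fm f g + fm f' g" "fm f (g + g') = fm f g + fm f g'"
proof -
  let ?X = "keys f \<union> keys f'" and ?Y = "keys g \<union> keys g'"
  show "fm (f + f') g = fm f g + fm f' g"
    using fm_super[of ?X "f + f'" "keys g" g] fm_super[of ?X f "keys g" g]
      fm_super[of ?X f' "keys g" g] Poly_Mapping.keys_add[of f f']
    by (simp add: lookup_add distrib_right single_add sum.distrib)
  show "fm f (g + g') = fm f g + fm f g'"
    using fm_super[of "keys f" f ?Y "g + g'"] fm_super[of "keys f" f ?Y g]
      fm_super[of "keys f" f ?Y g'] Poly_Mapping.keys_add[of g g']
    by (simp add: lookup_add distrib_left single_add sum.distrib)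
qed

lemma fm_0: "fm 0 g = 0" "fm f 0 = 0" by (simp_all add: fm_def)

lemma fm_sum: "fm (sum h X) g = (\<Sum>x\<in>X. fm (h x) g)" "fm g (sum h X) = (\<Sum>x\<in>X. fm g (h x))"
  by (induct X rule: infinite_finite_induct) (auto simp: fm_0 fm_add)

lemma fm_single: "fm (single p c) (single q d) = single (pp p q) (c * d)"
  by (subst fm_super[of "{p}" _ "{q}"]) auto

lemma fm_expand:
  assumes "f \<in> car" "g \<in> car"
  shows "fm f g \<in> car"
proof -
  have "pp p q \<in> carrier A \<times> carrier B" if "p \<in> keys f" "q \<in> keys g" for p q
  proof -
    have "p \<in> carrier A \<times> carrier B" "q \<in> carrier A \<times> carrier B" using assms that by blast+
    then show ?thesis by (auto simp: pp_def)
  qed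
  then have "keys (fm f g) \<subseteq> carrier A \<times> carrier B"
    unfolding fm_def by (intro keys_sum_sub) auto
  then show ?thesis by simp
qed

lemma fm_assoc: assumes "f \<in> car" "g \<in> car" "h \<in> car" shows "fm (fm f g) h = fm f (fm g h)"
proof -
  let ?s = "\<lambda>f p. single p (lookup f p)"
  have f: "f = (\<Sum>p\<in>keys f. ?s f p)" and g: "g = (\<Sum>p\<in>keys g. ?s g p)"
    and h: "h = (\<Sum>p\<in>keys h. ?s h p)" by (rule poly_mapping_sum_single)+
  have "fm (fm f g) h = fm (fm (\<Sum>p\<in>keys f. ?s f p) (\<Sum>p\<in>keys g. ?s g p)) (\<Sum>p\<in>keys h. ?s h p)"
    using f g h by simp
  also have "\<dots> = (\<Sum>r\<in>keys h. \<Sum>q\<in>keys g. \<Sum>p\<in>keys f. fm (fm (?s f p) (?s g q)) (?s h r))"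
    by (simp only: fm_sum)
  also have "\<dots> = (\<Sum>r\<in>keys h. \<Sum>q\<in>keys g. \<Sum>p\<in>keys f. fm (?s f p) (fm (?s g q) (?s h r)))"
  proof (intro sum.cong refl)
    fix r q p assume "r \<in> keys h" "q \<in> keys g" "p \<in> keys f"
    then have "r \<in> carrier A \<times> carrier B" "q \<in> carrier A \<times> carrier B" "p \<in> carrier A \<times> carrier B" using assms by auto
    then show "fm (fm (?s f p) (?s g q)) (?s h r) = fm (?s f p) (fm (?s g q) (?s h r))"
      by (auto simp: fm_single pp_def A.m_assoc B.m_assoc mult.assoc)
  qed
  also have "\<dots> = fm (\<Sum>p\<in>keys f. ?s f p) (fm (\<Sum>p\<in>keys g. ?s g p) (\<Sum>p\<in>keys h. ?s h p))"
    by (simp only: fm_sum)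
  also have "\<dots> = fm f (fm g h)" using f g h by simp
  finally show ?thesis .
qed

lemma fm_unit: assumes "f \<in> car"
  shows "fm (single (\<one>\<^bsub>A\<^esub>, \<one>\<^bsub>B\<^esub>) c) f = scl c f" "fm f (single (\<one>\<^bsub>A\<^esub>, \<one>\<^bsub>B\<^esub>) 1) = f"
proof -
  let ?s = "\<lambda>p. single p (lookup f p)"
  have f: "f = (\<Sum>p\<in>keys f. ?s p)" by (rule poly_mapping_sum_single)
  have k: "p \<in> carrier A \<times> carrier B" if "p \<in> keys f" for p using assms that by auto
  have u: "pp (\<one>\<^bsub>A\<^esub>, \<one>\<^bsub>B\<^esub>) p = p" "pp p (\<one>\<^bsub>A\<^esub>, \<one>\<^bsub>B\<^esub>) = p" if "p \<in> keys f" for p using k[OF that] by (auto simp: pp_def)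
  have "fm (single (\<one>\<^bsub>A\<^esub>, \<one>\<^bsub>B\<^esub>) c) (\<Sum>p\<in>keys f. ?s p) = (\<Sum>p\<in>keys f. scl c (?s p))"
    unfolding fm_sum by (intro sum.cong refl) (simp add: fm_single u scl_single)
  also have "\<dots> = scl c (\<Sum>p\<in>keys f. ?s p)"
    by (rule scl_sum[symmetric])
  finally show "fm (single (\<one>\<^bsub>A\<^esub>, \<one>\<^bsub>B\<^esub>) c) f = scl c f" using f by simp
  have "fm (\<Sum>p\<in>keys f. ?s p) (single (\<one>\<^bsub>A\<^esub>, \<one>\<^bsub>B\<^esub>) 1) = (\<Sum>p\<in>keys f. ?s p)"
    unfolding fm_sum by (intro sum.cong refl) (simp add: fm_single u)
  then show "fm f (single (\<one>\<^bsub>A\<^esub>, \<one>\<^bsub>B\<^esub>) 1) = f" using f by simp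
qed

lemma FT_ring: "ring FT"
proof (rule ringI)
  show "abelian_group FT"
  proof (rule abelian_groupI)
    fix f assume f: "f \<in> carrier FT"
    show "\<exists>g\<in>carrier FT. g \<oplus>\<^bsub>FT\<^esub> f = \<zero>\<^bsub>FT\<^esub>"
      by (rule bexI[of _ "- f"]) (use f in \<open>auto simp: FT_simps\<close>)
  next
    fix f g assume "f \<in> carrier FT" "g \<in> carrier FT"
    then show "f \<oplus>\<^bsub>FT\<^esub> g \<in> carrier FT" using Poly_Mapping.keys_add[of f g] by (auto simp: FT_simps)
  qed (auto simp: FT_simps add_ac)
  show "monoid FT"
    by (rule monoidI) (simp_all only: FT_simps, auto simp: fm_expand[simplified] fm_assoc fm_unit scl_def[symmetric] intro!: poly_mapping_eqI simp: lookup_scl)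
qed (auto simp: FT_simps fm_add)

lemma FT_ops: assumes "f \<in> car" shows "a_inv FT f = - f"
proof -
  interpret F: ring FT by (rule FT_ring)
  show ?thesis by (rule F.minus_equality) (use assms in \<open>auto simp: FT_simps\<close>)
qed

end

section \<open>Matrices over a coordinate algebra as a tensor product\<close>

lemma mat_monoid: "monoid (module_mat TYPE('k::field) n n)"
  by (rule monoidI) (auto simp: module_mat_simps)

locale matrix_tensor = point_action Pts V N G cf
  for Pts :: "(nat \<Rightarrow> 'k::{alg_closed_field, field_char_0}) set" and V N G cf +
  fixes n :: nat
begin

abbreviation "MM \<equiv> module_mat TYPE('k) n n"

sublocale FP: free_prod MM CC
  by (intro free_prod.intro mat_monoid) (use CC_cring in \<open>simp add: cring_def ring_def\<close>)

abbreviation "TA \<equiv> tensor_algebra MM CC"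

lemma car_D: "f \<in> FP.car \<Longrightarrow> q \<in> keys f \<Longrightarrow> fst q \<in> carrier_mat n n \<and> snd q \<in> carrier CC"
  by (auto simp: module_mat_simps)

lemma car_single: "a \<in> carrier_mat n n \<Longrightarrow> b \<in> carrier CC \<Longrightarrow> single (a, b) c \<in> FP.car"
  by (simp add: module_mat_simps)

lemma car_add: "f \<in> FP.car \<Longrightarrow> g \<in> FP.car \<Longrightarrow> f + g \<in> FP.car"
  using Poly_Mapping.keys_add[of f g] by auto

lemma car_diff: "f \<in> FP.car \<Longrightarrow> g \<in> FP.car \<Longrightarrow> f - g \<in> FP.car"
  using Poly_Mapping.keys_diff[of f g] by auto

lemma car_scl: "f \<in> FP.car \<Longrightarrow> scl c f \<in> FP.car"
  using scl_keys[of c f] by auto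

lemma car_sum: "(\<And>x. x \<in> X \<Longrightarrow> h x \<in> FP.car) \<Longrightarrow> sum h X \<in> FP.car"
  using keys_sum_sub[of X h "carrier MM \<times> carrier CC"] by auto

text \<open>At a point \<open>p\<close> the algebra \<open>M\<^sub>n(k) \<otimes> C\<close> specialises to \<open>M\<^sub>n(k)\<close>; this is an entry of the result.\<close>

definition tval :: "(nat \<Rightarrow> 'k) \<Rightarrow> nat \<Rightarrow> nat \<Rightarrow> ('k mat \<times> ((nat, 'k) mpol) set \<Rightarrow>\<^sub>0 'k) \<Rightarrow> 'k" where
  "tval p i j f = (\<Sum>q\<in>keys f. lookup f q * (fst q $$ (i, j) * vl p (snd q)))"

lemma tval_super: "finite X \<Longrightarrow> keys f \<subseteq> X \<Longrightarrow>
   tval p i j f = (\<Sum>q\<in>X. lookup f q * (fst q $$ (i, j) * vl p (snd q)))"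
  unfolding tval_def by (intro sum.mono_neutral_left) (auto simp: in_keys_iff)

lemma tval_add: "tval p i j (f + g) = tval p i j f + tval p i j g"
  using tval_super[of "keys f \<union> keys g" "f + g" p i j] tval_super[of "keys f \<union> keys g" f p i j]
    tval_super[of "keys f \<union> keys g" g p i j] Poly_Mapping.keys_add[of f g]
  by (simp add: lookup_add distrib_right sum.distrib)

lemma tval_0: "tval p i j 0 = 0" by (simp add: tval_def)

lemma tval_scl: "tval p i j (scl c f) = c * tval p i j f"
  using tval_super[OF _ scl_keys, of f p i j c] by (simp add: lookup_scl tval_def sum_distrib_left mult.assoc)

lemma tval_single: "tval p i j (single q c) = c * (fst q $$ (i, j) * vl p (snd q))"
  by (subst tval_super[of "{q}"]) auto

lemma tval_diff: "tval p i j (f - g) = tval p i j f - tval p i j g"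
  using tval_add[of p i j "f - g" g] by simp

lemma tval_sum: "tval p i j (sum h X) = (\<Sum>x\<in>X. tval p i j (h x))"
  by (induct X rule: infinite_finite_induct) (auto simp: tval_0 tval_add)

lemma tval_mult:
  assumes p: "p \<in> Pts" and f: "f \<in> FP.car" and g: "g \<in> FP.car" and ij: "i < n" "j < n"
  shows "tval p i j (FP.fm f g) = (\<Sum>l<n. tval p i l f * tval p l j g)"
proof -
  let ?L = "lookup" and ?K = "keys"
  have "tval p i j (FP.fm f g) = (\<Sum>a\<in>?K f. \<Sum>b\<in>?K g. ?L f a * ?L g b * ((fst a * fst b) $$ (i, j) * (vl p (snd a) * vl p (snd b))))"
    by (simp add: FP.fm_def tval_sum tval_single FP.pp_def module_mat_simps CC_vl[OF p])
  also have "\<dots> = (\<Sum>a\<in>?K f. \<Sum>b\<in>?K g. \<Sum>l<n. (?L f a * (fst a $$ (i, l) * vl p (snd a))) * (?L g b * (fst b $$ (l, j) * vl p (snd b))))"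
  proof (intro sum.cong refl)
    fix a b assume ab: "a \<in> ?K f" "b \<in> ?K g"
    have "fst a \<in> carrier_mat n n" "fst b \<in> carrier_mat n n" using car_D[OF f ab(1)] car_D[OF g ab(2)] by auto
    then have "(fst a * fst b) $$ (i, j) = (\<Sum>l<n. fst a $$ (i, l) * fst b $$ (l, j))"
      using ij by (simp add: scalar_prod_def atLeast0LessThan)
    then show "?L f a * ?L g b * ((fst a * fst b) $$ (i, j) * (vl p (snd a) * vl p (snd b)))
      = (\<Sum>l<n. (?L f a * (fst a $$ (i, l) * vl p (snd a))) * (?L g b * (fst b $$ (l, j) * vl p (snd b))))"
      by (simp only: sum_distrib_left sum_distrib_right, simp only: mult_ac)
  qed
  also have "\<dots> = (\<Sum>l<n. \<Sum>a\<in>?K f. \<Sum>b\<in>?K g. (?L f a * (fst a $$ (i, l) * vl p (snd a))) * (?L g b * (fst b $$ (l, j) * vl p (snd b))))"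
    by (rule sum_rot3[symmetric])
  also have "\<dots> = (\<Sum>l<n. tval p i l f * tval p l j g)"
    unfolding tval_def by (simp add: sum_product)
  finally show ?thesis .
qed

text \<open>Tensors that vanish at all points. This turns out to be the ideal of bilinearity relations, which allows
  to compute in the tensor product by evaluation.\<close>

definition "tker = {f \<in> FP.car. \<forall>p\<in>Pts. \<forall>i<n. \<forall>j<n. tval p i j f = 0}"

lemma tker_ideal: "ideal tker FP.FT"
proof -
  interpret F: ring FP.FT by (rule FP.FT_ring)
  show ?thesis
  proof (rule idealI[OF FP.FT_ring])
    show "subgroup tker (add_monoid FP.FT)"
    proof (rule F.add.subgroupI)
      show "tker \<subseteq> carrier FP.FT" by (auto simp: tker_def FP.FT_simps)
      show "tker \<noteq> {}" using tval_0 by (auto simp: tker_def intro!: exI[of _ 0])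
      fix f assume f: "f \<in> tker"
      then have "a_inv FP.FT f = scl (- 1) f" using FP.FT_ops[of f] by (simp add: tker_def scl_minus)
      then show "a_inv FP.FT f \<in> tker" using f car_scl[of f "-1"] by (auto simp: tker_def tval_scl)
      fix g assume "g \<in> tker"
      then show "f \<oplus>\<^bsub>FP.FT\<^esub> g \<in> tker" using f car_add[of f g] by (auto simp: tker_def FP.FT_simps tval_add)
    qed
    fix f x assume fx: "f \<in> tker" "x \<in> carrier FP.FT"
    then have c: "f \<in> FP.car" "x \<in> FP.car" by (auto simp: tker_def FP.FT_simps)
    have z: "tval p i j f = 0" if "p \<in> Pts" "i < n" "j < n" for p i j using fx that by (auto simp: tker_def)
    have "tval p i j (FP.fm x f) = 0" "tval p i j (FP.fm f x) = 0" if "p \<in> Pts" "i < n" "j < n" for p i j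
      using tval_mult[OF that(1) c(2,1) that(2,3)] tval_mult[OF that(1) c that(2,3)] z that by simp_all
    then show "x \<otimes>\<^bsub>FP.FT\<^esub> f \<in> tker" "f \<otimes>\<^bsub>FP.FT\<^esub> x \<in> tker"
      using FP.fm_expand[OF c] FP.fm_expand[OF c(2,1)] by (simp_all add: tker_def FP.FT_simps)
  qed
qed

definition "EU i j = Matrix.mat n n (\<lambda>(a, b). if a = i \<and> b = j then 1 else (0::'k))"

lemma EU_carrier: "EU i j \<in> carrier_mat n n" by (simp add: EU_def)

context
  fixes I
  assumes I: "ideal I FP.FT" and
    g1: "\<And>a a' b. a \<in> carrier_mat n n \<Longrightarrow> a' \<in> carrier_mat n n \<Longrightarrow> b \<in> carrier CC \<Longrightarrow>
      single (a + a', b) 1 - single (a, b) 1 - single (a', b) 1 \<in> I" and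
    g2: "\<And>a b b'. a \<in> carrier_mat n n \<Longrightarrow> b \<in> carrier CC \<Longrightarrow> b' \<in> carrier CC \<Longrightarrow>
      single (a, b \<oplus>\<^bsub>CC\<^esub> b') 1 - single (a, b) 1 - single (a, b') 1 \<in> I" and
    g3: "\<And>a b c. a \<in> carrier_mat n n \<Longrightarrow> b \<in> carrier CC \<Longrightarrow>
      single (c \<cdot>\<^sub>m a, b) 1 - single (a, b) c \<in> I" and
    g4: "\<And>a b c. a \<in> carrier_mat n n \<Longrightarrow> b \<in> carrier CC \<Longrightarrow>
      single (a, c \<odot>\<^bsub>CC\<^esub> b) 1 - single (a, b) c \<in> I"
begin

lemma I_car: "f \<in> I \<Longrightarrow> f \<in> FP.car"
  using ideal.Icarr[OF I] by (simp add: FP.FT_simps)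

lemma I_add: "f \<in> I \<Longrightarrow> g \<in> I \<Longrightarrow> f + g \<in> I"
  using additive_subgroup.a_closed[OF ideal.axioms(1)[OF I]] by (simp add: FP.FT_simps)

lemma I_0: "0 \<in> I"
  using additive_subgroup.zero_closed[OF ideal.axioms(1)[OF I]] by (simp add: FP.FT_simps)

lemma I_scl: "f \<in> I \<Longrightarrow> scl c f \<in> I"
proof -
  assume f: "f \<in> I"
  have "single (\<one>\<^bsub>MM\<^esub>, \<one>\<^bsub>CC\<^esub>) c \<in> carrier FP.FT"
    by (simp add: FP.FT_simps module_mat_simps CC_closed)
  from ideal.I_l_closed[OF I f this] show ?thesis
    using FP.fm_unit(1)[OF I_car[OF f]] by (simp add: FP.FT_simps)
qed

lemma I_diff: "f \<in> I \<Longrightarrow> g \<in> I \<Longrightarrow> f - g \<in> I"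
  using I_add[of f "scl (- 1) g"] I_scl[of g "- 1"] by (simp add: scl_minus)

lemma I_sum: "(\<And>x. x \<in> X \<Longrightarrow> h x \<in> I) \<Longrightarrow> sum h X \<in> I"
  by (induct X rule: infinite_finite_induct) (auto intro: I_0 I_add)

lemma I_trans: "f - g \<in> I \<Longrightarrow> g - h \<in> I \<Longrightarrow> f - h \<in> I"
  using I_add[of "f - g" "g - h"] by simp

lemma I_matrix:
  assumes a: "a \<in> carrier_mat n n" and b: "b \<in> carrier CC" and X: "finite X"
  shows "single (Matrix.mat n n (\<lambda>ij. if ij \<in> X then a $$ ij else 0), b) 1
      - (\<Sum>ij\<in>X. single (EU (fst ij) (snd ij), b) (a $$ ij)) \<in> I"
  using X
proof (induct X rule: finite_induct)
  case empty
  have "0 \<cdot>\<^sub>m EU 0 0 = Matrix.mat n n (\<lambda>ij. if ij \<in> {} then a $$ ij else 0)" by (auto simp: EU_def)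
  then show ?case using g3[OF EU_carrier b, of 0 0 0] by simp
next
  case (insert x X)
  let ?m = "\<lambda>X. Matrix.mat n n (\<lambda>ij. if ij \<in> X then a $$ ij else 0)"
  let ?E = "EU (fst x) (snd x)"
  have m: "?m (insert x X) = ?m X + a $$ x \<cdot>\<^sub>m ?E"
    using insert(2) by (intro eq_matI) (auto simp: EU_def)
  have "single (?m (insert x X), b) 1 - single (?m X, b) 1 - single (a $$ x \<cdot>\<^sub>m ?E, b) 1 \<in> I"
    unfolding m by (rule g1) (use b EU_carrier in auto)
  from I_add[OF I_add[OF this g3[OF EU_carrier b, of "a $$ x" "fst x" "snd x"]] insert(3)]
  show ?case using insert by (simp add: algebra_simps)
qed

lemma I_cls_sum: assumes a: "a \<in> carrier_mat n n" and "finite X"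
  shows "(\<Sum>x\<in>X. single (a, cls (u x)) 1) - single (a, cls (\<Sum>x\<in>X. u x)) 1 \<in> I"
  using assms(2)
proof (induct X rule: finite_induct)
  case empty
  have "0 \<odot>\<^bsub>CC\<^esub> cls 0 = cls 0" by (simp add: cls_hom)
  then have "single (a, cls 0) 1 \<in> I" using g4[OF a cls_closed, of 0 0] by simp
  from I_scl[OF this, of "- 1"] show ?case by (simp add: scl_minus)
next
  case (insert x X)
  have "single (a, cls (u x + (\<Sum>x\<in>X. u x))) 1 - single (a, cls (u x)) 1 - single (a, cls (\<Sum>x\<in>X. u x)) 1 \<in> I"
    using g2[OF a cls_closed cls_closed, of "u x" "\<Sum>x\<in>X. u x"] by (simp add: cls_hom)
  from I_diff[OF insert(3) this] show ?case using insert by (simp add: algebra_simps)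
qed

text \<open>Modulo the relations a tensor equals \<open>\<Sum> E\<^sub>i\<^sub>j \<otimes> c\<^sub>i\<^sub>j\<close>, where the values of the \<open>c\<^sub>i\<^sub>j\<close> are the entries of its
  values; if these are 0 then so are the \<open>c\<^sub>i\<^sub>j\<close>.\<close>

lemma tker_subset: "tker \<subseteq> I"
proof
  fix f assume f: "f \<in> tker"
  then have fc: "f \<in> FP.car" by (simp add: tker_def)
  let ?X = "{..<n} \<times> {..<n}" and ?K = "keys f" and ?L = "lookup f"
  let ?u = "\<lambda>ij q. mconst (?L q * fst q $$ ij) * rp (snd q)"
  define t where "t q = (\<Sum>ij\<in>?X. single (EU (fst ij) (snd ij), cls (?u ij q)) (1::'k))" for q
  have 1: "single q (?L q) - t q \<in> I" if q: "q \<in> ?K" for q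
  proof -
    obtain a b where ab: "q = (a, b)" "a \<in> carrier_mat n n" "b \<in> carrier CC" using car_D[OF fc q] by (cases q) auto
    have "Matrix.mat n n (\<lambda>ij. if ij \<in> ?X then a $$ ij else 0) = a" using ab by (intro eq_matI) auto
    then have "single (a, b) 1 - (\<Sum>ij\<in>?X. single (EU (fst ij) (snd ij), b) (a $$ ij)) \<in> I"
      using I_matrix[OF ab(2,3), of ?X] by simp
    from I_scl[OF this, of "?L q"]
    have 2: "single q (?L q) - (\<Sum>ij\<in>?X. single (EU (fst ij) (snd ij), b) (?L q * a $$ ij)) \<in> I"
      by (simp add: scl_diff scl_sum scl_single ab)
    have "(\<Sum>ij\<in>?X. single (EU (fst ij) (snd ij), cls (?u ij q)) 1 - single (EU (fst ij) (snd ij), b) (?L q * a $$ ij)) \<in> I"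
    proof (rule I_sum)
      fix ij assume "ij \<in> ?X"
      show "single (EU (fst ij) (snd ij), cls (?u ij q)) 1 - single (EU (fst ij) (snd ij), b) (?L q * a $$ ij) \<in> I"
        using g4[OF EU_carrier ab(3), of "fst ij" "snd ij" "?L q * a $$ ij"] by (simp add: CC_simps(5) ab(1))
    qed
    from I_diff[OF 2 this] show ?thesis by (simp add: t_def sum_subtractf)
  qed
  have 2: "(\<Sum>q\<in>?K. t q) - (\<Sum>ij\<in>?X. single (EU (fst ij) (snd ij), cls (\<Sum>q\<in>?K. ?u ij q)) 1) \<in> I"
  proof -
    have "(\<Sum>ij\<in>?X. (\<Sum>q\<in>?K. single (EU (fst ij) (snd ij), cls (?u ij q)) 1) - single (EU (fst ij) (snd ij), cls (\<Sum>q\<in>?K. ?u ij q)) 1) \<in> I"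
      by (intro I_sum I_cls_sum EU_carrier) simp
    moreover have "(\<Sum>q\<in>?K. t q) = (\<Sum>ij\<in>?X. \<Sum>q\<in>?K. single (EU (fst ij) (snd ij), cls (?u ij q)) 1)"
      unfolding t_def by (rule sum.swap)
    ultimately show ?thesis by (simp add: sum_subtractf)
  qed
  have 3: "(\<Sum>ij\<in>?X. single (EU (fst ij) (snd ij), cls (\<Sum>q\<in>?K. ?u ij q)) 1) \<in> I"
  proof (rule I_sum)
    fix ij assume ij: "ij \<in> ?X"
    have "evk p (\<Sum>q\<in>?K. ?u ij q) = 0" if p: "p \<in> Pts" for p
    proof -
      have "evk p (\<Sum>q\<in>?K. ?u ij q) = tval p (fst ij) (snd ij) f" by (simp add: evk_sum tval_def vl_def mult.assoc)
      then show ?thesis using f p ij by (auto simp: tker_def)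
    qed
    then have "cls (\<Sum>q\<in>?K. ?u ij q) = 0 \<odot>\<^bsub>CC\<^esub> cls 0" by (simp add: cls_hom cls_eq)
    then show "single (EU (fst ij) (snd ij), cls (\<Sum>q\<in>?K. ?u ij q)) 1 \<in> I"
      using g4[OF EU_carrier cls_closed, of "fst ij" "snd ij" 0 0] by simp
  qed
  have "(\<Sum>q\<in>?K. single q (?L q) - t q) \<in> I" by (intro I_sum 1)
  then have "f - (\<Sum>q\<in>?K. t q) \<in> I" using poly_mapping_sum_single[of f] by (simp add: sum_subtractf)
  from I_add[OF I_trans[OF this 2] 3] show "f \<in> I" by simp
qed

end

definition "bilin_rels = {single (a \<oplus>\<^bsub>MM\<^esub> a', b) 1 - single (a, b) 1
         - single (a', b) (1::'k) | a a' b.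
         a \<in> carrier MM \<and> a' \<in> carrier MM \<and> b \<in> carrier CC} \<union>
      {single (a, b \<oplus>\<^bsub>CC\<^esub> b') 1 - single (a, b) 1
         - single (a, b') 1 | a b b'.
         a \<in> carrier MM \<and> b \<in> carrier CC \<and> b' \<in> carrier CC} \<union>
      {single (c \<odot>\<^bsub>MM\<^esub> a, b) 1 - single (a, b) c | a b c.
         a \<in> carrier MM \<and> b \<in> carrier CC} \<union>
      {single (a, c \<odot>\<^bsub>CC\<^esub> b) 1 - single (a, b) c | a b c.
         a \<in> carrier MM \<and> b \<in> carrier CC}"

lemma bilin_rels_Idl: "tensor_ideal MM CC = Idl\<^bsub>FP.FT\<^esub> bilin_rels"
  unfolding tensor_ideal_def bilin_rels_def ..

lemma bilin_rels_I:
  "a \<in> carrier_mat n n \<Longrightarrow> a' \<in> carrier_mat n n \<Longrightarrow> b \<in> carrier CC \<Longrightarrow>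
    single (a + a', b) 1 - single (a, b) 1 - single (a', b) 1 \<in> bilin_rels"
  "a \<in> carrier_mat n n \<Longrightarrow> b \<in> carrier CC \<Longrightarrow> b' \<in> carrier CC \<Longrightarrow>
    single (a, b \<oplus>\<^bsub>CC\<^esub> b') 1 - single (a, b) 1 - single (a, b') 1 \<in> bilin_rels"
  "a \<in> carrier_mat n n \<Longrightarrow> b \<in> carrier CC \<Longrightarrow> single (c \<cdot>\<^sub>m a, b) 1 - single (a, b) c \<in> bilin_rels"
  "a \<in> carrier_mat n n \<Longrightarrow> b \<in> carrier CC \<Longrightarrow> single (a, c \<odot>\<^bsub>CC\<^esub> b) 1 - single (a, b) c \<in> bilin_rels"
  unfolding bilin_rels_def module_mat_simps
  by (rule UnI1, rule UnI1, rule UnI1, blast) (rule UnI1, rule UnI1, rule UnI2, blast, rule UnI1, rule UnI2, blast, rule UnI2, blast)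

lemma tker_I: "f \<in> FP.car \<Longrightarrow> (\<And>p i j. p \<in> Pts \<Longrightarrow> i < n \<Longrightarrow> j < n \<Longrightarrow> tval p i j f = 0) \<Longrightarrow> f \<in> tker"
  by (simp add: tker_def)

lemma bilin_rels_KK: "bilin_rels \<subseteq> tker"
proof
  fix x assume "x \<in> bilin_rels"
  then show "x \<in> tker"
    unfolding bilin_rels_def module_mat_simps
  proof (elim UnE CollectE exE conjE)
    fix a a' b assume x: "x = single (a + a', b) 1 - single (a, b) 1 - single (a', b) 1"
      and c: "a \<in> carrier_mat n n" "a' \<in> carrier_mat n n" "b \<in> carrier CC"
    show "x \<in> tker" unfolding x
      by (intro tker_I car_diff car_single) (use c in \<open>auto simp: tval_diff tval_add tval_single algebra_simps\<close>)
  next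
    fix a b b' assume x: "x = single (a, b \<oplus>\<^bsub>CC\<^esub> b') 1 - single (a, b) 1 - single (a, b') 1"
      and c: "a \<in> carrier_mat n n" "b \<in> carrier CC" "b' \<in> carrier CC"
    show "x \<in> tker" unfolding x
      by (intro tker_I car_diff car_single) (use c in \<open>auto simp: tval_diff tval_add tval_single algebra_simps CC_vl CC_closed\<close>)
  next
    fix a b c assume x: "x = single (c \<cdot>\<^sub>m a, b) 1 - single (a, b) c"
      and c: "a \<in> carrier_mat n n" "b \<in> carrier CC"
    show "x \<in> tker" unfolding x
      by (intro tker_I car_diff car_single) (use c in \<open>auto simp: tval_diff tval_add tval_single algebra_simps\<close>)
  next
    fix a b c assume x: "x = single (a, c \<odot>\<^bsub>CC\<^esub> b) 1 - single (a, b) c"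
      and c: "a \<in> carrier_mat n n" "b \<in> carrier CC"
    show "x \<in> tker" unfolding x
      by (intro tker_I car_diff car_single) (use c in \<open>auto simp: tval_diff tval_add tval_single algebra_simps CC_vl CC_closed\<close>)
  qed
qed

lemma tensor_ideal_eq: "tensor_ideal MM CC = tker"
proof
  interpret F: ring FP.FT by (rule FP.FT_ring)
  show "tensor_ideal MM CC \<subseteq> tker" unfolding bilin_rels_Idl by (rule F.genideal_minimal[OF tker_ideal bilin_rels_KK])
  have Sc: "bilin_rels \<subseteq> carrier FP.FT" using bilin_rels_KK by (auto simp: tker_def FP.FT_simps)
  have S: "x \<in> bilin_rels \<Longrightarrow> x \<in> tensor_ideal MM CC" for x unfolding bilin_rels_Idl using F.genideal_self[OF Sc] by blast
  show "tker \<subseteq> tensor_ideal MM CC"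
    by (rule tker_subset) (simp_all add: bilin_rels_Idl[symmetric] S bilin_rels_I, simp add: bilin_rels_Idl F.genideal_ideal[OF Sc])
qed

text \<open>The coset of \<open>f\<close>, described by values.\<close>

definition "tcls f = {h \<in> FP.car. \<forall>p\<in>Pts. \<forall>i<n. \<forall>j<n. tval p i j h = tval p i j f}"

lemma coset_eq: assumes "f \<in> FP.car" shows "tker +>\<^bsub>FP.FT\<^esub> f = tcls f"
proof (rule Set.set_eqI)
  fix h
  have "h \<in> tker +>\<^bsub>FP.FT\<^esub> f \<longleftrightarrow> (\<exists>k\<in>tker. h = k + f)" by (simp add: a_r_coset_def' FP.FT_simps)
  also have "\<dots> \<longleftrightarrow> h \<in> tcls f"
  proof
    assume "\<exists>k\<in>tker. h = k + f"
    then show "h \<in> tcls f" using assms car_add[of _ f] by (auto simp: tcls_def tker_def tval_add)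
  next
    assume h: "h \<in> tcls f"
    then have "h - f \<in> tker" using assms car_diff[of h f] by (intro tker_I) (auto simp: tcls_def tval_diff)
    then show "\<exists>k\<in>tker. h = k + f" by (intro bexI[of _ "h - f"]) auto
  qed
  finally show "h \<in> tker +>\<^bsub>FP.FT\<^esub> f \<longleftrightarrow> h \<in> tcls f" .
qed

lemma tcls_self: "f \<in> FP.car \<Longrightarrow> f \<in> tcls f" by (simp add: tcls_def)

lemma tcls_eqI: "(\<And>p i j. p \<in> Pts \<Longrightarrow> i < n \<Longrightarrow> j < n \<Longrightarrow> tval p i j f = tval p i j h) \<Longrightarrow> tcls f = tcls h"
  by (auto simp: tcls_def)

lemma tcls_eqD: "f \<in> FP.car \<Longrightarrow> tcls f = tcls h \<Longrightarrow> p \<in> Pts \<Longrightarrow> i < n \<Longrightarrow> j < n \<Longrightarrow> tval p i j f = tval p i j h"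
  using tcls_self[of f] by (auto simp: tcls_def)

lemma TA_carrier: "X \<in> carrier TA \<longleftrightarrow> (\<exists>f\<in>FP.car. X = tcls f)"
proof -
  have "carrier TA = (\<Union>a\<in>carrier FP.FT. {tker +>\<^bsub>FP.FT\<^esub> a})"
    by (simp add: tensor_algebra_def ring.defs module.defs FactRing_def A_RCOSETS_def' tensor_ideal_eq)
  then show ?thesis using coset_eq by (auto simp: FP.FT_simps)
qed

lemma TA_simps: assumes f: "f \<in> FP.car" and g: "g \<in> FP.car"
  shows "tcls f \<otimes>\<^bsub>TA\<^esub> tcls g = tcls (FP.fm f g)" "tcls f \<oplus>\<^bsub>TA\<^esub> tcls g = tcls (f + g)" "c \<odot>\<^bsub>TA\<^esub> tcls f = tcls (scl c f)"
    "\<one>\<^bsub>TA\<^esub> = tcls (single (1\<^sub>m n, \<one>\<^bsub>CC\<^esub>) 1)"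
proof -
  interpret K: ideal tker FP.FT by (rule tker_ideal)
  have fg: "f \<in> carrier FP.FT" "g \<in> carrier FP.FT" using f g by (auto simp: FP.FT_simps)
  have Q: "x \<otimes>\<^bsub>TA\<^esub> y = x \<otimes>\<^bsub>FP.FT Quot tker\<^esub> y" "x \<oplus>\<^bsub>TA\<^esub> y = x \<oplus>\<^bsub>FP.FT Quot tker\<^esub> y" "\<one>\<^bsub>TA\<^esub> = \<one>\<^bsub>FP.FT Quot tker\<^esub>" for x y
    by (simp_all add: tensor_algebra_def ring.defs module.defs tensor_ideal_eq)
  show "tcls f \<otimes>\<^bsub>TA\<^esub> tcls g = tcls (FP.fm f g)"
    using ring_hom_mult[OF K.rcos_ring_hom fg] coset_eq f g FP.fm_expand[OF f g] by (simp add: Q FP.FT_simps)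
  show "tcls f \<oplus>\<^bsub>TA\<^esub> tcls g = tcls (f + g)"
    using ring_hom_add[OF K.rcos_ring_hom fg] coset_eq f g car_add[OF f g] by (simp add: Q FP.FT_simps)
  show "\<one>\<^bsub>TA\<^esub> = tcls (single (1\<^sub>m n, \<one>\<^bsub>CC\<^esub>) 1)"
    using ring_hom_one[OF K.rcos_ring_hom] coset_eq[OF car_single[of "1\<^sub>m n" "\<one>\<^bsub>CC\<^esub>" 1]]
    by (simp add: Q FP.FT_simps module_mat_simps CC_closed)
  have "c \<odot>\<^bsub>TA\<^esub> tcls f = (\<Union>h\<in>tcls f. tker +>\<^bsub>FP.FT\<^esub> scl c h)"
    by (simp add: tensor_algebra_def ring.defs module.defs tensor_ideal_eq FP.FT_simps)
  also have "\<dots> = (\<Union>h\<in>tcls f. tcls (scl c f))"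
  proof (rule SUP_cong[OF refl])
    fix h assume h: "h \<in> tcls f"
    then have hc: "h \<in> FP.car" by (simp add: tcls_def)
    have "tcls (scl c h) = tcls (scl c f)" by (rule tcls_eqI) (use h in \<open>auto simp: tcls_def tval_scl\<close>)
    then show "tker +>\<^bsub>FP.FT\<^esub> scl c h = tcls (scl c f)" using coset_eq[OF car_scl[OF hc]] by simp
  qed
  also have "\<dots> = tcls (scl c f)" using tcls_self[OF f] by auto
  finally show "c \<odot>\<^bsub>TA\<^esub> tcls f = tcls (scl c f)" .
qed

lemma pure_cs: "a \<in> carrier_mat n n \<Longrightarrow> b \<in> carrier CC \<Longrightarrow> pure_tensor MM CC a b = tcls (single (a, b) 1)"
  unfolding pure_tensor_def tensor_ideal_eq by (rule coset_eq[OF car_single])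

text \<open>A polynomial with the values of an entry of \<open>f\<close>. Unlike \<open>tval\<close> it can be evaluated at moved points, where
  elements of \<open>C\<close> have no values of their own.\<close>

definition tpoly where "tpoly i j f = (\<Sum>q\<in>keys f. mconst (lookup f q * fst q $$ (i, j)) * rp (snd q))"
  for f :: "'k mat \<times> ((nat, 'k) mpol) set \<Rightarrow>\<^sub>0 'k"

lemma evk_HH: "evk p (tpoly i j f) = tval p i j f"
  by (simp add: tpoly_def evk_sum tval_def vl_def mult.assoc)

definition tmove where "tmove g f = (\<Sum>q\<in>keys f. single (fst q, \<gamma> g (snd q)) (lookup f q))"
  for f :: "'k mat \<times> ((nat, 'k) mpol) set \<Rightarrow>\<^sub>0 'k"

lemma tmove_car: "g \<in> G \<Longrightarrow> f \<in> FP.car \<Longrightarrow> tmove g f \<in> FP.car"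
  unfolding tmove_def by (rule car_sum, rule car_single) (use car_D[of f] \<gamma>_closed[of g] in auto)

lemma tval_FF: assumes "g \<in> G" "f \<in> FP.car" "p \<in> Pts" shows "tval p i j (tmove g f) = evk (mv g p) (tpoly i j f)"
proof -
  have "tval p i j (tmove g f) = (\<Sum>q\<in>keys f. lookup f q * (fst q $$ (i, j) * vl p (\<gamma> g (snd q))))"
    by (simp add: tmove_def tval_sum tval_single)
  also have "\<dots> = (\<Sum>q\<in>keys f. lookup f q * (fst q $$ (i, j) * evk (mv g p) (rp (snd q))))"
    by (intro sum.cong refl) (use car_D[OF assms(2)] vl_\<gamma>[OF assms(1,3)] in simp)
  also have "\<dots> = evk (mv g p) (tpoly i j f)" by (simp add: tpoly_def evk_sum mult.assoc)
  finally show ?thesis .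
qed

definition \<tau> where "\<tau> g X = (if X \<in> carrier TA then tcls (tmove g (SOME f. f \<in> X)) else undefined)"

lemma \<tau>_cs: assumes g: "g \<in> G" and f: "f \<in> FP.car" shows "\<tau> g (tcls f) = tcls (tmove g f)"
proof -
  define h where "h = (SOME h. h \<in> tcls f)"
  have h: "h \<in> tcls f" unfolding h_def by (rule someI[of "\<lambda>h. h \<in> tcls f", OF tcls_self[OF f]])
  have hc: "h \<in> FP.car" using h by (simp add: tcls_def)
  have "tcls (tmove g h) = tcls (tmove g f)"
  proof (rule tcls_eqI)
    fix p i j assume p: "p \<in> Pts" and ij: "i < n" "j < n"
    have "evk (mv g p) (tpoly i j h) = evk (mv g p) (tpoly i j f)"
      by (rule mv_eq[OF g p]) (use h ij in \<open>auto simp: evk_HH tcls_def\<close>)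
    then show "tval p i j (tmove g h) = tval p i j (tmove g f)" by (simp add: tval_FF[OF g hc p] tval_FF[OF g f p])
  qed
  moreover have "tcls f \<in> carrier TA" using f TA_carrier by blast
  ultimately show ?thesis by (simp add: \<tau>_def flip: h_def)
qed

lemma \<tau>_closed: "g \<in> G \<Longrightarrow> X \<in> carrier TA \<Longrightarrow> \<tau> g X \<in> carrier TA"
  using TA_carrier \<tau>_cs tmove_car by metis

lemma \<tau>_hom: assumes g: "g \<in> G" shows "\<tau> g \<in> alg_hom TA TA"
proof -
  have ops: "\<tau> g (X \<otimes>\<^bsub>TA\<^esub> Y) = \<tau> g X \<otimes>\<^bsub>TA\<^esub> \<tau> g Y \<and> \<tau> g (X \<oplus>\<^bsub>TA\<^esub> Y) = \<tau> g X \<oplus>\<^bsub>TA\<^esub> \<tau> g Y \<and> \<tau> g (c \<odot>\<^bsub>TA\<^esub> X) = c \<odot>\<^bsub>TA\<^esub> \<tau> g X"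
    if XY: "X \<in> carrier TA" "Y \<in> carrier TA" for X Y c
  proof -
    obtain f where f: "f \<in> FP.car" "X = tcls f" using XY(1) TA_carrier by blast
    obtain h where h: "h \<in> FP.car" "Y = tcls h" using XY(2) TA_carrier by blast
    have "tcls (tmove g (FP.fm f h)) = tcls (FP.fm (tmove g f) (tmove g h))"
    proof (rule tcls_eqI)
      fix p i j assume p: "p \<in> Pts" and ij: "i < n" "j < n"
      have "tval p i j (tmove g (FP.fm f h)) = evk (mv g p) (tpoly i j (FP.fm f h))" by (rule tval_FF[OF g FP.fm_expand[OF f(1) h(1)] p])
      also have "\<dots> = evk (mv g p) (\<Sum>l<n. tpoly i l f * tpoly l j h)"
        by (rule mv_eq[OF g p]) (simp add: evk_HH evk_sum tval_mult[OF _ f(1) h(1) ij])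
      also have "\<dots> = (\<Sum>l<n. tval p i l (tmove g f) * tval p l j (tmove g h))"
        by (simp add: evk_sum tval_FF[OF g f(1) p] tval_FF[OF g h(1) p])
      also have "\<dots> = tval p i j (FP.fm (tmove g f) (tmove g h))"
        by (rule tval_mult[OF p tmove_car[OF g f(1)] tmove_car[OF g h(1)] ij, symmetric])
      finally show "tval p i j (tmove g (FP.fm f h)) = tval p i j (FP.fm (tmove g f) (tmove g h))" .
    qed
    moreover have "tcls (tmove g (f + h)) = tcls (tmove g f + tmove g h)"
    proof (rule tcls_eqI)
      fix p i j assume p: "p \<in> Pts" and ij: "i < n" "j < n"
      have "evk (mv g p) (tpoly i j (f + h)) = evk (mv g p) (tpoly i j f + tpoly i j h)"
        by (rule mv_eq[OF g p]) (simp add: evk_HH tval_add)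
      then show "tval p i j (tmove g (f + h)) = tval p i j (tmove g f + tmove g h)"
        by (simp add: tval_add tval_FF[OF g f(1) p] tval_FF[OF g h(1) p] tval_FF[OF g car_add[OF f(1) h(1)] p])
    qed
    moreover have "tcls (tmove g (scl c f)) = tcls (scl c (tmove g f))"
    proof (rule tcls_eqI)
      fix p i j assume p: "p \<in> Pts" and ij: "i < n" "j < n"
      have "evk (mv g p) (tpoly i j (scl c f)) = evk (mv g p) (mconst c * tpoly i j f)"
        by (rule mv_eq[OF g p]) (simp add: evk_HH tval_scl)
      then show "tval p i j (tmove g (scl c f)) = tval p i j (scl c (tmove g f))"
        by (simp add: tval_scl tval_FF[OF g f(1) p] tval_FF[OF g car_scl[OF f(1)] p])
    qed
    ultimately show ?thesis
      unfolding f(2) h(2)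
      using TA_simps(1-3)[OF f(1) h(1)] TA_simps(1-3)[OF tmove_car[OF g f(1)] tmove_car[OF g h(1)]]
        \<tau>_cs[OF g f(1)] \<tau>_cs[OF g h(1)] \<tau>_cs[OF g FP.fm_expand[OF f(1) h(1)]] \<tau>_cs[OF g car_add[OF f(1) h(1)]]
        \<tau>_cs[OF g car_scl[OF f(1)]] by simp
  qed
  have c1: "single (1\<^sub>m n, \<one>\<^bsub>CC\<^esub>) 1 \<in> FP.car" by (rule car_single) (auto simp: CC_closed)
  have "tmove g (single (1\<^sub>m n, \<one>\<^bsub>CC\<^esub>) 1) = single (1\<^sub>m n, \<gamma> g \<one>\<^bsub>CC\<^esub>) 1" by (simp add: tmove_def)
  then have "\<tau> g \<one>\<^bsub>TA\<^esub> = \<one>\<^bsub>TA\<^esub>"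
    using \<tau>_cs[OF g c1] TA_simps(4)[OF c1 c1] \<gamma>_hom[OF g] ring_hom_one[of "\<gamma> g" CC CC] by (simp add: alg_hom_def)
  then show ?thesis
    unfolding alg_hom_def using ops \<tau>_closed[OF g] by (intro CollectI conjI ring_hom_memI allI ballI) blast+
qed

lemma \<tau>_action: "algebra_action (GL N\<lparr>carrier := G\<rparr>) TA \<tau>"
  unfolding algebra_action_def
proof (intro conjI ballI)
  show "group_action (GL N\<lparr>carrier := G\<rparr>) (carrier TA) \<tau>"
  proof (rule group_action_criterion)
    fix X assume "X \<in> carrier TA"
    then obtain f where f: "f \<in> FP.car" "X = tcls f" using TA_carrier by blast
    have "tcls (tmove (1\<^sub>m N) f) = tcls f"
    proof (rule tcls_eqI)
      fix p i j assume p: "p \<in> Pts"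
      have "mv (1\<^sub>m N) p = p" using act_one[OF p] by (simp add: mv_def)
      then show "tval p i j (tmove (1\<^sub>m N) f) = tval p i j f" by (simp add: tval_FF[OF G_one f(1) p] evk_HH)
    qed
    then show "\<tau> (1\<^sub>m N) X = X" by (simp add: f(2) \<tau>_cs[OF G_one f(1)])
  next
    fix g h X assume g: "g \<in> G" and h: "h \<in> G" and "X \<in> carrier TA"
    then obtain f where f: "f \<in> FP.car" "X = tcls f" using TA_carrier by blast
    have "tcls (tmove (g * h) f) = tcls (tmove g (tmove h f))"
    proof (rule tcls_eqI)
      fix p i j assume p: "p \<in> Pts"
      have m: "mv (g * h) p = mv h (mv g p)" using act_mult[OF g h p] by (simp add: mv_def)
      have "tval p i j (tmove g (tmove h f)) = evk (mv g p) (tpoly i j (tmove h f))" by (rule tval_FF[OF g tmove_car[OF h f(1)] p])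
      also have "\<dots> = evk (mv g p) (subst (sg h) (tpoly i j f))"
        by (rule mv_eq[OF g p]) (simp add: evk_HH tval_FF[OF h f(1)] evk_sg)
      also have "\<dots> = tval p i j (tmove (g * h) f)" by (simp add: evk_sg tval_FF[OF G_mult[OF g h] f(1) p] m)
      finally show "tval p i j (tmove (g * h) f) = tval p i j (tmove g (tmove h f))" ..
    qed
    then show "\<tau> (g * h) X = \<tau> g (\<tau> h X)"
      by (simp add: f(2) \<tau>_cs[OF G_mult[OF g h] f(1)] \<tau>_cs[OF h f(1)] \<tau>_cs[OF g tmove_car[OF h f(1)]])
  qed (simp_all add: \<tau>_closed, simp add: \<tau>_def)
  show "\<tau> g \<in> alg_hom TA TA" if "g \<in> carrier (GL N\<lparr>carrier := G\<rparr>)" for g using \<tau>_hom that by simp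
qed

theorem \<tau>_trivial: "trivial_tensor_action (GL N\<lparr>carrier := G\<rparr>) MM CC \<gamma> \<tau>"
  unfolding trivial_tensor_action_def
proof (intro conjI ballI \<tau>_action)
  fix g a b assume "g \<in> carrier (GL N\<lparr>carrier := G\<rparr>)" "a \<in> carrier MM" "b \<in> carrier CC"
  then have g: "g \<in> G" and a: "a \<in> carrier_mat n n" and b: "b \<in> carrier CC" by (auto simp: module_mat_simps)
  have "tmove g (single (a, b) 1) = single (a, \<gamma> g b) 1" by (simp add: tmove_def)
  then show "\<tau> g (pure_tensor MM CC a b) = pure_tensor MM CC a (\<gamma> g b)"
    using \<tau>_cs[OF g car_single[OF a b]] by (simp add: pure_cs a b \<gamma>_closed[OF g b])
qed

definition "tmat P = (\<Sum>i<n. \<Sum>j<n. single (EU i j, cls (P i j)) (1 :: 'k))"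

lemma tmat_car: "tmat P \<in> FP.car"
  unfolding tmat_def by (intro car_sum car_single EU_carrier cls_closed)

lemma tval_mt: assumes "p \<in> Pts" "i < n" "j < n" shows "tval p i j (tmat P) = evk p (P i j)"
proof -
  have "tval p i j (tmat P) = (\<Sum>a<n. \<Sum>b<n. if a = i \<and> b = j then evk p (P a b) else 0)"
    unfolding tmat_def tval_sum tval_single by (intro sum.cong refl) (use assms in \<open>auto simp: EU_def vl\<close>)
  also have "\<dots> = (\<Sum>a<n. if a = i then evk p (P a j) else 0)"
    by (intro sum.cong refl) (use assms in \<open>auto simp: sum.delta\<close>)
  also have "\<dots> = evk p (P i j)" using assms by simp
  finally show ?thesis .
qed

end

section \<open>The equivariant embedding\<close>

text \<open>The generators of \<open>R\<close> now span a \<open>G\<close>-stable subspace on which the group acts by regular functions.\<close>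

locale equivariant_setup = pi_setup Q F m e R \<iota> n L r
  for Q :: "'q ring" (structure) and F m e and R :: "('k::{alg_closed_field, field_char_0}, 'r) module" and \<iota> n L r +
  fixes N :: nat and G :: "'k mat set" and \<phi> :: "'k mat \<Rightarrow> 'r \<Rightarrow> 'r" and fr :: "nat \<Rightarrow> nat \<Rightarrow> 'k mat \<Rightarrow> 'k"
  assumes one_R: "\<one>\<^bsub>R\<^esub> \<noteq> \<zero>\<^bsub>R\<^esub>" and sub_G: "subgroup G (GL N)" and \<phi>: "algebra_action (GL N\<lparr>carrier := G\<rparr>) R \<phi>"
    and fr: "\<And>i j. fr i j \<in> GL_functions N"
    and \<phi>r: "\<And>g l. g \<in> G \<Longrightarrow> l < L \<Longrightarrow> \<phi> g (r l) = (\<Oplus>\<^bsub>R\<^esub>i\<in>{..<L}. fr i l g \<odot>\<^bsub>R\<^esub> r i)"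
begin

interpretation VR: kspace R using alg by (simp add: is_algebra_def kspace_def)

text \<open>Matrix representations of \<open>R\<close>. Besides those in \<open>Theta\<close> their composites with group elements are needed.\<close>

definition mat_hom :: "('r \<Rightarrow> nat \<Rightarrow> nat \<Rightarrow> 'k) \<Rightarrow> bool" where
  "mat_hom \<eta> \<longleftrightarrow> (\<forall>x\<in>carrier R. \<forall>y\<in>carrier R. \<forall>i<n. \<forall>j<n. \<eta> (x \<oplus>\<^bsub>R\<^esub> y) i j = \<eta> x i j + \<eta> y i j \<and>
     \<eta> (x \<otimes>\<^bsub>R\<^esub> y) i j = (\<Sum>l<n. \<eta> x i l * \<eta> y l j) \<and> (\<forall>c. \<eta> (c \<odot>\<^bsub>R\<^esub> x) i j = c * \<eta> x i j) \<and>
     \<eta> \<one>\<^bsub>R\<^esub> i j = (if i = j then 1 else 0))"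

lemma hmD: assumes "mat_hom \<eta>" "x \<in> carrier R" "y \<in> carrier R" "i < n" "j < n"
  shows "\<eta> (x \<oplus>\<^bsub>R\<^esub> y) i j = \<eta> x i j + \<eta> y i j" "\<eta> (x \<otimes>\<^bsub>R\<^esub> y) i j = (\<Sum>l<n. \<eta> x i l * \<eta> y l j)"
    "\<eta> (c \<odot>\<^bsub>R\<^esub> x) i j = c * \<eta> x i j" "\<eta> \<one>\<^bsub>R\<^esub> i j = (if i = j then 1 else 0)"
  using assms unfolding mat_hom_def by blast+

lemma mat_hom_Theta: "\<theta> \<in> Theta \<Longrightarrow> mat_hom \<theta>"
  unfolding mat_hom_def by (intro ballI allI impI conjI Theta_hom; assumption)

lemma \<phi>_hom: "g \<in> G \<Longrightarrow> \<phi> g \<in> alg_hom R R" and \<phi>_act: "group_action (GL N\<lparr>carrier := G\<rparr>) (carrier R) \<phi>"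
  using \<phi> by (auto simp: algebra_action_def)

lemma \<phi>_simps: assumes "g \<in> G" "x \<in> carrier R" "y \<in> carrier R"
  shows "\<phi> g x \<in> carrier R" "\<phi> g (x \<oplus>\<^bsub>R\<^esub> y) = \<phi> g x \<oplus>\<^bsub>R\<^esub> \<phi> g y" "\<phi> g (x \<otimes>\<^bsub>R\<^esub> y) = \<phi> g x \<otimes>\<^bsub>R\<^esub> \<phi> g y"
    "\<phi> g (c \<odot>\<^bsub>R\<^esub> x) = c \<odot>\<^bsub>R\<^esub> \<phi> g x" "\<phi> g \<one>\<^bsub>R\<^esub> = \<one>\<^bsub>R\<^esub>"
proof -
  have h: "\<phi> g \<in> Ring.ring_hom R R" using \<phi>_hom[OF assms(1)] by (simp add: alg_hom_def)
  show "\<phi> g x \<in> carrier R" "\<phi> g (x \<oplus>\<^bsub>R\<^esub> y) = \<phi> g x \<oplus>\<^bsub>R\<^esub> \<phi> g y" "\<phi> g (x \<otimes>\<^bsub>R\<^esub> y) = \<phi> g x \<otimes>\<^bsub>R\<^esub> \<phi> g y" "\<phi> g \<one>\<^bsub>R\<^esub> = \<one>\<^bsub>R\<^esub>"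
    using ring_hom_closed[OF h] ring_hom_add[OF h] ring_hom_mult[OF h] ring_hom_one[OF h] assms by auto
  show "\<phi> g (c \<odot>\<^bsub>R\<^esub> x) = c \<odot>\<^bsub>R\<^esub> \<phi> g x" using \<phi>_hom[OF assms(1)] assms by (simp add: alg_hom_def)
qed

lemma \<phi>_one: "x \<in> carrier R \<Longrightarrow> \<phi> (1\<^sub>m N) x = x"
  using group_action.id_eq_one[OF \<phi>_act] by (simp add: GL_ops) (metis restrict_apply')

lemma \<phi>_mult: "g \<in> G \<Longrightarrow> h \<in> G \<Longrightarrow> x \<in> carrier R \<Longrightarrow> \<phi> (g * h) x = \<phi> g (\<phi> h x)"
  using group_action.composition_rule[OF \<phi>_act, of x g h] by (simp add: GL_ops)

lemma \<phi>_bij: "g \<in> G \<Longrightarrow> bij_betw (\<phi> g) (carrier R) (carrier R)"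
  using group_action.bij_prop0[OF \<phi>_act, of g] by (simp add: Bij_def)

lemma hm_\<phi>: "mat_hom \<eta> \<Longrightarrow> g \<in> G \<Longrightarrow> mat_hom (\<lambda>x. \<eta> (\<phi> g x))"
  unfolding mat_hom_def by (simp add: \<phi>_simps)

lemma mat_hom_lc: assumes "mat_hom \<eta>" "finite A" "\<And>i. i \<in> A \<Longrightarrow> b i \<in> carrier R" "i < n" "j < n"
  shows "\<eta> (VR.lc c b A) i j = (\<Sum>l\<in>A. c l * \<eta> (b l) i j)"
  using assms(2,3)
proof (induct A rule: finite_induct)
  case empty
  have "0 \<odot>\<^bsub>R\<^esub> \<one>\<^bsub>R\<^esub> = \<zero>\<^bsub>R\<^esub>" by (rule VR.smult_k) simp
  then show ?case using hmD(3)[OF assms(1) fr.R.one_closed fr.R.one_closed assms(4,5), of 0] by (simp add: VR.lc_empty)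
next
  case (insert x H)
  have 1: "VR.lc c b (insert x H) = c x \<odot>\<^bsub>R\<^esub> b x \<oplus>\<^bsub>R\<^esub> VR.lc c b H" by (rule VR.lc_insert) (use insert in auto)
  have 2: "b x \<in> carrier R" "VR.lc c b H \<in> carrier R" using insert by (auto intro: VR.lc_closed)
  show ?case unfolding 1 using insert hmD(1)[OF assms(1) VR.smult_k(1)[OF 2(1)] 2(2) assms(4,5)] hmD(3)[OF assms(1) 2(1) 2(1) assms(4,5)] by simp
qed

definition "dec i = (case prod_decode i of (l, x) \<Rightarrow> (l, prod_decode x))"
definition "enc l a b = prod_encode (l, prod_encode (a, b))"
definition "coord_vars = (\<lambda>(l, a, b). enc l a b) ` ({..<L} \<times> {..<n} \<times> {..<n})"
definition "point_of \<eta> = entries_at dec L n (\<lambda>l. Matrix.mat n n (\<lambda>(i, j). \<eta> (r l) i j))" for \<eta> :: "'r \<Rightarrow> nat \<Rightarrow> nat \<Rightarrow> 'k"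

lemma dec_enc: "dec (enc l a b) = (l, a, b)" by (simp add: dec_def enc_def)

lemma enc_inj: "inj_on (\<lambda>(l, a, b). enc l a b) X"
  by (rule inj_onI) (auto simp: enc_def)

lemma point_of_enc: "l < L \<Longrightarrow> a < n \<Longrightarrow> b < n \<Longrightarrow> point_of \<eta> (enc l a b) = \<eta> (r l) a b"
  by (simp add: point_of_def entries_at_def dec_enc)

lemma point_of_out: assumes "i \<notin> coord_vars" shows "point_of \<eta> i = 0"
proof -
  obtain l x where lx: "prod_decode i = (l, x)" by fastforce
  obtain a b where ab: "prod_decode x = (a, b)" by fastforce
  have i: "i = enc l a b" using lx ab unfolding enc_def by (metis prod_decode_inverse)
  then have "\<not> (l < L \<and> a < n \<and> b < n)" using assms by (force simp: coord_vars_def)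
  then show ?thesis by (auto simp: point_of_def entries_at_def i dec_enc)
qed

lemma evk_pnt: "evk (point_of \<eta>) f = eval_at dec f \<eta>" by (simp add: point_of_def eval_at_def)

text \<open>Group elements act on the generators and not on positions within a matrix.\<close>

definition "cf i j = (case dec i of (l, a, b) \<Rightarrow> case dec j of (l', a', b') \<Rightarrow>
   if a = a' \<and> b = b' \<and> i \<in> coord_vars then fr l' l else (\<lambda>_. 0))"

lemma cf_GL: "cf i j \<in> GL_functions N"
  by (auto simp: cf_def fr GL_functions.const split: prod.splits)

text \<open>Moving the point of \<open>\<eta>\<close> yields the point of \<open>\<eta> \<circ> \<phi> g\<close>.\<close>

lemma cf_sum: assumes \<eta>: "mat_hom \<eta>" and g: "g \<in> G"
  shows "(\<Sum>j\<in>coord_vars. cf i j g * point_of \<eta> j) = point_of (\<lambda>x. \<eta> (\<phi> g x)) i"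
proof (cases "i \<in> coord_vars")
  case False
  have "(\<Sum>j\<in>coord_vars. cf i j g * point_of \<eta> j) = 0" by (rule sum.neutral) (use False in \<open>auto simp: cf_def split: prod.splits\<close>)
  then show ?thesis using point_of_out[OF False] by simp
next
  case True
  then obtain l a b where i: "i = enc l a b" and lab: "l < L" "a < n" "b < n" by (auto simp: coord_vars_def)
  have "(\<Sum>j\<in>coord_vars. cf i j g * point_of \<eta> j) = (\<Sum>(l', a', b')\<in>{..<L} \<times> {..<n} \<times> {..<n}. cf i (enc l' a' b') g * point_of \<eta> (enc l' a' b'))"
    unfolding coord_vars_def by (subst sum.reindex[OF enc_inj]) (simp add: case_prod_beta)
  also have "\<dots> = (\<Sum>(l', a', b')\<in>{..<L} \<times> {..<n} \<times> {..<n}. if a' = a \<and> b' = b then fr l' l g * \<eta> (r l') a b else 0)"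
    by (intro sum.cong refl) (use True in \<open>auto simp: cf_def i dec_enc point_of_enc\<close>)
  also have "\<dots> = (\<Sum>l'<L. \<Sum>a'<n. \<Sum>b'<n. if a' = a \<and> b' = b then fr l' l g * \<eta> (r l') a b else 0)"
    by (simp add: sum.cartesian_product)
  also have "\<dots> = (\<Sum>l'<L. fr l' l g * \<eta> (r l') a b)"
  proof (intro sum.cong refl)
    fix l'
    have "(\<Sum>a'<n. \<Sum>b'<n. if a' = a \<and> b' = b then fr l' l g * \<eta> (r l') a b else 0) = (\<Sum>a'<n. if a' = a then fr l' l g * \<eta> (r l') a b else 0)"
      by (intro sum.cong refl) (use lab in \<open>auto simp: sum.delta\<close>)
    then show "(\<Sum>a'<n. \<Sum>b'<n. if a' = a \<and> b' = b then fr l' l g * \<eta> (r l') a b else 0) = fr l' l g * \<eta> (r l') a b"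
      using lab by simp
  qed
  also have "\<dots> = \<eta> (\<phi> g (r l)) a b"
    using mat_hom_lc[OF \<eta>, of "{..<L}" r a b "\<lambda>i. fr i l g"] r lab \<phi>r[OF g lab(1)] by (simp add: VR.lc_def)
  finally show ?thesis using lab by (simp add: i point_of_enc)
qed

text \<open>The entries of \<open>\<eta> x\<close> are polynomials in those of the \<open>\<eta> (r l)\<close>, and the same ones for all \<open>\<eta>\<close>; so they
  also apply to the moved representations.\<close>

definition "represents x P \<longleftrightarrow> (\<forall>\<eta> i j. mat_hom \<eta> \<longrightarrow> i < n \<longrightarrow> j < n \<longrightarrow> evk (point_of \<eta>) (P i j) = \<eta> x i j)"

definition "representable = {x \<in> carrier R. \<exists>P. represents x P}"

lemma represents_I: "(\<And>\<eta> i j. mat_hom \<eta> \<Longrightarrow> i < n \<Longrightarrow> j < n \<Longrightarrow> evk (point_of \<eta>) (P i j) = \<eta> x i j) \<Longrightarrow> represents x P"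
  unfolding represents_def by blast

lemma represents_D: "represents x P \<Longrightarrow> mat_hom \<eta> \<Longrightarrow> i < n \<Longrightarrow> j < n \<Longrightarrow> evk (point_of \<eta>) (P i j) = \<eta> x i j"
  unfolding represents_def by blast

lemma representable_I: "x \<in> carrier R \<Longrightarrow> represents x P \<Longrightarrow> x \<in> representable"
  unfolding representable_def by blast

lemma representable_D: "x \<in> representable \<Longrightarrow> x \<in> carrier R" "x \<in> representable \<Longrightarrow> \<exists>P. represents x P"
  unfolding representable_def by blast+

lemma representable_smult: assumes "x \<in> representable" shows "c \<odot>\<^bsub>R\<^esub> x \<in> representable"
proof -
  note xc = representable_D(1)[OF assms]
  obtain P where P: "represents x P" using representable_D(2)[OF assms] by (rule exE)
  show ?thesis
    by (rule representable_I[OF VR.smult_k(1)[OF xc] represents_I[of "\<lambda>i j. mconst c * P i j"]])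
      (simp add: represents_D[OF P] hmD(3)[OF _ xc xc])
qed

lemma representable_add: assumes "x \<in> representable" "y \<in> representable" shows "x \<oplus>\<^bsub>R\<^esub> y \<in> representable"
proof -
  note c = representable_D(1)[OF assms(1)] representable_D(1)[OF assms(2)]
  obtain P where P: "represents x P" using representable_D(2)[OF assms(1)] by (rule exE)
  obtain S where S: "represents y S" using representable_D(2)[OF assms(2)] by (rule exE)
  show ?thesis
    by (rule representable_I[OF fr.R.add.m_closed[OF c] represents_I[of "\<lambda>i j. P i j + S i j"]])
      (simp add: represents_D[OF P] represents_D[OF S] hmD(1)[OF _ c])
qed

lemma representable_mult: assumes "x \<in> representable" "y \<in> representable" shows "x \<otimes>\<^bsub>R\<^esub> y \<in> representable"
proof -
  note c = representable_D(1)[OF assms(1)] representable_D(1)[OF assms(2)]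
  obtain P where P: "represents x P" using representable_D(2)[OF assms(1)] by (rule exE)
  obtain S where S: "represents y S" using representable_D(2)[OF assms(2)] by (rule exE)
  show ?thesis
    by (rule representable_I[OF fr.R.m_closed[OF c] represents_I[of "\<lambda>i j. \<Sum>l<n. P i l * S l j"]])
      (simp add: evk_sum represents_D[OF P] represents_D[OF S] hmD(2)[OF _ c])
qed

lemma representable_one: "\<one>\<^bsub>R\<^esub> \<in> representable"
proof (rule representable_I[OF fr.R.one_closed represents_I[of "\<lambda>i j. mconst (if i = j then 1 else 0)"]])
  fix \<eta> i j assume "mat_hom \<eta>" "i < n" "j < n"
  then show "evk (point_of \<eta>) (mconst (if i = j then 1 else 0)) = \<eta> \<one>\<^bsub>R\<^esub> i j"
    using hmD(4)[OF _ fr.R.one_closed fr.R.one_closed] by (simp del: mconst_simps)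
qed

lemma reps: assumes "x \<in> carrier R"
  shows "\<exists>P. represents x P"
proof -
  have "representable = carrier R"
  proof (rule gen)
    have zero: "\<zero>\<^bsub>R\<^esub> \<in> representable" using representable_smult[OF representable_one, of 0] VR.smult_k(6)[of "\<one>\<^bsub>R\<^esub>"] by simp
    show "subring representable R"
    proof (rule fr.R.subringI)
      show "representable \<subseteq> carrier R" using representable_D(1) by blast
      show "\<ominus>\<^bsub>R\<^esub> h \<in> representable" if "h \<in> representable" for h
        using representable_smult[OF that, of "- 1"] uminus_R[OF representable_D(1)[OF that]] by simp
    qed (rule representable_one representable_mult representable_add; assumption)+
    show "submodule (class_ring :: 'k ring) representable R"
      by unfold_locales (use representable_add representable_smult zero representable_D(1) in auto)
    show "r ` {..<L} \<subseteq> representable"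
    proof
      fix x assume "x \<in> r ` {..<L}"
      then obtain l where l: "l < L" "x = r l" by auto
      show "x \<in> representable" unfolding l(2)
        by (rule representable_I[OF r[OF l(1)] represents_I[of "\<lambda>i j. mvar (enc l i j)"]]) (simp add: point_of_enc l)
    qed
  qed
  then show ?thesis using representable_D(2) assms by blast
qed

definition "Pts = point_of ` Theta"

lemma point_of_PT: "\<theta> \<in> Theta \<Longrightarrow> point_of \<theta> \<in> Pts" by (simp add: Pts_def)

lemma Theta_ne: "Theta \<noteq> {}"
  using Theta_separates[OF fr.R.one_closed one_R] by blast

lemma matrix_tensor: "matrix_tensor Pts coord_vars N G cf"
  unfolding matrix_tensor_def
proof (intro point_action.intro point_set.intro point_action_axioms.intro)
  show "finite coord_vars" by (simp add: coord_vars_def)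
  show "Pts \<noteq> {}" using Theta_ne by (simp add: Pts_def)
  show "\<exists>t\<in>Pts. evk t f \<noteq> 0 \<and> evk t h \<noteq> 0" if "p \<in> Pts" "q \<in> Pts" "evk p f \<noteq> 0" "evk q h \<noteq> 0" for p q f h
    using that Theta_irreducible[of _ _ dec f h] unfolding Pts_def by (auto simp: evk_pnt)
  show "\<exists>q\<in>Pts. evk q f \<noteq> 0" if rep_pt: "g \<in> G" "p \<in> Pts" "evk (\<lambda>i. \<Sum>j\<in>coord_vars. cf i j g * p j) f \<noteq> 0" for g p f
  proof -
    obtain \<theta> where \<theta>: "\<theta> \<in> Theta" "p = point_of \<theta>" using rep_pt(2) by (auto simp: Pts_def)
    have "eval_at dec f (\<lambda>x. \<theta> (\<phi> g x)) \<noteq> 0" using rep_pt(3) cf_sum[OF mat_hom_Theta[OF \<theta>(1)] rep_pt(1)] by (simp add: \<theta>(2) evk_pnt)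
    from Theta_stable[OF \<phi>_hom[OF rep_pt(1)] \<phi>_bij[OF rep_pt(1)] \<theta>(1) this] show ?thesis by (auto simp: Pts_def evk_pnt)
  qed
  have pc: "point_of \<eta> = point_of \<eta>'" if "\<And>l. l < L \<Longrightarrow> \<eta> (r l) = \<eta>' (r l)" for \<eta> \<eta>'
    using that by (auto simp: point_of_def entries_at_def fun_eq_iff split: prod.splits)
  have G1: "1\<^sub>m N \<in> G" using subgroup.one_closed[OF sub_G] by (simp add: GL_ops)
  show "(\<Sum>j\<in>coord_vars. cf i j (1\<^sub>m N) * p j) = p i" if p: "p \<in> Pts" for p i
  proof -
    obtain \<theta> where \<theta>: "\<theta> \<in> Theta" "p = point_of \<theta>" using p by (auto simp: Pts_def)
    have "point_of (\<lambda>x. \<theta> (\<phi> (1\<^sub>m N) x)) = point_of \<theta>" by (rule pc) (simp add: \<phi>_one r)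
    then show ?thesis using cf_sum[OF mat_hom_Theta[OF \<theta>(1)] G1] by (simp add: \<theta>(2))
  qed
  show "(\<Sum>j\<in>coord_vars. cf i j (g * h) * p j) = (\<Sum>j\<in>coord_vars. cf i j h * (\<Sum>l\<in>coord_vars. cf j l g * p l))"
    if g: "g \<in> G" and h: "h \<in> G" and p: "p \<in> Pts" for g h p i
  proof -
    obtain \<theta> where \<theta>: "\<theta> \<in> Theta" "p = point_of \<theta>" using p by (auto simp: Pts_def)
    have gh: "g * h \<in> G" using subgroup.m_closed[OF sub_G g h] by (simp add: GL_ops)
    note h\<theta> = mat_hom_Theta[OF \<theta>(1)]
    have "point_of (\<lambda>x. \<theta> (\<phi> (g * h) x)) = point_of (\<lambda>x. \<theta> (\<phi> g (\<phi> h x)))" by (rule pc) (simp add: \<phi>_mult[OF g h] r)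
    then show ?thesis unfolding \<theta>(2) cf_sum[OF h\<theta> gh] cf_sum[OF h\<theta> g] cf_sum[OF hm_\<phi>[OF h\<theta> g] h] by simp
  qed
qed (use sub_G cf_GL point_of_out in \<open>auto simp: Pts_def\<close>)

interpretation MT: matrix_tensor Pts coord_vars N G cf n by (rule matrix_tensor)

definition "entry_polys x = (SOME P. represents x P)"

lemma entry_polys: "x \<in> carrier R \<Longrightarrow> mat_hom \<eta> \<Longrightarrow> i < n \<Longrightarrow> j < n \<Longrightarrow> evk (point_of \<eta>) (entry_polys x i j) = \<eta> x i j"
  using represents_D[OF someI_ex[OF reps], of x] unfolding entry_polys_def by blast

lemma tval_PX: "x \<in> carrier R \<Longrightarrow> \<theta> \<in> Theta \<Longrightarrow> i < n \<Longrightarrow> j < n \<Longrightarrow> MT.tval (point_of \<theta>) i j (MT.tmat (entry_polys x)) = \<theta> x i j"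
  using MT.tval_mt[of "point_of \<theta>" i j "entry_polys x"] entry_polys[OF _ mat_hom_Theta] by (simp add: Pts_def)

definition "\<psi> x = MT.tcls (MT.tmat (entry_polys x))"

lemma tcls_eqI: "(\<And>\<theta> i j. \<theta> \<in> Theta \<Longrightarrow> i < n \<Longrightarrow> j < n \<Longrightarrow> MT.tval (point_of \<theta>) i j f = MT.tval (point_of \<theta>) i j h) \<Longrightarrow> MT.tcls f = MT.tcls h"
  by (rule MT.tcls_eqI) (auto simp: Pts_def)

lemma \<psi>_hom: "\<psi> \<in> alg_hom R MT.TA"
  unfolding alg_hom_def
proof (intro CollectI conjI ring_hom_memI allI ballI)
  fix x assume x: "x \<in> carrier R"
  show "\<psi> x \<in> carrier MT.TA" using MT.tmat_car MT.TA_carrier unfolding \<psi>_def by blast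
  show "\<psi> (c \<odot>\<^bsub>R\<^esub> x) = c \<odot>\<^bsub>MT.TA\<^esub> \<psi> x" for c
    unfolding \<psi>_def MT.TA_simps(3)[OF MT.tmat_car MT.tmat_car]
    by (rule tcls_eqI) (simp add: MT.tval_scl tval_PX x VR.smult_k(1) hmD(3)[OF mat_hom_Theta x x])
  fix y assume y: "y \<in> carrier R"
  show "\<psi> (x \<oplus>\<^bsub>R\<^esub> y) = \<psi> x \<oplus>\<^bsub>MT.TA\<^esub> \<psi> y"
    unfolding \<psi>_def MT.TA_simps(2)[OF MT.tmat_car MT.tmat_car]
    by (rule tcls_eqI) (simp add: MT.tval_add tval_PX x y hmD(1)[OF mat_hom_Theta x y])
  show "\<psi> (x \<otimes>\<^bsub>R\<^esub> y) = \<psi> x \<otimes>\<^bsub>MT.TA\<^esub> \<psi> y"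
    unfolding \<psi>_def MT.TA_simps(1)[OF MT.tmat_car MT.tmat_car]
    by (rule tcls_eqI) (simp add: MT.tval_mult[OF point_of_PT MT.tmat_car MT.tmat_car] tval_PX x y hmD(2)[OF mat_hom_Theta x y])
next
  show "\<psi> \<one>\<^bsub>R\<^esub> = \<one>\<^bsub>MT.TA\<^esub>"
    unfolding \<psi>_def MT.TA_simps(4)[OF MT.tmat_car MT.tmat_car]
    by (rule tcls_eqI)
      (simp add: MT.tval_single tval_PX point_of_PT MT.CC_vl hmD(4)[OF mat_hom_Theta fr.R.one_closed fr.R.one_closed])
qed

lemma \<psi>_inj: "inj_on \<psi> (carrier R)"
proof (rule inj_onI)
  fix x y assume x: "x \<in> carrier R" and y: "y \<in> carrier R" and eq: "\<psi> x = \<psi> y"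
  have e: "\<theta> x i j = \<theta> y i j" if "\<theta> \<in> Theta" "i < n" "j < n" for \<theta> i j
    using MT.tcls_eqD[OF MT.tmat_car eq[unfolded \<psi>_def], of "point_of \<theta>" i j] that tval_PX x y by (simp add: Pts_def)
  let ?z = "x \<oplus>\<^bsub>R\<^esub> (- 1) \<odot>\<^bsub>R\<^esub> y"
  have y': "(- 1) \<odot>\<^bsub>R\<^esub> y \<in> carrier R" by (rule VR.smult_k(1)[OF y])
  have "\<theta> ?z i j = 0" if "\<theta> \<in> Theta" "i < n" "j < n" for \<theta> i j
    using hmD(1)[OF mat_hom_Theta[OF that(1)] x y' that(2,3)] hmD(3)[OF mat_hom_Theta[OF that(1)] y y that(2,3), of "- 1"] e[OF that] by simp
  then have "?z = \<zero>\<^bsub>R\<^esub>" using Theta_separates[of ?z] x y' by blast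
  moreover have "y \<oplus>\<^bsub>R\<^esub> (- 1) \<odot>\<^bsub>R\<^esub> y = \<zero>\<^bsub>R\<^esub>" using VR.smult_k(2)[OF y, of 1 "- 1"] VR.smult_k(5,6)[OF y] by simp
  ultimately show "x = y" using x y y' by (metis fr.R.add.right_cancel)
qed

text \<open>Both sides have the value \<open>\<theta> (\<phi> g x)\<close> at the point of \<open>\<theta>\<close>.\<close>

lemma \<psi>_equiv: assumes g: "g \<in> G" and x: "x \<in> carrier R" shows "\<psi> (\<phi> g x) = MT.\<tau> g (\<psi> x)"
  unfolding \<psi>_def MT.\<tau>_cs[OF g MT.tmat_car]
proof (rule tcls_eqI)
  fix \<theta> i j assume \<theta>: "\<theta> \<in> Theta" and ij: "i < n" "j < n"
  have p: "point_of \<theta> \<in> Pts" using \<theta> by (simp add: Pts_def)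
  have "MT.tval (point_of \<theta>) i j (MT.tmove g (MT.tmat (entry_polys x))) = evk (MT.mv g (point_of \<theta>)) (MT.tpoly i j (MT.tmat (entry_polys x)))"
    by (rule MT.tval_FF[OF g MT.tmat_car p])
  also have "\<dots> = evk (MT.mv g (point_of \<theta>)) (entry_polys x i j)"
    by (rule MT.mv_eq[OF g p]) (simp add: MT.evk_HH MT.tval_mt ij)
  also have "MT.mv g (point_of \<theta>) = point_of (\<lambda>x. \<theta> (\<phi> g x))" unfolding MT.mv_def using cf_sum[OF mat_hom_Theta[OF \<theta>] g] by blast
  also have "evk (point_of (\<lambda>x. \<theta> (\<phi> g x))) (entry_polys x i j) = \<theta> (\<phi> g x) i j" by (rule entry_polys[OF x hm_\<phi>[OF mat_hom_Theta[OF \<theta>] g] ij])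
  also have "\<dots> = MT.tval (point_of \<theta>) i j (MT.tmat (entry_polys (\<phi> g x)))" using tval_PX[OF _ \<theta> ij] \<phi>_simps(1)[OF g x x] by simp
  finally show "MT.tval (point_of \<theta>) i j (MT.tmat (entry_polys (\<phi> g x))) = MT.tval (point_of \<theta>) i j (MT.tmove g (MT.tmat (entry_polys x)))" ..
qed

theorem embedding: "\<exists>(C :: 'k fg_comm_alg) \<gamma>.
    is_algebra C \<and> domain C \<and> finitely_generated_algebra C \<and> regular_action N G C \<gamma> \<and>
    (\<exists>\<tau> \<psi>. trivial_tensor_action (GL N\<lparr>carrier := G\<rparr>) (module_mat TYPE('k) n n) C \<gamma> \<tau> \<and>
       \<psi> \<in> alg_hom R (tensor_algebra (module_mat TYPE('k) n n) C) \<and>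
       inj_on \<psi> (carrier R) \<and>
       (\<forall>g\<in>G. \<forall>r\<in>carrier R. \<psi> (\<phi> g r) = \<tau> g (\<psi> r)))"
  using MT.CC_algebra MT.CC_domain MT.CC_fg MT.\<gamma>_regular MT.\<tau>_trivial \<psi>_hom \<psi>_inj \<psi>_equiv by blast

end

theorem propositionB1:
  fixes R :: "('k::{alg_closed_field, field_char_0}, 'r) module"
    and Q :: "'q ring" and \<iota> :: "'r \<Rightarrow> 'q" and n :: nat
    and N :: nat and G :: "'k mat set" and \<phi> :: "'k mat \<Rightarrow> 'r \<Rightarrow> 'r"
  assumes "is_algebra R"
    and "prime_ring R"
    and "PI_algebra R"
    and "total_ring_of_fractions R Q \<iota>"
    and "central_simple_of_degree Q n"
    and "finitely_generated_algebra R"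
    and "linear_algebraic_group N G"
    and "regular_action N G R \<phi>"
  shows "\<exists>(C :: 'k fg_comm_alg) \<gamma>.
    is_algebra C \<and> domain C \<and> finitely_generated_algebra C \<and> regular_action N G C \<gamma> \<and>
    (\<exists>\<tau> \<psi>. trivial_tensor_action (GL N\<lparr>carrier := G\<rparr>) (module_mat TYPE('k) n n) C \<gamma> \<tau> \<and>
       \<psi> \<in> alg_hom R (tensor_algebra (module_mat TYPE('k) n n) C) \<and>
       inj_on \<psi> (carrier R) \<and>
       (\<forall>g\<in>G. \<forall>r\<in>carrier R. \<psi> (\<phi> g r) = \<tau> g (\<psi> r)))"
proof -
  have ringR: "ring R" using assms(1) by (simp add: is_algebra_def)
  interpret R: ring R by (rule ringR)
  interpret VR: kspace R using assms(1) by (simp add: is_algebra_def kspace_def)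
  have one: "\<one>\<^bsub>R\<^esub> \<noteq> \<zero>\<^bsub>R\<^esub>"
  proof
    assume "\<one>\<^bsub>R\<^esub> = \<zero>\<^bsub>R\<^esub>"
    then have "x = \<zero>\<^bsub>R\<^esub>" if "x \<in> carrier R" for x using R.l_one[OF that] R.l_null[OF that] by simp
    then show False using assms(2) by (auto simp: prime_ring_def)
  qed
  obtain e where central_simple: "central_simple Q (ring_center Q) (n * n) e" using central_simple_exists[OF assms(5)] by blast
  obtain S where S: "finite S" "S \<subseteq> carrier R"
    and Sgen: "\<And>T. subring T R \<Longrightarrow> submodule (class_ring :: 'k ring) T R \<Longrightarrow> S \<subseteq> T \<Longrightarrow> T = carrier R"
    using assms(6) unfolding finitely_generated_algebra_def by blast
  obtain V where V: "fin_dim_subspace R V" "VR.span S \<subseteq> V" "algebraic_representation_on N G R \<phi> V"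
    using assms(8) VR.span_fd[OF S] unfolding regular_action_def by blast
  obtain vs \<rho> where basis: "vectorspace.basis class_ring (R\<lparr>carrier := V\<rparr>) (set vs)"
    and hom: "algebraic_group_hom N G (length vs) (carrier (GL (length vs))) \<rho>"
    and \<phi>vs: "\<And>g j. g \<in> G \<Longrightarrow> j < length vs \<Longrightarrow> \<phi> g (vs ! j) = (\<Oplus>\<^bsub>R\<^esub>i\<in>{..<length vs}. \<rho> g $$ (i, j) \<odot>\<^bsub>R\<^esub> vs ! i)"
    using V(3) unfolding algebraic_representation_on_def by blast
  interpret W: vectorspace "class_ring :: 'k ring" "R\<lparr>carrier := V\<rparr>" using VR.subspace_is_vs V(1) by blast
  have sm: "submodule class_ring V R" using V(1) by (simp add: subspace_def)
  have VsR: "V \<subseteq> carrier R" using sm by (simp add: submodule_def)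
  have b: "W.gen_set (set vs)" "set vs \<subseteq> V" using basis by (auto simp: W.basis_def)
  have sp: "VR.span (set vs) = V" using b(1) VR.span_li_not_depend(1)[OF b(2) sm] by simp
  define L where "L = length vs"
  define r where "r l = vs ! l" for l
  have rim: "r ` {..<L} = set vs" by (auto simp: r_def L_def set_conv_nth)
  have gen: "T = carrier R" if T: "subring T R" "submodule (class_ring :: 'k ring) T R" "r ` {..<L} \<subseteq> T" for T
  proof (rule Sgen[OF T(1,2)])
    have "S \<subseteq> VR.span S" by (rule VR.in_own_span[OF S(2)])
    also have "\<dots> \<subseteq> VR.span (set vs)" using V(2) sp by simp
    also have "\<dots> \<subseteq> T" by (rule VR.span_is_subset) (use T rim in auto)
    finally show "S \<subseteq> T" .
  qed
  have "\<exists>f\<in>GL_functions N. \<forall>g\<in>G. \<rho> g $$ (i, j) = f g" if "i < L" "j < L" for i j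
  proof -
    have "(\<lambda>X. X $$ (i, j)) \<in> regular_functions L (carrier (GL L))"
      unfolding regular_functions_def
      by (intro CollectI bexI[of _ "\<lambda>X. X $$ (i, j)"]) (use GL_functions.entry[OF that] in auto)
    then have "(\<lambda>X. X $$ (i, j)) \<circ> \<rho> \<in> regular_functions N G" using hom unfolding algebraic_group_hom_def L_def by blast
    then show ?thesis by (simp add: regular_functions_def)
  qed
  note fex = this
  define fr where "fr i j = (if i < L \<and> j < L then SOME f. f \<in> GL_functions N \<and> (\<forall>g\<in>G. \<rho> g $$ (i, j) = f g) else (\<lambda>_. 0))" for i j
  have fr: "fr i j \<in> GL_functions N \<and> (\<forall>g\<in>G. \<rho> g $$ (i, j) = fr i j g)" if "i < L" "j < L" for i j
  proof -
    have "\<exists>f. f \<in> GL_functions N \<and> (\<forall>g\<in>G. \<rho> g $$ (i, j) = f g)" using fex[OF that] by blast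
    then have ex: "\<exists>f. f \<in> GL_functions N \<and> (\<forall>g\<in>G. \<rho> g $$ (i, j) = f g)" .
    have eq: "fr i j = (SOME f. f \<in> GL_functions N \<and> (\<forall>g\<in>G. \<rho> g $$ (i, j) = f g))" using that by (simp add: fr_def)
    show ?thesis unfolding eq by (rule someI_ex[OF ex])
  qed
  have fr': "fr i j \<in> GL_functions N" for i j
  proof (cases "i < L \<and> j < L")
    case False
    then show ?thesis by (auto simp: fr_def GL_functions.const)
  qed (use fr in blast)
  have rc: "r l \<in> carrier R" if "l < L" for l using that rim b(2) VsR by blast
  have \<phi>r: "\<phi> g (r l) = (\<Oplus>\<^bsub>R\<^esub>i\<in>{..<L}. fr i l g \<odot>\<^bsub>R\<^esub> r i)" if g: "g \<in> G" and l: "l < L" for g l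
  proof -
    have "\<phi> g (r l) = (\<Oplus>\<^bsub>R\<^esub>i\<in>{..<L}. \<rho> g $$ (i, l) \<odot>\<^bsub>R\<^esub> r i)" using \<phi>vs[OF g, of l] l by (simp add: r_def L_def)
    also have "\<dots> = (\<Oplus>\<^bsub>R\<^esub>i\<in>{..<L}. fr i l g \<odot>\<^bsub>R\<^esub> r i)"
      by (rule R.finsum_cong') (use fr l g rc VR.smult_k(1) in auto)
    finally show ?thesis .
  qed
  have Q: "ring Q" using assms(4) by (simp add: total_ring_of_fractions_def)
  have "pi_setup Q (ring_center Q) (n * n) e R \<iota> n L r"
    by (intro pi_setup.intro central_simple fraction_ring.intro fraction_ring_axioms.intro pi_setup_axioms.intro)
       (use ringR Q assms(1,4) rc gen in auto)
  then have "equivariant_setup Q (ring_center Q) (n * n) e R \<iota> n L r N G \<phi> fr"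
    using one assms(7,8) fr' \<phi>r
    by (intro equivariant_setup.intro equivariant_setup_axioms.intro)
       (auto simp: linear_algebraic_group_def regular_action_def)
  then show ?thesis by (rule equivariant_setup.embedding)
qed

end
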